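(* Let $(\mathcal H,\nu)$ be a pmp separable étale topological discrete groupoid, $\mathcal G$ a separable étale topological discrete groupoid, $\pi:\mathcal G\to\mathcal H$ a continuous class-bijective factor map, and $\mathbb P=\{\mathbb P_j\}_{j\in J}$ an asymptotically continuous sofic approximation to $(\mathcal H,\nu)$. Assume that $\mathcal H^0$ and $\mathcal G^0$ are compact and metrizable and that $\nu$ is regular. Then for any $p\in[1,\infty]$ and any bias $\beta\ne-$, $$h_{\mathbb P}(\pi)=\sup_\mu h_{\mathbb P,\mu}(\pi),$$ where the supremum is over all measures $\mu$ on $\mathcal G$ (determined by Borel probability measures on $\mathcal G^0$) such that $\pi_*\mu=\nu$ and $(\mathcal G,\mu)$ is probability-measure-preserving.
   Context: **Groupoids.** A groupoid $\mathcal H$ is a small category in which every morphism is invertible; it is identified with its set of morphisms, $\mathcal H^0\subset\mathcal H$ denotes the units (objects), $\mathfrak s,\mathfrak r:\mathcal H\to\mathcal H^0$ are source and range, and $fg$ is defined iff $\mathfrak s(f)=\mathfrak r(g)$. It is discrete if $\mathfrak s^{-1}(x),\mathfrak r^{-1}(x)$ are countable for all $x\in\mathcal H^0$. A measurable groupoid carries a standard Borel structure for which $\mathcal H^0$ and the set of composable pairs are Borel and source, range, composition and inversion are Borel. A discrete measurable groupoid with a Borel probability measure $\nu$ on $\mathcal H^0$ is pmp (probability-measure-preserving) if the measures $\nu_{\mathfrak s}(B)=\int|\mathfrak s^{-1}(x)\cap B|\,d\nu(x)$ and $\nu_{\mathfrak r}(B)=\int|\mathfrak r^{-1}(x)\cap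 B|\,d\nu(x)$ on $\mathcal H$ coincide; the common measure is again denoted $\nu$. $[[\mathcal H]]$ is the set of Borel $f\subset\mathcal H$ such that $\mathfrak s|_f,\mathfrak r|_f$ are Borel isomorphisms onto their images, with $fg=\{f'g':f'\in f,g'\in g \text{ composable}\}$ and $f^{-1}=\{h^{-1}:h\in f\}$. Put $\mathrm{tr}_{\mathcal H}(f)=\nu(f\cap\mathcal H^0)$. For $d\in\mathbb N$, $\Delta_d=\{1,\dots,d\}^2$ is the groupoid with $\mathfrak s(i,j)=(j,j)$, $\mathfrak r(i,j)=(i,i)$, $(i,j)(j,k)=(i,k)$; its unit set $\Delta_d^0$ is identified with $\{1,\dots,d\}$. $[[d]]:=[[\Delta_d]]$, $|f|_d=|f|/d$, $\mathrm{tr}_d(f)=|f\cap\Delta_d^0|/d$. For $f\in[[d]]$: $fj=i$ if $(i,j)\in f$, and for $A\subset\Delta_d^0$, $f\cdot A=\{i:(i,j)\in f\text{ for some }j\in A\}$. **Sofic approximations.** For finite $F\subset[[\mathcal H]]$ and $\delta>0$, $\sigma:[[\mathcal H]]\to[[d]]$ is $(F,\delta)$-multiplicative if $|\sigma(st)\vartriangle\sigma(s)\sigma(t)|_d<\delta$ for all $s,t\in F$, and $(F,\delta)$-trace-preserving if $|\mathrm{tr}_d(\sigma(s))-\mathrm{tr}_{\mathcal H}(s)|<\delta$ for all $s\in F$. $\mathrm{Map}([[\mathcal H]],[[d]])$ is the set of all maps, with the Borel structure generated by the sets $\{\sigma':\sigma'|_F=\sigma|_F\}$, $F$ finite. A sofic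 approximation to $(\mathcal H,\nu)$ is a family $\{\mathbb P_j\}_{j\in J}$ ($J$ a directed set) of Borel probability measures on $\mathrm{Map}([[\mathcal H]],[[d_j]])$, $d_j\in\mathbb N$, such that: (1) for all finite $F$ and $\delta>0$, $\lim_{j\to J}\mathbb P_j(\sigma\text{ is }(F,\delta)\text{-trace-preserving})=1$; (2) for all finite $F$ and $\delta>0$ there is $j$ such that for $j'\ge j$, $\mathbb P_{j'}$-a.e. $\sigma$ is $(F,\delta)$-multiplicative; (3) $\lim_{j\to J} d_j=\infty$; (4) if $\nu(f\vartriangle f')=0$ then $\sigma(f)=\sigma(f')$ for $\mathbb P_j$-a.e. $\sigma$. $\mathbb P$ is asymptotically continuous if for every finite $F\subset[[\mathcal H]]$ and $\delta>0$ there is $j\in J$ such that for all $j'\ge j$, $\mathbb P_{j'}$-a.e. $\sigma$ satisfies $|\sigma(f)\vartriangle\sigma(g)|_{d_{j'}}<\delta+\nu(f\vartriangle g)$ for all $f,g\in F$. **Bias.** A bias $\beta$ for $J$ is an element of $\{-,+\}$ or an ultrafilter on $J$ containing $\{j'\in J:j'\ge j\}$ for each $j$. $\lim_{j\to\beta}\Phi(j)$ means $\liminf_{j\to J}$ if $\beta=-$, $\limsup_{j\to J}$ if $\beta=+$, and the ultralimit otherwise. $\|\cdot\|_{p,\mathbb P_j}$ is the $L^p$-norm with respect to $\mathbb P_j$. **Topological groupoids.** A discrete topological groupoid is a discrete groupoid with a topology making source, range, inverse, composition continuous. A bisection is an open $U\subset\mathcal H$ such that $\mathfrak s|_U,\mathfrak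 r|_U$ are homeomorphisms onto open subsets of $\mathcal H^0$. $\mathcal H$ is étale if each element lies in a bisection. $[\mathcal H]_{top}$ is the set of bisections $U$ for which $\mathfrak s|_U,\mathfrak r|_U$ are homeomorphisms onto $\mathcal H^0$. For $A\subset\mathcal H^0$, $\partial A=\overline A\cap\overline{\mathcal H^0\setminus A}$, and $\mathcal B_\partial(\mathcal H^0,\nu)$ is the collection of Borel $A\subset\mathcal H^0$ with $\nu(\partial A)=0$. $[[\mathcal H]]_{top}$ is the set of $f\in[[\mathcal H]]$ of the form $f=\bigcup_{i=1}^nf_i$ where for each $i$ there is a bisection $U_i$ with $\overline{f_i}\subset U_i$, $\overline{\mathfrak s(f_i)}\subset\mathfrak s(U_i)$, $\overline{\mathfrak r(f_i)}\subset\mathfrak r(U_i)$; the $\mathfrak s(f_i)$ are pairwise disjoint elements of $\mathcal B_\partial(\mathcal H^0,\nu)$, and so are the $\mathfrak r(f_i)$. **Factor maps.** A groupoid morphism $\pi:\mathcal G\to\mathcal H$ (preserving products, inverses, units) is class-bijective if for every $a\in\mathcal G^0$ it restricts to bijections $\mathfrak s^{-1}(a)\to\mathfrak s^{-1}(\pi(a))$ and $\mathfrak r^{-1}(a)\to\mathfrak r^{-1}(\pi(a))$; a class-bijective factor map is moreover surjective. For $f\in[[\mathcal H]]$ and $x\in\mathcal G^0$ with $\pi(x)\in\mathfrak s(f)$, $f\cdot x\in\mathcal G^0$ is the range of the unique element of $\pi^{-1}(f)$ with source $x$; if $\pi(x)\notin\mathfrak s(f)$ put $f\cdot x=*$, a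 special symbol. For $P\subset\mathcal G^0$, $f\cdot P=\{f\cdot x:x\in P,\pi(x)\in\mathfrak s(f)\}$. **Topological entropy $h_{\mathbb P}(\pi)$.** For $x=(x_1,\dots,x_d)\in(\mathcal G^0)^d$ put $f\cdot x=(f\cdot x_1,\dots,f\cdot x_d)$ and, for $\sigma:[[\mathcal H]]\to[[d]]$, $x\circ\sigma(f)=(x_{\sigma(f)1},\dots,x_{\sigma(f)d})$, with $x_{\sigma(f)i}=*$ if $i\notin\mathfrak s(\sigma(f))$. A continuous pseudo-metric $\rho$ on $\mathcal G^0$ is extended to $\mathcal G^0\cup\{*\}$ by $\rho( *,* )=0$, $\rho( *,x)=\max_{y,z\in\mathcal G^0}\rho(y,z)$; on $d$-tuples $\rho_2(x,x')=(\frac1d\sum_i\rho(x_i,x_i')^2)^{1/2}$. For finite $F\subset[[\mathcal H]]$, finite $K\subset C(\mathcal H^0)$ and $\delta>0$, $Orb_\nu(\pi,\sigma,F,K,\delta,\rho)$ is the set of $x\in(\mathcal G^0)^d$ with $\rho_2(f\cdot x,x\circ\sigma(f))<\delta$ for all $f\in F$ and $|d^{-1}\sum_ik(\pi(x_i))-\int k\,d\nu|<\delta$ for all $k\in K$. $N_\epsilon(X,\rho_2)$ is the maximal cardinality of a subset of $X$ whose distinct points are at $\rho_2$-distance $>\epsilon$. Let $$h_{\mathbb P}(\pi,\rho)=\sup_{\epsilon>0}\inf_{\delta>0}\inf_{F}\inf_{K}\lim_{j\to\beta}\frac1{d_j}\log\|N_\epsilon(Orb_\nu(\pi,\cdot,F,K,\delta,\rho),\rho_2)\|_{p,\mathbb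 P_j},$$ with $F$ over finite subsets of $[[\mathcal H]]_{top}$ and $K$ over finite subsets of $C(\mathcal H^0)$. $\rho$ is dynamically generating if for all distinct $x,y\in\mathcal G^0$ there is $f\in[\mathcal H]_{top}$ with $\rho(f\cdot x,f\cdot y)>0$ (e.g. any continuous metric). $h_{\mathbb P}(\pi):=h_{\mathbb P}(\pi,\rho)$ for any dynamically generating continuous pseudo-metric $\rho$ on $\mathcal G^0$; the value does not depend on $\rho$. **Measure entropy $h_{\mathbb P,\mu}(\pi)$.** For a finite partition $\mathcal P$ of $\mathcal G^0$ and finite $F\subset[[\mathcal H]]$, $\mathcal P^F$ is the coarsest partition of $\mathcal G^0$ such that each $f\cdot P$ ($f\in F,P\in\mathcal P$) is a union of its atoms, and $\Sigma(\mathcal P)$ is the sigma-algebra generated by $\mathcal P$. $\mathcal B(\Delta_d^0)$ is the set of all subsets of $\Delta_d^0$. A homomorphism $\phi:\Sigma(\mathcal P)\to\mathcal B(\Delta_d^0)$ is a map preserving unions and intersections with $\phi(\emptyset)=\emptyset$, $\phi(\mathcal G^0)=\Delta_d^0$. For $\sigma:[[\mathcal H]]\to[[d]]$, $\delta>0$ and finite $F\ni\mathcal H^0$, $\mathrm{Hom}(\pi,\sigma,\mathcal P,F,\delta)$ is the set of homomorphisms $\phi:\Sigma(\mathcal P^F)\to\mathcal B(\Delta_d^0)$ with $\sum_{P\in\mathcal P}|\sigma(f)\cdot\phi(P)\vartriangle\phi(f\cdot P)|d^{-1}<\delta$ for all $f\in F$ and $\sum_{P\in\mathcal P^F}\big||\phi(P)|d^{-1}-\mu(P)\big|<\delta$.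 For $\mathcal Q\le\mathcal P$ (meaning $\mathcal P$ refines $\mathcal Q$), $|\mathrm{Hom}(\pi,\sigma,\mathcal P,F,\delta)|_{\mathcal Q}$ is the number of distinct restrictions to $\Sigma(\mathcal Q)$ of elements of $\mathrm{Hom}(\pi,\sigma,\mathcal P,F,\delta)$. For finite Borel partitions $\mathcal Q\le\mathcal P$ let $$h_{\mathbb P,\mu}(\pi,\mathcal Q,\mathcal P)=\inf_F\inf_{\delta>0}\lim_{j\to\beta}\frac1{d_j}\log\big\||\mathrm{Hom}(\pi,\cdot,\mathcal P,F,\delta)|_{\mathcal Q}\big\|_{p,\mathbb P_j},$$ $F$ over finite subsets of $[[\mathcal H]]$ containing $\mathcal H^0$; and $h_{\mathbb P,\mu}(\pi)=\sup_{\mathcal Q}\inf_{\mathcal P\ge\mathcal Q}h_{\mathbb P,\mu}(\pi,\mathcal Q,\mathcal P)$ over finite Borel partitions of $\mathcal G^0$. Conventions: $\log 0=-\infty$ and $\sup\emptyset=-\infty$.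
   Formalization: "Separable" topological groupoid is taken to mean second countable and Hausdorff, for both groupoids; without the Hausdorff condition the equality can fail, for example for the interval with doubled origin and ν a point mass there. *)

theory Defs
  imports
    "HOL-Analysis.Analysis"
    "HOL-Library.Disjoint_Sets"
    "HOL-Probability.Probability_Measure"
    "HOL-Probability.Essential_Supremum"
begin

section \<open>Groupoids\<close>

text \<open>As in the mathematical text, a groupoid is identified with its set \<open>arr\<close> of morphisms, an
  object being identified with its identity morphism. The operations are total functions whose values
  outside \<open>arr\<close>, respectively outside the composable pairs, are irrelevant.\<close>

record 'a gpd =
  arr :: "'a set"
  src :: "'a \<Rightarrow> 'a"
  rng :: "'a \<Rightarrow> 'a"
  mult :: "'a \<Rightarrow> 'a \<Rightarrow> 'a"
  units :: "'a set"

definition ginv :: "('a, 'm) gpd_scheme \<Rightarrow> 'a \<Rightarrow> 'a" where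
  "ginv H h = (THE k. k \<in> arr H \<and> src H k = rng H h \<and> rng H k = src H h \<and>
      mult H k h = src H h \<and> mult H h k = rng H h)"

definition composable :: "('a, 'm) gpd_scheme \<Rightarrow> ('a \<times> 'a) set" where
  "composable H = {(f, g). f \<in> arr H \<and> g \<in> arr H \<and> src H f = rng H g}"

locale groupoid =
  fixes H :: "('a, 'm) gpd_scheme"
  assumes units_arr: "units H \<subseteq> arr H"
    and src_units: "src H \<in> arr H \<rightarrow> units H"
    and rng_units: "rng H \<in> arr H \<rightarrow> units H"
    and unit_src: "u \<in> units H \<Longrightarrow> src H u = u"
    and unit_rng: "u \<in> units H \<Longrightarrow> rng H u = u"
    and mult_arr: "(f, g) \<in> composable H \<Longrightarrow> mult H f g \<in> arr H"
    and src_mult: "(f, g) \<in> composable H \<Longrightarrow> src H (mult H f g) = src H g"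
    and rng_mult: "(f, g) \<in> composable H \<Longrightarrow> rng H (mult H f g) = rng H f"
    and mult_assoc: "(f, g) \<in> composable H \<Longrightarrow> (g, h) \<in> composable H \<Longrightarrow>
        mult H (mult H f g) h = mult H f (mult H g h)"
    and mult_src: "f \<in> arr H \<Longrightarrow> mult H f (src H f) = f"
    and rng_mult_self: "f \<in> arr H \<Longrightarrow> mult H (rng H f) f = f"
    and invertible: "f \<in> arr H \<Longrightarrow>
        \<exists>k\<in>arr H. src H k = rng H f \<and> rng H k = src H f \<and> mult H k f = src H f \<and> mult H f k = rng H f"

locale discrete_groupoid = groupoid +
  assumes countable_src_fibre: "x \<in> units H \<Longrightarrow> countable {h \<in> arr H. src H h = x}"
    and countable_rng_fibre: "x \<in> units H \<Longrightarrow> countable {h \<in> arr H. rng H h = x}"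

definition set_mult :: "('a, 'm) gpd_scheme \<Rightarrow> 'a set \<Rightarrow> 'a set \<Rightarrow> 'a set" where
  "set_mult H f g = {mult H a b | a b. a \<in> f \<and> b \<in> g \<and> (a, b) \<in> composable H}"


section \<open>Measurable groupoids\<close>

definition borel_of :: "'a topology \<Rightarrow> 'a measure" where
  "borel_of T = sigma (topspace T) {U. openin T U}"

definition standard_borel :: "'a measure \<Rightarrow> bool" where
  "standard_borel M \<longleftrightarrow> (\<exists>T. completely_metrizable_space T \<and> second_countable T \<and>
      topspace T = space M \<and> sets (borel_of T) = sets M)"

locale measurable_groupoid = groupoid H for H :: "('a, 'm) gpd_scheme" +
  fixes M :: "'a measure"
  assumes space_M: "space M = arr H"
    and standard: "standard_borel M"
    and units_measurable: "units H \<in> sets M"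
    and composable_measurable: "composable H \<in> sets (M \<Otimes>\<^sub>M M)"
    and src_measurable: "src H \<in> M \<rightarrow>\<^sub>M M"
    and rng_measurable: "rng H \<in> M \<rightarrow>\<^sub>M M"
    and mult_measurable:
      "(\<lambda>(f, g). mult H f g) \<in> restrict_space (M \<Otimes>\<^sub>M M) (composable H) \<rightarrow>\<^sub>M M"
    and ginv_measurable: "ginv H \<in> M \<rightarrow>\<^sub>M M"

text \<open>The measures \<open>\<nu>\<^sub>s\<close> and \<open>\<nu>\<^sub>r\<close> on the groupoid, as functions of a Borel set. Cardinalities
  of fibres are counting measures, hence may be infinite.\<close>

definition src_meas :: "('a, 'm) gpd_scheme \<Rightarrow> 'a measure \<Rightarrow> 'a set \<Rightarrow> ennreal" where
  "src_meas H \<nu> B = (\<integral>\<^sup>+ x. emeasure (count_space UNIV) {h \<in> arr H \<inter> B. src H h = x} \<partial>\<nu>)"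

definition rng_meas :: "('a, 'm) gpd_scheme \<Rightarrow> 'a measure \<Rightarrow> 'a set \<Rightarrow> ennreal" where
  "rng_meas H \<nu> B = (\<integral>\<^sup>+ x. emeasure (count_space UNIV) {h \<in> arr H \<inter> B. rng H h = x} \<partial>\<nu>)"

text \<open>In a pmp groupoid the common measure on the groupoid is \<open>src_meas H \<nu>\<close>.\<close>

definition pmp :: "('a, 'm) gpd_scheme \<Rightarrow> 'a measure \<Rightarrow> 'a measure \<Rightarrow> bool" where
  "pmp H M \<nu> \<longleftrightarrow> discrete_groupoid H \<and> measurable_groupoid H M \<and>
     prob_space \<nu> \<and> space \<nu> = units H \<and> sets \<nu> = sets (restrict_space M (units H)) \<and>
     (\<forall>B\<in>sets M. src_meas H \<nu> B = rng_meas H \<nu> B)"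

definition borel_iso_on :: "'a measure \<Rightarrow> ('a \<Rightarrow> 'a) \<Rightarrow> 'a set \<Rightarrow> bool" where
  "borel_iso_on M \<theta> f \<longleftrightarrow> inj_on \<theta> f \<and> \<theta> \<in> restrict_space M f \<rightarrow>\<^sub>M M \<and>
     (\<forall>B\<in>sets M. B \<subseteq> f \<longrightarrow> \<theta> ` B \<in> sets M)"

definition full_pseudogroup :: "('a, 'm) gpd_scheme \<Rightarrow> 'a measure \<Rightarrow> 'a set set" where
  "full_pseudogroup H M = {f \<in> sets M. borel_iso_on M (src H) f \<and> borel_iso_on M (rng H) f}"

definition tr :: "('a, 'm) gpd_scheme \<Rightarrow> 'a measure \<Rightarrow> 'a set \<Rightarrow> real" where
  "tr H \<nu> f = measure \<nu> (f \<inter> units H)"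


section \<open>The finite groupoids \<open>\<Delta>\<^sub>d\<close>\<close>

definition pair_gpd :: "nat \<Rightarrow> (nat \<times> nat) gpd" where
  "pair_gpd d = \<lparr>
     arr = {1..d} \<times> {1..d},
     src = (\<lambda>(i, j). (j, j)),
     rng = (\<lambda>(i, j). (i, i)),
     mult = (\<lambda>(i, j) (j', k). (i, k)),
     units = {(i, i) | i. i \<in> {1..d}} \<rparr>"

definition fin_pseudogroup :: "nat \<Rightarrow> (nat \<times> nat) set set" where
  "fin_pseudogroup d = full_pseudogroup (pair_gpd d) (count_space (arr (pair_gpd d)))"

definition normcard :: "nat \<Rightarrow> 'b set \<Rightarrow> real" where
  "normcard d A = real (card A) / real d"

definition fin_tr :: "nat \<Rightarrow> (nat \<times> nat) set \<Rightarrow> real" where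
  "fin_tr d f = normcard d (f \<inter> units (pair_gpd d))"

text \<open>Here and below \<open>\<Delta>\<^sub>d\<^sup>0\<close> is identified with \<open>{1..d}\<close>; \<open>None\<close> means that \<open>j\<close> is not in the
  source of \<open>f\<close>.\<close>

definition fin_act :: "(nat \<times> nat) set \<Rightarrow> nat \<Rightarrow> nat option" where
  "fin_act f j = (if \<exists>i. (i, j) \<in> f then Some (THE i. (i, j) \<in> f) else None)"

definition fin_act_set :: "(nat \<times> nat) set \<Rightarrow> nat set \<Rightarrow> nat set" where
  "fin_act_set f A = {i. \<exists>j\<in>A. (i, j) \<in> f}"


section \<open>Sofic approximations\<close>

definition directed_set :: "'j set \<Rightarrow> ('j \<Rightarrow> 'j \<Rightarrow> bool) \<Rightarrow> bool" where
  "directed_set J le \<longleftrightarrow> J \<noteq> {} \<and> (\<forall>i\<in>J. le i i) \<and>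
     (\<forall>i\<in>J. \<forall>j\<in>J. \<forall>k\<in>J. le i j \<longrightarrow> le j k \<longrightarrow> le i k) \<and>
     (\<forall>i\<in>J. \<forall>j\<in>J. \<exists>k\<in>J. le i k \<and> le j k)"

definition tails :: "'j set \<Rightarrow> ('j \<Rightarrow> 'j \<Rightarrow> bool) \<Rightarrow> 'j filter" where
  "tails J le = (INF j\<in>J. principal {j' \<in> J. le j j'})"

type_synonym 'a sofic_map = "'a set \<Rightarrow> (nat \<times> nat) set"

definition Map_set :: "'a set set \<Rightarrow> nat \<Rightarrow> 'a sofic_map set" where
  "Map_set \<H> d = (\<H> \<rightarrow>\<^sub>E fin_pseudogroup d)"

definition Map_borel :: "'a set set \<Rightarrow> nat \<Rightarrow> 'a sofic_map measure" where
  "Map_borel \<H> d = sigma (Map_set \<H> d)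
     {{\<sigma>' \<in> Map_set \<H> d. \<forall>f\<in>F. \<sigma>' f = \<sigma> f} | \<sigma> F. \<sigma> \<in> Map_set \<H> d \<and> F \<in> Fpow \<H>}"

definition multiplicative_on ::
  "('a, 'm) gpd_scheme \<Rightarrow> nat \<Rightarrow> 'a set set \<Rightarrow> real \<Rightarrow> 'a sofic_map \<Rightarrow> bool" where
  "multiplicative_on H d F \<delta> \<sigma> \<longleftrightarrow> (\<forall>s\<in>F. \<forall>t\<in>F.
     normcard d (sym_diff (\<sigma> (set_mult H s t)) (set_mult (pair_gpd d) (\<sigma> s) (\<sigma> t))) < \<delta>)"

definition trace_preserving_on ::
  "('a, 'm) gpd_scheme \<Rightarrow> 'a measure \<Rightarrow> nat \<Rightarrow> 'a set set \<Rightarrow> real \<Rightarrow> 'a sofic_map \<Rightarrow> bool" where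
  "trace_preserving_on H \<nu> d F \<delta> \<sigma> \<longleftrightarrow> (\<forall>s\<in>F. \<bar>fin_tr d (\<sigma> s) - tr H \<nu> s\<bar> < \<delta>)"

definition sofic_approximation ::
  "('a, 'm) gpd_scheme \<Rightarrow> 'a measure \<Rightarrow> 'a measure \<Rightarrow> 'j set \<Rightarrow> ('j \<Rightarrow> 'j \<Rightarrow> bool) \<Rightarrow>
   ('j \<Rightarrow> nat) \<Rightarrow> ('j \<Rightarrow> 'a sofic_map measure) \<Rightarrow> bool" where
  "sofic_approximation H M \<nu> J le d \<P> \<longleftrightarrow>
     directed_set J le \<and>
     (\<forall>j\<in>J. 0 < d j \<and> prob_space (\<P> j) \<and>
        space (\<P> j) = Map_set (full_pseudogroup H M) (d j) \<and>
        sets (\<P> j) = sets (Map_borel (full_pseudogroup H M) (d j))) \<and>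
     (\<forall>F\<in>Fpow (full_pseudogroup H M). \<forall>\<delta>>0.
        ((\<lambda>j. measure (\<P> j) {\<sigma> \<in> space (\<P> j). trace_preserving_on H \<nu> (d j) F \<delta> \<sigma>}) \<longlongrightarrow> 1)
          (tails J le)) \<and>
     (\<forall>F\<in>Fpow (full_pseudogroup H M). \<forall>\<delta>>0. \<exists>j\<in>J. \<forall>j'\<in>J. le j j' \<longrightarrow>
        (AE \<sigma> in \<P> j'. multiplicative_on H (d j') F \<delta> \<sigma>)) \<and>
     filterlim d at_top (tails J le) \<and>
     (\<forall>f\<in>full_pseudogroup H M. \<forall>f'\<in>full_pseudogroup H M. src_meas H \<nu> (sym_diff f f') = 0 \<longrightarrow>
        (\<forall>j\<in>J. AE \<sigma> in \<P> j. \<sigma> f = \<sigma> f'))"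

definition asymptotically_continuous ::
  "('a, 'm) gpd_scheme \<Rightarrow> 'a measure \<Rightarrow> 'a measure \<Rightarrow> 'j set \<Rightarrow> ('j \<Rightarrow> 'j \<Rightarrow> bool) \<Rightarrow>
   ('j \<Rightarrow> nat) \<Rightarrow> ('j \<Rightarrow> 'a sofic_map measure) \<Rightarrow> bool" where
  "asymptotically_continuous H M \<nu> J le d \<P> \<longleftrightarrow>
     (\<forall>F\<in>Fpow (full_pseudogroup H M). \<forall>\<delta>>0. \<exists>j\<in>J. \<forall>j'\<in>J. le j j' \<longrightarrow>
        (AE \<sigma> in \<P> j'. \<forall>f\<in>F. \<forall>g\<in>F.
           ennreal (normcard (d j') (sym_diff (\<sigma> f) (\<sigma> g))) <
             ennreal \<delta> + src_meas H \<nu> (sym_diff f g)))"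


section \<open>Biases and exponential growth rates of \<open>L\<^sup>p\<close>-norms\<close>

datatype 'j bias = Bias_minus | Bias_plus | Bias_ultra "'j filter"

definition ultrafilter :: "'j filter \<Rightarrow> bool" where
  "ultrafilter U \<longleftrightarrow> U \<noteq> bot \<and> (\<forall>A. eventually A U \<or> eventually (\<lambda>x. \<not> A x) U)"

text \<open>A filter on the whole type which contains a subset of \<open>J\<close> is the same as a filter on \<open>J\<close>.\<close>

fun bias_for :: "'j set \<Rightarrow> ('j \<Rightarrow> 'j \<Rightarrow> bool) \<Rightarrow> 'j bias \<Rightarrow> bool" where
  "bias_for J le Bias_minus \<longleftrightarrow> True"
| "bias_for J le Bias_plus \<longleftrightarrow> True"
| "bias_for J le (Bias_ultra U) \<longleftrightarrow>
     ultrafilter U \<and> (\<forall>j\<in>J. eventually (\<lambda>j'. j' \<in> J \<and> le j j') U)"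

fun bias_lim :: "'j set \<Rightarrow> ('j \<Rightarrow> 'j \<Rightarrow> bool) \<Rightarrow> 'j bias \<Rightarrow> ('j \<Rightarrow> ereal) \<Rightarrow> ereal" where
  "bias_lim J le Bias_minus \<Phi> = Liminf (tails J le) \<Phi>"
| "bias_lim J le Bias_plus \<Phi> = Limsup (tails J le) \<Phi>"
| "bias_lim J le (Bias_ultra U) \<Phi> = Lim U \<Phi>"

definition ennpowr :: "ennreal \<Rightarrow> real \<Rightarrow> ennreal" where
  "ennpowr x r = (if x = \<infinity> then \<infinity> else ennreal (enn2real x powr r))"

definition lp_norm :: "ennreal \<Rightarrow> 'b measure \<Rightarrow> ('b \<Rightarrow> ennreal) \<Rightarrow> ennreal" where
  "lp_norm p M X = (if p = \<infinity> then esssup M X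
     else ennpowr (\<integral>\<^sup>+ \<sigma>. ennpowr (X \<sigma>) (enn2real p) \<partial>M) (1 / enn2real p))"

definition elog :: "ennreal \<Rightarrow> ereal" where
  "elog x = (if x = 0 then -\<infinity> else if x = \<infinity> then \<infinity> else ereal (ln (enn2real x)))"

definition growth_rate ::
  "'j set \<Rightarrow> ('j \<Rightarrow> 'j \<Rightarrow> bool) \<Rightarrow> ('j \<Rightarrow> nat) \<Rightarrow> ('j \<Rightarrow> 'b measure) \<Rightarrow> 'j bias \<Rightarrow> ennreal \<Rightarrow>
   (nat \<Rightarrow> 'b \<Rightarrow> ennreal) \<Rightarrow> ereal" where
  "growth_rate J le d \<P> \<beta> p X =
     bias_lim J le \<beta> (\<lambda>j. elog (lp_norm p (\<P> j) (X (d j))) / ereal (real (d j)))"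


section \<open>Topological groupoids\<close>

abbreviation unit_top :: "('a, 'm) gpd_scheme \<Rightarrow> 'a topology \<Rightarrow> 'a topology" where
  "unit_top H T \<equiv> subtopology T (units H)"

locale discrete_topological_groupoid = discrete_groupoid H for H :: "('a, 'm) gpd_scheme" +
  fixes T :: "'a topology"
  assumes topspace_T: "topspace T = arr H"
    and continuous_src: "continuous_map T T (src H)"
    and continuous_rng: "continuous_map T T (rng H)"
    and continuous_ginv: "continuous_map T T (ginv H)"
    and continuous_mult:
      "continuous_map (subtopology (prod_topology T T) (composable H)) T (\<lambda>(f, g). mult H f g)"

definition bisection :: "('a, 'm) gpd_scheme \<Rightarrow> 'a topology \<Rightarrow> 'a set \<Rightarrow> bool" where
  "bisection H T U \<longleftrightarrow> openin T U \<and>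
     openin (unit_top H T) (src H ` U) \<and>
     homeomorphic_map (subtopology T U) (subtopology T (src H ` U)) (src H) \<and>
     openin (unit_top H T) (rng H ` U) \<and>
     homeomorphic_map (subtopology T U) (subtopology T (rng H ` U)) (rng H)"

locale etale_groupoid = discrete_topological_groupoid +
  assumes in_bisection: "h \<in> arr H \<Longrightarrow> \<exists>U. bisection H T U \<and> h \<in> U"

text \<open>Separability is meant in the sense customary for topological groupoids: second countable,
  topological groupoids being Hausdorff. For an etale groupoid with compact metrizable unit space
  this is the same as being separable and metrizable.\<close>

locale separable_etale_groupoid = etale_groupoid +
  assumes Hausdorff: "Hausdorff_space T"
    and second_countable: "second_countable T"

definition full_group_top :: "('a, 'm) gpd_scheme \<Rightarrow> 'a topology \<Rightarrow> 'a set set" where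
  "full_group_top H T = {U. bisection H T U \<and> src H ` U = units H \<and> rng H ` U = units H}"

definition null_boundary_sets ::
  "('a, 'm) gpd_scheme \<Rightarrow> 'a topology \<Rightarrow> 'a measure \<Rightarrow> 'a set set" where
  "null_boundary_sets H T \<nu> = {A \<in> sets \<nu>. emeasure \<nu> (unit_top H T frontier_of A) = 0}"

definition pseudogroup_top ::
  "('a, 'm) gpd_scheme \<Rightarrow> 'a topology \<Rightarrow> 'a measure \<Rightarrow> 'a set set" where
  "pseudogroup_top H T \<nu> = {f \<in> full_pseudogroup H (borel_of T). \<exists>(n::nat) fs.
     f = (\<Union>i<n. fs i) \<and>
     (\<forall>i<n. \<exists>U. bisection H T U \<and> T closure_of fs i \<subseteq> U \<and>
        unit_top H T closure_of (src H ` fs i) \<subseteq> src H ` U \<and>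
        unit_top H T closure_of (rng H ` fs i) \<subseteq> rng H ` U) \<and>
     (\<forall>i<n. src H ` fs i \<in> null_boundary_sets H T \<nu> \<and> rng H ` fs i \<in> null_boundary_sets H T \<nu>) \<and>
     disjoint_family_on (\<lambda>i. src H ` fs i) {..<n} \<and>
     disjoint_family_on (\<lambda>i. rng H ` fs i) {..<n}}"

definition regular_measure :: "'a topology \<Rightarrow> 'a measure \<Rightarrow> bool" where
  "regular_measure T \<nu> \<longleftrightarrow> (\<forall>A\<in>sets \<nu>.
     emeasure \<nu> A = (INF U\<in>{U. openin T U \<and> A \<subseteq> U}. emeasure \<nu> U) \<and>
     emeasure \<nu> A = (SUP C\<in>{C. compactin T C \<and> C \<subseteq> A}. emeasure \<nu> C))"


section \<open>Class-bijective factor maps\<close>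

definition groupoid_morphism ::
  "('g, 'm) gpd_scheme \<Rightarrow> ('h, 'n) gpd_scheme \<Rightarrow> ('g \<Rightarrow> 'h) \<Rightarrow> bool" where
  "groupoid_morphism G H \<pi> \<longleftrightarrow> \<pi> \<in> arr G \<rightarrow> arr H \<and> \<pi> \<in> units G \<rightarrow> units H \<and>
     (\<forall>(f, g)\<in>composable G. (\<pi> f, \<pi> g) \<in> composable H \<and> \<pi> (mult G f g) = mult H (\<pi> f) (\<pi> g)) \<and>
     (\<forall>g\<in>arr G. \<pi> (ginv G g) = ginv H (\<pi> g))"

definition class_bijective_factor ::
  "('g, 'm) gpd_scheme \<Rightarrow> ('h, 'n) gpd_scheme \<Rightarrow> ('g \<Rightarrow> 'h) \<Rightarrow> bool" where
  "class_bijective_factor G H \<pi> \<longleftrightarrow> groupoid_morphism G H \<pi> \<and> \<pi> ` arr G = arr H \<and>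
     (\<forall>a\<in>units G.
        bij_betw \<pi> {g \<in> arr G. src G g = a} {h \<in> arr H. src H h = \<pi> a} \<and>
        bij_betw \<pi> {g \<in> arr G. rng G g = a} {h \<in> arr H. rng H h = \<pi> a})"

text \<open>The special symbol \<open>*\<close> is \<open>None\<close>.\<close>

definition act ::
  "('g, 'm) gpd_scheme \<Rightarrow> ('h, 'n) gpd_scheme \<Rightarrow> ('g \<Rightarrow> 'h) \<Rightarrow> 'h set \<Rightarrow> 'g \<Rightarrow> 'g option" where
  "act G H \<pi> f x = (if \<pi> x \<in> src H ` f
     then Some (rng G (THE g. g \<in> arr G \<and> \<pi> g \<in> f \<and> src G g = x)) else None)"

definition act_set ::
  "('g, 'm) gpd_scheme \<Rightarrow> ('h, 'n) gpd_scheme \<Rightarrow> ('g \<Rightarrow> 'h) \<Rightarrow> 'h set \<Rightarrow> 'g set \<Rightarrow> 'g set" where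
  "act_set G H \<pi> f P = {y. \<exists>x\<in>P. act G H \<pi> f x = Some y}"


section \<open>Topological entropy\<close>

definition continuous_pseudometric :: "'g topology \<Rightarrow> ('g \<Rightarrow> 'g \<Rightarrow> real) \<Rightarrow> bool" where
  "continuous_pseudometric X \<rho> \<longleftrightarrow>
     (\<forall>x\<in>topspace X. \<rho> x x = 0) \<and>
     (\<forall>x\<in>topspace X. \<forall>y\<in>topspace X. 0 \<le> \<rho> x y \<and> \<rho> x y = \<rho> y x) \<and>
     (\<forall>x\<in>topspace X. \<forall>y\<in>topspace X. \<forall>z\<in>topspace X. \<rho> x z \<le> \<rho> x y + \<rho> y z) \<and>
     continuous_map (prod_topology X X) euclideanreal (\<lambda>(x, y). \<rho> x y)"

text \<open>The supremum is a maximum as it is only used on compact spaces.\<close>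

fun ext_dist :: "'g set \<Rightarrow> ('g \<Rightarrow> 'g \<Rightarrow> real) \<Rightarrow> 'g option \<Rightarrow> 'g option \<Rightarrow> real" where
  "ext_dist A \<rho> None None = 0"
| "ext_dist A \<rho> (Some x) (Some y) = \<rho> x y"
| "ext_dist A \<rho> _ _ = (SUP (y, z)\<in>A \<times> A. \<rho> y z)"

definition dynamically_generating ::
  "('g, 'm) gpd_scheme \<Rightarrow> ('h, 'n) gpd_scheme \<Rightarrow> 'h topology \<Rightarrow> ('g \<Rightarrow> 'h) \<Rightarrow>
   ('g \<Rightarrow> 'g \<Rightarrow> real) \<Rightarrow> bool" where
  "dynamically_generating G H TH \<pi> \<rho> \<longleftrightarrow> (\<forall>x\<in>units G. \<forall>y\<in>units G. x \<noteq> y \<longrightarrow>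
     (\<exists>f\<in>full_group_top H TH. 0 < ext_dist (units G) \<rho> (act G H \<pi> f x) (act G H \<pi> f y)))"

definition dist2 :: "nat \<Rightarrow> ('b \<Rightarrow> 'b \<Rightarrow> real) \<Rightarrow> (nat \<Rightarrow> 'b) \<Rightarrow> (nat \<Rightarrow> 'b) \<Rightarrow> real" where
  "dist2 d \<rho> x x' = sqrt ((\<Sum>i\<in>{1..d}. (\<rho> (x i) (x' i))\<^sup>2) / real d)"

definition Orb ::
  "('g, 'm) gpd_scheme \<Rightarrow> ('h, 'n) gpd_scheme \<Rightarrow> 'h measure \<Rightarrow> ('g \<Rightarrow> 'h) \<Rightarrow> nat \<Rightarrow>
   'h sofic_map \<Rightarrow> 'h set set \<Rightarrow> ('h \<Rightarrow> real) set \<Rightarrow> real \<Rightarrow> ('g \<Rightarrow> 'g \<Rightarrow> real) \<Rightarrow> (nat \<Rightarrow> 'g) set" where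
  "Orb G H \<nu> \<pi> d \<sigma> F K \<delta> \<rho> = {x \<in> {1..d} \<rightarrow>\<^sub>E units G.
     (\<forall>f\<in>F. dist2 d (ext_dist (units G) \<rho>)
        (\<lambda>i. act G H \<pi> f (x i)) (\<lambda>i. map_option x (fin_act (\<sigma> f) i)) < \<delta>) \<and>
     (\<forall>k\<in>K. \<bar>(\<Sum>i\<in>{1..d}. k (\<pi> (x i))) / real d - (\<integral>y. k y \<partial>\<nu>)\<bar> < \<delta>)}"

definition sep_number :: "real \<Rightarrow> 'b set \<Rightarrow> ('b \<Rightarrow> 'b \<Rightarrow> real) \<Rightarrow> ennreal" where
  "sep_number \<epsilon> X r =
     (SUP S\<in>{S. finite S \<and> S \<subseteq> X \<and> pairwise (\<lambda>x y. \<epsilon> < r x y) S}. of_nat (card S))"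

definition top_entropy ::
  "('g, 'm) gpd_scheme \<Rightarrow> ('h, 'n) gpd_scheme \<Rightarrow> 'h topology \<Rightarrow> 'h measure \<Rightarrow> ('g \<Rightarrow> 'h) \<Rightarrow>
   'j set \<Rightarrow> ('j \<Rightarrow> 'j \<Rightarrow> bool) \<Rightarrow> ('j \<Rightarrow> nat) \<Rightarrow> ('j \<Rightarrow> 'h sofic_map measure) \<Rightarrow>
   'j bias \<Rightarrow> ennreal \<Rightarrow> ('g \<Rightarrow> 'g \<Rightarrow> real) \<Rightarrow> ereal" where
  "top_entropy G H TH \<nu> \<pi> J le d \<P> \<beta> p \<rho> =
     (SUP \<epsilon>\<in>{0<..}. INF \<delta>\<in>{0<..}. INF F\<in>Fpow (pseudogroup_top H TH \<nu>).
        INF K\<in>Fpow {k. continuous_map (unit_top H TH) euclideanreal k}.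
          growth_rate J le d \<P> \<beta> p
            (\<lambda>n \<sigma>. sep_number \<epsilon> (Orb G H \<nu> \<pi> n \<sigma> F K \<delta> \<rho>) (dist2 n \<rho>)))"


section \<open>Measure entropy\<close>

definition finite_partition :: "'g measure \<Rightarrow> 'g set set \<Rightarrow> bool" where
  "finite_partition \<mu> \<P> \<longleftrightarrow> finite \<P> \<and> partition_on (space \<mu>) \<P> \<and> \<P> \<subseteq> sets \<mu>"

definition coarsest_partition :: "'g set \<Rightarrow> 'g set set \<Rightarrow> 'g set set" where
  "coarsest_partition A S =
     (let good = (\<lambda>R. partition_on A R \<and> (\<forall>B\<in>S. \<exists>C\<subseteq>R. B = \<Union>C))
      in THE R. good R \<and> (\<forall>R'. good R' \<longrightarrow> refines A R' R))"

definition partition_act ::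
  "('g, 'm) gpd_scheme \<Rightarrow> ('h, 'n) gpd_scheme \<Rightarrow> ('g \<Rightarrow> 'h) \<Rightarrow> 'g set set \<Rightarrow> 'h set set \<Rightarrow>
   'g set set" where
  "partition_act G H \<pi> \<P> F = coarsest_partition (units G) {act_set G H \<pi> f P | f P. f \<in> F \<and> P \<in> \<P>}"

definition set_homs :: "'g set \<Rightarrow> 'g set set \<Rightarrow> nat \<Rightarrow> ('g set \<Rightarrow> nat set) set" where
  "set_homs A \<Sigma> d = {\<phi> \<in> \<Sigma> \<rightarrow>\<^sub>E Pow {1..d}. \<phi> {} = {} \<and> \<phi> A = {1..d} \<and>
     (\<forall>B\<in>\<Sigma>. \<forall>C\<in>\<Sigma>. \<phi> (B \<union> C) = \<phi> B \<union> \<phi> C \<and> \<phi> (B \<inter> C) = \<phi> B \<inter> \<phi> C)}"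

definition Hom ::
  "('g, 'm) gpd_scheme \<Rightarrow> ('h, 'n) gpd_scheme \<Rightarrow> 'g measure \<Rightarrow> ('g \<Rightarrow> 'h) \<Rightarrow> nat \<Rightarrow>
   'h sofic_map \<Rightarrow> 'g set set \<Rightarrow> 'h set set \<Rightarrow> real \<Rightarrow> ('g set \<Rightarrow> nat set) set" where
  "Hom G H \<mu> \<pi> d \<sigma> \<P> F \<delta> =
     {\<phi> \<in> set_homs (units G) (sigma_sets (units G) (partition_act G H \<pi> \<P> F)) d.
        (\<forall>f\<in>F. (\<Sum>P\<in>\<P>. normcard d
            (sym_diff (fin_act_set (\<sigma> f) (\<phi> P)) (\<phi> (act_set G H \<pi> f P)))) < \<delta>) \<and>
        (\<Sum>P\<in>partition_act G H \<pi> \<P> F. \<bar>normcard d (\<phi> P) - measure \<mu> P\<bar>) < \<delta>}"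

definition Hom_count ::
  "('g, 'm) gpd_scheme \<Rightarrow> ('h, 'n) gpd_scheme \<Rightarrow> 'g measure \<Rightarrow> ('g \<Rightarrow> 'h) \<Rightarrow> nat \<Rightarrow>
   'h sofic_map \<Rightarrow> 'g set set \<Rightarrow> 'h set set \<Rightarrow> real \<Rightarrow> 'g set set \<Rightarrow> nat" where
  "Hom_count G H \<mu> \<pi> d \<sigma> \<P> F \<delta> \<Q> =
     card ((\<lambda>\<phi>. restrict \<phi> (sigma_sets (units G) \<Q>)) ` Hom G H \<mu> \<pi> d \<sigma> \<P> F \<delta>)"

definition measure_entropy ::
  "('g, 'm) gpd_scheme \<Rightarrow> 'g measure \<Rightarrow> ('h, 'n) gpd_scheme \<Rightarrow> 'h measure \<Rightarrow> ('g \<Rightarrow> 'h) \<Rightarrow>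
   'j set \<Rightarrow> ('j \<Rightarrow> 'j \<Rightarrow> bool) \<Rightarrow> ('j \<Rightarrow> nat) \<Rightarrow> ('j \<Rightarrow> 'h sofic_map measure) \<Rightarrow>
   'j bias \<Rightarrow> ennreal \<Rightarrow> ereal" where
  "measure_entropy G \<mu> H M \<pi> J le d Pr \<beta> p =
     (SUP \<Q>\<in>{\<Q>. finite_partition \<mu> \<Q>}.
        INF \<P>\<in>{\<P>. finite_partition \<mu> \<P> \<and> refines (units G) \<P> \<Q>}.
          INF F\<in>{F \<in> Fpow (full_pseudogroup H M). units H \<in> F}. INF \<delta>\<in>{0<..}.
            growth_rate J le d Pr \<beta> p (\<lambda>n \<sigma>. of_nat (Hom_count G H \<mu> \<pi> n \<sigma> \<P> F \<delta> \<Q>)))"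

end

theory Submission imports Defs begin

text \<open>A bias other than \<open>-\<close> is a limes superior along a filter, so that the growth rate of a finite
  sum is the largest of the growth rates of its terms. Hence, by compactness of the space of set
  functions, some \<open>L\<close> is such that the microstates with empirical measure near \<open>L\<close> grow as fast as
  all microstates. A Borel measure \<open>\<mu>\<close> below \<open>L\<close> on open sets is invariant and lies over \<open>\<nu>\<close>, since
  microstates nearly intertwine the two actions, and on a partition with small atoms whose
  boundaries are null these microstates induce distinct approximate homomorphisms.

  Conversely, a homomorphism for a fine partition comes from a microstate. By packing in the
  Hamming metric, up to a small rate the homomorphisms have itineraries that differ on a positive
  proportion of indices; finitely many elements of the topological full group separate the
  corresponding points, so the microstates are \<open>\<epsilon>\<close>-separated.\<close>

section \<open>Borel measures on compact metrizable spaces\<close>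

text \<open>The two entropies test different objects: microstates are tested against
  \<open>pseudogroup_top\<close> and continuous functions, homomorphisms against all Borel elements
  of the full pseudogroup. Borel elements are therefore approximated by open ones, and asymptotic
  continuity makes the approximation visible in the sofic maps. A second obstacle is that
  \<open>\<rho>\<close> is only dynamically generating, so distinct points may be at
  \<open>\<rho>\<close>-distance zero; distance is recovered after translating by elements of the
  topological full group, and the open test elements are built to be stable under such translations.
  Third, empirical measures are followed on arbitrary sets, so \<open>L\<close> is merely finitely
  additive. It dominates \<open>\<mu>\<close> on open sets and is dominated by it on closed ones,
  hence each statement about \<open>\<mu>\<close> has to be squeezed between an open and a closed
  set. Finally, if \<open>\<rho>\<close> has diameter zero, the orbit condition says nothing about
  domains; then there is a single unit, and trace preservation takes over.\<close>

lemma space_borel_of [simp]: "space (borel_of X) = topspace X"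
  by (simp add: borel_of_def openin_subset subset_Pow_Union space_measure_of_conv)

lemma sets_borel_of: "sets (borel_of X) = sigma_sets (topspace X) {U. openin X U}"
  unfolding borel_of_def by (subst sets_measure_of) (auto dest: openin_subset)

lemma openin_borel_of: "openin X U \<Longrightarrow> U \<in> sets (borel_of X)"
  by (auto simp: sets_borel_of)

lemma closedin_borel_of: "closedin X C \<Longrightarrow> C \<in> sets (borel_of X)"
proof -
  assume C: "closedin X C"
  then have "topspace X - C \<in> sets (borel_of X)" by (intro openin_borel_of) auto
  then have "space (borel_of X) - (topspace X - C) \<in> sets (borel_of X)" by (rule sets.compl_sets)
  moreover have "space (borel_of X) - (topspace X - C) = C" using closedin_subset[OF C] by auto
  ultimately show ?thesis by simp
qed

lemma borel_of_measurable:
  assumes "continuous_map X Y f"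
  shows "f \<in> borel_of X \<rightarrow>\<^sub>M borel_of Y"
  unfolding borel_of_def[of Y]
proof (rule measurable_measure_of)
  show "f \<in> space (borel_of X) \<rightarrow> topspace Y" using assms by (simp add: continuous_map_def)
  fix U assume "U \<in> {U. openin Y U}"
  then have "openin X {x \<in> topspace X. f x \<in> U}" using assms openin_continuous_map_preimage by blast
  moreover have "f -` U \<inter> space (borel_of X) = {x \<in> topspace X. f x \<in> U}" by auto
  ultimately show "f -` U \<inter> space (borel_of X) \<in> sets (borel_of X)" by (simp add: openin_borel_of)
qed (auto dest: openin_subset)

lemma continuous_map_borel_measurable:
  assumes "continuous_map X euclideanreal f"
  shows "f \<in> borel_measurable (borel_of X)"
proof (rule borel_measurableI)
  fix S :: "real set" assume "open S"
  then have "openin X {x \<in> topspace X. f x \<in> S}" 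
    using assms openin_continuous_map_preimage by fastforce
  moreover have "f -` S \<inter> space (borel_of X) = {x \<in> topspace X. f x \<in> S}" by auto
  ultimately show "f -` S \<inter> space (borel_of X) \<in> sets (borel_of X)" by (simp add: openin_borel_of)
qed

lemma sets_restrict_borel_of:
  assumes "S \<in> sets (borel_of X)"
  shows "sets (restrict_space (borel_of X) S) = sets (borel_of (subtopology X S))"
proof -
  have S: "S \<subseteq> topspace X" using sets.sets_into_space[OF assms] by simp
  have "sets (restrict_space (borel_of X) S) = (\<inter>) S ` sigma_sets (topspace X) {U. openin X U}"
    unfolding sets_restrict_space sets_borel_of ..
  also have "\<dots> = sigma_sets S ((\<inter>) S ` {U. openin X U})"
    by (rule sigma_sets_Int) (use assms S in \<open>auto simp: sets_borel_of\<close>)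
  also have "((\<inter>) S ` {U. openin X U}) = {U. openin (subtopology X S) U}"
    by (auto simp: openin_subtopology Int_commute)
  also have "sigma_sets S \<dots> = sets (borel_of (subtopology X S))"
    using S by (simp add: sets_borel_of inf.absorb2)
  finally show ?thesis .
qed

lemma sets_borel_of_subtopology:
  assumes "S \<in> sets (borel_of X)"
  shows "sets (borel_of (subtopology X S)) = {A. A \<subseteq> S \<and> A \<in> sets (borel_of X)}"
proof -
  have "sets (borel_of (subtopology X S)) = (\<inter>) S ` sets (borel_of X)"
    using sets_restrict_borel_of[OF assms] by (simp add: sets_restrict_space)
  also have "\<dots> = {A. A \<subseteq> S \<and> A \<in> sets (borel_of X)}"
  proof (intro equalityI subsetI)
    show "A \<in> (\<inter>) S ` sets (borel_of X)" if "A \<in> {A. A \<subseteq> S \<and> A \<in> sets (borel_of X)}" for A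
      using that by (intro image_eqI[of _ _ A]) auto
  qed (use assms in auto)
  finally show ?thesis .
qed

text \<open>The image under a homeomorphism is the preimage under its continuous inverse.\<close>

lemma homeomorphic_image_borel_of:
  assumes "homeomorphic_map X Y f" "A \<in> sets (borel_of X)"
  shows "f ` A \<in> sets (borel_of Y)"
proof -
  obtain g where g: "homeomorphic_maps X Y f g" using assms homeomorphic_map_maps by blast
  then have c: "continuous_map Y X g" by (simp add: homeomorphic_maps_def)
  have "g -` A \<inter> space (borel_of Y) \<in> sets (borel_of Y)"
    using measurable_sets[OF borel_of_measurable[OF c] assms(2)] .
  moreover have "g -` A \<inter> space (borel_of Y) = f ` A"
    using g sets.sets_into_space[OF assms(2)]
    unfolding homeomorphic_maps_def continuous_map_def Pi_def by (force simp: image_iff)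
  ultimately show ?thesis by simp
qed

section \<open>Normality and regularity of finite measures in compact metrizable spaces\<close>

locale compact_metrizable =
  fixes X :: "'a topology"
  assumes compact: "compact_space X" and metrizable: "metrizable_space X"
begin

lemma Hausdorff: "Hausdorff_space X"
  using metrizable metrizable_imp_Hausdorff_space by blast

lemma normal: "normal_space X"
  using metrizable metrizable_imp_normal_space by blast

lemma compactin_iff_closedin: "compactin X C \<longleftrightarrow> closedin X C"
  using compact Hausdorff compactin_imp_closedin closedin_compact_space by blast

lemma open_nbhd:
  assumes "closedin X C" "openin X U" "C \<subseteq> U"
  obtains V where "openin X V" "C \<subseteq> V" "X closure_of V \<subseteq> U"
proof -
  have "closedin X (topspace X - U)" "disjnt C (topspace X - U)"
    using assms by (auto simp: disjnt_def)
  then obtain V W where VW: "openin X V" "openin X W" "C \<subseteq> V" "topspace X - U \<subseteq> W" "disjnt V W"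
    using normal assms(1) unfolding normal_space_def by meson
  have "X closure_of V \<subseteq> topspace X - W"
    by (rule closure_of_minimal) (use VW openin_subset[OF VW(1)] in \<open>auto simp: disjnt_def\<close>)
  then have "X closure_of V \<subseteq> U" using VW by blast
  then show ?thesis using that VW by blast
qed

text \<open>The level sets of a Urysohn function \<open>u\<close> are disjoint, so a finite measure
  charges only countably many of them. The frontier of \<open>{u < r}\<close> lies in
  \<open>{u = r}\<close>, and an interval of values \<open>r\<close> offers a null level.\<close>

lemma open_nbhd_null_frontier:
  assumes "closedin X C" "openin X U" "C \<subseteq> U" "finite_measure M" "sets M = sets (borel_of X)"
  obtains V where "openin X V" "C \<subseteq> V" "X closure_of V \<subseteq> U" "measure M (X frontier_of V) = 0"
proof -
  interpret finite_measure M by fact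
  have "closedin X (topspace X - U)" "disjnt C (topspace X - U)"
    using assms by (auto simp: disjnt_def)
  then obtain u where u: "continuous_map X (top_of_set {0..1::real}) u" "u ` C \<subseteq> {0}" "u ` (topspace X - U) \<subseteq> {1}"
    using Urysohn_lemma[OF normal assms(1), of "topspace X - U" 0 1] by auto
  then have cu: "continuous_map X euclideanreal u" by (simp add: continuous_map_in_subtopology)
  have mu: "u \<in> borel_measurable M"
    using continuous_map_borel_measurable[OF cu] by (simp add: measurable_cong_sets[OF assms(5) refl])
  interpret D: finite_measure "distr M borel u" by (rule finite_measure_distr[OF mu])
  have "countable {r. measure (distr M borel u) {r} \<noteq> 0}" by (rule D.countable_support)
  then obtain r where r: "r \<in> {0<..<1::real}" "measure (distr M borel u) {r} = 0"
    using uncountable_open_interval[of 0 "1::real"]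
    by (metis (mono_tags, lifting) countable_subset mem_Collect_eq subsetI zero_less_one)
  define V where "V = {x \<in> topspace X. u x < r}"
  have oV: "openin X V"
    using openin_continuous_map_preimage[OF cu, of "{..<r}"] by (simp add: V_def)
  have cV: "X closure_of V \<subseteq> {x \<in> topspace X. u x \<le> r}"
    using closedin_continuous_map_preimage[OF cu, of "{..r}"]
    by (intro closure_of_minimal) (auto simp: V_def)
  have "X frontier_of V \<subseteq> {x \<in> topspace X. u x = r}"
    using cV oV by (auto simp: frontier_of_def interior_of_openin V_def)
  moreover have "measure M {x \<in> topspace X. u x = r} = 0"
  proof -
    have "{x \<in> topspace X. u x = r} = u -` {r} \<inter> space M"
      using sets_eq_imp_space_eq[OF assms(5)] by auto
    then show ?thesis using r(2) by (simp add: measure_distr[OF mu])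
  qed
  moreover have "{x \<in> topspace X. u x = r} \<in> sets M"
    using closedin_continuous_map_preimage[OF cu, of "{r}"] by (simp add: assms(5) closedin_borel_of)
  ultimately have "measure M (X frontier_of V) = 0"
    by (metis finite_measure_mono measure_le_0_iff)
  moreover have "C \<subseteq> V" using u r closedin_subset[OF assms(1)] by (force simp: V_def)
  moreover have "X closure_of V \<subseteq> U" using cV u(3) r by force
  ultimately show ?thesis using that oV by blast
qed

text \<open>The sets with such approximations form a sigma-algebra containing the open sets, because
  in a metrizable space these are increasing unions of sequences of closed sets.\<close>

lemma regular_approx:
  assumes "finite_measure M" and sM: "sets M = sets (borel_of X)" and "A \<in> sets M" "e > 0"
  obtains C U where "closedin X C" "openin X U" "C \<subseteq> A" "A \<subseteq> U" "measure M (U - C) < e"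
proof -
  interpret finite_measure M by fact
  have spM: "space M = topspace X" using sets_eq_imp_space_eq[OF sM] by simp
  have oM: "openin X U \<Longrightarrow> U \<in> sets M" and cM: "closedin X U \<Longrightarrow> U \<in> sets M" for U
    using sM by (auto simp: openin_borel_of closedin_borel_of)
  let ?P = "\<lambda>A. \<forall>e>0. \<exists>C U. closedin X C \<and> openin X U \<and> C \<subseteq> A \<and> A \<subseteq> U \<and> measure M (U - C) < e"
  have "A \<in> sigma_sets (topspace X) {U. openin X U}" using assms by (simp add: sets_borel_of)
  then have "?P A"
  proof (induction rule: sigma_sets.induct)
    case (Basic U)
    then have U: "openin X U" by simp
    have "fsigma_in X U" using open_imp_fsigma_in[OF metrizable U] .
    then obtain D where D: "\<And>n::nat. closedin X (D n)" "\<And>n. D n \<subseteq> D (Suc n)" "\<Union> (range D) = U"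
      unfolding fsigma_in_ascending by blast
    have lim: "(\<lambda>n. measure M (D n)) \<longlonglongrightarrow> measure M (\<Union>n. D n)"
      by (rule finite_Lim_measure_incseq) (use D cM in \<open>auto intro: incseq_SucI\<close>)
    show ?case
    proof (intro allI impI)
      fix e :: real assume e: "e > 0"
      have "eventually (\<lambda>n. measure M (D n) > measure M (\<Union>n. D n) - e) sequentially"
        using e lim by (intro order_tendstoD(1)) auto
      then obtain n where n: "measure M (D n) > measure M U - e"
        using D(3) by (auto simp: eventually_sequentially)
      have DU: "D n \<subseteq> U" using D(3) by auto
      have "measure M (U - D n) = measure M U - measure M (D n)"
        by (rule finite_measure_Diff) (use DU D cM oM U in auto)
      then show "\<exists>C V. closedin X C \<and> openin X V \<and> C \<subseteq> U \<and> U \<subseteq> V \<and> measure M (V - C) < e"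
        using n D(1) U DU by (intro exI[of _ "D n"] exI[of _ U]) auto
    qed
  next
    case Empty
    show ?case by (auto intro!: exI[of _ "{}"])
  next
    case (Compl A)
    show ?case
    proof (intro allI impI)
      fix e :: real assume "e > 0"
      then obtain C U where CU: "closedin X C" "openin X U" "C \<subseteq> A" "A \<subseteq> U" "measure M (U - C) < e"
        using Compl.IH by meson
      have "topspace X - C - (topspace X - U) = U - C" using openin_subset[OF CU(2)] by auto
      then show "\<exists>C U. closedin X C \<and> openin X U \<and> C \<subseteq> topspace X - A \<and> topspace X - A \<subseteq> U \<and> measure M (U - C) < e"
        using CU by (intro exI[of _ "topspace X - U"] exI[of _ "topspace X - C"]) auto
    qed
  next
    case (Union A)
    show ?case
    proof (intro allI impI)
      fix e :: real assume e: "e > 0"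
      \<comment> \<open>The tolerances \<open>e / 4 * (1/2) ^ i\<close> add up to
        \<open>e / 2\<close>; the other half pays for replacing the union of all \<open>C i\<close>,
        which need not be closed, by a finite one.\<close>
      have "\<exists>C U. closedin X C \<and> openin X U \<and> C \<subseteq> A i \<and> A i \<subseteq> U \<and> measure M (U - C) < e / 4 * (1/2) ^ i" for i
        using Union.IH[of i, rule_format, of "e / 4 * (1/2) ^ i"] e by simp
      then obtain C U where CU: "\<And>i. closedin X (C i)" "\<And>i. openin X (U i)" "\<And>i. C i \<subseteq> A i" "\<And>i. A i \<subseteq> U i"
         "\<And>i. measure M (U i - C i) < e / 4 * (1/2) ^ i"
        by metis
      have mC: "range C \<subseteq> sets M" using CU cM by auto
      have mU: "range U \<subseteq> sets M" using CU oM by auto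
      have "(\<lambda>n. measure M (\<Union>i<n. C i)) \<longlonglongrightarrow> measure M (\<Union>n. \<Union>i<n. C i)"
        by (rule finite_Lim_measure_incseq) (use mC in \<open>fastforce simp: incseq_def\<close>)+
      moreover have "(\<Union>n. \<Union>i<n. C i) = (\<Union>i. C i)" by auto
      ultimately have "eventually (\<lambda>n. measure M (\<Union>i<n. C i) > measure M (\<Union>i. C i) - e/2) sequentially"
        using e by (intro order_tendstoD(1)) auto
      then obtain n where n: "measure M (\<Union>i<n. C i) > measure M (\<Union>i. C i) - e/2"
        by (auto simp: eventually_sequentially)
      have su: "summable (\<lambda>i. e / 4 * (1/2::real) ^ i)" by (intro summable_mult summable_geometric) auto
      have su2: "summable (\<lambda>i. measure M (U i - C i))"
        by (rule summable_comparison_test[OF _ su]) (use CU(5) in \<open>auto intro!: exI[of _ 0] less_imp_le\<close>)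
      have "measure M (\<Union>i. U i - C i) \<le> (\<Sum>i. measure M (U i - C i))"
        by (rule finite_measure_subadditive_countably) (use mC mU su2 in auto)
      also have "\<dots> \<le> (\<Sum>i. e / 4 * (1/2::real) ^ i)"
        by (rule suminf_le[OF _ su2 su]) (use CU(5) in \<open>auto intro: less_imp_le\<close>)
      also have "\<dots> = e/2" using suminf_mult[of "\<lambda>i. (1/2::real)^i" "e/4"] suminf_geometric[of "1/2::real"] by (simp add: summable_geometric)
      finally have 1: "measure M (\<Union>i. U i - C i) \<le> e/2" .
      have "measure M ((\<Union>i. C i) - (\<Union>i<n. C i)) = measure M (\<Union>i. C i) - measure M (\<Union>i<n. C i)"
        by (rule finite_measure_Diff) (use mC in auto)
      with n have 2: "measure M ((\<Union>i. C i) - (\<Union>i<n. C i)) < e/2" by simp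
      have "measure M ((\<Union>i. U i) - (\<Union>i<n. C i)) \<le> measure M ((\<Union>i. U i - C i) \<union> ((\<Union>i. C i) - (\<Union>i<n. C i)))"
        by (rule finite_measure_mono) (use mC mU in auto)
      also have "\<dots> \<le> measure M (\<Union>i. U i - C i) + measure M ((\<Union>i. C i) - (\<Union>i<n. C i))"
        by (rule measure_Un_le) (use mC mU in auto)
      finally have "measure M ((\<Union>i. U i) - (\<Union>i<n. C i)) < e" using 1 2 by simp
      moreover have 3: "closedin X (\<Union>i<n. C i)" "openin X (\<Union>i. U i)"
        using CU by (auto intro!: closedin_Union openin_Union)
      moreover have 4: "(\<Union>i<n. C i) \<subseteq> \<Union> (range A)" using CU(3) by fast
      moreover have 5: "\<Union> (range A) \<subseteq> (\<Union>i. U i)" using CU(4) by fast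
      ultimately show "\<exists>C U. closedin X C \<and> openin X U \<and> C \<subseteq> \<Union> (range A) \<and> \<Union> (range A) \<subseteq> U \<and> measure M (U - C) < e"
        using 3 4 5 by (intro exI[of _ "\<Union>i<n. C i"] exI[of _ "\<Union>i. U i"] conjI)
    qed
  qed
  then show ?thesis using \<open>e > 0\<close> that by meson
qed

end

context compact_metrizable begin

text \<open>The neighbourhood is chosen inside \<open>U \<inter> W\<close>, where regularity
  supplies an open \<open>W\<close> that exceeds \<open>C\<close> by less than
  \<open>e\<close>.\<close>

lemma open_nbhd_small:
  assumes "closedin X C" "openin X U" "C \<subseteq> U" and M: "finite_measure M" "sets M = sets (borel_of X)" and "e > 0"
  obtains V where "openin X V" "C \<subseteq> V" "X closure_of V \<subseteq> U" "measure M (X frontier_of V) = 0"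
    "measure M (V - C) < e"
proof -
  interpret finite_measure M by fact
  have oM: "openin X U \<Longrightarrow> U \<in> sets M" and cM: "closedin X U \<Longrightarrow> U \<in> sets M" for U
    using M by (auto simp: openin_borel_of closedin_borel_of)
  obtain D W where DW: "closedin X D" "openin X W" "D \<subseteq> C" "C \<subseteq> W" "measure M (W - D) < e"
    using regular_approx[OF M cM[OF assms(1)] \<open>e > 0\<close>] by blast
  obtain V where V: "openin X V" "C \<subseteq> V" "X closure_of V \<subseteq> U \<inter> W" "measure M (X frontier_of V) = 0"
    using open_nbhd_null_frontier[OF assms(1), of "U \<inter> W" M] assms DW by auto
  have "V \<subseteq> W" using V closure_of_subset[OF openin_subset[OF V(1)]] by auto
  then have "measure M (V - C) \<le> measure M (W - D)"
    using DW V oM cM assms(1) by (intro finite_measure_mono) auto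
  then show ?thesis using that[of V] V DW by auto
qed

lemma open_approx_inside:
  assumes U: "openin X U" and M: "finite_measure M" "sets M = sets (borel_of X)" and "e > 0"
  obtains V where "openin X V" "X closure_of V \<subseteq> U" "measure M U < measure M V + e"
proof -
  interpret finite_measure M by fact
  have oM: "openin X U \<Longrightarrow> U \<in> sets M" and cM: "closedin X U \<Longrightarrow> U \<in> sets M" for U
    using M by (auto simp: openin_borel_of closedin_borel_of)
  obtain D W where DW: "closedin X D" "openin X W" "D \<subseteq> U" "U \<subseteq> W" "measure M (W - D) < e"
    using regular_approx[OF M oM[OF U] \<open>e > 0\<close>] by blast
  obtain V where V: "openin X V" "D \<subseteq> V" "X closure_of V \<subseteq> U"
    using open_nbhd[OF DW(1) U DW(3)] by blast
  have VU: "V \<subseteq> U" using V closure_of_subset[OF openin_subset[OF V(1)]] by auto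
  have "measure M U - measure M V = measure M (U - V)"
    by (rule finite_measure_Diff[symmetric]) (use oM V U VU in auto)
  also have "\<dots> \<le> measure M (W - D)"
    by (rule finite_measure_mono) (use DW V oM cM in auto)
  finally show ?thesis using that[of V] V DW by auto
qed

text \<open>Regularity carries the inequality from open to Borel sets, and total mass one turns it
  into an equality by passing to complements.\<close>

lemma prob_eqI_open:
  assumes M: "prob_space M" "sets M = sets (borel_of X)" and N: "prob_space N" "sets N = sets (borel_of X)"
    and le: "\<And>U. openin X U \<Longrightarrow> measure M U \<le> measure N U"
  shows "M = N"
proof -
  interpret M: prob_space M by fact
  interpret N: prob_space N by fact
  have le': "measure M A \<le> measure N A" if A: "A \<in> sets M" for A
  proof (rule field_le_epsilon)
    fix e :: real assume "e > 0"
    then obtain C U where CU: "closedin X C" "openin X U" "C \<subseteq> A" "A \<subseteq> U" "measure N (U - C) < e"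
      using regular_approx[OF N.finite_measure_axioms N(2), of A e] A M N by auto
    have s: "C \<in> sets N" "U \<in> sets N" "A \<in> sets N" "U \<in> sets M"
      using CU M N A by (auto simp: openin_borel_of closedin_borel_of)
    have "measure M A \<le> measure M U" by (rule M.finite_measure_mono) (use CU s in auto)
    also have "\<dots> \<le> measure N U" using le CU by blast
    also have "\<dots> = measure N (U - C) + measure N C"
      using N.finite_measure_Diff[of U C] s CU by auto
    also have "measure N C \<le> measure N A" by (rule N.finite_measure_mono) (use CU s in auto)
    finally show "measure M A \<le> measure N A + e" using CU by simp
  qed
  have sp: "space M = space N" using M N sets_eq_imp_space_eq by metis
  show ?thesis
  proof (rule measure_eqI)
    fix A assume A: "A \<in> sets M"
    have "measure M (space M - A) \<le> measure N (space N - A)" using le'[of "space M - A"] sets.compl_sets[OF A] sp by simp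
    then have "measure N A \<le> measure M A"
      using M.prob_compl[OF A] N.prob_compl[of A] A M N by auto
    then show "emeasure M A = emeasure N A"
      using le'[OF A] by (simp add: M.emeasure_eq_measure N.emeasure_eq_measure)
  qed (use M N in simp)
qed

text \<open>Any finitely additive probability on all subsets of a compact space can be replaced by a Borel
  measure that is smaller on open sets: regularize from inside with closed sets on the open sets,
  then from outside, and apply Caratheodory's theorem.\<close>

lemma borel_measure_le_content:
  assumes nonneg: "\<And>A. A \<subseteq> topspace X \<Longrightarrow> 0 \<le> L A" and one: "L (topspace X) = (1::real)"
    and add: "\<And>A B. A \<subseteq> topspace X \<Longrightarrow> B \<subseteq> topspace X \<Longrightarrow> A \<inter> B = {} \<Longrightarrow> L (A \<union> B) = L A + L B"
  obtains M where "prob_space M" "sets M = sets (borel_of X)" "\<And>U. openin X U \<Longrightarrow> measure M U \<le> L U"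
proof -
  have mono: "L A \<le> L B" if "A \<subseteq> B" "B \<subseteq> topspace X" for A B
  proof -
    have "L (A \<union> (B - A)) = L A + L (B - A)" by (rule add) (use that in auto)
    moreover have "A \<union> (B - A) = B" using that by auto
    ultimately show ?thesis using nonneg[of "B - A"] that by auto
  qed
  have subadd: "L (A \<union> B) \<le> L A + L B" if "A \<subseteq> topspace X" "B \<subseteq> topspace X" for A B
  proof -
    have "L (A \<union> (B - A)) = L A + L (B - A)" by (rule add) (use that in auto)
    then show ?thesis using mono[of "B - A" B] that by auto
  qed
  \<comment> \<open>Inner values: the supremum of \<open>L\<close> over closed subsets. A finitely
    additive \<open>L\<close> may lose mass in this passage, so on open sets the result is only
    below \<open>L\<close>.\<close>
  define m where "m U = (SUP C\<in>{C. closedin X C \<and> C \<subseteq> U}. ennreal (L C))" for U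
  define f where "f A = (INF U\<in>{U. openin X U \<and> A \<subseteq> U}. m U)" for A
  have mI: "ennreal (L C) \<le> m U" if "closedin X C" "C \<subseteq> U" for C U
    unfolding m_def by (rule SUP_upper) (use that in auto)
  have mL: "m U \<le> ennreal (L U)" if "U \<subseteq> topspace X" for U
    unfolding m_def by (rule SUP_least) (use that mono in \<open>auto intro!: ennreal_leI\<close>)
  have m_mono: "U \<subseteq> V \<Longrightarrow> m U \<le> m V" for U V
    unfolding m_def by (rule SUP_subset_mono) auto
  have fm: "f U = m U" if "openin X U" for U
    unfolding f_def by (rule antisym) (use that m_mono in \<open>auto intro: INF_lower2 INF_greatest\<close>)
  have f_le: "f A \<le> m U" if "openin X U" "A \<subseteq> U" for A U
    unfolding f_def by (rule INF_lower) (use that in auto)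
  have L0: "L {} = 0" using add[of "{}" "{}"] by auto
  have m0: "m {} = 0" using mL[of "{}"] L0 by simp
  \<comment> \<open>Induction on the number of open sets: by normality the part of \<open>C\<close>
    missed by the other sets has a neighbourhood whose closure lies in \<open>U a\<close>, which
    splits \<open>C\<close> into two closed pieces.\<close>
  have finsub: "ennreal (L C) \<le> (\<Sum>i\<in>I. m (U i))"
    if "finite I" "closedin X C" "C \<subseteq> (\<Union>i\<in>I. U i)" "\<And>i. i \<in> I \<Longrightarrow> openin X (U i)" for I :: "nat set" and C U
    using that
  proof (induction arbitrary: C)
    case empty
    then show ?case using L0 by simp
  next
    case (insert a I)
    have o: "openin X (U a)" "openin X (\<Union>i\<in>I. U i)" using insert.prems by auto
    have "closedin X (C - (\<Union>i\<in>I. U i))" using insert.prems(1) o by (simp add: closedin_diff)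
    moreover have "C - (\<Union>i\<in>I. U i) \<subseteq> U a" using insert.prems(2) by auto
    ultimately obtain V where V: "openin X V" "C - (\<Union>i\<in>I. U i) \<subseteq> V" "X closure_of V \<subseteq> U a"
      using open_nbhd[of _ "U a"] o by blast
    have VU: "V \<subseteq> X closure_of V" using closure_of_subset[OF openin_subset[OF V(1)]] .
    have c: "closedin X (C \<inter> X closure_of V)" "closedin X (C - V)"
      using insert.prems(1) V by (auto simp: closedin_diff)
    have "L C \<le> L ((C \<inter> X closure_of V) \<union> (C - V))"
      by (rule mono) (use VU closedin_subset[OF insert.prems(1)] in auto)
    also have "\<dots> \<le> L (C \<inter> X closure_of V) + L (C - V)"
      by (rule subadd) (use c closedin_subset in auto)
    finally have "ennreal (L C) \<le> ennreal (L (C \<inter> X closure_of V)) + ennreal (L (C - V))"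
      by (metis c closedin_subset ennreal_leI ennreal_plus nonneg)
    also have "\<dots> \<le> m (U a) + (\<Sum>i\<in>I. m (U i))"
      by (intro add_mono mI insert.IH) (use c V insert.prems in auto)
    finally show ?case using insert.hyps by simp
  qed
  \<comment> \<open>Compactness of a closed \<open>C\<close> inside the union reduces the countable
    cover to a finite one.\<close>
  have msub: "m (\<Union>i. U i) \<le> (\<Sum>i. m (U i))" if U: "\<And>i::nat. openin X (U i)" for U
    unfolding m_def[of "\<Union>i. U i"]
  proof (rule SUP_least)
    fix C assume "C \<in> {C. closedin X C \<and> C \<subseteq> \<Union> (range U)}"
    then have C: "closedin X C" "C \<subseteq> \<Union> (range U)" by auto
    then have "compactin X C" using compactin_iff_closedin by blast
    then obtain \<F> where \<F>: "finite \<F>" "\<F> \<subseteq> range U" "C \<subseteq> \<Union>\<F>"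
      using C(2) U unfolding compactin_def by (metis (no_types, lifting) imageE)
    then obtain I where I: "finite I" "\<F> = U ` I" using finite_subset_image by metis
    have "ennreal (L C) \<le> (\<Sum>i\<in>I. m (U i))" by (rule finsub) (use I \<F> C U in auto)
    also have "\<dots> \<le> (\<Sum>i. m (U i))" by (rule sum_le_suminf) (use I in auto)
    finally show "ennreal (L C) \<le> (\<Sum>i. m (U i))" .
  qed
  have f1: "f A \<le> 1" if "A \<subseteq> topspace X" for A
    using order_trans[OF f_le[OF openin_topspace that] mL[OF subset_refl]] one by simp
  have oms: "outer_measure_space (Pow (topspace X)) f"
    unfolding outer_measure_space_def
  proof (intro conjI)
    show "positive (Pow (topspace X)) f" using fm[of "{}"] m0 by (simp add: positive_def)
    show "increasing (Pow (topspace X)) f"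
      unfolding increasing_def f_def by (intro ballI impI INF_superset_mono) auto
    show "countably_subadditive (Pow (topspace X)) f"
      unfolding countably_subadditive_def
    proof (intro allI impI)
      fix A :: "nat \<Rightarrow> 'a set" assume "range A \<subseteq> Pow (topspace X)"
      then have A: "\<And>i. A i \<subseteq> topspace X" by auto
      show "f (\<Union> (range A)) \<le> (\<Sum>i. f (A i))"
      proof (rule ennreal_le_epsilon)
        fix e :: real assume e: "e > 0"
        have "\<exists>U. openin X U \<and> A i \<subseteq> U \<and> m U < f (A i) + ennreal (e * (1/2) ^ Suc i)" for i
        proof -
          have "f (A i) + 0 < f (A i) + ennreal (e * (1/2) ^ Suc i)"
            using f1[OF A[of i]] e by (subst ennreal_add_left_cancel_less) (auto simp: top_unique)
          then have "f (A i) < f (A i) + ennreal (e * (1/2) ^ Suc i)" by simp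
          then show ?thesis unfolding f_def by (subst (asm) INF_less_iff) auto
        qed
        then obtain U where U: "\<And>i. openin X (U i)" "\<And>i. A i \<subseteq> U i"
          "\<And>i. m (U i) < f (A i) + ennreal (e * (1/2) ^ Suc i)" by metis
        have "f (\<Union> (range A)) \<le> m (\<Union> (range U))" by (rule f_le) (use U in auto)
        also have "\<dots> \<le> (\<Sum>i. m (U i))" by (rule msub) (rule U)
        also have "\<dots> \<le> (\<Sum>i. f (A i) + ennreal (e * (1/2) ^ Suc i))"
          by (rule suminf_le) (use U(3) in \<open>auto intro: less_imp_le\<close>)
        also have "\<dots> = (\<Sum>i. f (A i)) + (\<Sum>i. ennreal (e * (1/2) ^ Suc i))"
          by (rule suminf_add[symmetric]) auto
        also have "(\<Sum>i. ennreal (e * (1/2) ^ Suc i)) = ennreal e"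
          using sums_mult[OF power_half_series, of e] e by (intro suminf_ennreal_eq) auto
        finally show "f (\<Union> (range A)) \<le> (\<Sum>i. f (A i)) + ennreal e" .
      qed
    qed
  qed
  from sigma_algebra.caratheodory_lemma[OF sigma_algebra_Pow this]
  have ms: "measure_space (topspace X) (lambda_system (topspace X) (Pow (topspace X)) f) f" .
  \<comment> \<open>Caratheodory's condition for an open \<open>V\<close>: for an open
    \<open>U\<close> containing \<open>A\<close>, a closed \<open>C\<close> inside
    \<open>U \<inter> V\<close> is fixed first, then a closed \<open>D\<close> inside the open set
    \<open>U - C\<close>. As \<open>C\<close> and \<open>D\<close> are disjoint, \<open>L\<close> is
    additive on them.\<close>
  have "V \<in> lambda_system (topspace X) (Pow (topspace X)) f" if V: "openin X V" for V
    unfolding algebra.lambda_system_eq[OF algebra_Pow]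
  proof (rule CollectI, intro conjI ballI)
    show "V \<in> Pow (topspace X)" using openin_subset[OF V] by auto
    fix A assume "A \<in> Pow (topspace X)"
    then have A: "A \<subseteq> topspace X" by simp
    have "f (A \<inter> V) + f (A - V) \<le> f A"
      unfolding f_def[of A]
    proof (rule INF_greatest)
      fix U assume "U \<in> {U. openin X U \<and> A \<subseteq> U}"
      then have U: "openin X U" "A \<subseteq> U" by auto
      have "f (A \<inter> V) \<le> m (U \<inter> V)" by (rule f_le) (use U V in auto)
      then have "f (A \<inter> V) + f (A - V) \<le> m (U \<inter> V) + f (A - V)" by (rule add_right_mono)
      also have "m (U \<inter> V) + f (A - V) = (SUP C\<in>{C. closedin X C \<and> C \<subseteq> U \<inter> V}. ennreal (L C) + f (A - V))"
        unfolding m_def by (rule ennreal_SUP_add_left[symmetric]) (use f1[of "A - V"] A in \<open>auto simp: top_unique intro!: exI[of _ "{}"]\<close>)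
      also have "\<dots> \<le> m U"
      proof (rule SUP_least)
        fix C assume "C \<in> {C. closedin X C \<and> C \<subseteq> U \<inter> V}"
        then have C: "closedin X C" "C \<subseteq> U" "C \<subseteq> V" by auto
        have "f (A - V) \<le> m (U - C)" by (rule f_le) (use U C in auto)
        then have "ennreal (L C) + f (A - V) \<le> ennreal (L C) + m (U - C)" by (rule add_left_mono)
        also have "\<dots> = (SUP D\<in>{D. closedin X D \<and> D \<subseteq> U - C}. ennreal (L C) + ennreal (L D))"
          unfolding m_def by (rule ennreal_SUP_add_right) (auto intro!: exI[of _ "{}"])
        also have "\<dots> \<le> m U"
        proof (rule SUP_least)
          fix D assume "D \<in> {D. closedin X D \<and> D \<subseteq> U - C}"
          then have D: "closedin X D" "D \<subseteq> U - C" by auto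
          have CD: "C \<subseteq> topspace X" "D \<subseteq> topspace X" "C \<inter> D = {}" using C D closedin_subset by blast+
          have "ennreal (L C) + ennreal (L D) = ennreal (L (C \<union> D))"
            using CD by (simp add: add nonneg)
          also have "\<dots> \<le> m U" by (rule mI) (use C D in auto)
          finally show "ennreal (L C) + ennreal (L D) \<le> m U" .
        qed
        finally show "ennreal (L C) + f (A - V) \<le> m U" .
      qed
      finally show "f (A \<inter> V) + f (A - V) \<le> m U" .
    qed
    moreover have "f ((A \<inter> V) \<union> (A - V)) \<le> f (A \<inter> V) + f (A - V)"
    proof -
      interpret P: algebra "topspace X" "Pow (topspace X)" by (rule algebra_Pow)
      have "subadditive (Pow (topspace X)) f"
        using oms by (intro P.countably_subadditive_subadditive) (auto simp: outer_measure_space_def)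
      then show ?thesis by (rule subadditiveD) (use A openin_subset[OF V] in auto)
    qed
    moreover have "(A \<inter> V) \<union> (A - V) = A" by auto
    ultimately show "f (A \<inter> V) + f (A - V) = f A" by auto
  qed
  then have sub: "sets (borel_of X) \<subseteq> lambda_system (topspace X) (Pow (topspace X)) f"
    unfolding sets_borel_of using ms
    by (intro sigma_algebra.sigma_sets_subset) (auto simp: measure_space_def)
  define M where "M = measure_of (topspace X) (sets (borel_of X)) f"
  have ms': "measure_space (topspace X) (sets (borel_of X)) f"
    by (rule measure_down[OF ms _ sub]) (use sets.sigma_algebra_axioms[of "borel_of X"] in simp)
  have sM: "sets M = sets (borel_of X)"
    unfolding M_def by (subst sets_measure_of) (use sets.space_closed[of "borel_of X"] sets.sigma_sets_eq[of "borel_of X"] in auto)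
  have spM: "space M = topspace X" using sets_eq_imp_space_eq[OF sM] by simp
  have eM: "emeasure M A = f A" if "A \<in> sets (borel_of X)" for A
    unfolding M_def using ms' that by (intro emeasure_measure_of_sigma) (auto simp: measure_space_def)
  have "f (topspace X) = 1"
    unfolding fm[OF openin_topspace] using mL[OF subset_refl] mI[OF closedin_topspace subset_refl] one
    by (intro antisym) simp_all
  then have "prob_space M" by (intro prob_spaceI) (simp add: spM eM openin_borel_of)
  moreover have "measure M U \<le> L U" if "openin X U" for U
  proof -
    have "emeasure M U \<le> ennreal (L U)" using that by (simp add: eM openin_borel_of fm mL openin_subset)
    then show ?thesis using nonneg[OF openin_subset[OF that]] by (simp add: measure_def enn2real_leI)
  qed
  ultimately show ?thesis using that sM by blast
qed

end

text \<open>By Tychonoff's theorem the set functions with values in the unit interval form a compact space.\<close>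

lemma set_function_selection:
  fixes R :: "('a set \<Rightarrow> real) \<Rightarrow> 'a set set \<Rightarrow> real \<Rightarrow> bool"
  assumes "\<And>L. \<exists>\<A> e. finite \<A> \<and> 0 < e \<and> R L \<A> e"
  obtains \<L> where "finite \<L>"
    "\<And>l. \<forall>A. l A \<in> {0..1} \<Longrightarrow> \<exists>(L, \<A>, e)\<in>\<L>. finite \<A> \<and> 0 < e \<and> R L \<A> e \<and> (\<forall>A\<in>\<A>. \<bar>l A - L A\<bar> < e)"
proof -
  let ?T = "product_topology (\<lambda>_::'a set. top_of_set {0..1::real}) UNIV"
  have "compact_space (top_of_set {0..1::real})"
    by (simp add: compact_space_subtopology)
  then have comp: "compact_space ?T" by (simp add: compact_space_product_topology)
  obtain \<A> e where Ae: "\<And>L. finite (\<A> L)" "\<And>L. 0 < e L" "\<And>L. R L (\<A> L) (e L)"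
    using assms by metis
  define N where "N L = {l \<in> topspace ?T. \<forall>A\<in>\<A> L. \<bar>l A - L A\<bar> < e L}" for L
  have oN: "openin ?T (N L)" for L
  proof -
    have "openin ?T {l \<in> topspace ?T. \<bar>l A - L A\<bar> < e L}" for A
    proof -
      have c: "continuous_map ?T euclideanreal (\<lambda>l. l A)"
        using continuous_map_product_projection[of A UNIV "\<lambda>_. top_of_set {0..1::real}"]
        by (simp add: continuous_map_in_subtopology)
      have "continuous_map ?T euclideanreal (\<lambda>l. \<bar>l A - L A\<bar>)"
        by (intro continuous_map_real_abs continuous_map_diff c) simp
      from openin_continuous_map_preimage[OF this, of "{..<e L}"] show ?thesis by simp
    qed
    then have "openin ?T (topspace ?T \<inter> \<Inter> ((\<lambda>A. {l \<in> topspace ?T. \<bar>l A - L A\<bar> < e L}) ` \<A> L))"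
      by (intro openin_Int_Inter) (use Ae(1) in \<open>auto simp del: topspace_product_topology\<close>)
    also have "topspace ?T \<inter> \<Inter> ((\<lambda>A. {l \<in> topspace ?T. \<bar>l A - L A\<bar> < e L}) ` \<A> L) = N L"
      unfolding N_def by (auto simp del: topspace_product_topology)
    finally show ?thesis .
  qed
  \<comment> \<open>Every point of the cube lies in the basic neighbourhood that the hypothesis
    attaches to it, so these neighbourhoods cover the cube.\<close>
  have "l \<in> N l" if "l \<in> topspace ?T" for l
    using that Ae(2) by (simp add: N_def del: topspace_product_topology)
  then have "topspace ?T \<subseteq> \<Union> (range N)" by blast
  then obtain \<F> where \<F>: "finite \<F>" "\<F> \<subseteq> range N" "topspace ?T \<subseteq> \<Union> \<F>"
    using comp oN unfolding compact_space_alt by (metis (no_types, lifting) imageE)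
  then obtain S where S: "finite S" "\<F> = N ` S" by (metis finite_subset_image)
  show ?thesis
  proof (rule that[of "(\<lambda>L. (L, \<A> L, e L)) ` S"])
    fix l :: "'a set \<Rightarrow> real" assume "\<forall>A. l A \<in> {0..1}"
    then have "l \<in> topspace ?T" by auto
    then obtain L where "L \<in> S" "l \<in> N L" using \<F> S by blast
    then show "\<exists>(L, \<A>, e)\<in>(\<lambda>L. (L, \<A> L, e L)) ` S. finite \<A> \<and> 0 < e \<and> R L \<A> e \<and> (\<forall>A\<in>\<A>. \<bar>l A - L A\<bar> < e)"
      using Ae by (auto simp: N_def)
  qed (use S in simp)
qed

lemma continuous_pseudometric_slice:
  assumes "continuous_pseudometric X \<rho>" "x \<in> topspace X"
  shows "continuous_map X euclideanreal (\<rho> x)"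
proof -
  have "continuous_map X (prod_topology X X) (\<lambda>y. (x, y))"
    using assms(2) by (intro continuous_map_pairedI) auto
  moreover have "continuous_map (prod_topology X X) euclideanreal (\<lambda>(x, y). \<rho> x y)"
    using assms(1) by (simp add: continuous_pseudometric_def)
  ultimately have "continuous_map X euclideanreal ((\<lambda>(x, y). \<rho> x y) \<circ> (\<lambda>y. (x, y)))"
    by (rule continuous_map_compose)
  then show ?thesis by (simp add: o_def)
qed

section \<open>Partitions into small sets with null boundary\<close>

context compact_metrizable begin

text \<open>The sphere \<open>Z\<close> of every ball used is a null set; off these spheres the atoms are open.\<close>

lemma small_partition:
  assumes \<rho>: "continuous_pseudometric X \<rho>" and M: "finite_measure M" "sets M = sets (borel_of X)" and "e > 0"
  obtains \<Q> Z where "finite_partition M \<Q>" "closedin X Z" "measure M Z = 0"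
    "\<And>q. q \<in> \<Q> \<Longrightarrow> openin X (q - Z)"
    "\<And>q x y. q \<in> \<Q> \<Longrightarrow> x \<in> q \<Longrightarrow> y \<in> q \<Longrightarrow> \<rho> x y \<le> e"
proof -
  interpret finite_measure M by fact
  have spM: "space M = topspace X" using sets_eq_imp_space_eq[OF M(2)] by simp
  have oM: "openin X U \<Longrightarrow> U \<in> sets M" and cM: "closedin X U \<Longrightarrow> U \<in> sets M" for U
    using M by (auto simp: openin_borel_of closedin_borel_of)
  have "\<exists>r\<in>{0<..<e/2}. measure M {y \<in> topspace X. \<rho> x y = r} = 0" if x: "x \<in> topspace X" for x
  proof -
    have mu: "\<rho> x \<in> borel_measurable M"
      using continuous_map_borel_measurable[OF continuous_pseudometric_slice[OF \<rho> x]]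
      by (simp add: measurable_cong_sets[OF M(2) refl])
    interpret D: finite_measure "distr M borel (\<rho> x)" by (rule finite_measure_distr[OF mu])
    have "countable {r. measure (distr M borel (\<rho> x)) {r} \<noteq> 0}" by (rule D.countable_support)
    then obtain r where r: "r \<in> {0<..<e/2}" "measure (distr M borel (\<rho> x)) {r} = 0"
      using uncountable_open_interval[of 0 "e/2"] \<open>e > 0\<close>
      by (metis (mono_tags, lifting) countable_subset half_gt_zero mem_Collect_eq subsetI)
    have eq: "{y \<in> topspace X. \<rho> x y = r} = \<rho> x -` {r} \<inter> space M" using spM by auto
    have "measure M {y \<in> topspace X. \<rho> x y = r} = 0"
      using r(2) unfolding eq by (simp add: measure_distr[OF mu])
    then show ?thesis using r(1) by blast
  qed
  then obtain r where r: "\<And>x. x \<in> topspace X \<Longrightarrow> 0 < r x \<and> r x < e/2"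
    "\<And>x. x \<in> topspace X \<Longrightarrow> measure M {y \<in> topspace X. \<rho> x y = r x} = 0"
    by (metis greaterThanLessThan_iff)
  define B where "B x = {y \<in> topspace X. \<rho> x y < r x}" for x
  define S where "S x = {y \<in> topspace X. \<rho> x y = r x}" for x
  have oB: "openin X (B x)" if "x \<in> topspace X" for x
    using openin_continuous_map_preimage[OF continuous_pseudometric_slice[OF \<rho> that], of "{..<r x}"]
    by (simp add: B_def)
  have cBS: "openin X (topspace X - B x - S x)" and cS: "closedin X (S x)" if "x \<in> topspace X" for x
  proof -
    have "topspace X - B x - S x = {y \<in> topspace X. \<rho> x y \<in> {r x<..}}" by (auto simp: B_def S_def)
    then show "openin X (topspace X - B x - S x)"
      using openin_continuous_map_preimage[OF continuous_pseudometric_slice[OF \<rho> that], of "{r x<..}"] by simp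
    show "closedin X (S x)" 
      using closedin_continuous_map_preimage[OF continuous_pseudometric_slice[OF \<rho> that], of "{r x}"]
      by (simp add: S_def)
  qed
  have "x \<in> B x" if "x \<in> topspace X" for x
    using that r(1) \<rho> by (simp add: B_def continuous_pseudometric_def)
  then have "topspace X \<subseteq> \<Union> (B ` topspace X)" by auto
  then obtain \<F> where \<F>: "finite \<F>" "\<F> \<subseteq> B ` topspace X" "topspace X \<subseteq> \<Union> \<F>"
    using compact oB unfolding compact_space_alt by (metis (no_types, lifting) imageE)
  then obtain I where I: "finite I" "I \<subseteq> topspace X" "\<F> = B ` I" by (metis finite_subset_image)
  obtain xs where xs: "set xs = I" using I(1) finite_list by auto
  define n where "n = length xs"
  \<comment> \<open>The balls are made disjoint in the order of the list. Radii below
    \<open>e / 2\<close> keep the \<open>\<rho>\<close>-diameter of each piece at most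
    \<open>e\<close>.\<close>
  define A where "A i = B (xs ! i) - (\<Union>j<i. B (xs ! j))" for i
  have xsX: "xs ! i \<in> topspace X" if "i < n" for i using that xs I n_def by (metis nth_mem subsetD)
  define Z where "Z = (\<Union>i<n. S (xs ! i))"
  have Z: "closedin X Z" unfolding Z_def using cS xsX by (intro closedin_Union) auto
  have mZ: "measure M Z = 0"
  proof -
    have "measure M Z \<le> (\<Sum>i<n. measure M (S (xs ! i)))"
      unfolding Z_def by (rule finite_measure_subadditive_finite) (use cS cM xsX in auto)
    also have "\<dots> = 0" using r(2) xsX by (intro sum.neutral) (auto simp: S_def)
    finally show ?thesis by (simp add: measure_le_0_iff)
  qed
  have AZ: "openin X (A i - Z)" if i: "i < n" for i
  proof -
    \<comment> \<open>Off the spheres, to avoid an earlier ball means to be at distance larger than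
      its radius, which is an open condition.\<close>
    have "A i - Z = B (xs ! i) \<inter> (topspace X - Z) \<inter> ((\<Inter>j\<in>{..<i}. topspace X - B (xs ! j) - S (xs ! j)) \<inter> topspace X)"
      using i by (auto simp: A_def Z_def B_def)
    also have "openin X \<dots>"
      by (intro openin_Int openin_INT2 openin_INT) (use oB cBS xsX i Z in auto)
    finally show ?thesis .
  qed
  have cov: "\<exists>i<n. x \<in> A i" if "x \<in> topspace X" for x
  proof -
    have "\<exists>i<n. x \<in> B (xs ! i)" using \<F> I xs that unfolding n_def by (metis UN_E in_set_conv_nth subsetD)
    then obtain i where i: "i < n \<and> x \<in> B (xs ! i)" "\<And>j. j < i \<Longrightarrow> \<not> (j < n \<and> x \<in> B (xs ! j))"
      using exists_least_iff[of "\<lambda>i. i < n \<and> x \<in> B (xs ! i)"] by auto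
    then show ?thesis by (auto simp: A_def intro!: exI[of _ i])
  qed
  define \<Q> where "\<Q> = A ` {..<n} - {{}}"
  have disj: "i = j" if "x \<in> A i" "x \<in> A j" for i j x
    using that by (cases i j rule: linorder_cases) (auto simp: A_def)
  have "finite_partition M \<Q>"
    unfolding finite_partition_def partition_on_def spM
  proof (intro conjI)
    have "A i \<subseteq> topspace X" for i by (auto simp: A_def B_def)
    then have "\<Union> \<Q> \<subseteq> topspace X" unfolding \<Q>_def by blast
    moreover have "topspace X \<subseteq> \<Union> \<Q>" using cov unfolding \<Q>_def by fast
    ultimately show "\<Union> \<Q> = topspace X" by (rule equalityI)
    show "disjoint \<Q>"
      unfolding \<Q>_def disjoint_def using disj by (smt (verit) DiffE disjoint_iff imageE)
    show "\<Q> \<subseteq> sets M" using oM oB xsX by (auto simp: \<Q>_def A_def)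
  qed (auto simp: \<Q>_def)
  moreover have "\<rho> x y \<le> e" if q: "q \<in> \<Q>" "x \<in> q" "y \<in> q" for q x y
  proof -
    obtain i where i: "i < n" "x \<in> B (xs ! i)" "y \<in> B (xs ! i)" using q by (auto simp: \<Q>_def A_def)
    then have "\<rho> (xs ! i) x < e/2" "\<rho> (xs ! i) y < e/2" using r(1)[OF xsX[OF i(1)]] by (auto simp: B_def)
    moreover have "\<rho> x y \<le> \<rho> x (xs ! i) + \<rho> (xs ! i) y" "\<rho> x (xs ! i) = \<rho> (xs ! i) x"
      using \<rho> i xsX[OF i(1)] by (auto simp: continuous_pseudometric_def B_def)
    ultimately show ?thesis by simp
  qed
  ultimately show ?thesis using that[of \<Q> Z] Z mZ AZ by (auto simp: \<Q>_def)
qed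

end

section \<open>Packing in the Hamming metric\<close>

text \<open>An exponential Markov inequality. Inside the ball
  \<open>exp (t * d * ln (1 / s))\<close> times \<open>s\<close> to the Hamming distance is at least
  1, and the sum of these weights over all words factors into one sum over letters per position,
  each at most \<open>1 + m * s \<le> exp (m * s)\<close>.\<close>

lemma Hamming_ball_card:
  fixes s t :: real and d m :: nat
  assumes V: "finite V" "card V \<le> m" and a: "a \<in> {1..d} \<rightarrow>\<^sub>E V" and s: "0 < s" "s \<le> 1"
  shows "card {b \<in> {1..d} \<rightarrow>\<^sub>E V. card {i\<in>{1..d}. a i \<noteq> b i} \<le> t * d} \<le> exp ((m * s + t * ln (1 / s)) * d)"
proof -
  let ?E = "{1..d} \<rightarrow>\<^sub>E V" and ?h = "\<lambda>b. card {i\<in>{1..d}. a i \<noteq> b i}"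
  have fE: "finite ?E" using V by (intro finite_PiE) auto
  have w: "(\<Prod>i\<in>{1..d}. if b i = a i then 1 else s) = s ^ ?h b" for b
  proof -
    have "(\<Prod>i\<in>{1..d}. if b i = a i then 1 else s) = (\<Prod>i\<in>{i\<in>{1..d}. a i \<noteq> b i}. s)"
      by (rule prod.mono_neutral_cong_right) auto
    then show ?thesis by simp
  qed
  have "real (card {b \<in> ?E. ?h b \<le> t * d}) = (\<Sum>b\<in>{b \<in> ?E. ?h b \<le> t * d}. 1)" by simp
  also have "\<dots> \<le> (\<Sum>b\<in>{b \<in> ?E. ?h b \<le> t * d}. exp (t * d * ln (1 / s)) * s ^ ?h b)"
  proof (rule sum_mono)
    fix b assume "b \<in> {b \<in> ?E. ?h b \<le> t * d}"
    then have "real (?h b) * ln (1 / s) \<le> t * d * ln (1 / s)" using s by (intro mult_right_mono) auto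
    moreover have "s ^ ?h b = exp (- (real (?h b) * ln (1 / s)))"
      using s by (simp add: ln_div powr_realpow[symmetric] powr_def)
    ultimately show "1 \<le> exp (t * d * ln (1 / s)) * s ^ ?h b" by (simp flip: exp_add)
  qed
  also have "\<dots> \<le> (\<Sum>b\<in>?E. exp (t * d * ln (1 / s)) * s ^ ?h b)"
    using fE s by (intro sum_mono2) auto
  also have "\<dots> = exp (t * d * ln (1 / s)) * (\<Sum>b\<in>?E. \<Prod>i\<in>{1..d}. if b i = a i then 1 else s)"
    by (simp only: w sum_distrib_left)
  also have "(\<Sum>b\<in>?E. \<Prod>i\<in>{1..d}. if b i = a i then 1 else s) = (\<Prod>i\<in>{1..d}. \<Sum>v\<in>V. if v = a i then 1 else s)"
    by (rule prod_sum_PiE[symmetric]) (use V in auto)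
  also have "\<dots> \<le> (\<Prod>i\<in>{1..d}. exp (m * s))"
  proof (intro prod_mono conjI)
    fix i assume i: "i \<in> {1..d}"
    have "(\<Sum>v\<in>V. if v = a i then 1 else s) = (\<Sum>v\<in>{a i}. 1) + (\<Sum>v\<in>V - {a i}. s)"
      using a i V by (subst sum.subset_diff[of "{a i}"]) (auto intro!: sum.cong)
    also have "\<dots> \<le> 1 + m * s"
      using s V card_mono[of V "V - {a i}"] by (auto intro!: mult_right_mono)
    also have "\<dots> \<le> exp (m * s)" by (rule exp_ge_add_one_self)
    finally show "(\<Sum>v\<in>V. if v = a i then 1 else s) \<le> exp (m * s)" .
  qed (use s in \<open>auto intro!: sum_nonneg\<close>)
  also have "\<dots> = exp (m * s * d)" by (simp add: exp_of_nat_mult[symmetric] mult.commute)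
  also have "exp (t * d * ln (1 / s)) * exp (m * s * d) = exp ((m * s + t * ln (1 / s)) * d)"
    by (simp add: algebra_simps flip: exp_add)
  finally show ?thesis by simp
qed

text \<open>Take a maximal subset whose words differ pairwise in more than \<open>t * d\<close>
  places: its Hamming balls cover \<open>Y\<close>, and each holds at most
  \<open>exp (\<kappa> * d)\<close> words.\<close>

lemma packing:
  fixes \<kappa> :: real
  assumes "\<kappa> > 0"
  obtains t :: real where "t > 0"
    "\<And>(d::nat) V Y. finite V \<Longrightarrow> card V \<le> m \<Longrightarrow> Y \<subseteq> {1..d} \<rightarrow>\<^sub>E V \<Longrightarrow>
      \<exists>S\<subseteq>Y. pairwise (\<lambda>a b. t * d < card {i\<in>{1..d}. a i \<noteq> b i}) S \<and> card Y \<le> card S * exp (\<kappa> * d)"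
proof -
  \<comment> \<open>The choice gives \<open>m * s \<le> \<kappa> / 2\<close>, and \<open>t\<close>
    then makes the other exponent of \<open>Hamming_ball_card\<close> equal to
    \<open>\<kappa> / 2\<close>. Both depend on \<open>\<kappa>\<close> and \<open>m\<close> only,
    not on the length \<open>d\<close>.\<close>
  define s where "s = min (1/2) (\<kappa> / (2 * (real m + 1)))"
  define t where "t = \<kappa> / (2 * ln (1 / s))"
  have s: "0 < s" "s \<le> 1/2" unfolding s_def using assms by (simp, linarith)
  have ms: "m * s \<le> \<kappa> / 2"
  proof -
    have "m * s \<le> (real m + 1) * (\<kappa> / (2 * (real m + 1)))"
      using s assms by (intro mult_mono) (auto simp: s_def)
    also have "\<dots> = \<kappa> / 2"
    proof -
      have "real m + 1 \<noteq> 0" by linarith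
      then show ?thesis by (simp add: divide_simps)
    qed
    finally show ?thesis .
  qed
  have l: "ln (1 / s) > 0" using s by (intro ln_gt_zero) auto
  then have t: "t > 0" "t * ln (1 / s) = \<kappa> / 2" using assms by (auto simp: t_def)
  show ?thesis
  proof (rule that[OF t(1)])
    fix d :: nat and V :: "'a set" and Y :: "(nat \<Rightarrow> 'a) set"
    assume V: "finite V" "card V \<le> m" and Y: "Y \<subseteq> {1..d} \<rightarrow>\<^sub>E V"
    let ?h = "\<lambda>a b. card {i\<in>{1..d}. a i \<noteq> b i}"
    have fY: "finite Y" using V Y by (intro finite_subset[OF Y] finite_PiE) auto
    let ?\<S> = "{S. S \<subseteq> Y \<and> pairwise (\<lambda>a b. t * d < ?h a b) S}"
    have "finite ?\<S>" using fY by simp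
    moreover have "{} \<in> ?\<S>" by simp
    ultimately obtain S where S: "S \<in> ?\<S>" "\<And>S'. S' \<in> ?\<S> \<Longrightarrow> S \<subseteq> S' \<Longrightarrow> S = S'"
      using finite_has_maximal[of ?\<S>] by (metis (no_types, lifting) empty_iff)
    have fS: "finite S" using S(1) fY finite_subset by auto
    have sym: "?h a b = ?h b a" for a b :: "nat \<Rightarrow> 'a" by (rule arg_cong[where f=card]) auto
    have cov: "\<exists>a\<in>S. ?h a b \<le> t * d" if "b \<in> Y" for b
    proof (rule ccontr)
      assume "\<not> ?thesis"
      then have *: "\<And>a. a \<in> S \<Longrightarrow> t * d < ?h a b" by (auto simp: not_le)
      then have "\<And>a. a \<in> S \<Longrightarrow> t * d < ?h b a" using sym by metis
      with * have "insert b S \<in> ?\<S>"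
        using S(1) that by (auto simp: pairwise_insert)
      then have "b \<in> S" using S(2) by blast
      then have "t * d < ?h b b" by (rule *)
      then show False using t by (simp add: mult_less_0_iff)
    qed
    let ?B = "\<lambda>a. {b \<in> {1..d} \<rightarrow>\<^sub>E V. ?h a b \<le> t * d}"
    have fB: "finite (?B a)" for a using V by (intro finite_subset[OF _ finite_PiE[of "{1..d}" "\<lambda>_. V"]]) auto
    have "Y \<subseteq> (\<Union>a\<in>S. ?B a)"
    proof
      fix b assume b: "b \<in> Y"
      then obtain a where "a \<in> S" "?h a b \<le> t * d" using cov by auto
      moreover have "b \<in> {1..d} \<rightarrow>\<^sub>E V" using b Y by auto
      ultimately show "b \<in> (\<Union>a\<in>S. ?B a)" by (intro UN_I CollectI conjI)
    qed
    then have "card Y \<le> card (\<Union>a\<in>S. ?B a)"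
      by (rule card_mono[rotated]) (rule finite_UN_I[OF fS fB])
    also have "\<dots> \<le> (\<Sum>a\<in>S. card (?B a))" by (rule card_UN_le[OF fS])
    finally have "real (card Y) \<le> (\<Sum>a\<in>S. real (card (?B a)))" by (simp flip: of_nat_sum)
    also have "\<dots> \<le> (\<Sum>a\<in>S. exp (\<kappa> * d))"
    proof (rule sum_mono)
      fix a assume "a \<in> S"
      then have "a \<in> {1..d} \<rightarrow>\<^sub>E V" using S(1) Y by auto
      then have "card (?B a) \<le> exp ((m * s + t * ln (1 / s)) * d)"
        using Hamming_ball_card[OF V, of a d s t] s by auto
      also have "\<dots> \<le> exp (\<kappa> * d)" using ms t by (auto intro!: mult_right_mono)
      finally show "real (card (?B a)) \<le> exp (\<kappa> * d)" .
    qed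
    finally show "\<exists>S\<subseteq>Y. pairwise (\<lambda>a b. t * d < ?h a b) S \<and> card Y \<le> card S * exp (\<kappa> * d)"
      using S(1) by auto
  qed
qed

section \<open>Exponential growth rates\<close>

lemma eventually_tails:
  assumes "directed_set J le"
  shows "eventually P (tails J le) \<longleftrightarrow> (\<exists>j\<in>J. \<forall>j'\<in>J. le j j' \<longrightarrow> P j')"
proof -
  have "eventually P (tails J le) \<longleftrightarrow> (\<exists>j\<in>J. eventually P (principal {j'\<in>J. le j j'}))"
    unfolding tails_def
  proof (rule eventually_INF_base)
    show "J \<noteq> {}" using assms by (simp add: directed_set_def)
    fix a b assume ab: "a \<in> J" "b \<in> J"
    then obtain c where c: "c \<in> J" "le a c" "le b c" using assms unfolding directed_set_def by blast
    then have "{j'\<in>J. le c j'} \<subseteq> {j'\<in>J. le a j'} \<inter> {j'\<in>J. le b j'}"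
      using assms ab unfolding directed_set_def by blast
    then show "\<exists>x\<in>J. principal {j'\<in>J. le x j'} \<le> inf (principal {j'\<in>J. le a j'}) (principal {j'\<in>J. le b j'})"
      using c(1) by auto
  qed
  then show ?thesis by (auto simp: eventually_principal)
qed

text \<open>An ultrafilter decides each event \<open>\<Phi> x < c\<close>, so no \<open>c\<close>
  can lie strictly between the limes inferior and the limes superior; in \<open>ereal\<close> the
  limit therefore exists.\<close>

lemma ultrafilter_Lim:
  fixes \<Phi> :: "'j \<Rightarrow> ereal"
  assumes "ultrafilter U"
  shows "Lim U \<Phi> = Limsup U \<Phi>"
proof -
  have nb: "U \<noteq> bot" and dich: "\<And>A. eventually A U \<or> eventually (\<lambda>x. \<not> A x) U"
    using assms by (auto simp: ultrafilter_def)
  have "Limsup U \<Phi> \<le> Liminf U \<Phi>"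
  proof (rule ccontr)
    assume "\<not> ?thesis"
    then obtain c where c: "Liminf U \<Phi> < c" "c < Limsup U \<Phi>" using dense[of "Liminf U \<Phi>" "Limsup U \<Phi>"] by (auto simp: not_le)
    from dich[of "\<lambda>x. \<Phi> x < c"] show False
    proof
      assume "eventually (\<lambda>x. \<Phi> x < c) U"
      then have "Limsup U \<Phi> \<le> c" by (intro Limsup_bounded) (auto elim: eventually_mono)
      then show False using c by auto
    next
      assume "eventually (\<lambda>x. \<not> \<Phi> x < c) U"
      then have "c \<le> Liminf U \<Phi>" by (intro Liminf_bounded) (auto elim: eventually_mono)
      then show False using c by auto
    qed
  qed
  then have "Liminf U \<Phi> = Limsup U \<Phi>" using Liminf_le_Limsup[OF nb, of \<Phi>] by (intro antisym)
  then have "(\<Phi> \<longlongrightarrow> Limsup U \<Phi>) U" using nb by (subst tendsto_iff_Liminf_eq_Limsup) auto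
  then show ?thesis by (rule tendsto_Lim[OF nb])
qed

text \<open>Gives the admissible biases one common form. \<open>FF \<le> tails J le\<close> lets
  statements valid from some index on be used along \<open>FF\<close>.\<close>

lemma bias_lim_eq_Limsup:
  assumes "directed_set J le" "bias_for J le \<beta>" "\<beta> \<noteq> Bias_minus"
  obtains FF where "FF \<noteq> bot" "FF \<le> tails J le" "\<And>\<Phi>. bias_lim J le \<beta> \<Phi> = Limsup FF \<Phi>"
proof (cases \<beta>)
  case Bias_plus
  have "tails J le \<noteq> bot"
    unfolding trivial_limit_def eventually_tails[OF assms(1)] using assms(1) unfolding directed_set_def by blast
  then show ?thesis using that[of "tails J le"] Bias_plus by simp
next
  case (Bias_ultra U)
  then have U: "ultrafilter U" "\<And>j. j \<in> J \<Longrightarrow> eventually (\<lambda>j'. j' \<in> J \<and> le j j') U" using assms(2) by auto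
  have "U \<le> tails J le"
    unfolding tails_def by (intro INF_greatest) (use U(2) in \<open>simp add: le_principal\<close>)
  then show ?thesis using that[of U] U(1) Bias_ultra by (simp add: ultrafilter_Lim ultrafilter_def)
qed (use assms in simp)

lemma ennpowr_mono: "x \<le> y \<Longrightarrow> 0 \<le> r \<Longrightarrow> ennpowr x r \<le> ennpowr y r"
  unfolding ennpowr_def
  by (auto simp: top_unique less_top intro!: ennreal_leI powr_mono2 enn2real_mono)

lemma ennpowr_mult:
  assumes "c > 0" "r > 0"
  shows "ennpowr (ennreal c * x) r = ennreal (c powr r) * ennpowr x r"
  using assms by (cases x) (auto simp: ennpowr_def ennreal_mult_eq_top_iff ennreal_mult_top powr_mult simp flip: ennreal_mult)

lemma measurable_ennpowr [measurable]:
  assumes [measurable]: "X \<in> borel_measurable M"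
  shows "(\<lambda>x. ennpowr (X x) r) \<in> borel_measurable M"
  unfolding ennpowr_def by measurable

lemma elog_mono: "x \<le> y \<Longrightarrow> elog x \<le> elog y"
  unfolding elog_def
  by (auto simp: top_unique less_top enn2real_positive_iff zero_less_iff_neq_zero intro!: ln_mono enn2real_mono)

lemma elog_mult:
  assumes "c > 0"
  shows "elog (ennreal c * x) = ereal (ln c) + elog x"
  using assms by (cases x)
    (auto simp: elog_def ennreal_mult_eq_top_iff ennreal_mult_top enn2real_mult ln_mult simp flip: ennreal_mult)

lemma lp_norm_mono:
  assumes "AE x in M. X x \<le> Y x" "X \<in> borel_measurable M" "1 \<le> p"
  shows "lp_norm p M X \<le> lp_norm p M Y"
proof (cases "p = \<infinity>")
  case True
  then show ?thesis using assms by (simp add: lp_norm_def esssup_AE_mono)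
next
  case False
  then have "enn2real p \<ge> 0" by simp
  then have "(\<integral>\<^sup>+ x. ennpowr (X x) (enn2real p) \<partial>M) \<le> (\<integral>\<^sup>+ x. ennpowr (Y x) (enn2real p) \<partial>M)"
    using assms(1) by (intro nn_integral_mono_AE) (auto elim!: eventually_mono intro: ennpowr_mono)
  then show ?thesis using False by (simp add: lp_norm_def ennpowr_mono)
qed

lemma enn2real_exponent_ge_1: "1 \<le> p \<Longrightarrow> p \<noteq> \<infinity> \<Longrightarrow> 1 \<le> enn2real p"
  by (cases p) (auto simp: ennreal_1[symmetric] simp del: ennreal_1)

lemma lp_norm_cmult:
  assumes "c > 0" "X \<in> borel_measurable M" "1 \<le> p"
  shows "lp_norm p M (\<lambda>x. ennreal c * X x) \<le> ennreal c * lp_norm p M X"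
proof (cases "p = \<infinity>")
  case True
  have "AE x in M. ennreal c * X x \<le> ennreal c * esssup M X"
    using esssup_AE[where M=M and f=X] by (auto elim!: eventually_mono intro: mult_left_mono)
  then show ?thesis using True assms(2) by (simp add: lp_norm_def esssup_I)
next
  case False
  define q where "q = enn2real p"
  have q: "q \<ge> 1" using enn2real_exponent_ge_1 assms False by (simp add: q_def)
  have "(\<integral>\<^sup>+ x. ennpowr (ennreal c * X x) q \<partial>M) = ennreal (c powr q) * (\<integral>\<^sup>+ x. ennpowr (X x) q \<partial>M)"
    using assms q by (simp add: ennpowr_mult nn_integral_cmult)
  then show ?thesis using False assms q by (simp add: lp_norm_def q_def[symmetric] ennpowr_mult powr_powr)
qed

text \<open>A constant disappears after taking logarithms and dividing by \<open>d\<close>, so a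
  crude substitute for Minkowski's inequality suffices. One factor \<open>2 powr q\<close> comes
  from \<open>x + y \<le> 2 * max x y\<close>; the sum of the two integrals is at most twice their
  maximum, and \<open>2 \<le> 2 powr q\<close> as \<open>q \<ge> 1\<close>. Together they give
  4.\<close>

lemma lp_norm_add:
  assumes "X \<in> borel_measurable M" "Y \<in> borel_measurable M" "1 \<le> p"
  shows "lp_norm p M (\<lambda>x. X x + Y x) \<le> 4 * max (lp_norm p M X) (lp_norm p M Y)"
proof (cases "p = \<infinity>")
  case True
  have le: "x + y \<le> 4 * max a b" if "x \<le> a" "y \<le> b" for x y a b :: ennreal
  proof -
    have "x + y \<le> max a b + max a b" using that by (intro add_mono) (auto simp: le_max_iff_disj)
    also have "\<dots> = 2 * max a b" by (simp add: mult_2)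
    also have "\<dots> \<le> 4 * max a b" by (intro mult_right_mono) auto
    finally show ?thesis .
  qed
  have "AE x in M. X x + Y x \<le> 4 * max (esssup M X) (esssup M Y)"
    using esssup_AE[where M=M and f=X] esssup_AE[where M=M and f=Y] by eventually_elim (rule le)
  then show ?thesis using True assms by (simp add: lp_norm_def esssup_I)
next
  case False
  define q where "q = enn2real p"
  have q: "q \<ge> 1" using enn2real_exponent_ge_1 assms False by (simp add: q_def)
  define a b where "a = (\<integral>\<^sup>+ x. ennpowr (X x) q \<partial>M)" and "b = (\<integral>\<^sup>+ x. ennpowr (Y x) q \<partial>M)"
  have pt: "ennpowr (x + y) q \<le> ennreal (2 powr q) * (ennpowr x q + ennpowr y q)" for x y
  proof -
    have "ennpowr (x + y) q \<le> ennpowr (ennreal 2 * max x y) q"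
    proof (rule ennpowr_mono)
      have "x + y \<le> max x y + max x y" by (intro add_mono) auto
      then show "x + y \<le> ennreal 2 * max x y" by (simp add: mult_2)
    qed (use q in auto)
    also have "\<dots> = ennreal (2 powr q) * ennpowr (max x y) q" using q by (intro ennpowr_mult) auto
    also have "ennpowr (max x y) q \<le> ennpowr x q + ennpowr y q" by (simp add: max_def)
    finally show ?thesis by (simp add: mult_left_mono)
  qed
  have "(\<integral>\<^sup>+ x. ennpowr (X x + Y x) q \<partial>M) \<le> (\<integral>\<^sup>+ x. ennreal (2 powr q) * (ennpowr (X x) q + ennpowr (Y x) q) \<partial>M)"
    by (rule nn_integral_mono) (rule pt)
  also have "\<dots> = ennreal (2 powr q) * (a + b)"
    using assms by (simp add: nn_integral_cmult nn_integral_add a_def b_def)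
  also have "\<dots> \<le> ennreal (2 powr q) * (ennreal 2 * max a b)"
    by (intro mult_left_mono) (auto simp: mult_2 intro!: add_mono)
  also have "\<dots> \<le> ennreal (2 powr q) * (ennreal (2 powr q) * max a b)"
    using q powr_mono[of 1 q 2] by (intro mult_left_mono mult_right_mono ennreal_leI) auto
  also have "\<dots> = ennreal (4 powr q) * max a b"
    using powr_mult[of 2 2 q] by (simp add: mult.assoc[symmetric] flip: ennreal_mult)
  finally have "lp_norm p M (\<lambda>x. X x + Y x) \<le> ennpowr (ennreal (4 powr q) * max a b) (1 / q)"
    using False q by (simp add: lp_norm_def q_def[symmetric] ennpowr_mono)
  also have "\<dots> = ennreal 4 * ennpowr (max a b) (1 / q)"
    using q by (subst ennpowr_mult) (auto simp: powr_powr)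
  also have "ennpowr (max a b) (1 / q) \<le> max (ennpowr a (1 / q)) (ennpowr b (1 / q))"
    by (auto simp: max_def)
  finally show ?thesis
    using False by (simp add: lp_norm_def q_def[symmetric] a_def[symmetric] b_def[symmetric] mult_left_mono)
qed

lemma lp_norm_zero:
  assumes "AE x in M. X x = 0" "X \<in> borel_measurable M" "1 \<le> p"
  shows "lp_norm p M X = 0"
proof -
  have "lp_norm p M X \<le> lp_norm p M (\<lambda>_. 0)" using assms by (intro lp_norm_mono) auto
  also have "lp_norm p M (\<lambda>_. 0) \<le> 0"
  proof (cases "p = \<infinity>")
    case True then show ?thesis using esssup_I[of "\<lambda>_. 0::ennreal" M 0] by (simp add: lp_norm_def)
  next
    case False then show ?thesis using enn2real_exponent_ge_1[OF assms(3)] by (simp add: lp_norm_def ennpowr_def)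
  qed
  finally show ?thesis by simp
qed

text \<open>\<open>X\<close> dominates the indicator of \<open>A\<close>, whose norm is
  \<open>measure M A powr (1 / q)\<close>; an exponent of at most one does not decrease a number in
  the unit interval. For \<open>p = \<infinity>\<close> it is enough that \<open>A\<close> is not
  null.\<close>

lemma lp_norm_ge_half:
  assumes "prob_space M" "X \<in> borel_measurable M" "1 \<le> p" "A \<in> sets M" "measure M A \<ge> 1/2"
    and A: "AE x in M. x \<in> A \<longrightarrow> 1 \<le> X x"
  shows "ennreal (1/2) \<le> lp_norm p M X"
proof -
  interpret prob_space M by fact
  have ind: "AE x in M. indicator A x \<le> X x" using A by (auto simp: indicator_def)
  have "ennreal (1/2) \<le> lp_norm p M (indicator A)"
  proof (cases "p = \<infinity>")
    case True
    have "\<not> (AE x in M. x \<notin> A)" using prob_eq_0[OF assms(4)] assms(5) by auto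
    have "1 \<le> esssup M (indicator A :: _ \<Rightarrow> ennreal)"
    proof (rule ccontr)
      assume "\<not> ?thesis"
      then have "AE x in M. x \<notin> A"
        using esssup_AE[where M=M and f="indicator A :: _ \<Rightarrow> ennreal"] by (auto elim!: eventually_mono simp: indicator_def not_le split: if_splits)
      then show False using \<open>\<not> (AE x in M. x \<notin> A)\<close> by simp
    qed
    moreover have "ennreal (1/2) \<le> ennreal 1" by (rule ennreal_leI) simp
    ultimately show ?thesis using True unfolding lp_norm_def ennreal_1 by (auto intro: order_trans)
  next
    case False
    define q where "q = enn2real p"
    have q: "q \<ge> 1" using enn2real_exponent_ge_1 assms False by (simp add: q_def)
    have "(\<integral>\<^sup>+ x. ennpowr (indicator A x) q \<partial>M) = (\<integral>\<^sup>+ x. indicator A x \<partial>M)"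
      using q by (intro nn_integral_cong) (auto simp: indicator_def ennpowr_def)
    also have "\<dots> = ennreal (measure M A)" using assms(4) by (simp add: emeasure_eq_measure)
    finally have "lp_norm p M (indicator A) = ennreal (measure M A powr (1 / q))"
      using False by (simp add: lp_norm_def q_def[symmetric] ennpowr_def)
    moreover have "1/2 \<le> measure M A powr (1 / q)"
    proof -
      have "measure M A powr 1 \<le> measure M A powr (1 / q)" using q assms(5) by (intro powr_mono') auto
      then show ?thesis using assms(5) by simp
    qed
    ultimately show ?thesis by (simp add: ennreal_leI del: ennreal_half)
  qed
  also have "\<dots> \<le> lp_norm p M X" by (rule lp_norm_mono[OF ind]) (use assms in auto)
  finally show ?thesis .
qed

section \<open>Growth rates along a filter of indices\<close>

definition exp_growth ::
  "'j filter \<Rightarrow> ('j \<Rightarrow> nat) \<Rightarrow> ('j \<Rightarrow> 'b measure) \<Rightarrow> ennreal \<Rightarrow> (nat \<Rightarrow> 'b \<Rightarrow> ennreal) \<Rightarrow> ereal" where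
  "exp_growth FF d \<P> p X = Limsup FF (\<lambda>j. elog (lp_norm p (\<P> j) (X (d j))) / ereal (real (d j)))"

locale growth_setting =
  fixes FF :: "'j filter" and d :: "'j \<Rightarrow> nat" and \<P> :: "'j \<Rightarrow> 'b measure" and p :: ennreal
  assumes FF: "FF \<noteq> bot" and d_top: "filterlim d at_top FF"
    and prob: "eventually (\<lambda>j. prob_space (\<P> j)) FF" and p: "1 \<le> p"
begin

definition mble :: "(nat \<Rightarrow> 'b \<Rightarrow> ennreal) \<Rightarrow> bool" where
  "mble X \<longleftrightarrow> eventually (\<lambda>j. X (d j) \<in> borel_measurable (\<P> j)) FF"

abbreviation "growth \<equiv> exp_growth FF d \<P> p"

lemma d_pos: "eventually (\<lambda>j. 0 < d j) FF"
proof -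
  have "eventually (\<lambda>j. 1 \<le> d j) FF" using d_top unfolding filterlim_at_top by blast
  then show ?thesis by eventually_elim simp
qed

lemma small_inverse: "e > 0 \<Longrightarrow> eventually (\<lambda>j. c / real (d j) < e) FF"
proof -
  assume e: "e > 0"
  obtain n :: nat where n: "c / e < n" using reals_Archimedean2 by blast
  have "eventually (\<lambda>j. Suc n \<le> d j) FF" using d_top unfolding filterlim_at_top by blast
  then show ?thesis
  proof eventually_elim
    case (elim j)
    then have "c / e < real (d j)" using n by linarith
    then show ?case using e elim by (simp add: field_simps)
  qed
qed

lemma growth_mono_exp:
  assumes "mble X" "mble Y" and le: "eventually (\<lambda>j. AE \<sigma> in \<P> j. X (d j) \<sigma> \<le> ennreal (exp (\<kappa> * real (d j))) * Y (d j) \<sigma>) FF"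
  shows "growth X \<le> ereal \<kappa> + growth Y"
proof -
  have "growth X \<le> Limsup FF (\<lambda>j. ereal \<kappa> + elog (lp_norm p (\<P> j) (Y (d j))) / ereal (real (d j)))"
    unfolding exp_growth_def
  proof (rule Limsup_mono)
    show "\<forall>\<^sub>F j in FF. elog (lp_norm p (\<P> j) (X (d j))) / ereal (real (d j))
      \<le> ereal \<kappa> + elog (lp_norm p (\<P> j) (Y (d j))) / ereal (real (d j))"
      using le assms(1,2)[unfolded mble_def] d_pos
    proof eventually_elim
      case (elim j)
      have "lp_norm p (\<P> j) (X (d j)) \<le> lp_norm p (\<P> j) (\<lambda>\<sigma>. ennreal (exp (\<kappa> * real (d j))) * Y (d j) \<sigma>)"
        by (rule lp_norm_mono) (use elim p in auto)
      also have "\<dots> \<le> ennreal (exp (\<kappa> * real (d j))) * lp_norm p (\<P> j) (Y (d j))"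
        by (rule lp_norm_cmult) (use elim p in auto)
      finally have "elog (lp_norm p (\<P> j) (X (d j))) \<le> ereal (\<kappa> * real (d j)) + elog (lp_norm p (\<P> j) (Y (d j)))"
        using elog_mono elog_mult[of "exp (\<kappa> * real (d j))"] by fastforce
      then have "elog (lp_norm p (\<P> j) (X (d j))) / ereal (real (d j))
         \<le> (ereal (\<kappa> * real (d j)) + elog (lp_norm p (\<P> j) (Y (d j)))) / ereal (real (d j))"
        using elim by (intro ereal_divide_right_mono) auto
      also have "\<dots> = ereal \<kappa> + elog (lp_norm p (\<P> j) (Y (d j))) / ereal (real (d j))"
        using elim by (cases "elog (lp_norm p (\<P> j) (Y (d j)))") (auto simp: add_divide_distrib)
      finally show ?case .
    qed
  qed
  also have "\<dots> = ereal \<kappa> + growth Y"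
    unfolding exp_growth_def by (rule Limsup_add_ereal_left[OF FF]) simp
  finally show ?thesis .
qed

lemma growth_mono:
  assumes "mble X" "mble Y" and "eventually (\<lambda>j. AE \<sigma> in \<P> j. X (d j) \<sigma> \<le> Y (d j) \<sigma>) FF"
  shows "growth X \<le> growth Y"
  using growth_mono_exp[of X Y 0] assms by simp

lemma growth_zero: "growth (\<lambda>n \<sigma>. 0) = -\<infinity>"
proof -
  have "growth (\<lambda>n \<sigma>. 0) \<le> -\<infinity>"
    unfolding exp_growth_def
  proof (rule Limsup_bounded)
    show "\<forall>\<^sub>F j in FF. elog (lp_norm p (\<P> j) (\<lambda>\<sigma>. 0)) / ereal (real (d j)) \<le> - \<infinity>"
      using d_pos by eventually_elim (simp add: lp_norm_zero p elog_def)
  qed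
  then show ?thesis by simp
qed

text \<open>The factor 4 of \<open>lp_norm_add\<close> contributes \<open>ln 4 / d\<close>, which
  vanishes along the filter; two reals \<open>c < c'\<close> below \<open>h\<close> leave room for
  it.\<close>

lemma growth_add_less:
  assumes "mble X" "mble Y" "growth X < h" "growth Y < h"
  shows "growth (\<lambda>n \<sigma>. X n \<sigma> + Y n \<sigma>) < h"
proof -
  obtain c where c: "max (growth X) (growth Y) < ereal c" "ereal c < h"
    using ereal_dense2[of "max (growth X) (growth Y)" h] assms by auto
  then obtain c' where c': "ereal c < ereal c'" "ereal c' < h" using ereal_dense2 by blast
  have "growth X < c" "growth Y < c" using c by auto
  note ev = this[unfolded exp_growth_def, THEN Limsup_lessD]
  have "growth (\<lambda>n \<sigma>. X n \<sigma> + Y n \<sigma>) \<le> c'"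
    unfolding exp_growth_def
  proof (rule Limsup_bounded)
    have "eventually (\<lambda>j. ln 4 / real (d j) < c' - c) FF" by (rule small_inverse) (use c' in auto)
    then show "\<forall>\<^sub>F j in FF. elog (lp_norm p (\<P> j) (\<lambda>\<sigma>. X (d j) \<sigma> + Y (d j) \<sigma>)) / ereal (real (d j)) \<le> ereal c'"
      using ev assms(1,2)[unfolded mble_def] d_pos
    proof eventually_elim
      case (elim j)
      let ?x = "lp_norm p (\<P> j) (X (d j))" and ?y = "lp_norm p (\<P> j) (Y (d j))"
      have "lp_norm p (\<P> j) (\<lambda>\<sigma>. X (d j) \<sigma> + Y (d j) \<sigma>) \<le> ennreal 4 * max ?x ?y"
        using lp_norm_add[of "X (d j)" "\<P> j" "Y (d j)" p] elim p by simp
      then have "elog (lp_norm p (\<P> j) (\<lambda>\<sigma>. X (d j) \<sigma> + Y (d j) \<sigma>)) \<le> ereal (ln 4) + elog (max ?x ?y)"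
        using elog_mono elog_mult[of 4] by fastforce
      also have "elog (max ?x ?y) \<le> max (elog ?x) (elog ?y)" by (auto simp: max_def)
      finally have "elog (lp_norm p (\<P> j) (\<lambda>\<sigma>. X (d j) \<sigma> + Y (d j) \<sigma>)) / ereal (real (d j))
        \<le> (ereal (ln 4) + max (elog ?x) (elog ?y)) / ereal (real (d j))"
        using elim by (intro ereal_divide_right_mono) (auto intro: add_left_mono)
      also have "\<dots> = ereal (ln 4 / real (d j)) + max (elog ?x) (elog ?y) / ereal (real (d j))"
        using elim by (cases "max (elog ?x) (elog ?y)") (auto simp: add_divide_distrib)
      also have "\<dots> \<le> ereal (c' - c) + ereal c"
        using elim by (intro add_mono) (auto simp: max_def)
      finally show ?case by simp
    qed
  qed
  then show ?thesis using c' by (auto intro: le_less_trans)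
qed

text \<open>The bound \<open>-\<infinity> < h\<close> covers the empty sum, whose growth is
  \<open>-\<infinity>\<close>.\<close>

lemma growth_sum_less:
  assumes "finite I" "-\<infinity> < h" "\<And>i. i \<in> I \<Longrightarrow> mble (X i)" "\<And>i. i \<in> I \<Longrightarrow> growth (X i) < h"
  shows "mble (\<lambda>n \<sigma>. \<Sum>i\<in>I. X i n \<sigma>) \<and> growth (\<lambda>n \<sigma>. \<Sum>i\<in>I. X i n \<sigma>) < h"
  using assms
proof (induction I)
  case empty
  then show ?case by (simp add: growth_zero mble_def)
next
  case (insert i I)
  then have IH: "mble (\<lambda>n \<sigma>. \<Sum>i\<in>I. X i n \<sigma>)" "growth (\<lambda>n \<sigma>. \<Sum>i\<in>I. X i n \<sigma>) < h" "mble (X i)" "growth (X i) < h" by auto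
  have "mble (\<lambda>n \<sigma>. X i n \<sigma> + (\<Sum>i\<in>I. X i n \<sigma>))"
    using IH(1,3) unfolding mble_def by eventually_elim (rule borel_measurable_add)
  then show ?case using growth_add_less[OF IH(3,1,4,2)] insert.hyps by simp
qed

text \<open>If \<open>X\<close> vanished almost surely wherever \<open>E\<close> and
  \<open>R\<close> hold, its growth would be \<open>-\<infinity>\<close>. This produces sofic maps
  with a nonzero count and any prescribed almost sure property.\<close>

lemma growth_witness:
  assumes "mble X" "-\<infinity> < growth X" "eventually E FF" "eventually (\<lambda>j. AE \<sigma> in \<P> j. R j \<sigma>) FF"
  shows "\<exists>j \<sigma>. E j \<and> \<sigma> \<in> space (\<P> j) \<and> R j \<sigma> \<and> X (d j) \<sigma> \<noteq> 0"
proof (rule ccontr)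
  assume "\<not> ?thesis"
  then have *: "\<And>j \<sigma>. E j \<Longrightarrow> \<sigma> \<in> space (\<P> j) \<Longrightarrow> R j \<sigma> \<Longrightarrow> X (d j) \<sigma> = 0" by blast
  have "growth X \<le> growth (\<lambda>n \<sigma>. 0)"
  proof (rule growth_mono[OF assms(1)])
    show "\<forall>\<^sub>F j in FF. AE \<sigma> in \<P> j. X (d j) \<sigma> \<le> 0"
      using assms(3,4)
    proof eventually_elim
      case (elim j)
      from elim(2) AE_space show ?case by eventually_elim (use * elim(1) in auto)
    qed
  qed (simp add: mble_def)
  then show False using assms(2) by (simp add: growth_zero)
qed

text \<open>An event of probability at least one half keeps the norm above \<open>1/2\<close>, and
  \<open>ln 2 / d\<close> tends to zero. It serves for conditions that hold with high probability
  but not almost surely.\<close>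

lemma growth_nonneg:
  assumes "mble X" and ev: "eventually (\<lambda>j. A j \<in> sets (\<P> j) \<and> measure (\<P> j) (A j) \<ge> 1/2 \<and>
    (AE \<sigma> in \<P> j. \<sigma> \<in> A j \<longrightarrow> 1 \<le> X (d j) \<sigma>)) FF"
  shows "0 \<le> growth X"
proof (rule ccontr)
  assume "\<not> 0 \<le> growth X"
  then obtain c where c: "growth X < ereal c" "ereal c < 0" using ereal_dense2[of "growth X" 0] by (auto simp: not_le)
  have "eventually (\<lambda>j. ln 2 / real (d j) < - c) FF" by (rule small_inverse) (use c in auto)
  with ev prob assms(1)[unfolded mble_def] Limsup_lessD[OF c(1)[unfolded exp_growth_def]] d_pos
  have "eventually (\<lambda>j. False) FF"
  proof eventually_elim
    case (elim j)
    have "ennreal (1/2) \<le> lp_norm p (\<P> j) (X (d j))"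
      by (rule lp_norm_ge_half[where A="A j"]) (use elim p in auto)
    then have "elog (ennreal (1/2)) \<le> elog (lp_norm p (\<P> j) (X (d j)))" by (rule elog_mono)
    moreover have "elog (ennreal (1/2)) = ereal (- ln 2)"
      using elog_mult[of "1/2" 1] by (simp add: elog_def ln_div)
    ultimately have "ereal (- ln 2) / ereal (real (d j)) \<le> elog (lp_norm p (\<P> j) (X (d j))) / ereal (real (d j))"
      using elim by (intro ereal_divide_right_mono) auto
    also have "\<dots> < ereal c" using elim by simp
    finally have "- ln 2 / real (d j) < c" using elim by simp
    then show ?case using elim by simp
  qed
  then show False using FF by simp
qed

end

text \<open>Only finitely many restrictions to \<open>F\<close> exist, as
  \<open>fin_pseudogroup d\<close> is finite, so each preimage is a finite union of generating
  cylinders. The counting functions of both entropies are measurable for this reason.\<close>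

lemma Map_borel_measurable_finite:
  assumes X: "\<And>\<sigma> \<sigma>'. \<sigma> \<in> Map_set \<H> d \<Longrightarrow> \<sigma>' \<in> Map_set \<H> d \<Longrightarrow> (\<And>f. f \<in> F \<Longrightarrow> \<sigma> f = \<sigma>' f) \<Longrightarrow> X \<sigma> = X \<sigma>'"
    and F: "F \<in> Fpow \<H>" and M: "space M = Map_set \<H> d" "sets M = sets (Map_borel \<H> d)"
    and XN: "\<And>\<sigma>. \<sigma> \<in> Map_set \<H> d \<Longrightarrow> X \<sigma> \<in> space N"
  shows "X \<in> M \<rightarrow>\<^sub>M N"
proof (rule measurableI)
  let ?G = "{{\<sigma>' \<in> Map_set \<H> d. \<forall>f\<in>F. \<sigma>' f = \<sigma> f} | \<sigma> F. \<sigma> \<in> Map_set \<H> d \<and> F \<in> Fpow \<H>}"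
  show "X \<sigma> \<in> space N" if "\<sigma> \<in> space M" for \<sigma> using that M XN by simp
  fix A assume "A \<in> sets N"
  define C where "C \<sigma> = {\<sigma>' \<in> Map_set \<H> d. \<forall>f\<in>F. \<sigma>' f = \<sigma> f}" for \<sigma>
  have eq: "X -` A \<inter> space M = \<Union> (C ` (X -` A \<inter> space M))"
  proof (intro equalityI subsetI)
    fix \<sigma> assume "\<sigma> \<in> X -` A \<inter> space M"
    moreover from this have "\<sigma> \<in> C \<sigma>" by (auto simp: C_def M)
    ultimately show "\<sigma> \<in> \<Union> (C ` (X -` A \<inter> space M))" by blast
  next
    fix \<sigma>' assume "\<sigma>' \<in> \<Union> (C ` (X -` A \<inter> space M))"
    then obtain \<sigma> where \<sigma>: "\<sigma> \<in> Map_set \<H> d" "X \<sigma> \<in> A" "\<sigma>' \<in> C \<sigma>" by (auto simp: M)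
    then have "X \<sigma>' = X \<sigma>" by (intro X) (auto simp: C_def)
    then show "\<sigma>' \<in> X -` A \<inter> space M" using \<sigma> by (auto simp: C_def M)
  qed
  have gen: "?G \<subseteq> Pow (Map_set \<H> d)" by auto
  have C: "C \<sigma> \<in> sets M" if "\<sigma> \<in> Map_set \<H> d" for \<sigma>
    unfolding M Map_borel_def using that F by (subst sets_measure_of[OF gen]) (auto simp: C_def)
  have "finite (C ` Map_set \<H> d)"
  proof (rule finite_surj)
    have "fin_pseudogroup d \<subseteq> Pow ({1..d} \<times> {1..d})"
      by (auto simp: fin_pseudogroup_def full_pseudogroup_def pair_gpd_def)
    then have "finite (fin_pseudogroup d)" by (rule finite_subset) simp
    then show "finite (F \<rightarrow>\<^sub>E fin_pseudogroup d)" using F by (intro finite_PiE) (auto simp: Fpow_def)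
    show "C ` Map_set \<H> d \<subseteq> C ` (F \<rightarrow>\<^sub>E fin_pseudogroup d)"
    proof
      fix c assume "c \<in> C ` Map_set \<H> d"
      then obtain \<sigma> where \<sigma>: "\<sigma> \<in> Map_set \<H> d" "c = C \<sigma>" by auto
      then have "c = C (restrict \<sigma> F)" by (auto simp: C_def)
      moreover have "restrict \<sigma> F \<in> F \<rightarrow>\<^sub>E fin_pseudogroup d" using \<sigma> F by (auto simp: Map_set_def Fpow_def)
      ultimately show "c \<in> C ` (F \<rightarrow>\<^sub>E fin_pseudogroup d)" by blast
    qed
  qed
  then have "finite (C ` (X -` A \<inter> space M))" by (rule finite_subset[rotated]) (auto simp: M)
  then show "X -` A \<inter> space M \<in> sets M"
    by (subst eq, intro sets.finite_Union) (use C M in auto)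
qed

section \<open>Etale groupoids\<close>

lemma (in groupoid) inverse_unique:
  assumes "f \<in> arr H" "k \<in> arr H" "src H k = rng H f" "rng H k = src H f" "mult H k f = src H f"
    and k': "k' \<in> arr H" "src H k' = rng H f" "rng H k' = src H f" "mult H f k' = rng H f"
  shows "k = k'"
proof -
  have c: "(k, f) \<in> composable H" "(f, k') \<in> composable H" using assms by (auto simp: composable_def)
  have "mult H (mult H k f) k' = mult H k (mult H f k')" by (rule mult_assoc) (use c in auto)
  then show ?thesis using assms by (metis mult_src rng_mult_self)
qed

lemma (in groupoid) ginv_props:
  assumes "f \<in> arr H"
  shows "ginv H f \<in> arr H" "src H (ginv H f) = rng H f" "rng H (ginv H f) = src H f"
    "mult H (ginv H f) f = src H f" "mult H f (ginv H f) = rng H f"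
proof -
  let ?P = "\<lambda>k. k \<in> arr H \<and> src H k = rng H f \<and> rng H k = src H f \<and> mult H k f = src H f \<and> mult H f k = rng H f"
  obtain k where k: "?P k" using invertible[OF assms] by auto
  have "?P (ginv H f)"
    unfolding ginv_def
  proof (rule theI)
    show "?P k" by (rule k)
    show "k' = k" if "?P k'" for k'
      by (rule inverse_unique[of f]) (use assms k that in auto)
  qed
  then show "ginv H f \<in> arr H" "src H (ginv H f) = rng H f" "rng H (ginv H f) = src H f"
    "mult H (ginv H f) f = src H f" "mult H f (ginv H f) = rng H f" by auto
qed

lemma (in groupoid) ginv_ginv:
  assumes "f \<in> arr H"
  shows "ginv H (ginv H f) = f"
proof -
  note i = ginv_props[OF assms] and ii = ginv_props[OF ginv_props(1)[OF assms]]
  show ?thesis by (rule inverse_unique[of "ginv H f"]) (use i ii assms in auto)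
qed

lemma (in groupoid) units_eq: "units H = {h \<in> arr H. src H h = h}"
  using units_arr src_units unit_src by force

section \<open>Topology and Borel structure of an etale groupoid with compact metrizable unit
  space\<close>

locale etale_compact = separable_etale_groupoid H T for H :: "('a, 'm) gpd_scheme" and T +
  assumes compact_units: "compact_space (unit_top H T)"
    and metrizable_units: "metrizable_space (unit_top H T)"
begin

abbreviation "X \<equiv> unit_top H T"

abbreviation "FP \<equiv> full_pseudogroup H (borel_of T)"

lemma topspace_X [simp]: "topspace X = units H"
  using units_arr topspace_T by auto

sublocale X: compact_metrizable X
  using compact_units metrizable_units by unfold_locales

lemma src_in [simp]: "h \<in> arr H \<Longrightarrow> src H h \<in> units H" and rng_in [simp]: "h \<in> arr H \<Longrightarrow> rng H h \<in> units H"
  using src_units rng_units by auto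

lemma closedin_units: "closedin T (units H)"
proof -
  have "closedin T {h \<in> topspace T. src H h = h}"
    by (rule closedin_continuous_maps_eq[OF Hausdorff continuous_src]) simp
  then show ?thesis by (simp add: units_eq topspace_T)
qed

lemma units_borel: "units H \<in> sets (borel_of T)"
  by (rule closedin_borel_of[OF closedin_units])

lemma sets_X: "sets (borel_of X) = {A. A \<subseteq> units H \<and> A \<in> sets (borel_of T)}"
  by (rule sets_borel_of_subtopology[OF units_borel])

lemma continuous_src_X: "continuous_map T X (src H)" and continuous_rng_X: "continuous_map T X (rng H)"
  using continuous_src continuous_rng by (auto simp: continuous_map_in_subtopology topspace_T)

lemma bisectionD:
  assumes "bisection H T U"
  shows "openin T U" "U \<subseteq> arr H" "inj_on (src H) U" "inj_on (rng H) U"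
proof -
  show o: "openin T U" using assms by (simp add: bisection_def)
  show U: "U \<subseteq> arr H" using openin_subset[OF o] topspace_T by simp
  then have "topspace (subtopology T U) = U" using topspace_T by auto
  then show "inj_on (src H) U" "inj_on (rng H) U"
    using assms homeomorphic_imp_injective_map unfolding bisection_def by metis+
qed

lemma open_map_bisection:
  assumes U: "openin T U" and m: "m \<in> {src H, rng H}" and O: "openin X (m ` U)"
    and h: "homeomorphic_map (subtopology T U) (subtopology T (m ` U)) m" and V: "openin T V"
  shows "openin X (m ` (V \<inter> U))"
proof -
  have "openin (subtopology T U) (V \<inter> U)" using V by (auto simp: openin_subtopology)
  then have 1: "openin (subtopology T (m ` U)) (m ` (V \<inter> U))"
    using h by (metis homeomorphic_imp_open_map open_map_def)
  have "m ` U \<subseteq> units H" using openin_subset[OF O] by simp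
  then have "subtopology T (m ` U) = subtopology X (m ` U)"
    by (simp add: subtopology_subtopology inf.absorb2)
  then show ?thesis using 1 O openin_trans_full by metis
qed

text \<open>Openness is local, and on a bisection source and range are homeomorphisms onto open
  sets.\<close>

lemma open_map_src: "openin T V \<Longrightarrow> openin X (src H ` V)"
  and open_map_rng: "openin T V \<Longrightarrow> openin X (rng H ` V)"
proof -
  assume V: "openin T V"
  have "openin X (m ` V)" if m: "m \<in> {src H, rng H}" for m
  proof -
    have "m ` V = (\<Union>U\<in>{U. bisection H T U}. m ` (V \<inter> U))"
    proof (intro equalityI subsetI)
      fix y assume "y \<in> m ` V"
      then obtain h where h: "h \<in> V" "y = m h" by auto
      then have "h \<in> arr H" using openin_subset[OF V] topspace_T by auto
      then obtain U where "bisection H T U" "h \<in> U" using in_bisection by blast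
      then show "y \<in> (\<Union>U\<in>{U. bisection H T U}. m ` (V \<inter> U))" using h by blast
    qed auto
    also have "openin X \<dots>"
    proof (rule openin_Union, clarify)
      fix U assume "bisection H T U"
      then have "openin T U" "openin X (m ` U)" "homeomorphic_map (subtopology T U) (subtopology T (m ` U)) m"
        using m by (auto simp: bisection_def)
      then show "openin X (m ` (V \<inter> U))" by (rule open_map_bisection[OF _ m _ _ V])
    qed
    finally show ?thesis .
  qed
  then show "openin X (src H ` V)" "openin X (rng H ` V)" by auto
qed

text \<open>Since source and range are continuous open maps, injectivity on an open set already
  makes them homeomorphisms onto open images. Bisections can then be recognised by injectivity
  alone.\<close>

lemma bisectionI:
  assumes U: "openin T U" "inj_on (src H) U" "inj_on (rng H) U"
  shows "bisection H T U"
proof -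
  have "openin X (m ` U) \<and> homeomorphic_map (subtopology T U) (subtopology T (m ` U)) m"
    if m: "m \<in> {src H, rng H}" for m
  proof
    show o: "openin X (m ` U)" using m open_map_src open_map_rng U by auto
    have mU: "m ` U \<subseteq> units H" using openin_subset[OF o] by simp
    have U': "U \<subseteq> arr H" using openin_subset[OF U(1)] topspace_T by simp
    show "homeomorphic_map (subtopology T U) (subtopology T (m ` U)) m"
    proof (rule bijective_open_imp_homeomorphic_map)
      show "continuous_map (subtopology T U) (subtopology T (m ` U)) m"
        using m continuous_src continuous_rng U' topspace_T
        by (auto simp: continuous_map_in_subtopology continuous_map_from_subtopology)
      show "open_map (subtopology T U) (subtopology T (m ` U)) m"
        unfolding open_map_def
      proof (intro allI impI)
        fix V assume "openin (subtopology T U) V"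
        then have V: "openin T V" "V \<subseteq> U" using U(1) openin_open_subtopology by blast+
        have "openin X (m ` V)" using V m open_map_src open_map_rng by auto
        moreover have "subtopology T (m ` U) = subtopology X (m ` U)"
          using mU by (simp add: subtopology_subtopology inf.absorb2)
        moreover have "m ` V = m ` V \<inter> m ` U" using V by auto
        ultimately show "openin (subtopology T (m ` U)) (m ` V)"
          by (metis openin_subtopology)
      qed
      show "m ` topspace (subtopology T U) = topspace (subtopology T (m ` U))"
        using U' mU units_arr topspace_T by (simp add: inf.absorb2)
      show "inj_on m (topspace (subtopology T U))"
        using m U U' topspace_T by (auto simp: inf.absorb2)
    qed
  qed
  then show ?thesis using U(1) by (auto simp: bisection_def)
qed

lemma bisection_iff: "bisection H T U \<longleftrightarrow> openin T U \<and> inj_on (src H) U \<and> inj_on (rng H) U"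
  using bisectionI bisectionD by blast

lemma src_section:
  assumes "bisection H T U"
  obtains s where "continuous_map (subtopology T (src H ` U)) T s" "\<And>h. h \<in> U \<Longrightarrow> s (src H h) = h"
proof -
  have "homeomorphic_map (subtopology T U) (subtopology T (src H ` U)) (src H)"
    using assms by (simp add: bisection_def)
  then obtain s where "homeomorphic_maps (subtopology T U) (subtopology T (src H ` U)) (src H) s"
    using homeomorphic_map_maps by blast
  then have "continuous_map (subtopology T (src H ` U)) T s" "\<And>h. h \<in> U \<Longrightarrow> s (src H h) = h"
    using bisectionD(2)[OF assms] topspace_T
    by (auto simp: homeomorphic_maps_def continuous_map_in_subtopology)
  then show ?thesis using that by blast
qed

text \<open>The lift is the image of the compact set \<open>C\<close> under the continuous inverse
  of the source map on \<open>U\<close>.\<close>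

lemma compactin_src_lift:
  assumes U: "bisection H T U" and C: "closedin X C" "C \<subseteq> src H ` U"
  shows "compactin T {h \<in> U. src H h \<in> C}"
proof -
  obtain s where s: "continuous_map (subtopology T (src H ` U)) T s" "\<And>h. h \<in> U \<Longrightarrow> s (src H h) = h"
    using src_section[OF U] by blast
  have "compactin X C" using C X.compactin_iff_closedin by blast
  then have "compactin T C" by (simp add: compactin_subtopology)
  then have "compactin (subtopology T (src H ` U)) C" using C by (simp add: compactin_subtopology)
  then have "compactin T (s ` C)" using s(1) image_compactin by blast
  moreover have "s ` C = {h \<in> U. src H h \<in> C}" using C(2) s(2) by force
  ultimately show ?thesis by simp
qed

lemma openin_src_lift:
  assumes U: "openin T U" and V: "openin X V"
  shows "openin T {h \<in> U. src H h \<in> V}"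
proof -
  have "openin T {h \<in> topspace T. src H h \<in> V}" by (rule openin_continuous_map_preimage[OF continuous_src_X V])
  moreover have "{h \<in> U. src H h \<in> V} = U \<inter> {h \<in> topspace T. src H h \<in> V}" using openin_subset[OF U] by auto
  ultimately show ?thesis using U by auto
qed

lemma locally_compact: "locally_compact_space T"
  unfolding locally_compact_space_def
proof
  fix x assume "x \<in> topspace T"
  then obtain U where U: "bisection H T U" "x \<in> U" using in_bisection topspace_T by auto
  note U' = bisectionD[OF U(1)]
  have sx: "src H x \<in> units H" using U U' by auto
  have "closedin X {src H x}" using X.Hausdorff sx by (metis closedin_Hausdorff_sing_eq topspace_X)
  then obtain V where V: "openin X V" "{src H x} \<subseteq> V" "X closure_of V \<subseteq> src H ` U"
    using X.open_nbhd[of "{src H x}" "src H ` U"] open_map_src[OF U'(1)] U by blast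
  show "\<exists>V K. openin T V \<and> compactin T K \<and> x \<in> V \<and> V \<subseteq> K"
  proof (intro exI conjI)
    show "openin T {h \<in> U. src H h \<in> V}" by (rule openin_src_lift[OF U'(1) V(1)])
    show "compactin T {h \<in> U. src H h \<in> X closure_of V}"
      by (rule compactin_src_lift[OF U(1) _ V(3)]) simp
    show "{h \<in> U. src H h \<in> V} \<subseteq> {h \<in> U. src H h \<in> X closure_of V}"
      using closure_of_subset[OF openin_subset[OF V(1)]] by auto
  qed (use U V in auto)
qed

lemma regular: "regular_space T"
  using locally_compact Hausdorff locally_compact_Hausdorff_imp_regular_space by blast

lemma countable_subcover:
  assumes "\<And>B. B \<in> \<B> \<Longrightarrow> openin T B" "arr H \<subseteq> \<Union> \<B>"
  obtains B :: "nat \<Rightarrow> 'a set" where "\<And>n. B n \<in> \<B> \<or> B n = {}" "(\<Union>n. B n) = arr H"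
proof -
  have "Lindelof_space T" using second_countable second_countable_imp_Lindelof_space by blast
  moreover have "\<Union> \<B> = topspace T" using assms topspace_T openin_subset by blast
  ultimately obtain \<V> where V: "countable \<V>" "\<V> \<subseteq> \<B>" "\<Union> \<V> = topspace T"
    using assms(1) unfolding Lindelof_space_def by meson
  define B where "B = from_nat_into (insert {} \<V>)"
  have B: "range B = insert {} \<V>"
    unfolding B_def using V(1) by (intro range_from_nat_into) auto
  show ?thesis
  proof (rule that)
    show "B n \<in> \<B> \<or> B n = {}" for n using B V by (metis insertE rangeI subsetD)
    have "\<Union> (range B) = \<Union> (insert {} \<V>)" using B by simp
    then show "(\<Union>n. B n) = arr H" using V topspace_T by simp
  qed
qed

lemma countable_bisections:
  obtains B :: "nat \<Rightarrow> 'a set" where "\<And>n. bisection H T (B n)" "(\<Union>n. B n) = arr H"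
proof -
  have b0: "bisection H T {}" by (simp add: bisection_iff)
  obtain B :: "nat \<Rightarrow> 'a set" where "\<And>n. B n \<in> {U. bisection H T U} \<or> B n = {}" "(\<Union>n. B n) = arr H"
    by (rule countable_subcover[of "{U. bisection H T U}"]) (use in_bisection bisectionD in auto)
  then show ?thesis using that b0 by (metis mem_Collect_eq)
qed

text \<open>Countably many bisections cover the arrows, and on each of them the map is a
  homeomorphism onto an open set; the image is a countable union of Borel sets.\<close>

lemma image_borel:
  assumes A: "A \<in> sets (borel_of T)" and m: "m \<in> {src H, rng H}"
  shows "m ` A \<in> sets (borel_of X)"
proof -
  obtain B :: "nat \<Rightarrow> 'a set" where B: "\<And>n. bisection H T (B n)" "(\<Union>n. B n) = arr H"
    using countable_bisections by blast
  have "A \<subseteq> arr H" using sets.sets_into_space[OF A] topspace_T by simp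
  then have "m ` A = (\<Union>n. m ` (A \<inter> B n))" using B(2) by blast
  also have "\<dots> \<in> sets (borel_of X)"
  proof (rule sets.countable_UN'')
    fix n
    note b = bisectionD[OF B(1)[of n]]
    have "homeomorphic_map (subtopology T (B n)) (subtopology T (m ` B n)) m"
      and o: "openin X (m ` B n)" using B(1)[of n] m by (auto simp: bisection_def)
    moreover have "A \<inter> B n \<in> sets (borel_of (subtopology T (B n)))"
      using A b by (subst sets_borel_of_subtopology) (auto simp: openin_borel_of)
    ultimately have "m ` (A \<inter> B n) \<in> sets (borel_of (subtopology T (m ` B n)))"
      by (blast intro: homeomorphic_image_borel_of)
    moreover have "subtopology T (m ` B n) = subtopology X (m ` B n)"
      using openin_subset[OF o] by (simp add: subtopology_subtopology inf.absorb2)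
    ultimately show "m ` (A \<inter> B n) \<in> sets (borel_of X)"
      using sets_borel_of_subtopology[OF openin_borel_of[OF o]] by simp
  qed auto
  finally show ?thesis .
qed

text \<open>Source and range are continuous, and by \<open>image_borel\<close> they map Borel sets
  to Borel sets, so of a Borel isomorphism only injectivity remains to be checked.\<close>

lemma full_pseudogroup_iff:
  "f \<in> FP \<longleftrightarrow> f \<in> sets (borel_of T) \<and> inj_on (src H) f \<and> inj_on (rng H) f"
proof -
  have "m \<in> restrict_space (borel_of T) f \<rightarrow>\<^sub>M borel_of T" if "m \<in> {src H, rng H}" for m
    using that borel_of_measurable[OF continuous_src] borel_of_measurable[OF continuous_rng]
    by (auto intro: measurable_restrict_space1)
  moreover have "m ` B \<in> sets (borel_of T)" if "m \<in> {src H, rng H}" "B \<in> sets (borel_of T)" for m B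
    using image_borel[OF that(2,1)] sets_X by auto
  ultimately show ?thesis unfolding full_pseudogroup_def borel_iso_on_def by auto
qed

end

text \<open>Urysohn's metrization theorem: countably many Urysohn functions embed the space into a
  countable power of the real line.\<close>

lemma second_countable_regular_imp_metrizable:
  assumes sc: "second_countable T" and reg: "regular_space T" and Haus: "Hausdorff_space T"
  shows "metrizable_space T"
proof -
  obtain \<B> where \<B>: "countable \<B>" "\<And>V. V \<in> \<B> \<Longrightarrow> openin T V"
    "\<And>U x. openin T U \<Longrightarrow> x \<in> U \<Longrightarrow> \<exists>V\<in>\<B>. x \<in> V \<and> V \<subseteq> U"
    using sc unfolding second_countable_def by metis
  have norm: "normal_space T"
    by (rule regular_Lindelof_imp_normal_space[OF reg second_countable_imp_Lindelof_space[OF sc]])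
  \<comment> \<open>Each such pair has a Urysohn function that vanishes on \<open>U\<close> and
    equals 1 off \<open>V\<close>. By regularity a pair fits between any point and any of its open
    neighbourhoods.\<close>
  define I where "I = {(U, V). U \<in> \<B> \<and> V \<in> \<B> \<and> T closure_of U \<subseteq> V}"
  have cI: "countable I" by (rule countable_subset[of _ "\<B> \<times> \<B>"]) (use \<B>(1) in \<open>auto simp: I_def\<close>)
  have "\<exists>u. continuous_map T euclideanreal u \<and> (\<forall>x\<in>fst i. u x = 0) \<and> (\<forall>x\<in>topspace T - snd i. u x = 1)"
    if i: "i \<in> I" for i
  proof -
    obtain U V where UV: "i = (U, V)" "U \<in> \<B>" "V \<in> \<B>" "T closure_of U \<subseteq> V" using i by (auto simp: I_def)
    have "closedin T (T closure_of U)" "closedin T (topspace T - V)" "disjnt (T closure_of U) (topspace T - V)"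
      using UV \<B>(2) by (auto simp: disjnt_def)
    from Urysohn_lemma[OF norm this, of 0 1] obtain u
      where u: "continuous_map T (top_of_set {0..1::real}) u" "u ` (T closure_of U) \<subseteq> {0}" "u ` (topspace T - V) \<subseteq> {1}"
      by auto
    have "U \<subseteq> T closure_of U" using closure_of_subset[OF openin_subset[OF \<B>(2)[OF UV(2)]]] .
    then show ?thesis using u UV(1) by (intro exI[of _ u]) (auto simp: continuous_map_in_subtopology)
  qed
  then obtain u where u: "\<And>i. i \<in> I \<Longrightarrow> continuous_map T euclideanreal (u i)"
    "\<And>i x. i \<in> I \<Longrightarrow> x \<in> fst i \<Longrightarrow> u i x = 0" "\<And>i x. i \<in> I \<Longrightarrow> x \<in> topspace T \<Longrightarrow> x \<notin> snd i \<Longrightarrow> u i x = 1"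
    by (metis DiffI)
  have sep: "\<exists>i\<in>I. x \<in> fst i \<and> snd i \<subseteq> W" if W: "openin T W" "x \<in> W" for x W
  proof -
    obtain V where V: "V \<in> \<B>" "x \<in> V" "V \<subseteq> W" using \<B>(3) W by blast
    have "V \<subseteq> topspace T" using openin_subset[OF \<B>(2)[OF V(1)]] .
    then have "x \<in> topspace T - (topspace T - V)" using V(2) by blast
    moreover have "closedin T (topspace T - V)" using \<B>(2)[OF V(1)] by (intro closedin_diff) auto
    ultimately obtain U' V' where U': "openin T U'" "openin T V'" "x \<in> U'" "topspace T - V \<subseteq> V'" "disjnt U' V'"
      using reg unfolding regular_space_def by metis
    obtain U where U: "U \<in> \<B>" "x \<in> U" "U \<subseteq> U'" using \<B>(3) U' by blast
    have "T closure_of U \<subseteq> topspace T - V'"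
      by (rule closure_of_minimal) (use U U' openin_subset[OF U'(1)] in \<open>auto simp: disjnt_def\<close>)
    then have "(U, V) \<in> I" using U V U' by (auto simp: I_def)
    then show ?thesis using U V by (intro bexI[of _ "(U, V)"]) auto
  qed
  let ?P = "product_topology (\<lambda>_. euclideanreal) I"
  define e where "e x = (\<lambda>i\<in>I. u i x)" for x
  have "continuous_map T ?P e"
    unfolding continuous_map_componentwise e_def using u(1) by (auto simp: extensional_def)
  then have ce: "continuous_map T (subtopology ?P (e ` topspace T)) e" by (simp add: continuous_map_in_subtopology)
  have inj: "inj_on e (topspace T)"
  proof (rule inj_onI, rule ccontr)
    fix x y assume xy: "x \<in> topspace T" "y \<in> topspace T" "e x = e y" "x \<noteq> y"
    then obtain W where W: "openin T W" "x \<in> W" "y \<notin> W"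
      using Haus unfolding Hausdorff_space_def by (metis disjnt_iff)
    then obtain i where i: "i \<in> I" "x \<in> fst i" "snd i \<subseteq> W" using sep by blast
    then have "y \<notin> snd i" using W by blast
    then have "u i x = 0" "u i y = 1" using u(2)[OF i(1,2)] u(3)[OF i(1) xy(2)] by auto
    moreover have "u i x = u i y" using xy(3) i(1) by (auto simp: e_def dest: fun_cong[of _ _ i])
    ultimately show False by simp
  qed
  have om: "open_map T (subtopology ?P (e ` topspace T)) e"
    unfolding open_map_def
  proof (intro allI impI)
    fix W assume W: "openin T W"
    show "openin (subtopology ?P (e ` topspace T)) (e ` W)"
    proof (subst openin_subopen, intro ballI)
      fix z assume "z \<in> e ` W"
      then obtain x where x: "x \<in> W" "z = e x" by blast
      then obtain i where i: "i \<in> I" "x \<in> fst i" "snd i \<subseteq> W" using sep W by blast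
      have xT: "x \<in> topspace T" using x openin_subset[OF W] by auto
      \<comment> \<open>The coordinate \<open>i\<close> is 0 at \<open>x\<close> and 1 off
        \<open>snd i\<close>, so a value below 1 forces a point into \<open>W\<close>.\<close>
      have "openin ?P {z \<in> topspace ?P. z i \<in> {..<1}}"
        by (rule openin_continuous_map_preimage[OF continuous_map_product_projection[OF i(1)]]) simp
      then have "openin (subtopology ?P (e ` topspace T)) ({z \<in> topspace ?P. z i \<in> {..<1}} \<inter> e ` topspace T)"
        by (auto simp: openin_subtopology)
      moreover have "e x \<in> {z \<in> topspace ?P. z i \<in> {..<1}} \<inter> e ` topspace T"
        using xT i u(2) by (auto simp: e_def)
      moreover have "{z \<in> topspace ?P. z i \<in> {..<1}} \<inter> e ` topspace T \<subseteq> e ` W"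
      proof
        fix z' assume "z' \<in> {z \<in> topspace ?P. z i \<in> {..<1}} \<inter> e ` topspace T"
        then obtain y where y: "y \<in> topspace T" "e y i \<in> {..<1}" "z' = e y" by blast
        then have "u i y \<noteq> 1" using i(1) by (simp add: e_def)
        then have "y \<in> W" using u(3)[OF i(1) y(1)] i(3) by auto
        then show "z' \<in> e ` W" using y(3) by blast
      qed
      ultimately show "\<exists>S. openin (subtopology ?P (e ` topspace T)) S \<and> z \<in> S \<and> S \<subseteq> e ` W"
        unfolding x(2) by blast
    qed
  qed
  have im: "e ` topspace T = topspace (subtopology ?P (e ` topspace T))" by (auto simp: e_def)
  have "homeomorphic_map T (subtopology ?P (e ` topspace T)) e"
    by (rule bijective_open_imp_homeomorphic_map[OF ce om im inj])
  then have "T homeomorphic_space subtopology ?P (e ` topspace T)"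
    using homeomorphic_map_imp_homeomorphic_space by blast
  moreover have "metrizable_space ?P"
    unfolding metrizable_space_product_topology using cI
    by (auto simp: metrizable_space_euclidean intro: countable_subset)
  then have "metrizable_space (subtopology ?P (e ` topspace T))" by (rule metrizable_space_subtopology)
  ultimately show ?thesis using homeomorphic_metrizable_space by blast
qed

context etale_compact begin

lemma standard_borel: "standard_borel (borel_of T)"
proof -
  have "metrizable_space T"
    by (rule second_countable_regular_imp_metrizable[OF second_countable regular Hausdorff])
  then have "completely_metrizable_space T"
    using locally_compact locally_compact_imp_completely_metrizable_space by blast
  then show ?thesis unfolding standard_borel_def using second_countable by (intro exI[of _ T]) simp
qed

text \<open>\<open>pmp\<close> contains the axioms of a measurable groupoid, so for \<open>G\<close>
  they have to be derived from the topology. Second countability makes open subsets of the product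
  measurable for the product sigma-algebra.\<close>

lemma measurable_groupoid: "measurable_groupoid H (borel_of T)"
proof
  let ?M = "borel_of T"
  obtain \<B> where \<B>: "countable \<B>" "\<And>V. V \<in> \<B> \<Longrightarrow> openin T V"
    "\<And>U x. openin T U \<Longrightarrow> x \<in> U \<Longrightarrow> \<exists>V\<in>\<B>. x \<in> V \<and> V \<subseteq> U"
    using second_countable unfolding second_countable_def by metis
  show sp: "space ?M = arr H" by (simp add: topspace_T)
  show "standard_borel ?M" by (rule standard_borel)
  show "units H \<in> sets ?M" by (rule units_borel)
  show ms: "src H \<in> ?M \<rightarrow>\<^sub>M ?M" "rng H \<in> ?M \<rightarrow>\<^sub>M ?M" "ginv H \<in> ?M \<rightarrow>\<^sub>M ?M"
    using borel_of_measurable continuous_src continuous_rng continuous_ginv by blast+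
  have pre: "{f \<in> arr H. src H f \<in> V} \<in> sets ?M" "{f \<in> arr H. rng H f \<in> V} \<in> sets ?M" if "V \<in> \<B>" for V
  proof -
    have "src H -` V \<inter> space ?M \<in> sets ?M" "rng H -` V \<inter> space ?M \<in> sets ?M"
      using measurable_sets ms openin_borel_of[OF \<B>(2)[OF that]] by blast+
    moreover have "src H -` V \<inter> space ?M = {f \<in> arr H. src H f \<in> V}" "rng H -` V \<inter> space ?M = {f \<in> arr H. rng H f \<in> V}"
      using sp by auto
    ultimately show "{f \<in> arr H. src H f \<in> V} \<in> sets ?M" "{f \<in> arr H. rng H f \<in> V} \<in> sets ?M" by simp_all
  qed
  \<comment> \<open>Pairs whose source and range lie both in \<open>V\<close> or both outside; a
    base of a Hausdorff topology distinguishes any two units. The additional index \<open>{}\<close>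
    makes the countable intersection nonempty.\<close>
  define D where "D V = ({f \<in> arr H. src H f \<in> V} \<times> {f \<in> arr H. rng H f \<in> V}) \<union>
    ((arr H - {f \<in> arr H. src H f \<in> V}) \<times> (arr H - {f \<in> arr H. rng H f \<in> V}))" for V
  have arrM: "arr H \<in> sets ?M" using sets.top[of ?M] sp by simp
  have "composable H = (arr H \<times> arr H) \<inter> (\<Inter>V\<in>insert {} \<B>. D V)"
  proof (intro equalityI subsetI)
    fix p assume p: "p \<in> (arr H \<times> arr H) \<inter> (\<Inter>V\<in>insert {} \<B>. D V)"
    obtain f g where fg: "p = (f, g)" by fastforce
    have a: "f \<in> arr H" "g \<in> arr H" and D: "\<And>V. V \<in> \<B> \<Longrightarrow> (f, g) \<in> D V" using p fg by auto
    have "src H f = rng H g"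
    proof (rule ccontr)
      assume "src H f \<noteq> rng H g"
      moreover have "src H f \<in> topspace T" "rng H g \<in> topspace T" using a units_arr topspace_T src_in rng_in by blast+
      ultimately obtain W where "openin T W" "src H f \<in> W" "rng H g \<notin> W"
        using Hausdorff unfolding Hausdorff_space_def by (metis disjnt_iff)
      then obtain V where "V \<in> \<B>" "src H f \<in> V" "rng H g \<notin> V" using \<B>(3) by blast
      then show False using D[of V] a by (auto simp: D_def)
    qed
    then show "p \<in> composable H" using a fg by (simp add: composable_def)
  qed (auto simp: composable_def D_def)
  moreover have "D V \<in> sets (?M \<Otimes>\<^sub>M ?M)" if "V \<in> insert {} \<B>" for V
  proof (cases "V = {}")
    case True then show ?thesis using arrM by (simp add: D_def)
  next
    case False then show ?thesis unfolding D_def using pre[of V] that arrM by auto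
  qed
  then have "(\<Inter>V\<in>insert {} \<B>. D V) \<in> sets (?M \<Otimes>\<^sub>M ?M)"
    using \<B>(1) by (intro sets.countable_INT') blast+
  ultimately show "composable H \<in> sets (?M \<Otimes>\<^sub>M ?M)"
    using arrM by (metis sets.Int pair_measureI)
  have openM: "W \<in> sets (?M \<Otimes>\<^sub>M ?M)" if W: "openin (prod_topology T T) W" for W
  proof -
    have "W = (\<Union>(U, V)\<in>{(U, V) \<in> \<B> \<times> \<B>. U \<times> V \<subseteq> W}. U \<times> V)"
    proof (intro equalityI subsetI)
      fix p assume p: "p \<in> W"
      obtain f g where fg: "p = (f, g)" by fastforce
      obtain U V where "openin T U" "openin T V" "f \<in> U" "g \<in> V" "U \<times> V \<subseteq> W"
        using W p fg unfolding openin_prod_topology_alt by metis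
      moreover from this obtain U' V' where "U' \<in> \<B>" "V' \<in> \<B>" "f \<in> U'" "g \<in> V'" "U' \<subseteq> U" "V' \<subseteq> V" using \<B>(3) by metis
      ultimately show "p \<in> (\<Union>(U, V)\<in>{(U, V) \<in> \<B> \<times> \<B>. U \<times> V \<subseteq> W}. U \<times> V)"
        unfolding fg by (intro UN_I[of "(U', V')"]) auto
    qed auto
    also have "\<dots> \<in> sets (?M \<Otimes>\<^sub>M ?M)"
    proof (rule sets.countable_UN'')
      show "countable {(U, V) \<in> \<B> \<times> \<B>. U \<times> V \<subseteq> W}"
        by (rule countable_subset[of _ "\<B> \<times> \<B>"]) (use \<B>(1) in auto)
    qed (use \<B>(2) in \<open>auto intro!: pair_measureI openin_borel_of\<close>)
    finally show ?thesis .
  qed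
  show "(\<lambda>(f, g). mult H f g) \<in> restrict_space (?M \<Otimes>\<^sub>M ?M) (composable H) \<rightarrow>\<^sub>M ?M"
    unfolding borel_of_def[of T]
  proof (rule measurable_measure_of)
    have spr: "space (restrict_space (?M \<Otimes>\<^sub>M ?M) (composable H)) = composable H"
      by (auto simp: space_restrict_space space_pair_measure composable_def topspace_T)
    then have spr': "space (restrict_space (sigma (topspace T) {U. openin T U} \<Otimes>\<^sub>M sigma (topspace T) {U. openin T U}) (composable H)) = composable H"
      by (simp add: borel_of_def)
    show "(\<lambda>(f, g). mult H f g) \<in> space (restrict_space (sigma (topspace T) {U. openin T U} \<Otimes>\<^sub>M sigma (topspace T) {U. openin T U}) (composable H)) \<rightarrow> topspace T"
      unfolding spr' using mult_arr topspace_T by auto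
    fix U assume "U \<in> {U. openin T U}"
    then have "openin (subtopology (prod_topology T T) (composable H))
      {p \<in> topspace (subtopology (prod_topology T T) (composable H)). (\<lambda>(f, g). mult H f g) p \<in> U}"
      using openin_continuous_map_preimage[OF continuous_mult] by blast
    then obtain W where W: "openin (prod_topology T T) W"
      "{p \<in> topspace (subtopology (prod_topology T T) (composable H)). (\<lambda>(f, g). mult H f g) p \<in> U} = W \<inter> composable H"
      unfolding openin_subtopology by blast
    have "(\<lambda>(f, g). mult H f g) -` U \<inter> composable H = W \<inter> composable H"
      unfolding W(2)[symmetric] by (auto simp: composable_def topspace_T)
    moreover have "W \<inter> composable H \<in> sets (restrict_space (?M \<Otimes>\<^sub>M ?M) (composable H))"
      unfolding sets_restrict_space using openM[OF W(1)] by auto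
    ultimately show "(\<lambda>(f, g). mult H f g) -` U \<inter> space (restrict_space (sigma (topspace T) {U. openin T U} \<Otimes>\<^sub>M sigma (topspace T) {U. openin T U}) (composable H))
      \<in> sets (restrict_space (sigma (topspace T) {U. openin T U} \<Otimes>\<^sub>M sigma (topspace T) {U. openin T U}) (composable H))"
      unfolding spr' by (simp add: borel_of_def)
  qed (auto dest: openin_subset)
qed

end

section \<open>Counting fibres, and a criterion for measure preservation\<close>

lemma fibre_count:
  fixes B :: "nat \<Rightarrow> 'a set"
  assumes "disjoint_family B" and inj: "\<And>n. inj_on m (B n)"
  shows "emeasure (count_space UNIV) {h \<in> \<Union> (range B). m h = x} = (\<Sum>n. indicator (m ` B n) x)"
proof -
  have "emeasure (count_space UNIV) {h \<in> B n. m h = x} = indicator (m ` B n) x" for n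
  proof (cases "x \<in> m ` B n")
    case True
    then obtain h where "h \<in> B n" "m h = x" by auto
    then have "{h \<in> B n. m h = x} = {h}" using inj[of n] by (auto simp: inj_on_def)
    then show ?thesis using True by (simp add: emeasure_count_space)
  next
    case False
    then have "{h \<in> B n. m h = x} = {}" by auto
    then show ?thesis using False by (metis emeasure_empty indicator_simps(2))
  qed
  moreover have "(\<Sum>n. emeasure (count_space UNIV) {h \<in> B n. m h = x}) = emeasure (count_space UNIV) (\<Union>n. {h \<in> B n. m h = x})"
    by (rule suminf_emeasure) (use assms(1) in \<open>auto simp: disjoint_family_on_def\<close>)
  moreover have "(\<Union>n. {h \<in> B n. m h = x}) = {h \<in> \<Union> (range B). m h = x}" by auto
  ultimately show ?thesis by simp
qed

context etale_compact begin

lemma units_measure_sets: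
  assumes "sets \<nu> = sets (borel_of X)"
  shows "sets \<nu> = sets (restrict_space (borel_of T) (units H))"
  using assms sets_restrict_borel_of[OF units_borel] by simp

lemma fibre_integral:
  fixes B :: "nat \<Rightarrow> 'a set"
  assumes \<nu>: "sets \<nu> = sets (borel_of X)" and m: "m \<in> {src H, rng H}"
    and B: "disjoint_family B" "\<And>n. B n \<in> sets (borel_of T)" "\<And>n. inj_on m (B n)"
  shows "(\<integral>\<^sup>+ x. emeasure (count_space UNIV) {h \<in> arr H \<inter> \<Union> (range B). m h = x} \<partial>\<nu>) = (\<Sum>n. emeasure \<nu> (m ` B n))"
proof -
  have "\<Union> (range B) \<subseteq> arr H" using sets.sets_into_space[OF B(2)] topspace_T by auto
  then have "arr H \<inter> \<Union> (range B) = \<Union> (range B)" by (rule inf_absorb2)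
  then have "(\<integral>\<^sup>+ x. emeasure (count_space UNIV) {h \<in> arr H \<inter> \<Union> (range B). m h = x} \<partial>\<nu>)
    = (\<integral>\<^sup>+ x. (\<Sum>n. indicator (m ` B n) x) \<partial>\<nu>)"
    using fibre_count[OF B(1,3)] by simp
  also have "\<dots> = (\<Sum>n. \<integral>\<^sup>+ x. indicator (m ` B n) x \<partial>\<nu>)"
    using image_borel[OF B(2) m] \<nu> by (intro nn_integral_suminf) simp
  also have "\<dots> = (\<Sum>n. emeasure \<nu> (m ` B n))"
    using image_borel[OF B(2) m] \<nu> by simp
  finally show ?thesis .
qed

text \<open>Any Borel set is cut along the disjointed \<open>B n\<close> into pieces on which both
  maps are injective; by \<open>fibre_integral\<close> both measures become countable sums, and
  these agree term by term.\<close>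

lemma pmpI:
  fixes B :: "nat \<Rightarrow> 'a set"
  assumes \<mu>: "prob_space \<mu>" "sets \<mu> = sets (borel_of X)"
    and B: "\<And>n. B n \<in> sets (borel_of T)" "\<And>n. inj_on (src H) (B n)" "\<And>n. inj_on (rng H) (B n)" "(\<Union>n. B n) = arr H"
    and eq: "\<And>n A. A \<in> sets (borel_of T) \<Longrightarrow> A \<subseteq> B n \<Longrightarrow> emeasure \<mu> (src H ` A) = emeasure \<mu> (rng H ` A)"
  shows "pmp H (borel_of T) \<mu>"
  unfolding pmp_def
proof (intro conjI ballI)
  show "discrete_groupoid H" by (rule discrete_groupoid_axioms)
  show "measurable_groupoid H (borel_of T)" by (rule measurable_groupoid)
  show "space \<mu> = units H" using sets_eq_imp_space_eq[OF \<mu>(2)] by (simp only: space_borel_of topspace_X)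
  show "sets \<mu> = sets (restrict_space (borel_of T) (units H))" using \<mu>(2) by (rule units_measure_sets)
  fix A assume A: "A \<in> sets (borel_of T)"
  define D where "D n = A \<inter> disjointed B n" for n
  have DB: "D n \<subseteq> B n" for n using disjointed_subset[of B n] by (auto simp: D_def)
  have "disjoint_family D" using disjoint_family_disjointed[of B] by (auto simp: D_def disjoint_family_on_def)
  moreover have Ds: "D n \<in> sets (borel_of T)" for n
    unfolding D_def using A sets.range_disjointed_sets[of B "borel_of T"] B(1) by auto
  moreover have "inj_on (src H) (D n)" "inj_on (rng H) (D n)" for n using DB B inj_on_subset by metis+
  moreover have "\<Union> (range D) = A"
    using UN_disjointed_eq[of B] B(4) sets.sets_into_space[OF A] topspace_T by (auto simp: D_def)
  ultimately show "src_meas H \<mu> A = rng_meas H \<mu> A"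
    using fibre_integral[OF \<mu>(2), of "src H" D] fibre_integral[OF \<mu>(2), of "rng H" D] eq[OF Ds DB]
    by (simp add: src_meas_def rng_meas_def)
qed (rule \<mu>)

section \<open>Inverses and translates of bisections\<close>

definition finv :: "'a set \<Rightarrow> 'a set" where "finv f = ginv H ` f"

lemma finv_iff: "f \<subseteq> arr H \<Longrightarrow> h \<in> finv f \<longleftrightarrow> h \<in> arr H \<and> ginv H h \<in> f"
  unfolding finv_def using ginv_ginv ginv_props(1) by force

lemma finv_finv: "f \<subseteq> arr H \<Longrightarrow> finv (finv f) = f"
  unfolding finv_def image_image using ginv_ginv by (auto simp: subset_iff image_iff)

lemma finv_images:
  assumes "f \<subseteq> arr H"
  shows "finv f \<subseteq> arr H" "src H ` finv f = rng H ` f" "rng H ` finv f = src H ` f"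
proof -
  have "\<And>h. h \<in> f \<Longrightarrow> ginv H h \<in> arr H \<and> src H (ginv H h) = rng H h \<and> rng H (ginv H h) = src H h"
    using assms ginv_props by blast
  then show "finv f \<subseteq> arr H" "src H ` finv f = rng H ` f" "rng H ` finv f = src H ` f"
    unfolding finv_def image_image by (auto intro!: image_cong)
qed

lemma finv_inj:
  assumes "f \<subseteq> arr H" "inj_on (src H) f" "inj_on (rng H) f"
  shows "inj_on (src H) (finv f)" "inj_on (rng H) (finv f)"
proof -
  have p: "\<And>h. h \<in> f \<Longrightarrow> src H (ginv H h) = rng H h \<and> rng H (ginv H h) = src H h"
    using assms ginv_props by blast
  show "inj_on (src H) (finv f)"
    unfolding finv_def by (rule inj_onI) (use p assms(3) in \<open>auto dest: inj_onD\<close>)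
  show "inj_on (rng H) (finv f)"
    unfolding finv_def by (rule inj_onI) (use p assms(2) in \<open>auto dest: inj_onD\<close>)
qed

lemma finv_preimage:
  assumes "f \<subseteq> arr H" shows "finv f = {h \<in> topspace T. ginv H h \<in> f}"
  using finv_iff[OF assms] topspace_T by auto

lemma finv_bisection:
  assumes "bisection H T U" shows "bisection H T (finv U)"
  unfolding bisection_iff
  using bisectionD[OF assms] finv_inj openin_continuous_map_preimage[OF continuous_ginv]
  by (auto simp: finv_preimage)

lemma finv_full_pseudogroup:
  assumes "f \<in> FP" shows "finv f \<in> FP"
proof -
  have f: "f \<in> sets (borel_of T)" "inj_on (src H) f" "inj_on (rng H) f" using assms full_pseudogroup_iff by auto
  then have fa: "f \<subseteq> arr H" using sets.sets_into_space topspace_T by fastforce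
  have "ginv H -` f \<inter> space (borel_of T) \<in> sets (borel_of T)"
    by (rule measurable_sets[OF borel_of_measurable[OF continuous_ginv] f(1)])
  moreover have "ginv H -` f \<inter> space (borel_of T) = finv f" unfolding finv_preimage[OF fa] by auto
  ultimately show ?thesis using finv_inj[OF fa f(2,3)] full_pseudogroup_iff by auto
qed

lemma full_groupD:
  assumes "g \<in> full_group_top H T"
  shows "bisection H T g" "g \<subseteq> arr H" "src H ` g = units H" "rng H ` g = units H"
  using assms bisectionD(2) by (auto simp: full_group_top_def)

lemma finv_full_group: "g \<in> full_group_top H T \<Longrightarrow> finv g \<in> full_group_top H T"
proof -
  assume g: "g \<in> full_group_top H T"
  note gD = full_groupD[OF g]
  show ?thesis
    by (simp add: full_group_top_def finv_bisection[OF gD(1)] finv_images[OF gD(2)] gD(3,4))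
qed

text \<open>With \<open>s\<close> the inverse of the source map on \<open>g\<close>, the translation
  is \<open>mult H (s (rng H h)) h\<close>. It is defined on all arrows because every unit is a
  source of \<open>g\<close>.\<close>

lemma translation:
  assumes g: "g \<in> full_group_top H T"
  obtains l where "continuous_map T T l"
    "\<And>a h. a \<in> g \<Longrightarrow> h \<in> arr H \<Longrightarrow> src H a = rng H h \<Longrightarrow> l h = mult H a h"
proof -
  note gD = full_groupD[OF g]
  obtain s where s: "continuous_map (subtopology T (src H ` g)) T s" "\<And>h. h \<in> g \<Longrightarrow> s (src H h) = h"
    using src_section[OF gD(1)] by blast
  have s1: "continuous_map X T s" using s(1) gD(3) by simp
  have s2: "s u \<in> g" "src H (s u) = u" if "u \<in> units H" for u
  proof -
    have "u \<in> src H ` g" using that by (simp only: gD(3))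
    then obtain a where "a \<in> g" "src H a = u" by blast
    then show "s u \<in> g" "src H (s u) = u" using s(2) by auto
  qed
  have "continuous_map T T (s \<circ> rng H)" by (rule continuous_map_compose[OF continuous_rng_X s1])
  from continuous_map_pairedI[OF this continuous_map_id[unfolded id_def]] have "continuous_map T (prod_topology T T) (\<lambda>h. ((s \<circ> rng H) h, h))" .
  moreover have "(\<lambda>h. ((s \<circ> rng H) h, h)) \<in> topspace T \<rightarrow> composable H"
    using s2 gD(2) topspace_T by (auto simp: composable_def)
  ultimately have "continuous_map T (subtopology (prod_topology T T) (composable H)) (\<lambda>h. ((s \<circ> rng H) h, h))"
    by (simp add: continuous_map_in_subtopology image_subset_iff_funcset)
  from continuous_map_compose[OF this continuous_mult]
  have "continuous_map T T (\<lambda>h. mult H (s (rng H h)) h)" by (simp add: o_def)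
  moreover have "mult H (s (rng H h)) h = mult H a h" if "a \<in> g" "h \<in> arr H" "src H a = rng H h" for a h
    using s(2)[OF that(1)] that(3) by simp
  ultimately show ?thesis using that by blast
qed

text \<open>Multiplication by \<open>a\<close> undoes multiplication by \<open>ginv H a\<close>, so
  the product is the preimage of \<open>U\<close> under left translation by \<open>g\<close>. In
  this form continuity of the translation yields openness.\<close>

lemma set_mult_iff:
  assumes g: "g \<in> full_group_top H T" and U: "U \<subseteq> arr H"
  shows "k \<in> set_mult H (finv g) U \<longleftrightarrow> k \<in> arr H \<and> (\<exists>a\<in>g. src H a = rng H k \<and> mult H a k \<in> U)"
proof
  note gD = full_groupD[OF g]
  assume "k \<in> set_mult H (finv g) U"
  then obtain b h where bh: "b \<in> finv g" "h \<in> U" "(b, h) \<in> composable H" "k = mult H b h"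
    unfolding set_mult_def by blast
  then obtain a where a: "a \<in> g" "b = ginv H a" by (auto simp: finv_def)
  note ia = ginv_props[OF subsetD[OF gD(2) a(1)]]
  have c: "(a, b) \<in> composable H" using a ia gD(2) by (auto simp: composable_def)
  have "mult H a k = mult H (mult H a b) h" using mult_assoc[OF c bh(3)] bh(4) by simp
  also have "\<dots> = mult H (rng H a) h" using ia(5) a(2) by simp
  also have "rng H a = rng H h" using bh(3) ia(2) a(2) by (simp add: composable_def)
  also have "mult H (rng H h) h = h" using rng_mult_self U bh(2) by blast
  finally have "mult H a k \<in> U" using bh(2) by simp
  moreover have "src H a = rng H k" using rng_mult[OF bh(3)] bh(4) ia(3) a(2) by simp
  ultimately show "k \<in> arr H \<and> (\<exists>a\<in>g. src H a = rng H k \<and> mult H a k \<in> U)"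
    using mult_arr[OF bh(3)] bh(4) a(1) by blast
next
  note gD = full_groupD[OF g]
  assume "k \<in> arr H \<and> (\<exists>a\<in>g. src H a = rng H k \<and> mult H a k \<in> U)"
  then obtain a where k: "k \<in> arr H" and a: "a \<in> g" "src H a = rng H k" "mult H a k \<in> U" by blast
  have aa: "a \<in> arr H" using a(1) gD(2) by blast
  note ia = ginv_props[OF aa]
  have c: "(ginv H a, a) \<in> composable H" "(a, k) \<in> composable H" using ia aa k a(2) by (auto simp: composable_def)
  have "mult H (ginv H a) (mult H a k) = mult H (mult H (ginv H a) a) k" using mult_assoc[OF c] by simp
  also have "\<dots> = k" using ia(4) a(2) rng_mult_self[OF k] by simp
  finally have "mult H (ginv H a) (mult H a k) = k" .
  moreover have "(ginv H a, mult H a k) \<in> composable H"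
    using ia mult_arr[OF c(2)] rng_mult[OF c(2)] by (simp add: composable_def)
  ultimately show "k \<in> set_mult H (finv g) U"
    unfolding set_mult_def finv_def using a by (metis (mono_tags, lifting) imageI mem_Collect_eq)
qed

lemma translate_open:
  assumes g: "g \<in> full_group_top H T" and U: "openin T U"
  shows "openin T (set_mult H g U)"
proof -
  have Ua: "U \<subseteq> arr H" using openin_subset[OF U] topspace_T by simp
  have g': "finv g \<in> full_group_top H T" by (rule finv_full_group[OF g])
  obtain l where l: "continuous_map T T l"
    "\<And>a h. a \<in> finv g \<Longrightarrow> h \<in> arr H \<Longrightarrow> src H a = rng H h \<Longrightarrow> l h = mult H a h"
    using translation[OF g'] by blast
  have "openin T {h \<in> topspace T. l h \<in> U}" by (rule openin_continuous_map_preimage[OF l(1) U])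
  also have "{h \<in> topspace T. l h \<in> U} = set_mult H g U"
  proof (intro equalityI subsetI)
    fix h assume "h \<in> {h \<in> topspace T. l h \<in> U}"
    then have h: "h \<in> arr H" "l h \<in> U" using topspace_T by auto
    have "rng H h \<in> src H ` finv g" using rng_in[OF h(1)] by (simp only: full_groupD(3)[OF g'])
    then obtain a where a: "a \<in> finv g" "src H a = rng H h" by auto
    then have "mult H a h \<in> U" using l(2)[OF a(1) h(1) a(2)] h(2) by simp
    then have "h \<in> set_mult H (finv (finv g)) U" using set_mult_iff[OF g' Ua] a h by blast
    then show "h \<in> set_mult H g U" using finv_finv[OF full_groupD(2)[OF g]] by simp
  next
    fix h assume "h \<in> set_mult H g U"
    then have "h \<in> set_mult H (finv (finv g)) U" using finv_finv[OF full_groupD(2)[OF g]] by simp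
    then obtain a where a: "h \<in> arr H" "a \<in> finv g" "src H a = rng H h" "mult H a h \<in> U"
      using set_mult_iff[OF g' Ua] by blast
    then show "h \<in> {h \<in> topspace T. l h \<in> U}" using l(2)[OF a(2,1,3)] topspace_T by auto
  qed
  finally show ?thesis .
qed

lemma set_mult_inj:
  assumes f: "f \<subseteq> arr H" "inj_on (src H) f" "inj_on (rng H) f" and g: "g \<subseteq> arr H" "inj_on (src H) g" "inj_on (rng H) g"
  shows "set_mult H f g \<subseteq> arr H" "inj_on (src H) (set_mult H f g)" "inj_on (rng H) (set_mult H f g)"
proof -
  show "set_mult H f g \<subseteq> arr H" using mult_arr by (auto simp: set_mult_def)
  show "inj_on (src H) (set_mult H f g)"
  proof (rule inj_onI)
    fix x y assume "x \<in> set_mult H f g" "y \<in> set_mult H f g" and e: "src H x = src H y"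
    then obtain a b a' b' where ab: "a \<in> f" "b \<in> g" "(a, b) \<in> composable H" "x = mult H a b"
      "a' \<in> f" "b' \<in> g" "(a', b') \<in> composable H" "y = mult H a' b'" unfolding set_mult_def by blast
    then have "src H b = src H b'" using e src_mult by metis
    then have "b = b'" using ab g(2) by (meson inj_onD)
    then have "src H a = src H a'" using ab by (simp add: composable_def)
    then have "a = a'" using ab f(2) by (meson inj_onD)
    then show "x = y" using ab \<open>b = b'\<close> by simp
  qed
  show "inj_on (rng H) (set_mult H f g)"
  proof (rule inj_onI)
    fix x y assume "x \<in> set_mult H f g" "y \<in> set_mult H f g" and e: "rng H x = rng H y"
    then obtain a b a' b' where ab: "a \<in> f" "b \<in> g" "(a, b) \<in> composable H" "x = mult H a b"
      "a' \<in> f" "b' \<in> g" "(a', b') \<in> composable H" "y = mult H a' b'" unfolding set_mult_def by blast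
    then have "rng H a = rng H a'" using e rng_mult by metis
    then have "a = a'" using ab f(3) by (meson inj_onD)
    then have "rng H b = rng H b'" using ab by (simp add: composable_def)
    then have "b = b'" using ab g(3) by (meson inj_onD)
    then show "x = y" using ab \<open>a = a'\<close> by simp
  qed
qed

lemma translate_src:
  assumes g: "g \<in> full_group_top H T" and U: "U \<subseteq> arr H"
  shows "src H ` set_mult H g U = src H ` U"
    "{k \<in> set_mult H g U. src H k \<in> V} = set_mult H g {h \<in> U. src H h \<in> V}"
proof -
  note gD = full_groupD[OF g]
  show "src H ` set_mult H g U = src H ` U"
  proof (intro equalityI subsetI)
    fix x assume "x \<in> src H ` set_mult H g U"
    then show "x \<in> src H ` U" by (auto simp: set_mult_def src_mult)
  next
    fix x assume "x \<in> src H ` U"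
    then obtain h where h: "h \<in> U" "x = src H h" by auto
    then have "rng H h \<in> src H ` g" using U rng_in by (auto simp only: gD(3))
    then obtain a where a: "a \<in> g" "src H a = rng H h" by auto
    then have c: "(a, h) \<in> composable H" using gD(2) U h by (auto simp: composable_def)
    then have "mult H a h \<in> set_mult H g U" using a h by (auto simp: set_mult_def)
    then show "x \<in> src H ` set_mult H g U" using src_mult[OF c] h by (metis image_eqI)
  qed
  show "{k \<in> set_mult H g U. src H k \<in> V} = set_mult H g {h \<in> U. src H h \<in> V}"
    by (auto simp: set_mult_def src_mult) (metis src_mult)+
qed

lemma translate_bisection:
  assumes g: "g \<in> full_group_top H T" and U: "bisection H T U"
  shows "bisection H T (set_mult H g U)"
  unfolding bisection_iff
  using translate_open[OF g bisectionD(1)[OF U]] bisectionD[OF U] bisectionD[OF full_groupD(1)[OF g]]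
    set_mult_inj[of g U] by blast

end

lemma (in compact_metrizable) disjoint_open_nbhds:
  fixes C :: "nat \<Rightarrow> 'a set"
  assumes C: "\<And>i. i < N \<Longrightarrow> closedin X (C i)" and disj: "disjoint_family_on C {..<N}"
  obtains Q where "\<And>i. i < N \<Longrightarrow> openin X (Q i)" "\<And>i. i < N \<Longrightarrow> C i \<subseteq> Q i" "disjoint_family_on Q {..<N}"
proof -
  have "\<exists>A B. openin X A \<and> openin X B \<and> C i \<subseteq> A \<and> C j \<subseteq> B \<and> A \<inter> B = {}" if ij: "i < N" "j < N" "i \<noteq> j" for i j
  proof -
    have "disjnt (C i) (C j)" using disj ij unfolding disjoint_family_on_def disjnt_def by auto
    then show ?thesis using normal C[OF ij(1)] C[OF ij(2)] unfolding normal_space_def disjnt_def by meson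
  qed
  then obtain A B where AB: "\<And>i j. i < N \<Longrightarrow> j < N \<Longrightarrow> i \<noteq> j \<Longrightarrow>
      openin X (A i j) \<and> openin X (B i j) \<and> C i \<subseteq> A i j \<and> C j \<subseteq> B i j \<and> A i j \<inter> B i j = {}"
    by metis
  \<comment> \<open>For each pair the separation indexed by the smaller index first is used on both
    sides, so that \<open>W i j\<close> and \<open>W j i\<close> are disjoint.\<close>
  define W where "W i j = (if i = j then topspace X else if i < j then A i j else B j i)" for i j
  define Q where "Q i = (\<Inter>j\<in>{..<N}. W i j) \<inter> topspace X" for i
  have W: "openin X (W i j)" "C i \<subseteq> W i j" if "i < N" "j < N" for i j
    using that AB[of i j] AB[of j i] closedin_subset[OF C[OF that(1)]] by (auto simp: W_def)
  show ?thesis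
  proof (rule that)
    show "openin X (Q i)" if "i < N" for i
      unfolding Q_def by (rule openin_INT) (use W that in auto)
    show "C i \<subseteq> Q i" if "i < N" for i
      using W(2)[OF that] closedin_subset[OF C[OF that]] unfolding Q_def by (intro Int_greatest INT_greatest) auto
    show "disjoint_family_on Q {..<N}"
      unfolding disjoint_family_on_def
    proof (intro ballI impI)
      fix i j assume ij: "i \<in> {..<N}" "j \<in> {..<N}" "i \<noteq> j"
      have "W i j \<inter> W j i = {}"
        using ij AB[of i j] AB[of j i] by (cases "i < j") (auto simp: W_def)
      moreover have "Q i \<subseteq> W i j" "Q j \<subseteq> W j i" using ij by (auto simp: Q_def)
      ultimately show "Q i \<inter> Q j = {}" by blast
    qed
  qed
qed

section \<open>Open elements of the topological pseudogroup\<close>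

locale pmp_etale = etale_compact +
  fixes \<nu> :: "'a measure"
  assumes pmp: "pmp H (borel_of T) \<nu>"
begin

sublocale \<nu>: prob_space \<nu>
  using pmp by (simp add: pmp_def)

lemma space_\<nu> [simp]: "space \<nu> = units H"
  using pmp by (simp add: pmp_def)

lemma sets_\<nu>: "sets \<nu> = sets (borel_of X)"
  using pmp sets_restrict_borel_of[OF units_borel] by (simp add: pmp_def)

lemma open_\<nu>: "openin X U \<Longrightarrow> U \<in> sets \<nu>" and closed_\<nu>: "closedin X U \<Longrightarrow> U \<in> sets \<nu>"
  using sets_\<nu> by (auto simp: openin_borel_of closedin_borel_of)

lemma src_sets: "A \<in> sets (borel_of T) \<Longrightarrow> src H ` A \<in> sets \<nu>"
  and rng_sets: "A \<in> sets (borel_of T) \<Longrightarrow> rng H ` A \<in> sets \<nu>"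
  using image_borel sets_\<nu> by auto

text \<open>When both maps are injective on \<open>A\<close>, the fibre counts are indicators of the
  two images; \<open>A\<close> enters \<open>fibre_integral\<close> as a disjoint sequence with one
  nonempty term.\<close>

lemma pmp_eq:
  assumes A: "A \<in> sets (borel_of T)" and inj: "inj_on (src H) A" "inj_on (rng H) A"
  shows "measure \<nu> (src H ` A) = measure \<nu> (rng H ` A)"
proof -
  define D where "D n = (if n = (0::nat) then A else {})" for n
  have D: "disjoint_family D" "\<And>n. D n \<in> sets (borel_of T)" "\<Union> (range D) = A"
    using A by (auto simp: D_def disjoint_family_on_def split: if_splits)
  have inj': "inj_on (src H) (D n)" "inj_on (rng H) (D n)" for n using inj by (auto simp: D_def)
  have "(\<Sum>n. emeasure \<nu> (m ` D n)) = emeasure \<nu> (m ` A)" for m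
  proof -
    have "(\<Sum>n. emeasure \<nu> (m ` D n)) = (\<Sum>n\<in>{0}. emeasure \<nu> (m ` D n))"
      by (rule suminf_finite) (auto simp: D_def)
    then show ?thesis by (simp add: D_def)
  qed
  moreover have "src_meas H \<nu> A = rng_meas H \<nu> A" using pmp A by (simp add: pmp_def)
  ultimately have "emeasure \<nu> (src H ` A) = emeasure \<nu> (rng H ` A)"
    using fibre_integral[OF sets_\<nu> _ D(1,2) inj'(1)] fibre_integral[OF sets_\<nu> _ D(1,2) inj'(2)]
    by (simp add: src_meas_def rng_meas_def D(3))
  then show ?thesis by (simp add: measure_def)
qed

lemma src_meas_sym_diff:
  assumes "f \<in> FP" "f' \<in> FP"
  shows "src_meas H \<nu> (sym_diff f f') = ennreal (measure \<nu> (src H ` (f - f')) + measure \<nu> (src H ` (f' - f)))"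
proof -
  define D where "D n = (if n = (0::nat) then f - f' else if n = 1 then f' - f else {})" for n
  have f: "f \<in> sets (borel_of T)" "f' \<in> sets (borel_of T)" "inj_on (src H) f" "inj_on (src H) f'"
    using assms full_pseudogroup_iff by auto
  have D: "disjoint_family D" "\<And>n. D n \<in> sets (borel_of T)" "\<Union> (range D) = sym_diff f f'"
    using f by (auto simp: D_def disjoint_family_on_def split: if_splits)
  have inj: "inj_on (src H) (D n)" for n
    using f inj_on_subset[OF f(3), of "f - f'"] inj_on_subset[OF f(4), of "f' - f"] by (auto simp: D_def)
  have "(\<Sum>n. emeasure \<nu> (src H ` D n)) = (\<Sum>n\<in>{0,1}. emeasure \<nu> (src H ` D n))"
    by (rule suminf_finite) (auto simp: D_def)
  then show ?thesis
    using fibre_integral[OF sets_\<nu> _ D(1,2) inj]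
    by (simp add: src_meas_def D(3)) (simp add: D_def \<nu>.emeasure_eq_measure)
qed

text \<open>Open pieces of the kind allowed in \<open>pseudogroup_top\<close>. Only the source side
  is prescribed; the conditions on the closure of \<open>f\<close> and on the range follow in
  \<open>nice_geometry\<close> from compactness and the invariance of \<open>\<nu>\<close>.\<close>

definition nice :: "'a set \<Rightarrow> bool" where
  "nice f \<longleftrightarrow> (\<exists>U V. bisection H T U \<and> openin X V \<and> X closure_of V \<subseteq> src H ` U \<and>
     measure \<nu> (X frontier_of V) = 0 \<and> f = {h \<in> U. src H h \<in> V})"

lemma nice_basic:
  assumes "nice f"
  shows "openin T f" "f \<subseteq> arr H" "inj_on (src H) f" "inj_on (rng H) f" "bisection H T f"
    "f \<in> sets (borel_of T)" "f \<in> FP"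
proof -
  obtain U V where UV: "bisection H T U" "openin X V" "f = {h \<in> U. src H h \<in> V}"
    using assms by (auto simp: nice_def)
  note b = bisectionD[OF UV(1)]
  show o: "openin T f" unfolding UV(3) by (rule openin_src_lift[OF b(1) UV(2)])
  have "f \<subseteq> U" using UV(3) by auto
  then show i: "inj_on (src H) f" "inj_on (rng H) f" "f \<subseteq> arr H" using b inj_on_subset by auto
  show "bisection H T f" using o i bisection_iff by blast
  show "f \<in> sets (borel_of T)" using openin_borel_of[OF o] .
  then show "f \<in> FP" using i full_pseudogroup_iff by blast
qed

text \<open>The lift \<open>K\<close> of the closure of \<open>V\<close> is compact, so the closures
  of \<open>f\<close> and of its range stay in \<open>K\<close> and in the range of
  \<open>K\<close>. The frontier of the range lies in the range of the lift of the frontier of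
  \<open>V\<close>, which is null by \<open>pmp_eq\<close>.\<close>

lemma nice_geometry:
  assumes "nice f"
  obtains U where "bisection H T U" "f \<subseteq> U" "T closure_of f \<subseteq> U"
    "X closure_of (src H ` f) \<subseteq> src H ` U" "X closure_of (rng H ` f) \<subseteq> rng H ` U"
    "measure \<nu> (X frontier_of (src H ` f)) = 0" "measure \<nu> (X frontier_of (rng H ` f)) = 0"
proof -
  obtain U V where UV: "bisection H T U" "openin X V" "X closure_of V \<subseteq> src H ` U"
    "measure \<nu> (X frontier_of V) = 0" "f = {h \<in> U. src H h \<in> V}"
    using assms by (auto simp: nice_def)
  note b = bisectionD[OF UV(1)]
  define K where "K = {h \<in> U. src H h \<in> X closure_of V}"
  have Kc: "compactin T K" unfolding K_def by (rule compactin_src_lift[OF UV(1) _ UV(3)]) simp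
  have VV: "V \<subseteq> X closure_of V" using closure_of_subset[OF openin_subset[OF UV(2)]] .
  have fK: "f \<subseteq> K" using VV by (auto simp: K_def UV(5))
  have KU: "K \<subseteq> U" by (auto simp: K_def)
  have sf: "src H ` f = V" using VV UV(3) by (force simp: UV(5))
  have clf: "T closure_of f \<subseteq> K"
    by (rule closure_of_minimal[OF fK compactin_imp_closedin[OF Hausdorff Kc]])
  have "compactin X (rng H ` K)" by (rule image_compactin[OF Kc continuous_rng_X])
  then have rK: "closedin X (rng H ` K)" using X.compactin_iff_closedin by blast
  have clr: "X closure_of (rng H ` f) \<subseteq> rng H ` K"
    by (rule closure_of_minimal[OF image_mono[OF fK] rK])
  have or: "openin X (rng H ` f)" by (rule open_map_rng[OF nice_basic(1)[OF assms]])
  let ?F = "{h \<in> U. src H h \<in> X frontier_of V}"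
  have "X frontier_of (rng H ` f) = X closure_of (rng H ` f) - rng H ` f"
    using or by (simp add: frontier_of_def interior_of_openin)
  also have "\<dots> \<subseteq> rng H ` (K - f)" using clr by blast
  also have "K - f \<subseteq> ?F" using UV(2) by (auto simp: K_def UV(5) frontier_of_def interior_of_openin)
  finally have fr: "X frontier_of (rng H ` f) \<subseteq> rng H ` ?F" by blast
  have "closedin X (X frontier_of V)" "X frontier_of V \<subseteq> src H ` U"
    using UV(3) by (auto simp: frontier_of_def closedin_frontier_of)
  then have "compactin T ?F" by (rule compactin_src_lift[OF UV(1)])
  then have Fs: "?F \<in> sets (borel_of T)" by (intro closedin_borel_of compactin_imp_closedin[OF Hausdorff])
  have Fi: "inj_on (src H) ?F" "inj_on (rng H) ?F" using b inj_on_subset[of _ U ?F] by auto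
  have "measure \<nu> (X frontier_of (rng H ` f)) \<le> measure \<nu> (rng H ` ?F)"
    by (rule \<nu>.finite_measure_mono[OF fr rng_sets[OF Fs]])
  also have "\<dots> = measure \<nu> (src H ` ?F)" using pmp_eq[OF Fs Fi] by simp
  also have "\<dots> \<le> measure \<nu> (X frontier_of V)"
    by (rule \<nu>.finite_measure_mono) (auto simp: closed_\<nu> closedin_frontier_of)
  finally have "measure \<nu> (X frontier_of (rng H ` f)) = 0" using UV(4) by (simp add: measure_le_0_iff)
  moreover have "measure \<nu> (X frontier_of (src H ` f)) = 0" "X closure_of (src H ` f) \<subseteq> src H ` U"
    using UV sf by auto
  ultimately show ?thesis using that[OF UV(1)] fK KU clf clr by blast
qed

text \<open>The range conditions in \<open>nice_geometry\<close> are the source conditions for the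
  inverse.\<close>

lemma nice_finv:
  assumes "nice f" shows "nice (finv f)"
proof -
  obtain U where U: "bisection H T U" "f \<subseteq> U" "X closure_of (rng H ` f) \<subseteq> rng H ` U"
     "measure \<nu> (X frontier_of (rng H ` f)) = 0"
    using nice_geometry[OF assms] by metis
  note b = bisectionD[OF U(1)]
  have "finv f = {h \<in> finv U. src H h \<in> rng H ` f}"
  proof (intro equalityI subsetI)
    fix h assume "h \<in> finv f"
    then show "h \<in> {h \<in> finv U. src H h \<in> rng H ` f}"
      using finv_images(2)[OF nice_basic(2)[OF assms]] U(2) by (auto simp: finv_def)
  next
    fix h assume "h \<in> {h \<in> finv U. src H h \<in> rng H ` f}"
    then obtain u k where uk: "u \<in> U" "h = ginv H u" "k \<in> f" "src H h = rng H k" by (auto simp: finv_def)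
    then have "rng H u = rng H k" using ginv_props(2) b(2) by auto
    then have "u = k" using uk U(2) b(4) by (auto dest: inj_onD)
    then show "h \<in> finv f" using uk by (simp add: finv_def)
  qed
  then show ?thesis
    unfolding nice_def using finv_bisection[OF U(1)] open_map_rng[OF nice_basic(1)[OF assms]] U(3,4) finv_images(2)[OF b(2)]
    by (intro exI[of _ "finv U"] exI[of _ "rng H ` f"]) simp
qed

lemma nice_translate:
  assumes "g \<in> full_group_top H T" "nice f" shows "nice (set_mult H g f)"
proof -
  obtain U V where UV: "bisection H T U" "openin X V" "X closure_of V \<subseteq> src H ` U"
    "measure \<nu> (X frontier_of V) = 0" "f = {h \<in> U. src H h \<in> V}"
    using assms(2) by (auto simp: nice_def)
  note b = bisectionD[OF UV(1)]
  show ?thesis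
    unfolding nice_def
    by (rule exI[of _ "set_mult H g U"], rule exI[of _ V])
      (simp add: translate_bisection[OF assms(1) UV(1)] translate_src[OF assms(1) b(2)] UV)
qed

lemma nice_full_group:
  assumes "g \<in> full_group_top H T" shows "nice g"
proof -
  note gD = full_groupD[OF assms]
  have "X closure_of (units H) = units H" "X frontier_of (units H) = {}"
    using closure_of_topspace[of X] frontier_of_topspace[of X] unfolding topspace_X by auto
  moreover have "openin X (units H)" using openin_topspace[of X] unfolding topspace_X .
  moreover have "g = {h \<in> g. src H h \<in> units H}" using gD(2) by auto
  ultimately show ?thesis
    unfolding nice_def using gD(1,3) by (intro exI[of _ g] exI[of _ "units H"]) simp
qed

lemma nice_nbhd:
  assumes "h \<in> arr H" obtains f where "nice f" "h \<in> f"
proof -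
  obtain U where U: "bisection H T U" "h \<in> U" using in_bisection assms by blast
  have "closedin X {src H h}"
    using X.Hausdorff assms by (metis closedin_Hausdorff_sing_eq topspace_X src_in)
  then obtain V where V: "openin X V" "{src H h} \<subseteq> V" "X closure_of V \<subseteq> src H ` U" "measure \<nu> (X frontier_of V) = 0"
    using X.open_nbhd_null_frontier[of "{src H h}" "src H ` U" \<nu>] open_map_src[OF bisectionD(1)[OF U(1)]] U sets_\<nu>
      \<nu>.finite_measure_axioms by blast
  show ?thesis
    by (rule that[of "{h \<in> U. src H h \<in> V}"]) (use U V in \<open>auto simp: nice_def\<close>)
qed

text \<open>Members of \<open>pseudogroup_top\<close> that are open. Openness lets preimages be
  tested by \<open>\<mu>\<close> and \<open>L\<close>, and the family is stable under translation by
  the topological full group.\<close>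

definition open_pseudogroup :: "'a set set" where
  "open_pseudogroup = {f. \<exists>(n::nat) F. f = (\<Union>i<n. F i) \<and> (\<forall>i<n. nice (F i)) \<and>
     disjoint_family_on (\<lambda>i. src H ` F i) {..<n} \<and> disjoint_family_on (\<lambda>i. rng H ` F i) {..<n}}"

lemma inj_on_disjoint_images:
  assumes "\<And>i. i < n \<Longrightarrow> inj_on m (F i)" "disjoint_family_on (\<lambda>i. m ` F i) {..<n::nat}"
  shows "inj_on m (\<Union>i<n. F i)"
proof (rule inj_onI)
  fix x y assume "x \<in> (\<Union>i<n. F i)" "y \<in> (\<Union>i<n. F i)" and e: "m x = m y"
  then obtain i j where ij: "i < n" "j < n" "x \<in> F i" "y \<in> F j" by auto
  have "i = j"
  proof (rule ccontr)
    assume "i \<noteq> j"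
    then have "m ` F i \<inter> m ` F j = {}" using assms(2) ij by (auto simp: disjoint_family_on_def)
    then show False using ij e by (metis IntI empty_iff imageI)
  qed
  then show "x = y" using ij e assms(1) by (auto dest: inj_onD)
qed

text \<open>The closure of the source of a finite union adds only the null frontiers of the parts,
  hence the equality of measures at the end. It allows the complement of the domain to be replaced
  by an open set.\<close>

lemma open_pseudogroup_basic:
  assumes "f \<in> open_pseudogroup"
  shows "openin T f" "f \<subseteq> arr H" "inj_on (src H) f" "inj_on (rng H) f"
    "f \<in> FP" "f \<in> pseudogroup_top H T \<nu>"
    "measure \<nu> (X closure_of (src H ` f)) = measure \<nu> (src H ` f)"
proof -
  obtain n :: nat and F where F: "f = (\<Union>i<n. F i)" "\<And>i. i < n \<Longrightarrow> nice (F i)"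
     "disjoint_family_on (\<lambda>i. src H ` F i) {..<n}" "disjoint_family_on (\<lambda>i. rng H ` F i) {..<n}"
    using assms unfolding open_pseudogroup_def by blast
  show o: "openin T f" unfolding F(1) using F(2) nice_basic(1) by auto
  then show a: "f \<subseteq> arr H" using openin_subset topspace_T by auto
  show i: "inj_on (src H) f" "inj_on (rng H) f"
    unfolding F(1) using F(2-4) nice_basic(3,4) by (auto intro!: inj_on_disjoint_images)
  show fp: "f \<in> FP"
    using i openin_borel_of[OF o] full_pseudogroup_iff by blast
  have nb: "src H ` F i \<in> null_boundary_sets H T \<nu> \<and> rng H ` F i \<in> null_boundary_sets H T \<nu>" if "i < n" for i
    using nice_geometry[OF F(2)[OF that]] nice_basic(6)[OF F(2)[OF that]] src_sets rng_sets
    unfolding null_boundary_sets_def \<nu>.emeasure_eq_measure by (metis (mono_tags, lifting) ennreal_0 mem_Collect_eq)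
  have "\<forall>i<n. \<exists>U. bisection H T U \<and> T closure_of F i \<subseteq> U \<and>
        X closure_of (src H ` F i) \<subseteq> src H ` U \<and> X closure_of (rng H ` F i) \<subseteq> rng H ` U"
    using nice_geometry F(2) by metis
  then show "f \<in> pseudogroup_top H T \<nu>"
    unfolding pseudogroup_top_def using fp nb F by (intro CollectI conjI exI[of _ n] exI[of _ F]) auto
  have "X closure_of (src H ` f) = (\<Union>i<n. X closure_of (src H ` F i))"
    unfolding F(1) image_UN by (subst closure_of_Union) auto
  also have "\<dots> \<subseteq> src H ` f \<union> (\<Union>i<n. X frontier_of (src H ` F i))"
  proof (rule UN_least)
    fix i assume i: "i \<in> {..<n}"
    then have "openin X (src H ` F i)" using open_map_src[OF nice_basic(1)] F(2) by simp
    then have "X closure_of (src H ` F i) \<subseteq> src H ` F i \<union> X frontier_of (src H ` F i)"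
      by (auto simp: frontier_of_def interior_of_openin)
    then show "X closure_of (src H ` F i) \<subseteq> src H ` f \<union> (\<Union>i<n. X frontier_of (src H ` F i))"
      using i unfolding F(1) by blast
  qed
  finally have sub: "X closure_of (src H ` f) \<subseteq> src H ` f \<union> (\<Union>i<n. X frontier_of (src H ` F i))" .
  have os: "openin X (src H ` f)" by (rule open_map_src[OF o])
  have frs: "X frontier_of A \<in> sets \<nu>" for A by (rule closed_\<nu>) (simp add: closedin_frontier_of)
  have "measure \<nu> (\<Union>i<n. X frontier_of (src H ` F i)) \<le> (\<Sum>i<n. measure \<nu> (X frontier_of (src H ` F i)))"
    by (rule \<nu>.finite_measure_subadditive_finite) (use frs in auto)
  also have "\<dots> = 0" using nice_geometry F(2) by (intro sum.neutral) (metis lessThan_iff)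
  finally have z: "measure \<nu> (\<Union>i<n. X frontier_of (src H ` F i)) \<le> 0" .
  have "measure \<nu> (X closure_of (src H ` f)) \<le> measure \<nu> (src H ` f \<union> (\<Union>i<n. X frontier_of (src H ` F i)))"
    by (rule \<nu>.finite_measure_mono[OF sub]) (use open_\<nu>[OF os] frs in auto)
  also have "\<dots> \<le> measure \<nu> (src H ` f) + measure \<nu> (\<Union>i<n. X frontier_of (src H ` F i))"
    by (rule measure_Un_le) (use open_\<nu>[OF os] frs in auto)
  finally have "measure \<nu> (X closure_of (src H ` f)) \<le> measure \<nu> (src H ` f)" using z by simp
  moreover have "measure \<nu> (src H ` f) \<le> measure \<nu> (X closure_of (src H ` f))"
    by (rule \<nu>.finite_measure_mono[OF closure_of_subset[OF openin_subset[OF os]]]) (simp add: closed_\<nu>)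
  ultimately show "measure \<nu> (X closure_of (src H ` f)) = measure \<nu> (src H ` f)" by simp
qed

lemma nice_open_pseudogroup: "nice f \<Longrightarrow> f \<in> open_pseudogroup"
  unfolding open_pseudogroup_def
  by (intro CollectI exI[of _ "Suc 0"] exI[of _ "\<lambda>_. f"]) (simp add: disjoint_family_on_def lessThan_Suc)

lemma translate_open_pseudogroup:
  assumes g: "g \<in> full_group_top H T" and f: "f \<in> open_pseudogroup"
  shows "set_mult H g f \<in> open_pseudogroup"
proof -
  obtain n :: nat and F where F: "f = (\<Union>i<n. F i)" "\<And>i. i < n \<Longrightarrow> nice (F i)"
     "disjoint_family_on (\<lambda>i. src H ` F i) {..<n}" "disjoint_family_on (\<lambda>i. rng H ` F i) {..<n}"
    using f unfolding open_pseudogroup_def by blast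
  note gD = full_groupD[OF g] and gb = bisectionD[OF full_groupD(1)[OF g]]
  have "disjoint_family_on (\<lambda>i. src H ` set_mult H g (F i)) {..<n}"
    using F(2,3) translate_src(1)[OF g nice_basic(2)] by (simp add: disjoint_family_on_def)
  moreover have "disjoint_family_on (\<lambda>i. rng H ` set_mult H g (F i)) {..<n}"
    unfolding disjoint_family_on_def
  proof (intro ballI impI, rule ccontr)
    fix i j assume ij: "i \<in> {..<n}" "j \<in> {..<n}" "i \<noteq> j"
      "rng H ` set_mult H g (F i) \<inter> rng H ` set_mult H g (F j) \<noteq> {}"
    then obtain x y where xy: "x \<in> set_mult H g (F i)" "y \<in> set_mult H g (F j)" "rng H x = rng H y" by blast
    then obtain a b a' b' where ab: "a \<in> g" "b \<in> F i" "(a, b) \<in> composable H" "x = mult H a b"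
      "a' \<in> g" "b' \<in> F j" "(a', b') \<in> composable H" "y = mult H a' b'" unfolding set_mult_def by blast
    then have "rng H a = rng H a'" using xy rng_mult by metis
    then have "a = a'" using ab gb(4) by (meson inj_onD)
    then have "rng H b = rng H b'" using ab by (simp add: composable_def)
    then show False using F(4) ij ab unfolding disjoint_family_on_def by (metis IntI empty_iff imageI)
  qed
  moreover have "set_mult H g f = (\<Union>i<n. set_mult H g (F i))" unfolding F(1) set_mult_def by blast
  ultimately show ?thesis
    unfolding open_pseudogroup_def using nice_translate[OF g F(2)] by blast
qed

end

context pmp_etale begin

text \<open>Along a countable cover by bisections \<open>f\<close> splits into pieces
  \<open>E n\<close>; finitely many carry most of the mass, and each contains a compact piece with
  sources \<open>C n\<close>. The sources of these compact pieces are disjoint, and so are their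
  ranges, so both can be thickened to disjoint open sets inside the bisections.\<close>

lemma approx_open_pseudogroup:
  assumes f: "f \<in> FP" and "e > 0"
  obtains f' where "f' \<in> open_pseudogroup"
    "measure \<nu> (src H ` (f - f')) + measure \<nu> (src H ` (f' - f)) < e"
proof -
  obtain B :: "nat \<Rightarrow> 'a set" where B: "\<And>n. bisection H T (B n)" "(\<Union>n. B n) = arr H"
    using countable_bisections by blast
  note b = bisectionD[OF B(1)]
  have fs: "f \<in> sets (borel_of T)" "inj_on (src H) f" "inj_on (rng H) f" using f full_pseudogroup_iff by auto
  have fa: "f \<subseteq> arr H" using sets.sets_into_space[OF fs(1)] topspace_T by simp
  define E where "E n = f \<inter> disjointed B n" for n
  have Es: "E n \<in> sets (borel_of T)" for n
    unfolding E_def using fs(1) sets.range_disjointed_sets[of B "borel_of T"] openin_borel_of[OF b(1)] by auto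
  have EB: "E n \<subseteq> B n" "E n \<subseteq> f" for n using disjointed_subset[of B n] by (auto simp: E_def)
  have Ef: "(\<Union>n. E n) = f" using UN_disjointed_eq[of B] B(2) fa by (auto simp: E_def)
  have Edisj: "n = m" if "h \<in> E n" "h \<in> E m" for n m h
    using that disjoint_family_disjointed[of B] unfolding E_def disjoint_family_on_def by (metis IntD2 IntI UNIV_I empty_iff)
  have sE: "src H ` E n \<in> sets \<nu>" for n by (rule src_sets[OF Es])
  have lim: "(\<lambda>N. measure \<nu> (\<Union>n<N. src H ` E n)) \<longlonglongrightarrow> measure \<nu> (\<Union>N. \<Union>n<N. src H ` E n)"
    by (rule \<nu>.finite_Lim_measure_incseq) (use sE in \<open>fastforce simp: incseq_def\<close>)+
  have "(\<Union>N. \<Union>n<N. src H ` E n) = src H ` f" using Ef by blast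
  with lim have "eventually (\<lambda>N. measure \<nu> (\<Union>n<N. src H ` E n) > measure \<nu> (src H ` f) - e/3) sequentially"
    using \<open>e > 0\<close> by (intro order_tendstoD(1)) auto
  then obtain N where N: "measure \<nu> (\<Union>n<N. src H ` E n) > measure \<nu> (src H ` f) - e/3"
    by (auto simp: eventually_sequentially)
  \<comment> \<open>The error \<open>e\<close> is shared by three parts: the pieces beyond
    \<open>N\<close>, the closed sets \<open>C n\<close> inside the sources, and the open sets
    \<open>V n\<close> around them. The last two occur once for each of the \<open>N\<close>
    pieces.\<close>
  define e' where "e' = e / (3 * (real N + 1))"
  have e': "e' > 0" "real N * e' \<le> e/3"
  proof -
    show "e' > 0" using \<open>e > 0\<close> by (simp add: e'_def)
    have "real N * e' = (e / 3) * (real N / (real N + 1))" by (simp add: e'_def)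
    also have "\<dots> \<le> (e / 3) * 1" using \<open>e > 0\<close> by (intro mult_left_mono) auto
    finally show "real N * e' \<le> e/3" by simp
  qed
  have "\<exists>C. closedin X C \<and> C \<subseteq> src H ` E n \<and> measure \<nu> (src H ` E n - C) < e'" for n
  proof -
    obtain C U where CU: "closedin X C" "openin X U" "C \<subseteq> src H ` E n" "src H ` E n \<subseteq> U" "measure \<nu> (U - C) < e'"
      using X.regular_approx[OF \<nu>.finite_measure_axioms sets_\<nu> sE e'(1)] by metis
    have "measure \<nu> (src H ` E n - C) \<le> measure \<nu> (U - C)"
      by (rule \<nu>.finite_measure_mono) (use CU open_\<nu> closed_\<nu> in auto)
    then show ?thesis using CU by (intro exI[of _ C]) auto
  qed
  then obtain C where C: "\<And>n. closedin X (C n)" "\<And>n. C n \<subseteq> src H ` E n"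
     "\<And>n. measure \<nu> (src H ` E n - C n) < e'" by metis
  \<comment> \<open>Injectivity of the source map on \<open>B n\<close> or on \<open>f\<close>
    identifies the arrow with one of \<open>E n\<close>.\<close>
  have CE: "h \<in> E n" if h: "h \<in> B n \<or> h \<in> f" "src H h \<in> C n" for h n
  proof -
    obtain h' where "h' \<in> E n" "src H h = src H h'" using h(2) C(2) by blast
    then have "h = h'" using h(1) EB b(3) fs(2) by (metis inj_onD subsetD)
    then show ?thesis using \<open>h' \<in> E n\<close> by simp
  qed
  define D where "D n = rng H ` {h \<in> B n. src H h \<in> C n}" for n
  have CB: "C n \<subseteq> src H ` B n" for n using C(2) EB(1) by blast
  have "compactin X (D n)" for n
    unfolding D_def by (rule image_compactin[OF compactin_src_lift[OF B(1) C(1) CB] continuous_rng_X])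
  then have D: "closedin X (D n)" for n using X.compactin_iff_closedin by blast
  have Cdisj: "disjoint_family_on C {..<N}"
    unfolding disjoint_family_on_def
  proof (intro ballI impI, rule ccontr)
    fix n m assume nm: "n \<noteq> m" "C n \<inter> C m \<noteq> {}"
    then obtain h where "h \<in> E n" "src H h \<in> C m" using C(2) by blast
    then show False using CE[of h m] EB Edisj nm(1) by blast
  qed
  have Ddisj: "disjoint_family_on D {..<N}"
    unfolding disjoint_family_on_def
  proof (intro ballI impI, rule ccontr)
    fix n m assume nm: "n \<noteq> m" "D n \<inter> D m \<noteq> {}"
    then obtain h k where hk: "h \<in> B n" "src H h \<in> C n" "k \<in> B m" "src H k \<in> C m" "rng H h = rng H k"
      unfolding D_def by blast
    then have "h \<in> E n" "k \<in> E m" using CE by blast+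
    moreover from this have "h = k" using EB(2) fs(3) hk(5) by (meson inj_onD subsetD)
    ultimately show False using Edisj nm(1) by blast
  qed
  obtain O1 where O1: "\<And>i. i < N \<Longrightarrow> openin X (O1 i)" "\<And>i. i < N \<Longrightarrow> C i \<subseteq> O1 i" "disjoint_family_on O1 {..<N}"
    using X.disjoint_open_nbhds[of N C] C(1) Cdisj by metis
  obtain O2 where O2: "\<And>i. i < N \<Longrightarrow> openin X (O2 i)" "\<And>i. i < N \<Longrightarrow> D i \<subseteq> O2 i" "disjoint_family_on O2 {..<N}"
    using X.disjoint_open_nbhds[of N D] D Ddisj by metis
  \<comment> \<open>Sources in \<open>O1 n\<close> whose arrow in \<open>B n\<close> ends in
    \<open>O2 n\<close>: shrinking into \<open>W n\<close> keeps the sources and the ranges of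
    different pieces apart at once.\<close>
  define W where "W n = O1 n \<inter> src H ` {h \<in> B n. rng H h \<in> O2 n}" for n
  have "\<exists>V. openin X V \<and> C n \<subseteq> V \<and> X closure_of V \<subseteq> W n \<and> measure \<nu> (X frontier_of V) = 0 \<and> measure \<nu> (V - C n) < e'"
    if n: "n < N" for n
  proof -
    have "openin T {h \<in> topspace T. rng H h \<in> O2 n}" by (rule openin_continuous_map_preimage[OF continuous_rng_X O2(1)[OF n]])
    then have "openin T (B n \<inter> {h \<in> topspace T. rng H h \<in> O2 n})" using b(1) by auto
    also have "B n \<inter> {h \<in> topspace T. rng H h \<in> O2 n} = {h \<in> B n. rng H h \<in> O2 n}" using b(2) topspace_T by auto
    finally have "openin X (W n)" unfolding W_def using O1(1)[OF n] open_map_src by auto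
    moreover have "C n \<subseteq> W n"
    proof
      fix x assume x: "x \<in> C n"
      then obtain h where h: "h \<in> B n" "x = src H h" using CB by blast
      then have "rng H h \<in> O2 n" using x O2(2)[OF n] by (auto simp: D_def)
      then show "x \<in> W n" using h x O1(2)[OF n] by (auto simp: W_def)
    qed
    ultimately show ?thesis
      using X.open_nbhd_small[OF C(1) _ _ \<nu>.finite_measure_axioms sets_\<nu> e'(1)] by metis
  qed
  then obtain V where V: "\<And>n. n < N \<Longrightarrow> openin X (V n)" "\<And>n. n < N \<Longrightarrow> C n \<subseteq> V n"
    "\<And>n. n < N \<Longrightarrow> X closure_of V n \<subseteq> W n" "\<And>n. n < N \<Longrightarrow> measure \<nu> (X frontier_of V n) = 0"
    "\<And>n. n < N \<Longrightarrow> measure \<nu> (V n - C n) < e'" by metis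
  have VW: "V n \<subseteq> W n" if "n < N" for n
    using V(3)[OF that] closure_of_subset[OF openin_subset[OF V(1)[OF that]]] by blast
  define F where "F n = {h \<in> B n. src H h \<in> V n}" for n
  define f' where "f' = (\<Union>n<N. F n)"
  have nF: "nice (F n)" if "n < N" for n
    unfolding nice_def F_def
    by (rule exI[of _ "B n"], rule exI[of _ "V n"]) (use V[OF that] B(1) in \<open>auto simp: W_def\<close>)
  have F1: "src H ` F n \<subseteq> O1 n" if "n < N" for n using VW[OF that] by (auto simp: F_def W_def)
  have F2: "rng H ` F n \<subseteq> O2 n" if n: "n < N" for n
  proof
    fix y assume "y \<in> rng H ` F n"
    then obtain h where h: "h \<in> B n" "src H h \<in> V n" "y = rng H h" by (auto simp: F_def)
    then obtain h' where "h' \<in> B n" "rng H h' \<in> O2 n" "src H h = src H h'" using VW[OF n] by (auto simp: W_def)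
    then show "y \<in> O2 n" using h b(3) by (metis inj_onD)
  qed
  have "disjoint_family_on (\<lambda>i. src H ` F i) {..<N}" "disjoint_family_on (\<lambda>i. rng H ` F i) {..<N}"
    using F1 F2 O1(3) O2(3) unfolding disjoint_family_on_def by (metis (no_types) disjoint_iff lessThan_iff subsetD)+
  then have f': "f' \<in> open_pseudogroup" unfolding open_pseudogroup_def f'_def using nF by blast
  have f'f: "src H ` (f' - f) \<subseteq> (\<Union>n<N. V n - C n)"
  proof
    fix x assume "x \<in> src H ` (f' - f)"
    then obtain h n where h: "n < N" "h \<in> B n" "src H h \<in> V n" "h \<notin> f" "x = src H h" by (auto simp: f'_def F_def)
    then have "src H h \<notin> C n" using CE EB(2) by blast
    then show "x \<in> (\<Union>n<N. V n - C n)" using h by blast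
  qed
  have ff': "src H ` (f - f') \<subseteq> (src H ` f - (\<Union>n<N. src H ` E n)) \<union> (\<Union>n<N. src H ` E n - C n)"
  proof
    fix x assume "x \<in> src H ` (f - f')"
    then obtain h where h: "h \<in> f" "h \<notin> f'" "x = src H h" by auto
    show "x \<in> (src H ` f - (\<Union>n<N. src H ` E n)) \<union> (\<Union>n<N. src H ` E n - C n)"
    proof (cases "x \<in> (\<Union>n<N. src H ` E n)")
      case True
      then obtain n where n: "n < N" "x \<in> src H ` E n" by blast
      have "x \<notin> C n"
      proof
        assume x: "x \<in> C n"
        then have "h \<in> E n" using CE h by blast
        then have "h \<in> F n" using x V(2)[OF n(1)] EB(1) h by (auto simp: F_def)
        then show False using h(2) n(1) by (auto simp: f'_def)
      qed
      then show ?thesis using n by blast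
    qed (use h in auto)
  qed
  have Cs: "C n \<in> sets \<nu>" for n using C(1) by (rule closed_\<nu>)
  have "measure \<nu> (src H ` (f' - f)) \<le> measure \<nu> (\<Union>n<N. V n - C n)"
    by (rule \<nu>.finite_measure_mono[OF f'f]) (use V(1) open_\<nu> Cs in auto)
  also have "\<dots> \<le> (\<Sum>n<N. measure \<nu> (V n - C n))"
    by (rule \<nu>.finite_measure_subadditive_finite) (use V(1) open_\<nu> Cs in auto)
  also have "\<dots> \<le> (\<Sum>n<N. e')" by (rule sum_mono) (use V(5) in \<open>auto intro: less_imp_le\<close>)
  finally have 1: "measure \<nu> (src H ` (f' - f)) \<le> e/3" using e'(2) by simp
  have "measure \<nu> (\<Union>n<N. src H ` E n - C n) \<le> (\<Sum>n<N. measure \<nu> (src H ` E n - C n))"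
    by (rule \<nu>.finite_measure_subadditive_finite) (use sE Cs in auto)
  also have "\<dots> \<le> (\<Sum>n<N. e')" by (rule sum_mono) (use C(3) in \<open>auto intro: less_imp_le\<close>)
  finally have 2: "measure \<nu> (\<Union>n<N. src H ` E n - C n) \<le> e/3" using e'(2) by simp
  have 3: "measure \<nu> (src H ` f - (\<Union>n<N. src H ` E n)) < e/3"
    by (subst \<nu>.finite_measure_Diff) (use N sE src_sets[OF fs(1)] EB(2) in auto)
  have "measure \<nu> (src H ` (f - f')) \<le> measure \<nu> ((src H ` f - (\<Union>n<N. src H ` E n)) \<union> (\<Union>n<N. src H ` E n - C n))"
    by (rule \<nu>.finite_measure_mono[OF ff']) (use sE Cs src_sets[OF fs(1)] in auto)
  also have "\<dots> \<le> measure \<nu> (src H ` f - (\<Union>n<N. src H ` E n)) + measure \<nu> (\<Union>n<N. src H ` E n - C n)"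
    by (rule measure_Un_le) (use sE Cs src_sets[OF fs(1)] in auto)
  finally show ?thesis using that[OF f'] 1 2 3 by simp
qed

end

section \<open>Class-bijective factor maps\<close>

locale factor = H: pmp_etale H TH \<nu> + G: etale_compact G TG
  for H :: "('h, 'm) gpd_scheme" and TH \<nu> and G :: "('g, 'n) gpd_scheme" and TG +
  fixes \<pi> :: "'g \<Rightarrow> 'h"
  assumes cb: "class_bijective_factor G H \<pi>" and \<pi>_cont: "continuous_map TG TH \<pi>"
begin

abbreviation "fp \<equiv> full_pseudogroup H (borel_of TH)"

abbreviation "mv \<equiv> act G H \<pi>"

abbreviation "mvs \<equiv> act_set G H \<pi>"

abbreviation "fg \<equiv> full_group_top H TH"

abbreviation "alg \<P> F \<equiv> sigma_sets (units G) (partition_act G H \<pi> \<P> F)"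

lemma \<pi>_arr: "g \<in> arr G \<Longrightarrow> \<pi> g \<in> arr H" and \<pi>_units: "g \<in> units G \<Longrightarrow> \<pi> g \<in> units H"
  using cb by (auto simp: class_bijective_factor_def groupoid_morphism_def)

lemma \<pi>_mult:
  assumes "(f, g) \<in> composable G"
  shows "(\<pi> f, \<pi> g) \<in> composable H" "\<pi> (mult G f g) = mult H (\<pi> f) (\<pi> g)"
  using cb assms unfolding class_bijective_factor_def groupoid_morphism_def by blast+

lemma \<pi>_ginv: "g \<in> arr G \<Longrightarrow> \<pi> (ginv G g) = ginv H (\<pi> g)"
  using cb by (auto simp: class_bijective_factor_def groupoid_morphism_def)

lemma units_arrG: "u \<in> units G \<Longrightarrow> u \<in> arr G"
  using G.units_arr by blast

lemma \<pi>_src: assumes g: "g \<in> arr G" shows "\<pi> (src G g) = src H (\<pi> g)"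
proof -
  have u: "src G g \<in> units G" using g by simp
  then have "(g, src G g) \<in> composable G"
    using g G.unit_rng units_arrG by (auto simp: composable_def)
  then have "src H (\<pi> g) = rng H (\<pi> (src G g))" using \<pi>_mult(1) by (auto simp: composable_def)
  then show ?thesis using H.unit_rng[OF \<pi>_units[OF u]] by simp
qed

lemma \<pi>_rng: assumes g: "g \<in> arr G" shows "\<pi> (rng G g) = rng H (\<pi> g)"
proof -
  have u: "rng G g \<in> units G" using g by simp
  then have "(rng G g, g) \<in> composable G"
    using g G.unit_src units_arrG by (auto simp: composable_def)
  then have "src H (\<pi> (rng G g)) = rng H (\<pi> g)" using \<pi>_mult(1) by (auto simp: composable_def)
  then show ?thesis using H.unit_src[OF \<pi>_units[OF u]] by simp
qed

lemma lift_src: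
  assumes "x \<in> units G" "h \<in> arr H" "src H h = \<pi> x"
  obtains g where "g \<in> arr G" "src G g = x" "\<pi> g = h"
proof -
  have "bij_betw \<pi> {g \<in> arr G. src G g = x} {h \<in> arr H. src H h = \<pi> x}"
    using cb assms by (auto simp: class_bijective_factor_def)
  then have "h \<in> \<pi> ` {g \<in> arr G. src G g = x}" using assms unfolding bij_betw_def by blast
  then show ?thesis using that by blast
qed

lemma \<pi>_inj_src:
  assumes "g \<in> arr G" "g' \<in> arr G" "src G g = src G g'" "\<pi> g = \<pi> g'" shows "g = g'"
proof -
  have "inj_on \<pi> {k \<in> arr G. src G k = src G g}"
    using cb assms(1) by (auto simp: class_bijective_factor_def bij_betw_def)
  then show ?thesis using assms by (auto dest: inj_onD)
qed

lemma \<pi>_inj_rng: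
  assumes "g \<in> arr G" "g' \<in> arr G" "rng G g = rng G g'" "\<pi> g = \<pi> g'" shows "g = g'"
proof -
  have "inj_on \<pi> {k \<in> arr G. rng G k = rng G g}"
    using cb assms(1) by (auto simp: class_bijective_factor_def bij_betw_def)
  then show ?thesis using assms by (auto dest: inj_onD)
qed

definition lift :: "'h set \<Rightarrow> 'g set" where "lift f = {g \<in> arr G. \<pi> g \<in> f}"

lemma lift_preimage: "lift f = {g \<in> topspace TG. \<pi> g \<in> f}"
  by (simp add: lift_def G.topspace_T)

lemma lift_open: "openin TH f \<Longrightarrow> openin TG (lift f)"
  unfolding lift_preimage by (rule openin_continuous_map_preimage[OF \<pi>_cont])

lemma lift_borel:
  assumes "f \<in> sets (borel_of TH)" shows "lift f \<in> sets (borel_of TG)"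
proof -
  have "\<pi> -` f \<inter> space (borel_of TG) \<in> sets (borel_of TG)"
    by (rule measurable_sets[OF borel_of_measurable[OF \<pi>_cont] assms])
  moreover have "\<pi> -` f \<inter> space (borel_of TG) = lift f" by (auto simp: lift_preimage)
  ultimately show ?thesis by simp
qed

lemma lift_inj_src: assumes "inj_on (src H) f" shows "inj_on (src G) (lift f)"
proof (rule inj_onI)
  fix g g' assume g: "g \<in> lift f" "g' \<in> lift f" "src G g = src G g'"
  then have a: "g \<in> arr G" "g' \<in> arr G" "\<pi> g \<in> f" "\<pi> g' \<in> f" by (auto simp: lift_def)
  have "src H (\<pi> g) = src H (\<pi> g')" using \<pi>_src[OF a(1)] \<pi>_src[OF a(2)] g(3) by simp
  then have "\<pi> g = \<pi> g'" by (rule inj_onD[OF assms]) (use a in auto)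
  then show "g = g'" using \<pi>_inj_src a g(3) by blast
qed

lemma lift_inj_rng: assumes "inj_on (rng H) f" shows "inj_on (rng G) (lift f)"
proof (rule inj_onI)
  fix g g' assume g: "g \<in> lift f" "g' \<in> lift f" "rng G g = rng G g'"
  then have a: "g \<in> arr G" "g' \<in> arr G" "\<pi> g \<in> f" "\<pi> g' \<in> f" by (auto simp: lift_def)
  have "rng H (\<pi> g) = rng H (\<pi> g')" using \<pi>_rng[OF a(1)] \<pi>_rng[OF a(2)] g(3) by simp
  then have "\<pi> g = \<pi> g'" by (rule inj_onD[OF assms]) (use a in auto)
  then show "g = g'" using \<pi>_inj_rng a g(3) by blast
qed

text \<open>The action as a relation: inverses become converses and products become
  compositions.\<close>

definition moves :: "'h set \<Rightarrow> 'g \<Rightarrow> 'g \<Rightarrow> bool" where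
  "moves f x y \<longleftrightarrow> (\<exists>g\<in>lift f. src G g = x \<and> rng G g = y)"

lemma moves_units: assumes "moves f x y" shows "x \<in> units G" "y \<in> units G"
  using assms by (auto simp: moves_def lift_def)

lemma moves_\<pi>: assumes "moves f x y" shows "\<pi> x \<in> src H ` f" "\<pi> y \<in> rng H ` f"
  using assms \<pi>_src \<pi>_rng by (auto simp: moves_def lift_def)

lemma moves_fun: "inj_on (src H) f \<Longrightarrow> moves f x y \<Longrightarrow> moves f x y' \<Longrightarrow> y = y'"
  using inj_onD[OF lift_inj_src] unfolding moves_def by metis

lemma moves_inj: "inj_on (rng H) f \<Longrightarrow> moves f x y \<Longrightarrow> moves f x' y \<Longrightarrow> x = x'"
  using inj_onD[OF lift_inj_rng] unfolding moves_def by metis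

lemma moves_dom:
  assumes "f \<subseteq> arr H" "x \<in> units G" "\<pi> x \<in> src H ` f" obtains y where "moves f x y"
proof -
  obtain h where h: "h \<in> f" "src H h = \<pi> x" using assms(3) by auto
  then obtain g where "g \<in> arr G" "src G g = x" "\<pi> g = h" using lift_src assms by blast
  then show ?thesis using that[of "rng G g"] h by (auto simp: moves_def lift_def)
qed

lemma moves_finv:
  assumes f: "f \<subseteq> arr H" shows "moves (H.finv f) y x \<longleftrightarrow> moves f x y"
proof -
  have *: "moves (H.finv f) y x" if f: "f \<subseteq> arr H" and m: "moves f x y" for f x y
  proof -
    obtain g where g: "g \<in> arr G" "\<pi> g \<in> f" "src G g = x" "rng G g = y"
      using m by (auto simp: moves_def lift_def)
    note i = G.ginv_props[OF g(1)]
    have "\<pi> (ginv G g) \<in> H.finv f" unfolding H.finv_def using \<pi>_ginv[OF g(1)] g(2) by auto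
    then show ?thesis using i g unfolding moves_def lift_def by (intro bexI[of _ "ginv G g"]) auto
  qed
  show ?thesis using *[OF f] *[OF H.finv_images(1)[OF f]] H.finv_finv[OF f] by metis
qed

text \<open>A factorisation of \<open>\<pi> k\<close> is lifted one factor after the other, starting
  at the source \<open>x\<close>. The product of the lifts is \<open>k\<close>, since
  \<open>\<pi>\<close> is injective on arrows with a given source.\<close>

lemma moves_mult:
  assumes f: "f \<subseteq> arr H" "g \<subseteq> arr H"
  shows "moves (set_mult H f g) x z \<longleftrightarrow> (\<exists>y. moves g x y \<and> moves f y z)"
proof
  assume "moves (set_mult H f g) x z"
  then obtain k where k: "k \<in> arr G" "\<pi> k \<in> set_mult H f g" "src G k = x" "rng G k = z"
    by (auto simp: moves_def lift_def)
  then obtain a b where ab: "a \<in> f" "b \<in> g" "(a, b) \<in> composable H" "\<pi> k = mult H a b"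
    unfolding set_mult_def by blast
  have x: "x \<in> units G" using k by auto
  have "src H b = \<pi> x" using H.src_mult[OF ab(3)] ab(4) \<pi>_src[OF k(1)] k(3) by simp
  then obtain b' where b': "b' \<in> arr G" "src G b' = x" "\<pi> b' = b" using lift_src[OF x] ab f by blast
  have "src H a = \<pi> (rng G b')" using ab(3) \<pi>_rng[OF b'(1)] b' by (simp add: composable_def)
  then obtain a' where a': "a' \<in> arr G" "src G a' = rng G b'" "\<pi> a' = a"
    using lift_src[of "rng G b'" a] ab f b' by auto
  have c: "(a', b') \<in> composable G" using a' b' by (simp add: composable_def)
  have "mult G a' b' = k"
    by (rule \<pi>_inj_src) (use G.mult_arr[OF c] G.src_mult[OF c] \<pi>_mult[OF c] a' b' k ab in auto)
  then have "rng G a' = z" using G.rng_mult[OF c] k by simp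
  then show "\<exists>y. moves g x y \<and> moves f y z"
    using a' b' ab unfolding moves_def lift_def by (intro exI[of _ "rng G b'"]) auto
next
  assume "\<exists>y. moves g x y \<and> moves f y z"
  then obtain a b where ab: "a \<in> arr G" "b \<in> arr G" "\<pi> a \<in> f" "\<pi> b \<in> g" "src G b = x" "rng G b = src G a" "rng G a = z"
    unfolding moves_def lift_def by auto
  have c: "(a, b) \<in> composable G" using ab by (simp add: composable_def)
  have "\<pi> (mult G a b) \<in> set_mult H f g" unfolding set_mult_def using \<pi>_mult[OF c] ab by auto
  then show "moves (set_mult H f g) x z"
    unfolding moves_def lift_def using G.mult_arr[OF c] G.src_mult[OF c] G.rng_mult[OF c] ab
    by (intro bexI[of _ "mult G a b"]) auto
qed

lemma act_iff:
  assumes f: "f \<subseteq> arr H" "inj_on (src H) f" and x: "x \<in> units G"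
  shows "mv f x = Some y \<longleftrightarrow> moves f x y" "mv f x = None \<longleftrightarrow> \<pi> x \<notin> src H ` f"
proof -
  show "mv f x = None \<longleftrightarrow> \<pi> x \<notin> src H ` f" by (simp add: act_def)
  show "mv f x = Some y \<longleftrightarrow> moves f x y"
  proof (cases "\<pi> x \<in> src H ` f")
    case True
    then obtain z where "moves f x z" using moves_dom f x by blast
    then obtain g where g: "g \<in> arr G \<and> \<pi> g \<in> f \<and> src G g = x" by (auto simp: moves_def lift_def)
    have "(THE g. g \<in> arr G \<and> \<pi> g \<in> f \<and> src G g = x) = g"
    proof (rule the_equality)
      show "g \<in> arr G \<and> \<pi> g \<in> f \<and> src G g = x" by (rule g)
      fix g' assume "g' \<in> arr G \<and> \<pi> g' \<in> f \<and> src G g' = x"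
      then show "g' = g" using g inj_onD[OF lift_inj_src[OF f(2)], of g' g] by (auto simp: lift_def)
    qed
    then have "mv f x = Some (rng G g)" using True by (simp add: act_def)
    moreover have "moves f x (rng G g)" using g by (auto simp: moves_def lift_def)
    ultimately show ?thesis using moves_fun[OF f(2)] by auto
  next
    case False
    then show ?thesis using moves_\<pi>(1)[of f x y] by (auto simp: act_def)
  qed
qed

lemma act_set_eq:
  assumes f: "f \<subseteq> arr H" "inj_on (src H) f" and P: "P \<subseteq> units G"
  shows "mvs f P = {y. \<exists>x\<in>P. moves f x y}"
    "mvs f P = rng G ` {g \<in> lift f. src G g \<in> P}"
proof -
  show e: "mvs f P = {y. \<exists>x\<in>P. moves f x y}"
    using act_iff(1)[OF f] P unfolding act_set_def by blast
  show "mvs f P = rng G ` {g \<in> lift f. src G g \<in> P}"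
    unfolding e moves_def by auto
qed

lemma act_set_units: "P \<subseteq> units G \<Longrightarrow> mvs (units H) P = P"
proof -
  assume P: "P \<subseteq> units G"
  have i: "inj_on (src H) (units H)" using H.unit_src by (simp add: inj_on_def)
  have u: "moves (units H) x x" if "x \<in> units G" for x
    unfolding moves_def lift_def
    using that \<pi>_units[OF that] units_arrG[OF that] G.unit_src[OF that] G.unit_rng[OF that] by (intro bexI[of _ x]) auto
  have "moves (units H) x y \<longleftrightarrow> x = y" if "x \<in> units G" for x y
    using u[OF that] moves_fun[OF i] by blast
  then have "{y. \<exists>x\<in>P. moves (units H) x y} = P" using P by (auto simp: subset_iff)
  then show ?thesis unfolding act_set_eq(1)[OF H.units_arr i P] .
qed

lemma units_full_pseudogroup: "units H \<in> fp"
  using H.units_borel H.unit_src H.unit_rng unfolding H.full_pseudogroup_iff by (simp add: inj_on_def)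

lemma fpD:
  assumes "f \<in> fp"
  shows "f \<in> sets (borel_of TH)" "f \<subseteq> arr H" "inj_on (src H) f" "inj_on (rng H) f"
  using assms sets.sets_into_space[of f "borel_of TH"] H.topspace_T by (auto simp: H.full_pseudogroup_iff)

lemma act_set_borel:
  assumes f: "f \<in> fp" and P: "P \<in> sets (borel_of G.X)"
  shows "mvs f P \<in> sets (borel_of G.X)" "{g \<in> lift f. src G g \<in> P} \<in> sets (borel_of TG)"
proof -
  have "src G -` P \<inter> space (borel_of TG) \<in> sets (borel_of TG)"
    by (rule measurable_sets[OF borel_of_measurable[OF G.continuous_src_X] P])
  then have "lift f \<inter> (src G -` P \<inter> space (borel_of TG)) \<in> sets (borel_of TG)"
    using lift_borel[OF fpD(1)[OF f]] by auto
  also have "lift f \<inter> (src G -` P \<inter> space (borel_of TG)) = {g \<in> lift f. src G g \<in> P}"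
    by (auto simp: lift_preimage)
  finally show *: "{g \<in> lift f. src G g \<in> P} \<in> sets (borel_of TG)" .
  have "P \<subseteq> units G" using sets.sets_into_space[OF P] unfolding space_borel_of G.topspace_X .
  then show "mvs f P \<in> sets (borel_of G.X)"
    using G.image_borel[OF *, of "rng G"] act_set_eq(2)[OF fpD(2,3)[OF f]] by simp
qed

text \<open>The set is the source image of an open set of arrows, and the source map is
  open.\<close>

lemma open_preimage:
  assumes f: "openin TH f" and N: "openin G.X N"
  shows "openin G.X {x. \<exists>y\<in>N. moves f x y}"
proof -
  have "openin TG {g \<in> topspace TG. rng G g \<in> N}" by (rule openin_continuous_map_preimage[OF G.continuous_rng_X N])
  then have "openin TG (lift f \<inter> {g \<in> topspace TG. rng G g \<in> N})" using lift_open[OF f] by auto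
  then have "openin G.X (src G ` (lift f \<inter> {g \<in> topspace TG. rng G g \<in> N}))" by (rule G.open_map_src)
  also have "src G ` (lift f \<inter> {g \<in> topspace TG. rng G g \<in> N}) = {x. \<exists>y\<in>N. moves f x y}"
    by (auto simp: moves_def lift_preimage)
  finally show ?thesis .
qed

lemma \<pi>_contX: "continuous_map G.X H.X \<pi>"
  using continuous_map_from_subtopology[OF \<pi>_cont] \<pi>_units unfolding continuous_map_in_subtopology
  by (auto simp: G.topspace_T)

text \<open>For elements of the topological full group the action is defined at every unit, so
  \<open>the\<close> is harmless.\<close>

definition gact :: "'h set \<Rightarrow> 'g \<Rightarrow> 'g" where "gact g x = the (mv g x)"

lemma gact:
  assumes g: "g \<in> fg" and x: "x \<in> units G"
  shows "mv g x = Some (gact g x)" "moves g x (gact g x)" "gact g x \<in> units G"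
proof -
  note gD = H.full_groupD[OF g] and b = H.bisectionD[OF H.full_groupD(1)[OF g]]
  have "\<pi> x \<in> src H ` g" using \<pi>_units[OF x] by (simp only: gD(3))
  then have "mv g x \<noteq> None" using act_iff(2)[OF gD(2) b(3) x] by simp
  then show "mv g x = Some (gact g x)" by (auto simp: gact_def)
  then show "moves g x (gact g x)" using act_iff(1)[OF gD(2) b(3) x] by simp
  then show "gact g x \<in> units G" by (rule moves_units)
qed

lemma gact_cont: assumes g: "g \<in> fg" shows "continuous_map G.X G.X (gact g)"
  unfolding continuous_map_def
proof (intro conjI allI impI)
  show "gact g \<in> topspace G.X \<rightarrow> topspace G.X" unfolding G.topspace_X using gact(3)[OF g] by blast
  fix U assume U: "openin G.X U"
  note b = H.bisectionD[OF H.full_groupD(1)[OF g]]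
  have "{x \<in> topspace G.X. gact g x \<in> U} = {x. \<exists>y\<in>U. moves g x y}"
    unfolding G.topspace_X using gact[OF g] moves_fun[OF b(3)] moves_units by blast
  then show "openin G.X {x \<in> topspace G.X. gact g x \<in> U}" using open_preimage[OF b(1) U] by simp
qed

end

section \<open>Partial permutations and counting\<close>

lemma fin_pseudogroupD:
  assumes "s \<in> fin_pseudogroup d"
  shows "s \<subseteq> {1..d} \<times> {1..d}" "(i, j) \<in> s \<Longrightarrow> (i', j) \<in> s \<Longrightarrow> i = i'"
    "(i, j) \<in> s \<Longrightarrow> (i, j') \<in> s \<Longrightarrow> j = j'" "finite s"
proof -
  show s: "s \<subseteq> {1..d} \<times> {1..d}" and
    i: "(i, j) \<in> s \<Longrightarrow> (i', j) \<in> s \<Longrightarrow> i = i'" "(i, j) \<in> s \<Longrightarrow> (i, j') \<in> s \<Longrightarrow> j = j'"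
    using assms unfolding fin_pseudogroup_def full_pseudogroup_def borel_iso_on_def pair_gpd_def
    by (auto simp: inj_on_def)
  show "finite s" by (rule finite_subset[OF s]) simp
qed

lemma fin_act_iff:
  assumes "s \<in> fin_pseudogroup d"
  shows "fin_act s j = Some i \<longleftrightarrow> (i, j) \<in> s" "fin_act s j = None \<longleftrightarrow> (\<forall>i. (i, j) \<notin> s)"
proof -
  have "(THE i. (i, j) \<in> s) = i" if "(i, j) \<in> s" for i
    using that fin_pseudogroupD(2)[OF assms] by (intro the_equality)
  then show "fin_act s j = Some i \<longleftrightarrow> (i, j) \<in> s" "fin_act s j = None \<longleftrightarrow> (\<forall>i. (i, j) \<notin> s)"
    by (auto simp: fin_act_def)
qed

abbreviation "pmult d \<equiv> set_mult (pair_gpd d)"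

lemma fin_mult_iff:
  assumes "s \<in> fin_pseudogroup d" "t \<in> fin_pseudogroup d"
  shows "(i, k) \<in> pmult d s t \<longleftrightarrow> (\<exists>j. (i, j) \<in> s \<and> (j, k) \<in> t)"
  using fin_pseudogroupD(1)[OF assms(1)] fin_pseudogroupD(1)[OF assms(2)]
  unfolding set_mult_def composable_def pair_gpd_def by fastforce

lemma normcard_less:
  assumes "normcard d A < e" "finite A" "0 < d" "B \<subseteq> A"
  shows "real (card B) \<le> e * d"
proof -
  have "real (card B) \<le> real (card A)" using assms card_mono by auto
  then show ?thesis using assms by (simp add: normcard_def field_simps)
qed

lemma card_le_inj:
  assumes "inj_on \<phi> A" "\<phi> ` A \<subseteq> B" "finite B" "real (card B) \<le> r"
  shows "real (card A) \<le> r"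
  using card_inj_on_le[OF assms(1-3)] assms(4) by linarith

lemma card_Un_real: "real (card (A \<union> B)) \<le> real (card A) + real (card B)"
  using card_Un_le[of A B] by linarith

lemma card_le_Un:
  assumes "A \<subseteq> B \<union> C" "finite B" "finite C"
  shows "real (card A) \<le> real (card B) + real (card C)"
  using card_mono[of "B \<union> C" A] card_Un_le[of B C] assms by simp

text \<open>Chebyshev's inequality for the mean square distance.\<close>

lemma dist2_count:
  assumes nn: "\<And>i. i \<in> {1..d} \<Longrightarrow> 0 \<le> r (x i) (x' i)" and lt: "dist2 d r x x' < \<delta>" and "c > 0" "d > 0"
  shows "real (card {i\<in>{1..d}. c \<le> r (x i) (x' i)}) \<le> (\<delta> / c)\<^sup>2 * d"
proof -
  let ?S = "\<Sum>i\<in>{1..d}. (r (x i) (x' i))\<^sup>2"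
  let ?A = "{i\<in>{1..d}. c \<le> r (x i) (x' i)}"
  have S0: "0 \<le> ?S" by (simp add: sum_nonneg)
  have "?S / d = (dist2 d r x x')\<^sup>2" using S0 by (simp add: dist2_def)
  also have "\<dots> \<le> \<delta>\<^sup>2" using lt S0 by (intro power_mono) (auto simp: dist2_def)
  finally have S: "?S \<le> \<delta>\<^sup>2 * d" using \<open>d > 0\<close> by (simp add: field_simps)
  have "real (card ?A) * c\<^sup>2 = (\<Sum>i\<in>?A. c\<^sup>2)" by simp
  also have "\<dots> \<le> (\<Sum>i\<in>?A. (r (x i) (x' i))\<^sup>2)"
    using \<open>c > 0\<close> by (intro sum_mono power_mono) auto
  also have "\<dots> \<le> ?S" by (rule sum_mono2) auto
  finally show ?thesis using S \<open>c > 0\<close> by (simp add: power_divide field_simps)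
qed

text \<open>The squares are at most \<open>a\<^sup>2\<close> off the exceptional indices and at most
  \<open>D\<^sup>2\<close> on them.\<close>

lemma dist2_le:
  assumes nn: "\<And>i. i \<in> {1..d} \<Longrightarrow> 0 \<le> r (x i) (x' i)" and D: "\<And>i. i \<in> {1..d} \<Longrightarrow> r (x i) (x' i) \<le> D"
    and a: "0 \<le> a" and b: "real (card {i\<in>{1..d}. \<not> r (x i) (x' i) \<le> a}) \<le> b * d" and "d > 0"
  shows "dist2 d r x x' \<le> sqrt (a\<^sup>2 + D\<^sup>2 * b)"
proof -
  let ?A = "{i\<in>{1..d}. \<not> r (x i) (x' i) \<le> a}"
  have "(\<Sum>i\<in>{1..d}. (r (x i) (x' i))\<^sup>2) \<le> (\<Sum>i\<in>{1..d}. a\<^sup>2 + (if i \<in> ?A then D\<^sup>2 else 0))"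
  proof (rule sum_mono)
    fix i assume i: "i \<in> {1..d}"
    show "(r (x i) (x' i))\<^sup>2 \<le> a\<^sup>2 + (if i \<in> ?A then D\<^sup>2 else 0)"
    proof (cases "r (x i) (x' i) \<le> a")
      case True
      then have "(r (x i) (x' i))\<^sup>2 \<le> a\<^sup>2" using nn[OF i] by (rule power_mono)
      then show ?thesis by (auto intro: order_trans)
    next
      case False
      then have "(r (x i) (x' i))\<^sup>2 \<le> D\<^sup>2" using nn[OF i] D[OF i] by (intro power_mono)
      then show ?thesis using False i by (simp add: add_increasing)
    qed
  qed
  also have "\<dots> = d * a\<^sup>2 + D\<^sup>2 * card ?A"
    by (simp add: sum.distrib sum.If_cases Int_def mult.commute)
  also have "\<dots> \<le> d * a\<^sup>2 + D\<^sup>2 * (b * d)" using b by (intro add_left_mono mult_left_mono) auto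
  finally have "(\<Sum>i\<in>{1..d}. (r (x i) (x' i))\<^sup>2) / d \<le> a\<^sup>2 + D\<^sup>2 * b"
    using \<open>d > 0\<close> by (simp add: field_simps)
  then show ?thesis unfolding dist2_def by (rule real_sqrt_le_mono)
qed

lemma (in factor) set_mult_finv:
  assumes f: "f \<in> fp"
  shows "set_mult H f (H.finv f) = rng H ` f"
proof -
  note fD = fpD[OF f]
  show "set_mult H f (H.finv f) = rng H ` f"
  proof (intro equalityI subsetI)
    fix h assume "h \<in> set_mult H f (H.finv f)"
    then obtain a c where ac: "a \<in> f" "c \<in> f" "src H a = rng H (ginv H c)" "h = mult H a (ginv H c)"
      unfolding set_mult_def H.finv_def composable_def by blast
    have "c \<in> arr H" "a \<in> arr H" using ac fD(2) by auto
    then have "a = c" using ac H.ginv_props(3) fD(3) by (metis inj_onD)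
    then show "h \<in> rng H ` f" using ac H.ginv_props(5)[OF \<open>a \<in> arr H\<close>] by auto
  next
    fix h assume "h \<in> rng H ` f"
    then obtain a where a: "a \<in> f" "h = rng H a" by auto
    then have "a \<in> arr H" using fD(2) by auto
    note i = H.ginv_props[OF this]
    show "h \<in> set_mult H f (H.finv f)"
      unfolding set_mult_def H.finv_def composable_def using a i \<open>a \<in> arr H\<close>
      by (intro CollectI exI[of _ a] exI[of _ "ginv H a"]) auto
  qed
qed

lemma (in factor) set_mult_finv_full_pseudogroup:
  assumes f: "f \<in> fp"
  shows "set_mult H f (H.finv f) \<in> fp"
proof -
  note fD = fpD[OF f]
  have ru: "rng H ` f \<subseteq> units H" using fD(2) by auto
  have "rng H ` f \<in> sets (borel_of H.X)" by (rule H.image_borel[OF fD(1)]) simp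
  then have "rng H ` f \<in> sets (borel_of TH)" unfolding H.sets_X by simp
  then show "set_mult H f (H.finv f) \<in> fp"
    unfolding set_mult_finv[OF f] H.full_pseudogroup_iff
    using inj_on_subset[OF fpD(3)[OF units_full_pseudogroup] ru] inj_on_subset[OF fpD(4)[OF units_full_pseudogroup] ru]
    by blast
qed

text \<open>If \<open>s s \<approx> s\<close> for a partial permutation, then \<open>s\<close> is almost contained in the diagonal;
  this is why almost multiplicativity alone yields almost compatibility with inverses.\<close>

lemma (in factor) sofic_inverse:
  assumes f: "f \<in> fp" and \<sigma>: "\<sigma> \<in> Map_set (fp) d"
    and m: "multiplicative_on H d F0 e \<sigma>" and F0: "{f, H.finv f, set_mult H f (H.finv f)} \<subseteq> F0" and "d > 0"
  shows "real (card {(i, j) \<in> \<sigma> f. (j, i) \<notin> \<sigma> (H.finv f)}) \<le> 2 * e * d"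
proof -
  note fD = fpD[OF f]
  have f': "H.finv f \<in> fp" by (rule H.finv_full_pseudogroup[OF f])
  note r = set_mult_finv[OF f] and rf = set_mult_finv_full_pseudogroup[OF f]
  have ru: "rng H ` f \<subseteq> units H" using fD(2) by auto
  have uf: "set_mult H (rng H ` f) f = f"
  proof (intro equalityI subsetI)
    fix h assume "h \<in> set_mult H (rng H ` f) f"
    then obtain a b where ab: "a \<in> units H" "b \<in> f" "(a, b) \<in> composable H" "h = mult H a b"
      unfolding set_mult_def using ru by blast
    then have "a = rng H b" using H.unit_src by (simp add: composable_def)
    then show "h \<in> f" using ab H.rng_mult_self fD(2) by auto
  next
    fix h assume h: "h \<in> f"
    then have "h \<in> arr H" using fD(2) by auto
    then have "(rng H h, h) \<in> composable H" "mult H (rng H h) h = h"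
      using H.unit_src H.rng_in H.units_arr H.rng_mult_self unfolding composable_def by auto
    then show "h \<in> set_mult H (rng H ` f) f" unfolding set_mult_def using h by force
  qed
  let ?s = "\<sigma> f" and ?t = "\<sigma> (H.finv f)" and ?u = "\<sigma> (rng H ` f)"
  have fin: "?s \<in> fin_pseudogroup d" "?t \<in> fin_pseudogroup d" "?u \<in> fin_pseudogroup d"
    using \<sigma> f f' rf unfolding Map_set_def r by auto
  note sD = fin_pseudogroupD[OF fin(1)]
  have fm: "finite (pmult d a b)" if ab: "a \<in> fin_pseudogroup d" "b \<in> fin_pseudogroup d" for a b
  proof (rule finite_subset)
    show "pmult d a b \<subseteq> {1..d} \<times> {1..d}"
    proof
      fix p assume p: "p \<in> pmult d a b"
      obtain i k where ik: "p = (i, k)" by fastforce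
      then obtain j where "(i, j) \<in> a" "(j, k) \<in> b" using p fin_mult_iff[OF ab] by blast
      then show "p \<in> {1..d} \<times> {1..d}" using fin_pseudogroupD(1)[OF ab(1)] fin_pseudogroupD(1)[OF ab(2)] ik by blast
    qed
  qed simp
  have m1: "normcard d (sym_diff ?u (pmult d ?s ?t)) < e"
    and m2: "normcard d (sym_diff ?s (pmult d ?u ?s)) < e"
  proof -
    have "normcard d (sym_diff (\<sigma> (set_mult H a b)) (pmult d (\<sigma> a) (\<sigma> b))) < e"
      if "a \<in> F0" "b \<in> F0" for a b
      using m that by (simp add: multiplicative_on_def)
    from this[of f "H.finv f"] this[of "rng H ` f" f] F0
    show "normcard d (sym_diff ?u (pmult d ?s ?t)) < e"
      "normcard d (sym_diff ?s (pmult d ?u ?s)) < e"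
      unfolding r uf by auto
  qed
  have "real (card (?u - pmult d ?s ?t)) \<le> e * d"
    by (rule normcard_less[OF m1]) (use fm fin fin_pseudogroupD(4) \<open>d > 0\<close> in auto)
  moreover have "real (card (?s - pmult d ?u ?s)) \<le> e * d"
    by (rule normcard_less[OF m2]) (use fm fin fin_pseudogroupD(4) \<open>d > 0\<close> in auto)
  moreover have "real (card {(i, j) \<in> ?s. (i, i) \<in> ?u - pmult d ?s ?t}) \<le> e * d"
    by (rule card_le_inj[of "\<lambda>(i, j). (i, i)" _ "?u - pmult d ?s ?t"])
      (use calculation fin fin_pseudogroupD(4) sD in \<open>auto simp: inj_on_def\<close>)
  moreover have "real (card {(i, j) \<in> ?s. (j, i) \<notin> ?t}) \<le> real (card (?s - pmult d ?u ?s))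
      + real (card {(i, j) \<in> ?s. (i, i) \<in> ?u - pmult d ?s ?t})"
  proof (rule card_le_Un)
    \<comment> \<open>Off the first set \<open>(i, j)\<close> factors through \<open>?u\<close>, and
      uniqueness of the image of \<open>j\<close> forces \<open>(i, i) \<in> ?u\<close>. Off the
      second set \<open>(i, i)\<close> lies in the product of \<open>?s\<close> and
      \<open>?t\<close>, whose middle index can only be \<open>j\<close>.\<close>
    show "{(i, j) \<in> ?s. (j, i) \<notin> ?t} \<subseteq> (?s - pmult d ?u ?s)
      \<union> {(i, j) \<in> ?s. (i, i) \<in> ?u - pmult d ?s ?t}"
    proof (rule subsetI, rule ccontr)
      fix p assume p: "p \<in> {(i, j) \<in> ?s. (j, i) \<notin> ?t}"
        "p \<notin> (?s - pmult d ?u ?s) \<union> {(i, j) \<in> ?s. (i, i) \<in> ?u - pmult d ?s ?t}"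
      obtain i j where "p = (i, j)" by fastforce
      with p have ij: "(i, j) \<in> ?s" "(j, i) \<notin> ?t" "\<not> ((i, i) \<in> ?u - pmult d ?s ?t)"
        "(i, j) \<in> pmult d ?u ?s" by auto
      then obtain k where k: "(i, k) \<in> ?u" "(k, j) \<in> ?s" using fin_mult_iff[OF fin(3,1)] by blast
      then have "(i, i) \<in> ?u" using sD(2) ij by blast
      then have "(i, i) \<in> pmult d ?s ?t" using ij by blast
      then obtain l where "(i, l) \<in> ?s" "(l, i) \<in> ?t" using fin_mult_iff[OF fin(1,2)] by blast
      then show False using sD(3) ij by blast
    qed
    show "finite (?s - pmult d ?u ?s)" using sD(4) by simp
    show "finite {(i, j) \<in> ?s. (i, i) \<in> ?u - pmult d ?s ?t}"
      by (rule finite_subset[OF _ sD(4)]) auto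
  qed
  ultimately show "real (card {(i, j) \<in> ?s. (j, i) \<notin> ?t}) \<le> 2 * e * d" by linarith
qed

section \<open>The pseudometric, and separation by the topological full group\<close>

locale factor_metric = factor +
  fixes \<rho> :: "'c \<Rightarrow> 'c \<Rightarrow> real"
  assumes \<rho>: "continuous_pseudometric G.X \<rho>" and gen: "dynamically_generating G H TH \<pi> \<rho>"
begin

text \<open>Also the value of \<open>ext_dist\<close> between a point and the symbol
  \<open>None\<close>, hence the cost of a domain mismatch.\<close>

definition diam :: real where "diam = (SUP (y, z)\<in>units G \<times> units G. \<rho> y z)"

lemma \<rho>_props:
  assumes "x \<in> units G" "y \<in> units G"
  shows "\<rho> x x = 0" "0 \<le> \<rho> x y" "\<rho> x y = \<rho> y x" "z \<in> units G \<Longrightarrow> \<rho> x z \<le> \<rho> x y + \<rho> y z" "\<rho> x y \<le> diam"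
proof -
  show "\<rho> x x = 0" "0 \<le> \<rho> x y" "\<rho> x y = \<rho> y x" "z \<in> units G \<Longrightarrow> \<rho> x z \<le> \<rho> x y + \<rho> y z"
    using \<rho> assms unfolding continuous_pseudometric_def G.topspace_X by blast+
  let ?P = "prod_topology G.X G.X"
  have c: "continuous_map ?P euclideanreal (\<lambda>(x, y). \<rho> x y)" using \<rho> by (simp add: continuous_pseudometric_def)
  have "compact_space ?P" using G.compact_units by (simp add: compact_space_prod_topology)
  then have "compactin euclideanreal ((\<lambda>(x, y). \<rho> x y) ` topspace ?P)"
    using image_compactin c compact_space_def by blast
  then have "bounded ((\<lambda>(x, y). \<rho> x y) ` (units G \<times> units G))"
    unfolding topspace_prod_topology G.topspace_X by (simp add: compact_imp_bounded)
  then have "bdd_above ((\<lambda>(x, y). \<rho> x y) ` (units G \<times> units G))" by (rule bounded_imp_bdd_above)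
  then show "\<rho> x y \<le> diam" unfolding diam_def using cSUP_upper[of "(x, y)" "units G \<times> units G" "\<lambda>(x, y). \<rho> x y"] assms by auto
qed

lemma diam_nonneg: assumes "units G \<noteq> {}" shows "0 \<le> diam"
  using assms \<rho>_props(2,5) by (metis all_not_in_conv order_trans)

abbreviation "ed \<equiv> ext_dist (units G) \<rho>"

lemma ed_simps: "ed (Some x) None = diam" "ed None (Some x) = diam"
  by (simp_all add: diam_def)

lemma ed_bounds:
  assumes "a \<in> insert None (Some ` units G)" "b \<in> insert None (Some ` units G)" "units G \<noteq> {}"
  shows "0 \<le> ed a b" "ed a b \<le> diam"
  using assms diam_nonneg \<rho>_props(2,5)
  by (auto simp del: ext_dist.simps simp add: ext_dist.simps(1,2) ed_simps)

lemma \<rho>_cont_comp: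
  assumes "continuous_map Z G.X u" "continuous_map Z G.X v"
  shows "continuous_map Z euclideanreal (\<lambda>z. \<rho> (u z) (v z))"
proof -
  have c: "continuous_map (prod_topology G.X G.X) euclideanreal (\<lambda>(x, y). \<rho> x y)"
    using \<rho> by (simp add: continuous_pseudometric_def)
  have "continuous_map Z (prod_topology G.X G.X) (\<lambda>z. (u z, v z))" using assms by (rule continuous_map_pairedI)
  from continuous_map_compose[OF this c] show ?thesis by (simp add: o_def)
qed

text \<open>For each pair in \<open>K \<times> K'\<close> dynamical generation gives some
  \<open>g\<close> and a threshold \<open>1 / (n + 1)\<close> exceeded after translation. These
  conditions are open, and compactness leaves finitely many of them.\<close>

lemma separate:
  assumes K: "closedin G.X K" "closedin G.X K'" "K \<inter> K' = {}"
  obtains Gs \<theta> where "finite Gs" "Gs \<subseteq> fg" "\<theta> > 0"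
    "\<And>x y. x \<in> K \<Longrightarrow> y \<in> K' \<Longrightarrow> \<exists>g\<in>Gs. \<theta> < \<rho> (gact g x) (gact g y)"
proof -
  let ?P = "prod_topology G.X G.X"
  define W where "W p = {z \<in> topspace ?P. \<rho> (gact (fst p) (fst z)) (gact (fst p) (snd z)) \<in> {1 / real (Suc (snd p))<..}}"
    for p :: "'a set \<times> nat"
  have oW: "openin ?P (W p)" if "fst p \<in> fg" for p
    unfolding W_def
    by (rule openin_continuous_map_preimage[of _ euclideanreal], rule \<rho>_cont_comp)
      (use continuous_map_compose[OF continuous_map_fst gact_cont[OF that]]
         continuous_map_compose[OF continuous_map_snd gact_cont[OF that]] in \<open>auto simp: o_def\<close>)
  have KU: "K \<subseteq> units G" "K' \<subseteq> units G" using closedin_subset[OF K(1)] closedin_subset[OF K(2)] unfolding G.topspace_X .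
  have cov: "\<exists>p. fst p \<in> fg \<and> (x, y) \<in> W p" if xy: "x \<in> K" "y \<in> K'" for x y
  proof -
    have u: "x \<in> units G" "y \<in> units G" "x \<noteq> y" using xy KU K(3) by auto
    then obtain g where g: "g \<in> fg" "0 < ed (mv g x) (mv g y)"
      using gen unfolding dynamically_generating_def by blast
    then have "0 < \<rho> (gact g x) (gact g y)" using gact(1)[OF g(1)] u by simp
    then obtain n where "1 / real (Suc n) < \<rho> (gact g x) (gact g y)" by (metis nat_approx_posE)
    then show ?thesis using g(1) u unfolding W_def topspace_prod_topology G.topspace_X by (intro exI[of _ "(g, n)"]) simp
  qed
  have cK: "compactin ?P (K \<times> K')" using K G.X.compactin_iff_closedin by (simp add: compactin_Times)
  have WK: "K \<times> K' \<subseteq> \<Union> (W ` {p. fst p \<in> fg})" using cov by fast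
  have "\<forall>U\<in>W ` {p. fst p \<in> fg}. openin ?P U" using oW by auto
  then obtain \<F> where \<F>: "finite \<F>" "\<F> \<subseteq> W ` {p. fst p \<in> fg}" "K \<times> K' \<subseteq> \<Union> \<F>"
    using cK[unfolded compactin_def, THEN conjunct2, rule_format, of "W ` {p. fst p \<in> fg}"] WK by auto
  then obtain S where S: "finite S" "S \<subseteq> {p. fst p \<in> fg}" "\<F> = W ` S" by (metis finite_subset_image)
  \<comment> \<open>The largest index gives the smallest threshold; the inserted 0 covers an empty
    family.\<close>
  define N where "N = Max (insert 0 (snd ` S))"
  show ?thesis
  proof (rule that[of "fst ` S" "1 / real (Suc N)"])
    fix x y assume "x \<in> K" "y \<in> K'"
    then obtain p where p: "p \<in> S" "(x, y) \<in> W p" using \<F>(3) S(3) by blast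
    have "snd p \<le> N" unfolding N_def using S(1) p(1) by (intro Max_ge) auto
    then have "1 / real (Suc N) \<le> 1 / real (Suc (snd p))" by (simp add: frac_le)
    also have "\<dots> < \<rho> (gact (fst p) x) (gact (fst p) y)" using p(2) by (simp add: W_def)
    finally show "\<exists>g\<in>fst ` S. 1 / real (Suc N) < \<rho> (gact g x) (gact g y)" using p(1) by blast
  qed (use S in auto)
qed

end

text \<open>A partial permutation is injective, so each target index has at most one origin.\<close>

lemma fin_preimage_card:
  assumes s: "s \<in> fin_pseudogroup d" and B: "finite B"
  shows "card {i. \<exists>j\<in>B. (j, i) \<in> s} \<le> card B" "finite {i. \<exists>j\<in>B. (j, i) \<in> s}"
proof -
  note sD = fin_pseudogroupD[OF s]
  let ?S = "{(j, i) \<in> s. j \<in> B}"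
  have fS: "finite ?S" by (rule finite_subset[OF _ sD(4)]) auto
  have e: "{i. \<exists>j\<in>B. (j, i) \<in> s} = snd ` ?S" by force
  show "finite {i. \<exists>j\<in>B. (j, i) \<in> s}" unfolding e using fS by simp
  have "card {i. \<exists>j\<in>B. (j, i) \<in> s} \<le> card ?S" unfolding e by (rule card_image_le[OF fS])
  also have "\<dots> \<le> card B"
    by (rule card_inj_on_le[of fst]) (use B sD(3) in \<open>auto simp: inj_on_def\<close>)
  finally show "card {i. \<exists>j\<in>B. (j, i) \<in> s} \<le> card B" .
qed

section \<open>Approximate microstates and the filter they generate\<close>

context factor_metric begin

abbreviation "pt \<equiv> pseudogroup_top H TH \<nu>"

abbreviation "CH \<equiv> {k. continuous_map H.X euclideanreal k}"

abbreviation "off_dom n \<sigma> f x \<equiv> {i\<in>{1..n}. (mv f (x i) = None) \<noteq> (fin_act (\<sigma> f) i = None)}"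

abbreviation "off_orb n \<sigma> f x a \<equiv> {i\<in>{1..n}. \<not> ed (mv f (x i)) (map_option x (fin_act (\<sigma> f) i)) \<le> a}"

definition emp :: "nat \<Rightarrow> (nat \<Rightarrow> 'c) \<Rightarrow> 'c set \<Rightarrow> real" where
  "emp n x A = real (card {i\<in>{1..n}. x i \<in> A}) / real n"

abbreviation "orb n \<sigma> F K \<delta> \<equiv> Orb G H \<nu> \<pi> n \<sigma> F K \<delta> \<rho>"

text \<open>The domain condition is carried along explicitly, because membership in
  \<open>orb\<close> forces it only when \<open>diam\<close> is positive.\<close>

definition Orb_near ::
  "('c set \<Rightarrow> real) \<Rightarrow> 'a set set \<Rightarrow> ('a \<Rightarrow> real) set \<Rightarrow> 'c set set \<Rightarrow> real \<Rightarrow> nat \<Rightarrow> 'a sofic_map \<Rightarrow> (nat \<Rightarrow> 'c) set" where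
  "Orb_near L F K \<A> \<delta> n \<sigma> = {x \<in> orb n \<sigma> F K \<delta>.
     (\<forall>f\<in>F. real (card (off_dom n \<sigma> f x)) < \<delta> * n) \<and>
     (\<forall>A\<in>\<A>. \<bar>emp n x A - L A\<bar> < \<delta>)}"

text \<open>Collects those conditions on a sofic map that hold almost surely from some index on.
  Trace preservation holds only with probability tending to one and is kept apart.\<close>

definition almost_sofic :: "'a set set \<Rightarrow> real \<Rightarrow> nat \<Rightarrow> 'a sofic_map \<Rightarrow> bool" where
  "almost_sofic F0 \<delta> n \<sigma> \<longleftrightarrow> 0 < n \<and> \<sigma> \<in> Map_set fp n \<and> multiplicative_on H n F0 \<delta> \<sigma> \<and>
     (\<forall>f\<in>F0. \<forall>g\<in>F0. ennreal (normcard n (sym_diff (\<sigma> f) (\<sigma> g))) < ennreal \<delta> + src_meas H \<nu> (sym_diff f g))"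

text \<open>The filter of approximate microstates whose empirical measures are close to \<open>L\<close>.\<close>

definition config :: "('c set \<Rightarrow> real) \<Rightarrow> (nat \<times> 'a sofic_map \<times> (nat \<Rightarrow> 'c)) filter" where
  "config L = (INF (F, K, F0, \<A>, \<delta>)\<in>{(F, K, F0, \<A>, \<delta>). F \<in> Fpow pt \<and> K \<in> Fpow CH \<and> F0 \<in> Fpow fp \<and> finite \<A> \<and> 0 < \<delta>}.
     principal {(n, \<sigma>, x). almost_sofic F0 \<delta> n \<sigma> \<and> x \<in> Orb_near L F K \<A> \<delta> n \<sigma>})"

lemma Orb_near_antimono:
  assumes "F \<subseteq> F'" "K \<subseteq> K'" "\<A> \<subseteq> \<A>'" "\<delta>' \<le> \<delta>"
  shows "Orb_near L F' K' \<A>' \<delta>' n \<sigma> \<subseteq> Orb_near L F K \<A> \<delta> n \<sigma>"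
proof
  fix x assume x: "x \<in> Orb_near L F' K' \<A>' \<delta>' n \<sigma>"
  have "\<delta>' * n \<le> \<delta> * n" using assms(4) by (intro mult_right_mono) auto
  then show "x \<in> Orb_near L F K \<A> \<delta> n \<sigma>"
    using x assms unfolding Orb_near_def Orb_def by (auto intro: less_le_trans)
qed

lemma almost_sofic_antimono:
  assumes "F0 \<subseteq> F0'" "\<delta>' \<le> \<delta>" "almost_sofic F0' \<delta>' n \<sigma>" shows "almost_sofic F0 \<delta> n \<sigma>"
proof -
  have "ennreal \<delta>' + a \<le> ennreal \<delta> + a" for a using assms(2) by (intro add_right_mono ennreal_leI)
  then show ?thesis
    using assms unfolding almost_sofic_def multiplicative_on_def by (meson less_le_trans subsetD)
qed

text \<open>Constraints are directed under unions and minima of tolerances, so a single principal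
  filter of the family decides each event.\<close>

lemma eventually_config:
  "eventually Q (config L) \<longleftrightarrow> (\<exists>F K F0 \<A> \<delta>. F \<in> Fpow pt \<and> K \<in> Fpow CH \<and> F0 \<in> Fpow fp \<and> finite \<A> \<and> 0 < \<delta> \<and>
     (\<forall>n \<sigma> x. almost_sofic F0 \<delta> n \<sigma> \<longrightarrow> x \<in> Orb_near L F K \<A> \<delta> n \<sigma> \<longrightarrow> Q (n, \<sigma>, x)))"
proof -
  let ?I = "{(F, K, F0, \<A> :: 'c set set, \<delta> :: real). F \<in> Fpow pt \<and> K \<in> Fpow CH \<and> F0 \<in> Fpow fp \<and> finite \<A> \<and> 0 < \<delta>}"
  let ?S = "\<lambda>(F, K, F0, \<A>, \<delta>). {(n, \<sigma>, x). almost_sofic F0 \<delta> n \<sigma> \<and> x \<in> Orb_near L F K \<A> \<delta> n \<sigma>}"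
  have c: "config L = (INF t\<in>?I. principal (?S t))" unfolding config_def by (simp add: case_prod_beta')
  have "eventually Q (config L) \<longleftrightarrow> (\<exists>t\<in>?I. eventually Q (principal (?S t)))"
    unfolding c
  proof (rule eventually_INF_base)
    have "({}, {}, {}, {}, 1) \<in> ?I" by (simp add: Fpow_def)
    then show "?I \<noteq> {}" by blast
    fix a b assume "a \<in> ?I" "b \<in> ?I"
    then obtain F K F0 \<A> \<delta> F' K' F0' \<A>' \<delta>' where ab: "a = (F, K, F0, \<A>, \<delta>)" "b = (F', K', F0', \<A>', \<delta>')" 
      "F \<in> Fpow pt" "K \<in> Fpow CH" "F0 \<in> Fpow fp" "finite \<A>" "0 < \<delta>"
      "F' \<in> Fpow pt" "K' \<in> Fpow CH" "F0' \<in> Fpow fp" "finite \<A>'" "0 < \<delta>'" by auto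
    let ?c = "(F \<union> F', K \<union> K', F0 \<union> F0', \<A> \<union> \<A>', min \<delta> \<delta>')"
    have "?c \<in> ?I" using ab by (auto simp: Fpow_def)
    moreover have "?S ?c \<subseteq> ?S a \<inter> ?S b"
      unfolding ab(1,2)
      using Orb_near_antimono[of F "F \<union> F'" K "K \<union> K'" \<A> "\<A> \<union> \<A>'" "min \<delta> \<delta>'" \<delta> L]
        Orb_near_antimono[of F' "F \<union> F'" K' "K \<union> K'" \<A>' "\<A> \<union> \<A>'" "min \<delta> \<delta>'" \<delta>' L]
        almost_sofic_antimono[of F0 "F0 \<union> F0'" "min \<delta> \<delta>'" \<delta>] almost_sofic_antimono[of F0' "F0 \<union> F0'" "min \<delta> \<delta>'" \<delta>']
      by (auto; blast)
    ultimately show "\<exists>t\<in>?I. principal (?S t) \<le> inf (principal (?S a)) (principal (?S b))"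
      by (intro bexI[of _ ?c]) (simp_all only: inf_principal principal_le_iff)
  qed
  also have "\<dots> \<longleftrightarrow> (\<exists>F K F0 \<A> \<delta>. F \<in> Fpow pt \<and> K \<in> Fpow CH \<and> F0 \<in> Fpow fp \<and> finite \<A> \<and> 0 < \<delta> \<and>
     (\<forall>n \<sigma> x. almost_sofic F0 \<delta> n \<sigma> \<longrightarrow> x \<in> Orb_near L F K \<A> \<delta> n \<sigma> \<longrightarrow> Q (n, \<sigma>, x)))"
    by (simp add: eventually_principal) blast
  finally show ?thesis .
qed

lemma config_event:
  assumes "F \<in> Fpow pt" "K \<in> Fpow CH" "F0 \<in> Fpow fp" "finite \<A>" "0 < \<delta>"
    "\<And>n \<sigma> x. almost_sofic F0 \<delta> n \<sigma> \<Longrightarrow> x \<in> Orb_near L F K \<A> \<delta> n \<sigma> \<Longrightarrow> Q (n, \<sigma>, x)"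
  shows "eventually Q (config L)"
  unfolding eventually_config using assms by metis

lemma ev_basic: "eventually (\<lambda>(n, \<sigma>, x). 0 < n \<and> \<sigma> \<in> Map_set fp n \<and> (\<forall>i\<in>{1..n}. x i \<in> units G)) (config L)"
  by (rule config_event[of "{}" "{}" "{}" "{}" 1])
    (auto simp: Fpow_def almost_sofic_def Orb_near_def Orb_def PiE_iff)

lemma ptD: assumes "f \<in> pt" shows "f \<in> fp" "f \<subseteq> arr H" "inj_on (src H) f"
  using assms fpD unfolding pseudogroup_top_def by auto

lemma act_range:
  assumes "f \<in> fp" "x \<in> units G" shows "mv f x \<in> insert None (Some ` units G)"
proof (cases "mv f x")
  case (Some y)
  then have "moves f x y" using act_iff(1)[OF fpD(2,3)[OF assms(1)] assms(2)] by simp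
  then show ?thesis using moves_units(2) Some by auto
qed simp

lemma fin_act_range:
  assumes "s \<in> fin_pseudogroup n" "\<And>i. i \<in> {1..n} \<Longrightarrow> x i \<in> A"
  shows "map_option x (fin_act s i) \<in> insert None (Some ` A)"
proof (cases "fin_act s i")
  case (Some j)
  then have "(j, i) \<in> s" using fin_act_iff(1)[OF assms(1)] by simp
  then have "j \<in> {1..n}" using fin_pseudogroupD(1)[OF assms(1)] by auto
  then show ?thesis using assms(2) Some by auto
qed simp

lemma ev_ed:
  fixes c e :: real
  assumes f: "f \<in> pt" and "c > 0" "e > 0"
  shows "eventually (\<lambda>(n, \<sigma>, x). real (card {i\<in>{1..n}. c \<le> ed (mv f (x i)) (map_option x (fin_act (\<sigma> f) i))}) \<le> e * n) (config L)"
\<comment> \<open>With this tolerance Chebyshev's bound \<open>(c * sqrt e / c)\<^sup>2\<close> is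
  exactly \<open>e\<close>.\<close>
proof (rule config_event[of "{f}" "{}" "{}" "{}" "c * sqrt e"])
  fix n \<sigma> x assume s: "almost_sofic {} (c * sqrt e) n \<sigma>" and x: "x \<in> Orb_near L {f} {} {} (c * sqrt e) n \<sigma>"
  have xu: "\<And>i. i \<in> {1..n} \<Longrightarrow> x i \<in> units G" using x by (auto simp: Orb_near_def Orb_def PiE_iff)
  have n: "0 < n" and \<sigma>: "\<sigma> f \<in> fin_pseudogroup n"
    using s ptD(1)[OF f] by (auto simp: almost_sofic_def Map_set_def)
  have ne: "units G \<noteq> {}" using xu[of 1] n by auto
  have "real (card {i\<in>{1..n}. c \<le> ed (mv f (x i)) (map_option x (fin_act (\<sigma> f) i))}) \<le> (c * sqrt e / c)\<^sup>2 * n"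
  proof (rule dist2_count[where r=ed and x="\<lambda>i. mv f (x i)"
      and x'="\<lambda>i. map_option x (fin_act (\<sigma> f) i)" and \<delta>="c * sqrt e"])
    show "0 \<le> ed (mv f (x i)) (map_option x (fin_act (\<sigma> f) i))" if "i \<in> {1..n}" for i
      by (rule ed_bounds(1)[OF act_range[OF ptD(1)[OF f] xu[OF that]] fin_act_range[OF \<sigma> xu] ne])
    show "dist2 n ed (\<lambda>i. mv f (x i)) (\<lambda>i. map_option x (fin_act (\<sigma> f) i)) < c * sqrt e"
      using x by (simp add: Orb_near_def Orb_def)
  qed (use assms n in auto)
  then show "case (n, \<sigma>, x) of (n, \<sigma>, x) \<Rightarrow> real (card {i\<in>{1..n}. c \<le> ed (mv f (x i)) (map_option x (fin_act (\<sigma> f) i))}) \<le> e * n"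
    using assms by simp
qed (use assms in \<open>auto simp: Fpow_def\<close>)

lemma ev_dom:
  fixes e :: real
  assumes f: "f \<in> pt" and "e > 0"
  shows "eventually (\<lambda>(n, \<sigma>, x). real (card (off_dom n \<sigma> f x)) \<le> e * n) (config L)"
  by (rule config_event[of "{f}" "{}" "{}" "{}" e])
    (use assms in \<open>auto simp: Fpow_def Orb_near_def intro: less_imp_le\<close>)

lemma ev_emp: "e > 0 \<Longrightarrow> eventually (\<lambda>(n, \<sigma>, x). \<bar>emp n x A - L A\<bar> < e) (config L)"
  by (rule config_event[of "{}" "{}" "{}" "{A}" e]) (auto simp: Fpow_def Orb_near_def)

lemma ev_mult: "F0 \<in> Fpow fp \<Longrightarrow> e > 0 \<Longrightarrow> eventually (\<lambda>(n, \<sigma>, x). multiplicative_on H n F0 e \<sigma>) (config L)"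
  by (rule config_event[of "{}" "{}" F0 "{}" e]) (auto simp: Fpow_def almost_sofic_def)

text \<open>The point where asymptotic continuity enters. The mass of the symmetric difference is
  given as a real \<open>m\<close>, which keeps the later counts out of
  \<open>ennreal\<close>.\<close>

lemma ev_cont:
  assumes "f \<in> fp" "g \<in> fp" "e > 0" "src_meas H \<nu> (sym_diff f g) = ennreal m" "0 \<le> m"
  shows "eventually (\<lambda>(n, \<sigma>, x). normcard n (sym_diff (\<sigma> f) (\<sigma> g)) < e + m) (config L)"
proof (rule config_event[of "{}" "{}" "{f, g}" "{}" e])
  fix n \<sigma> x assume s: "almost_sofic {f, g} e n \<sigma>"
  have "ennreal (normcard n (sym_diff (\<sigma> f) (\<sigma> g))) < ennreal e + ennreal m"
    using s assms(4) by (auto simp: almost_sofic_def)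
  also have "\<dots> = ennreal (e + m)" using assms by simp
  finally have "normcard n (sym_diff (\<sigma> f) (\<sigma> g)) < e + m"
    by (subst (asm) ennreal_less_iff) (simp_all add: normcard_def)
  then show "case (n, \<sigma>, x) of (n, \<sigma>, x) \<Rightarrow> normcard n (sym_diff (\<sigma> f) (\<sigma> g)) < e + m" by simp
qed (use assms in \<open>auto simp: Fpow_def\<close>)

lemma ev_K:
  assumes "continuous_map H.X euclideanreal k" "e > 0"
  shows "eventually (\<lambda>(n, \<sigma>, x). \<bar>(\<Sum>i\<in>{1..n}. k (\<pi> (x i))) / real n - (\<integral>y. k y \<partial>\<nu>)\<bar> < e) (config L)"
  by (rule config_event[of "{}" "{k}" "{}" "{}" e]) (use assms in \<open>auto simp: Fpow_def Orb_near_def Orb_def\<close>)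

text \<open>\<open>\<rho>\<close> need not separate \<open>K\<close> from \<open>K'\<close>, but
  finitely many \<open>g\<close> in the full group do, with a gap \<open>\<theta>\<close>. For most
  \<open>i\<close> with image \<open>j\<close>, the point \<open>x i\<close> moved by
  \<open>f\<close> and then by \<open>g\<close> is near the point indexed by the image of
  \<open>i\<close> under the sofic map of the product; \<open>x j\<close> moved by \<open>g\<close>
  is near the point indexed by the image of \<open>j\<close> under \<open>\<sigma> g\<close>; and
  multiplicativity makes the two indices equal. Taking \<open>f\<close> from
  \<open>open_pseudogroup\<close> makes the product with \<open>g\<close> a test element
  again.\<close>

lemma ev_close:
  fixes e :: real
  assumes f: "f \<in> H.open_pseudogroup" and K: "closedin G.X K" "closedin G.X K'" "K \<inter> K' = {}" and "e > 0"
  shows "eventually (\<lambda>(n, \<sigma>, x). real (card {i\<in>{1..n}. \<exists>j y. (j, i) \<in> \<sigma> f \<and> moves f (x i) y \<and> y \<in> K \<and> x j \<in> K'}) \<le> e * n) (config L)"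
proof -
  obtain Gs \<theta> where Gs: "finite Gs" "Gs \<subseteq> fg" "\<theta> > 0"
    "\<And>x y. x \<in> K \<Longrightarrow> y \<in> K' \<Longrightarrow> \<exists>g\<in>Gs. \<theta> < \<rho> (gact g x) (gact g y)"
    using separate[OF K] by metis
  \<comment> \<open>Each \<open>g\<close> has three exceptional sets of density at most
    \<open>e'\<close>: misbehaviour of the product at \<open>i\<close>, misbehaviour of
    \<open>g\<close> at the image of \<open>i\<close>, and failure of multiplicativity.\<close>
  define e' where "e' = e / (3 * (real (card Gs) + 1))"
  have e': "e' > 0" "card Gs * (3 * e') \<le> e"
  proof -
    show "e' > 0" using \<open>e > 0\<close> by (simp add: e'_def)
    have "card Gs * (3 * e') = e * (real (card Gs) / (real (card Gs) + 1))" by (simp add: e'_def field_simps)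
    also have "\<dots> \<le> e * 1" using \<open>e > 0\<close> by (intro mult_left_mono) auto
    finally show "card Gs * (3 * e') \<le> e" by simp
  qed
  have gop: "g \<in> H.open_pseudogroup" "set_mult H g f \<in> H.open_pseudogroup" if "g \<in> Gs" for g
    using that Gs(2) H.nice_full_group H.nice_open_pseudogroup H.translate_open_pseudogroup f by auto
  note opD = H.open_pseudogroup_basic
  have pts: "g \<in> pt" "set_mult H g f \<in> pt" "g \<in> fp" "set_mult H g f \<in> fp" if "g \<in> Gs" for g
    using opD(5,6) gop[OF that] by auto
  have ffp: "f \<in> fp" using opD(5) f by blast
  have "eventually (\<lambda>z. \<forall>g\<in>Gs. (case z of (n, \<sigma>, x) \<Rightarrow> real (card {i\<in>{1..n}. \<theta>/2 \<le> ed (mv (set_mult H g f) (x i)) (map_option x (fin_act (\<sigma> (set_mult H g f)) i))}) \<le> e' * n)) (config L)"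
    by (intro eventually_ball_finite[OF Gs(1)] ballI ev_ed) (use pts Gs(3) e' in auto)
  moreover have "eventually (\<lambda>z. \<forall>g\<in>Gs. (case z of (n, \<sigma>, x) \<Rightarrow> real (card {i\<in>{1..n}. \<theta>/2 \<le> ed (mv g (x i)) (map_option x (fin_act (\<sigma> g) i))}) \<le> e' * n)) (config L)"
    by (intro eventually_ball_finite[OF Gs(1)] ballI ev_ed) (use pts Gs(3) e' in auto)
  moreover have "eventually (\<lambda>(n, \<sigma>, x). multiplicative_on H n (insert f Gs) e' \<sigma>) (config L)"
    by (rule ev_mult) (use pts ffp Gs(1) e' in \<open>auto simp: Fpow_def\<close>)
  ultimately show ?thesis using ev_basic
  proof eventually_elim
    case (elim z)
    obtain n \<sigma> x where z: "z = (n, \<sigma>, x)" by (cases z)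
    note el = elim[unfolded z case_prod_conv]
    have n: "0 < n" and \<sigma>: "\<And>f. f \<in> fp \<Longrightarrow> \<sigma> f \<in> fin_pseudogroup n" and xu: "\<And>i. i \<in> {1..n} \<Longrightarrow> x i \<in> units G"
      using el(4) by (auto simp: Map_set_def)
    let ?sf = "\<sigma> f"
    note sfD = fin_pseudogroupD[OF \<sigma>[OF ffp]]
    define B1 where "B1 g = {i\<in>{1..n}. \<theta>/2 \<le> ed (mv (set_mult H g f) (x i)) (map_option x (fin_act (\<sigma> (set_mult H g f)) i))}" for g
    define B2 where "B2 g = {j\<in>{1..n}. \<theta>/2 \<le> ed (mv g (x j)) (map_option x (fin_act (\<sigma> g) j))}" for g
    define E where "E g = pmult n (\<sigma> g) ?sf - \<sigma> (set_mult H g f)" for g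
    define S where "S g = B1 g \<union> {i. \<exists>j\<in>B2 g. (j, i) \<in> ?sf} \<union> snd ` E g" for g
    have fB2: "finite (B2 g)" for g by (simp add: B2_def)
    have E: "finite (E g)" "real (card (E g)) \<le> e' * n" if "g \<in> Gs" for g
    proof -
      have fin: "finite (sym_diff (\<sigma> (set_mult H g f)) (pmult n (\<sigma> g) ?sf))"
      proof (rule finite_subset)
        have "pmult n (\<sigma> g) ?sf \<subseteq> {1..n} \<times> {1..n}"
          by (auto simp: set_mult_def composable_def pair_gpd_def)
        then show "sym_diff (\<sigma> (set_mult H g f)) (pmult n (\<sigma> g) ?sf) \<subseteq> {1..n} \<times> {1..n}"
          using fin_pseudogroupD(1)[OF \<sigma>[OF pts(4)[OF that]]] by blast
      qed simp
      show "finite (E g)" by (rule finite_subset[OF _ fin]) (auto simp: E_def)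
      have "normcard n (sym_diff (\<sigma> (set_mult H g f)) (pmult n (\<sigma> g) ?sf)) < e'"
        using el(3) that by (simp add: multiplicative_on_def)
      then show "real (card (E g)) \<le> e' * n" by (rule normcard_less[OF _ fin n]) (auto simp: E_def)
    qed
    have cS: "finite (S g) \<and> real (card (S g)) \<le> 3 * e' * n" if "g \<in> Gs" for g
    proof
      note p = fin_preimage_card[OF \<sigma>[OF ffp] fB2[of g]]
      show "finite (S g)" using E(1)[OF that] p(2) by (simp add: S_def B1_def)
      have 1: "real (card (B1 g)) \<le> e' * n" using el(1) that by (simp add: B1_def)
      have 2: "real (card {i. \<exists>j\<in>B2 g. (j, i) \<in> ?sf}) \<le> e' * n" using el(2) that p(1) by (force simp: B2_def)
      have 3: "real (card (snd ` E g)) \<le> e' * n" using card_image_le[OF E(1)[OF that], of snd] E(2)[OF that] by linarith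
      show "real (card (S g)) \<le> 3 * e' * n"
        unfolding S_def using 1 2 3 card_Un_real[of "B1 g \<union> {i. \<exists>j\<in>B2 g. (j, i) \<in> ?sf}" "snd ` E g"]
          card_Un_real[of "B1 g" "{i. \<exists>j\<in>B2 g. (j, i) \<in> ?sf}"] by linarith
    qed
    have sub: "{i\<in>{1..n}. \<exists>j y. (j, i) \<in> ?sf \<and> moves f (x i) y \<and> y \<in> K \<and> x j \<in> K'} \<subseteq> (\<Union>g\<in>Gs. S g)"
    proof clarify
      fix i j y assume i: "i \<in> {1..n}" "(j, i) \<in> ?sf" "moves f (x i) y" "y \<in> K" "x j \<in> K'"
      then obtain g where g: "g \<in> Gs" "\<theta> < \<rho> (gact g y) (gact g (x j))" using Gs(4) by blast
      have gG: "g \<in> fg" using g Gs(2) by auto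
      have j: "j \<in> {1..n}" using sfD(1) i(2) by auto
      have yu: "y \<in> units G" "x j \<in> units G" "x i \<in> units G" using moves_units i xu j by auto
      note gy = gact[OF gG yu(1)] and gx = gact[OF gG yu(2)]
      have "moves (set_mult H g f) (x i) (gact g y)"
        unfolding moves_mult[OF fpD(2)[OF pts(3)[OF g(1)]] fpD(2)[OF ffp]] using i(3) gy(2) by blast
      then have a: "mv (set_mult H g f) (x i) = Some (gact g y)"
        using act_iff(1)[OF fpD(2,3)[OF pts(4)[OF g(1)]] yu(3)] by simp
      have "i \<in> S g"
      proof (rule ccontr)
        assume n_i: "i \<notin> S g"
        then have "j \<notin> B2 g" using i(2) by (auto simp: S_def)
        then have lt: "ed (Some (gact g (x j))) (map_option x (fin_act (\<sigma> g) j)) < \<theta>/2"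
          using j gx(1) by (simp add: B2_def not_le)
        have "\<rho> (gact g y) (gact g (x j)) \<le> diam" using \<rho>_props(5) gy gx by auto
        \<comment> \<open>An undefined image of \<open>j\<close> would be at distance
          \<open>diam\<close>, contradicting \<open>lt\<close>; hence \<open>\<sigma> g\<close> is
          defined at \<open>j\<close>.\<close>
        then have big: "diam \<ge> \<theta>/2" using g(2) Gs(3) by linarith
        have "fin_act (\<sigma> g) j \<noteq> None"
        proof
          assume "fin_act (\<sigma> g) j = None"
          then have "ed (Some (gact g (x j))) None < \<theta>/2" using lt by (simp only: option.map)
          then show False using big unfolding ed_simps by linarith
        qed
        then obtain l where l: "fin_act (\<sigma> g) j = Some l" by auto
        then have lj: "(l, j) \<in> \<sigma> g" using fin_act_iff(1)[OF \<sigma>[OF pts(3)[OF g(1)]]] by simp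
        then have lu: "x l \<in> units G" using fin_pseudogroupD(1)[OF \<sigma>[OF pts(3)[OF g(1)]]] xu by auto
        have "(l, i) \<in> pmult n (\<sigma> g) ?sf"
          using fin_mult_iff[OF \<sigma>[OF pts(3)[OF g(1)]] \<sigma>[OF ffp]] lj i(2) by blast
        moreover have "(l, i) \<notin> E g" using n_i by (force simp: S_def)
        ultimately have "(l, i) \<in> \<sigma> (set_mult H g f)" by (simp add: E_def)
        then have "fin_act (\<sigma> (set_mult H g f)) i = Some l"
          using fin_act_iff(1)[OF \<sigma>[OF pts(4)[OF g(1)]]] by simp
        moreover have "i \<notin> B1 g" using n_i by (simp add: S_def)
        ultimately have "\<rho> (gact g y) (x l) < \<theta>/2" using i(1) a by (simp add: B1_def not_le)
        moreover have "\<rho> (gact g (x j)) (x l) < \<theta>/2" using lt l by simp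
        moreover have "\<rho> (gact g y) (gact g (x j)) \<le> \<rho> (gact g y) (x l) + \<rho> (x l) (gact g (x j))"
          using \<rho>_props(4)[of "gact g y" "x l" "gact g (x j)"] gy(3) gx(3) lu by blast
        moreover have "\<rho> (x l) (gact g (x j)) = \<rho> (gact g (x j)) (x l)" using \<rho>_props(3) gx(3) lu by blast
        ultimately show False using g(2) by linarith
      qed
      then show "i \<in> (\<Union>g\<in>Gs. S g)" using g(1) by blast
    qed
    have "card {i\<in>{1..n}. \<exists>j y. (j, i) \<in> ?sf \<and> moves f (x i) y \<and> y \<in> K \<and> x j \<in> K'} \<le> card (\<Union>g\<in>Gs. S g)"
      by (rule card_mono[OF _ sub]) (use Gs(1) cS in auto)
    also have "\<dots> \<le> (\<Sum>g\<in>Gs. card (S g))" by (rule card_UN_le[OF Gs(1)])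
    finally have "real (card {i\<in>{1..n}. \<exists>j y. (j, i) \<in> ?sf \<and> moves f (x i) y \<and> y \<in> K \<and> x j \<in> K'}) \<le> (\<Sum>g\<in>Gs. real (card (S g)))"
      by (simp flip: of_nat_sum)
    also have "\<dots> \<le> (\<Sum>g\<in>Gs. 3 * e' * n)" by (rule sum_mono) (use cS in auto)
    also have "\<dots> = (card Gs * (3 * e')) * n" by simp
    also have "\<dots> \<le> e * n" using e'(2) by (intro mult_right_mono) auto
    finally show ?case by (simp add: z)
  qed
qed

end

section \<open>Limits of empirical measures\<close>

text \<open>Nontriviality says that microstates with empirical measures near \<open>L\<close> exist
  under all constraints and tolerances. Every property of \<open>L\<close> is read off from
  this.\<close>

locale content = factor_metric +
  fixes L :: "'c set \<Rightarrow> real"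
  assumes nontrivial: "config L \<noteq> bot"
begin

text \<open>Events of a nontrivial filter are nonempty, so an inequality between empirical measures
  passes to \<open>L\<close>. The error is split into thirds: one in the hypothesis and one for each
  of the two values of \<open>L\<close>.\<close>

lemma L_le_add:
  assumes "\<And>e::real. e > 0 \<Longrightarrow> eventually (\<lambda>(n, \<sigma>, x). emp n x A \<le> emp n x B + c + e) (config L)"
  shows "L A \<le> L B + c"
proof (rule field_le_epsilon)
  fix e :: real assume "e > 0"
  then have "e/3 > 0" by simp
  from assms[OF this] ev_emp[OF this, where A=A and L=L] ev_emp[OF this, where A=B and L=L]
  have "eventually (\<lambda>z. L A \<le> L B + c + e) (config L)"
  proof eventually_elim
    case (elim z)
    obtain n \<sigma> x where z: "z = (n, \<sigma>, x)" by (cases z)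
    show ?case using elim unfolding z case_prod_conv abs_less_iff by linarith
  qed
  then show "L A \<le> L B + c + e" using eventually_happens'[OF nontrivial] by blast
qed

lemma L_le:
  assumes "\<And>e::real. e > 0 \<Longrightarrow> eventually (\<lambda>(n, \<sigma>, x). emp n x A \<le> emp n x B + e) (config L)"
  shows "L A \<le> L B"
  using L_le_add[of A B 0] assms by simp

lemma emp_mono: "A \<subseteq> B \<Longrightarrow> emp n x A \<le> emp n x B"
  unfolding emp_def by (intro divide_right_mono of_nat_mono card_mono) auto

lemma L_mono: assumes "A \<subseteq> B" shows "L A \<le> L B"
  by (rule L_le, rule always_eventually) (use emp_mono[OF assms] in \<open>auto intro: add_increasing2\<close>)

lemma L_eqI:
  assumes "eventually (\<lambda>(n, \<sigma>, x). emp n x A + emp n x B = emp n x C + c) (config L)"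
  shows "L A + L B = L C + c"
proof -
  have "\<bar>L A + L B - (L C + c)\<bar> \<le> 0"
  proof (rule field_le_epsilon)
    fix e :: real assume "e > 0"
    then have "e/4 > 0" by simp
    from assms ev_emp[OF this, where A=A and L=L] ev_emp[OF this, where A=B and L=L] ev_emp[OF this, where A=C and L=L]
    have "eventually (\<lambda>z. \<bar>L A + L B - (L C + c)\<bar> \<le> e) (config L)"
    proof eventually_elim
      case (elim z)
      obtain n \<sigma> x where z: "z = (n, \<sigma>, x)" by (cases z)
      show ?case using elim unfolding z case_prod_conv abs_less_iff by linarith
    qed
    then show "\<bar>L A + L B - (L C + c)\<bar> \<le> 0 + e" using eventually_happens'[OF nontrivial] by fastforce
  qed
  then show ?thesis by simp
qed

lemma emp_Un: "A \<inter> B = {} \<Longrightarrow> emp n x (A \<union> B) = emp n x A + emp n x B"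
proof -
  assume d: "A \<inter> B = {}"
  have "{i\<in>{1..n}. x i \<in> A \<union> B} = {i\<in>{1..n}. x i \<in> A} \<union> {i\<in>{1..n}. x i \<in> B}" by auto
  then have "card {i\<in>{1..n}. x i \<in> A \<union> B} = card {i\<in>{1..n}. x i \<in> A} + card {i\<in>{1..n}. x i \<in> B}"
    using d by (simp add: card_Un_disjoint disjoint_iff)
  then show ?thesis by (simp add: emp_def add_divide_distrib)
qed

lemma L_Un: "A \<inter> B = {} \<Longrightarrow> L (A \<union> B) = L A + L B"
  using L_eqI[of A B "A \<union> B" 0] emp_Un[of A B] by (simp add: case_prod_beta')

lemma L_empty: "L {} = 0"
  using L_Un[of "{}" "{}"] by simp

lemma L_nonneg: "0 \<le> L A"
  using L_mono[of "{}" A] L_empty by simp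

lemma L_units: "L (units G) = 1"
proof -
  have "eventually (\<lambda>(n, \<sigma>, x). emp n x (units G) + emp n x {} = emp n x {} + 1) (config L)"
    using ev_basic
  proof eventually_elim
    case (elim z)
    obtain n \<sigma> x where z: "z = (n, \<sigma>, x)" by (cases z)
    have "{i\<in>{1..n}. x i \<in> units G} = {1..n}" using elim unfolding z by auto
    then have "emp n x (units G) = 1" unfolding emp_def using elim z by simp
    then show ?case by (simp add: z)
  qed
  from L_eqI[OF this] show ?thesis by simp
qed

lemma L_Compl: "A \<subseteq> units G \<Longrightarrow> L (units G - A) = 1 - L A"
  using L_Un[of A "units G - A"] L_units by (simp add: Un_absorb1)

lemma limit_measure:
  obtains \<mu> where "prob_space \<mu>" "sets \<mu> = sets (borel_of G.X)" "\<And>U. openin G.X U \<Longrightarrow> measure \<mu> U \<le> L U"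
  by (rule G.X.borel_measure_le_content[of L]) (use L_nonneg L_units L_Un in \<open>auto simp del: topspace_subtopology simp: G.topspace_X\<close>)

end

section \<open>The limit measure lies over the base measure and is invariant\<close>

locale content_measure = content +
  fixes \<mu> :: "'c measure"
  assumes prob_\<mu>: "prob_space \<mu>" and sets_\<mu>: "sets \<mu> = sets (borel_of G.X)"
    and open_le: "openin G.X U \<Longrightarrow> measure \<mu> U \<le> L U"
begin

sublocale \<mu>: prob_space \<mu> by (rule prob_\<mu>)

lemma space_\<mu>: "space \<mu> = units G"
  using sets_eq_imp_space_eq[OF sets_\<mu>] by (simp only: space_borel_of G.topspace_X)

lemma openG: "openin G.X U \<Longrightarrow> U \<in> sets \<mu>" and closedG: "closedin G.X U \<Longrightarrow> U \<in> sets \<mu>"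
  using sets_\<mu> by (auto simp: openin_borel_of closedin_borel_of)

lemma openin_units: "openin G.X U \<Longrightarrow> U \<subseteq> units G" and closedin_units: "closedin G.X U \<Longrightarrow> U \<subseteq> units G"
  using openin_subset[of G.X U] closedin_subset[of G.X U] unfolding G.topspace_X by blast+

lemma openin_unitsI: "openin G.X (units G)"
  using openin_topspace[of G.X] unfolding G.topspace_X .

text \<open>Passing to complements reverses the inequality on open sets, as \<open>\<mu>\<close> and
  \<open>L\<close> both have total mass one.\<close>

lemma closed_le: assumes K: "closedin G.X K" shows "L K \<le> measure \<mu> K"
proof -
  have "openin G.X (units G - K)" using openin_diff[OF openin_unitsI K] .
  then have "measure \<mu> (units G - K) \<le> L (units G - K)" by (rule open_le)
  moreover have "measure \<mu> (units G - K) = 1 - measure \<mu> K"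
    using \<mu>.prob_compl[OF closedG[OF K]] space_\<mu> by simp
  ultimately show ?thesis using L_Compl[OF closedin_units[OF K]] by simp
qed

lemma fin_mu: "finite_measure \<mu>" by unfold_locales

text \<open>The preimage of \<open>V\<close> is approximated from inside by \<open>U\<close>. A
  continuous \<open>k\<close> that is 1 on the image of the closure of \<open>U\<close> and vanishes
  off \<open>V\<close> is one of the test functions, so its empirical mean is near its integral,
  which is at most \<open>measure \<nu> V\<close>.\<close>

lemma pushforward_le:
  assumes V: "openin H.X V" shows "measure \<mu> {x \<in> units G. \<pi> x \<in> V} \<le> measure \<nu> V"
proof (rule field_le_epsilon)
  fix e :: real assume e: "e > 0"
  have "openin G.X {x \<in> topspace G.X. \<pi> x \<in> V}" by (rule openin_continuous_map_preimage[OF \<pi>_contX V])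
  then have "openin G.X {x \<in> units G. \<pi> x \<in> V}" unfolding G.topspace_X .
  then obtain U where U: "openin G.X U" "G.X closure_of U \<subseteq> {x \<in> units G. \<pi> x \<in> V}"
    "measure \<mu> {x \<in> units G. \<pi> x \<in> V} < measure \<mu> U + e/2"
    using G.X.open_approx_inside[OF _ fin_mu sets_\<mu>, of "{x \<in> units G. \<pi> x \<in> V}" "e/2"] e by auto
  let ?K = "G.X closure_of U"
  have UK: "U \<subseteq> ?K" using closure_of_subset[OF openin_subset[OF U(1)]] .
  have "compactin G.X ?K" using G.X.compactin_iff_closedin by simp
  then have "compactin H.X (\<pi> ` ?K)" by (rule image_compactin[OF _ \<pi>_contX])
  then have c: "closedin H.X (\<pi> ` ?K)" using H.X.compactin_iff_closedin by blast
  have Vu: "V \<subseteq> units H" using openin_subset[OF V] unfolding H.topspace_X .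
  have cV: "closedin H.X (topspace H.X - V)" by (rule closedin_diff[OF closedin_topspace V])
  have dV: "disjnt (topspace H.X - V) (\<pi> ` ?K)" using U(2) by (auto simp: disjnt_def)
  obtain k where k: "continuous_map H.X (top_of_set {0..1::real}) k" "k ` (topspace H.X - V) \<subseteq> {0}" "k ` (\<pi> ` ?K) \<subseteq> {1}"
    by (rule Urysohn_lemma[OF H.X.normal cV c dV zero_le_one]) (rule that)
  have kc: "continuous_map H.X euclideanreal k" using k(1) by (simp add: continuous_map_in_subtopology)
  have k01: "0 \<le> k y" "k y \<le> 1" if "y \<in> units H" for y
    using k(1) that unfolding continuous_map_in_subtopology H.topspace_X by (auto simp: image_subset_iff)
  have kV: "k y \<le> indicator V y" if "y \<in> units H" for y
    using k01[OF that] k(2) that unfolding H.topspace_X by (cases "y \<in> V") auto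
  have Vs: "V \<in> sets \<nu>" by (rule H.open_\<nu>[OF V])
  have "(\<integral>y. k y \<partial>\<nu>) \<le> (\<integral>y. indicator V y \<partial>\<nu>)"
  proof (rule integral_mono_AE')
    show "integrable \<nu> (indicator V :: 'a \<Rightarrow> real)"
      by (rule integrable_real_indicator[OF Vs]) (simp add: H.\<nu>.emeasure_eq_measure)
    show "AE y in \<nu>. k y \<le> indicator V y" by (rule AE_I2) (use kV in simp)
  qed simp
  also have "\<dots> = measure \<nu> V" using Vs Vu by (simp add: inf_absorb1)
  finally have ik: "(\<integral>y. k y \<partial>\<nu>) \<le> measure \<nu> V" .
  have "L ?K \<le> L {} + (\<integral>y. k y \<partial>\<nu>)"
  proof (rule L_le_add)
    fix e :: real assume "e > 0"
    from ev_K[OF kc this] ev_basic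
    show "eventually (\<lambda>(n, \<sigma>, x). emp n x ?K \<le> emp n x {} + (\<integral>y. k y \<partial>\<nu>) + e) (config L)"
    proof eventually_elim
      case (elim z)
      obtain n \<sigma> x where z: "z = (n, \<sigma>, x)" by (cases z)
      have xu: "\<And>i. i \<in> {1..n} \<Longrightarrow> x i \<in> units G" and n: "0 < n" using elim(2) unfolding z by auto
      have "real (card {i\<in>{1..n}. x i \<in> ?K}) = (\<Sum>i\<in>{1..n}. if x i \<in> ?K then 1 else 0)"
        by (simp add: sum.If_cases Int_def)
      also have "\<dots> \<le> (\<Sum>i\<in>{1..n}. k (\<pi> (x i)))"
      proof (rule sum_mono)
        fix i assume "i \<in> {1..n}"
        then show "(if x i \<in> ?K then 1 else 0) \<le> k (\<pi> (x i))" using k(3) k01(1)[OF \<pi>_units[OF xu]] by (auto simp: image_subset_iff)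
      qed
      finally have "emp n x ?K \<le> (\<Sum>i\<in>{1..n}. k (\<pi> (x i))) / real n" unfolding emp_def by (rule divide_right_mono) simp
      moreover have "emp n x {} = 0" by (simp add: emp_def)
      ultimately show ?case using elim(1) unfolding z case_prod_conv abs_less_iff by linarith
    qed
  qed
  then have "L U \<le> measure \<nu> V" using L_mono[OF UK] ik L_empty by linarith
  then show "measure \<mu> {x \<in> units G. \<pi> x \<in> V} \<le> measure \<nu> V + e" using U(3) open_le[OF U(1)] e by linarith
qed

lemma \<pi>_measurable: "\<pi> \<in> \<mu> \<rightarrow>\<^sub>M \<nu>"
  using borel_of_measurable[OF \<pi>_contX] measurable_cong_sets[OF sets_\<mu> H.sets_\<nu>] by simp

lemma pushforward: "distr \<mu> \<nu> \<pi> = \<nu>"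
proof (rule H.X.prob_eqI_open)
  show "prob_space (distr \<mu> \<nu> \<pi>)" by (rule \<mu>.prob_space_distr[OF \<pi>_measurable])
  fix U assume U: "openin H.X U"
  have "\<pi> -` U \<inter> space \<mu> = {x \<in> units G. \<pi> x \<in> U}" using space_\<mu> by auto
  then show "measure (distr \<mu> \<nu> \<pi>) U \<le> measure \<nu> U"
    using pushforward_le[OF U] by (simp add: measure_distr[OF \<pi>_measurable H.open_\<nu>[OF U]])
qed (auto simp: H.sets_\<nu> H.\<nu>.prob_space_axioms)

text \<open>Off few indices, \<open>f\<close> moves a point in \<open>K\<close> and the sofic map
  moves its index; by \<open>ev_close\<close> the new index rarely carries a point outside
  \<open>V\<close>. As the sofic map is injective on indices, \<open>K\<close> has hardly more
  indices than \<open>V\<close>.\<close>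

lemma L_move:
  assumes f: "f \<in> H.open_pseudogroup" and K: "closedin G.X K" "\<And>x. x \<in> K \<Longrightarrow> \<pi> x \<in> src H ` f"
    and T: "closedin G.X {y. \<exists>x\<in>K. moves f x y}"
    and V: "openin G.X V" "{y. \<exists>x\<in>K. moves f x y} \<subseteq> V"
  shows "L K \<le> L V"
proof (rule L_le)
  fix e :: real assume "e > 0"
  then have e2: "e/2 > 0" by simp
  note fb = H.open_pseudogroup_basic[OF f]
  note D = fpD[OF fb(5)]
  let ?T = "{y. \<exists>x\<in>K. moves f x y}"
  have "closedin G.X (units G - V)" using V(1) closedin_topspace[of G.X] unfolding G.topspace_X by (intro closedin_diff)
  then have "eventually (\<lambda>(n, \<sigma>, x). real (card {i\<in>{1..n}. \<exists>j y. (j, i) \<in> \<sigma> f \<and> moves f (x i) y \<and> y \<in> ?T \<and> x j \<in> units G - V}) \<le> e/2 * n) (config L)"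
    by (intro ev_close[OF f T _ _ e2]) (use V(2) in auto)
  then show "eventually (\<lambda>(n, \<sigma>, x). emp n x K \<le> emp n x V + e) (config L)"
    using ev_dom[OF fb(6) e2] ev_basic
  proof eventually_elim
    case (elim z)
    obtain n \<sigma> x where z: "z = (n, \<sigma>, x)" by (cases z)
    note el = elim[unfolded z case_prod_conv]
    have n: "0 < n" and \<sigma>: "\<sigma> f \<in> fin_pseudogroup n" and xu: "\<And>i. i \<in> {1..n} \<Longrightarrow> x i \<in> units G"
      using el(3) fb(5) by (auto simp: Map_set_def)
    let ?B1 = "{i\<in>{1..n}. \<exists>j y. (j, i) \<in> \<sigma> f \<and> moves f (x i) y \<and> y \<in> ?T \<and> x j \<in> units G - V}"
    let ?B2 = "(off_dom n \<sigma> f x)"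
    let ?B3 = "{i. \<exists>j\<in>{j\<in>{1..n}. x j \<in> V}. (j, i) \<in> \<sigma> f}"
    have p: "card ?B3 \<le> card {j\<in>{1..n}. x j \<in> V}" "finite ?B3" by (rule fin_preimage_card[OF \<sigma>], simp)+
    have sub: "{i\<in>{1..n}. x i \<in> K} \<subseteq> ?B1 \<union> (?B2 \<union> ?B3)"
    proof (rule subsetI, rule ccontr)
      fix i assume i: "i \<in> {i\<in>{1..n}. x i \<in> K}" and nin: "i \<notin> ?B1 \<union> (?B2 \<union> ?B3)"
      have dom: "\<pi> (x i) \<in> src H ` f" using i K(2) by simp
      then obtain y where y: "moves f (x i) y" using moves_dom[OF D(2) xu] i by blast
      have "mv f (x i) \<noteq> None" using act_iff(2)[OF D(2,3) xu] i dom by simp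
      moreover have "(mv f (x i) = None) = (fin_act (\<sigma> f) i = None)" using nin i by blast
      ultimately have "fin_act (\<sigma> f) i \<noteq> None" by metis
      then obtain j where j: "(j, i) \<in> \<sigma> f" using fin_act_iff(2)[OF \<sigma>] by metis
      then have jn: "j \<in> {1..n}" using fin_pseudogroupD(1)[OF \<sigma>] by auto
      then have "x j \<notin> V" using nin j by blast
      then have "x j \<in> units G - V" using xu[OF jn] by simp
      moreover have "y \<in> ?T" using y i by blast
      ultimately show False using nin i y j by blast
    qed
    have fB: "finite ?B1" "finite ?B2" by simp_all
    have "real (card {i\<in>{1..n}. x i \<in> K}) \<le> real (card ?B1) + real (card (?B2 \<union> ?B3))"
      by (rule card_le_Un[OF sub fB(1)]) (use fB(2) p(2) in simp)
    also have "real (card (?B2 \<union> ?B3)) \<le> real (card ?B2) + real (card ?B3)" by (rule card_Un_real)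
    finally have "real (card {i\<in>{1..n}. x i \<in> K}) \<le> e/2 * n + (e/2 * n + real (card {j\<in>{1..n}. x j \<in> V}))"
      using el(1,2) p(1) by linarith
    then have "real (card {i\<in>{1..n}. x i \<in> K}) / n \<le> (e/2 * n + (e/2 * n + real (card {j\<in>{1..n}. x j \<in> V}))) / n"
      by (rule divide_right_mono) simp
    also have "\<dots> = emp n x V + e" using n by (simp add: emp_def field_simps)
    finally show ?case by (simp add: z emp_def)
  qed
qed

text \<open>\<open>\<mu>\<close> is below \<open>L\<close> on open sets and above it on closed ones,
  so the move for \<open>L\<close> is sandwiched: \<open>C\<close> inside an open \<open>W\<close>,
  the closure of \<open>W\<close> moved into an open \<open>V\<close>, the closure of
  \<open>V\<close> inside \<open>U\<close>. Regularity makes \<open>C\<close> and \<open>U\<close>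
  close in measure to \<open>A\<close> and to its image.\<close>

lemma \<mu>_move:
  assumes f: "H.nice f" and A: "A \<in> sets \<mu>" "\<And>x. x \<in> A \<Longrightarrow> \<pi> x \<in> src H ` f"
  shows "measure \<mu> A \<le> measure \<mu> {y. \<exists>x\<in>A. moves f x y}"
proof (rule field_le_epsilon)
  fix e :: real assume e: "e > 0"
  note nb = H.nice_basic[OF f]
  have fop: "f \<in> H.open_pseudogroup" by (rule H.nice_open_pseudogroup[OF f])
  let ?t = "\<lambda>A. {y. \<exists>x\<in>A. moves f x y}"
  have lb: "bisection G TG (lift f)"
    unfolding G.bisection_iff using lift_open[OF nb(1)] lift_inj_src[OF nb(3)] lift_inj_rng[OF nb(4)] by blast
  have Au: "A \<subseteq> units G" using sets.sets_into_space[OF A(1)] space_\<mu> by simp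
  have dom: "x \<in> src G ` lift f" if x: "x \<in> units G" "\<pi> x \<in> src H ` f" for x
  proof -
    obtain y where "moves f x y" using moves_dom[OF nb(2) x] by blast
    then show ?thesis by (auto simp: moves_def)
  qed
  have tA: "?t A \<in> sets \<mu>"
    using act_set_borel(1)[OF nb(7), of A] A(1) sets_\<mu> act_set_eq(1)[OF nb(2,3) Au] by simp
  obtain C where C: "closedin G.X C" "C \<subseteq> A" "measure \<mu> A < measure \<mu> C + e/2"
  proof -
    obtain C U where CU: "closedin G.X C" "openin G.X U" "C \<subseteq> A" "A \<subseteq> U" "measure \<mu> (U - C) < e/2"
      using G.X.regular_approx[OF fin_mu sets_\<mu> A(1), of "e/2"] e by auto
    have "measure \<mu> A \<le> measure \<mu> (C \<union> (U - C))"
      by (rule \<mu>.finite_measure_mono) (use CU openG closedG in auto)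
    also have "\<dots> \<le> measure \<mu> C + measure \<mu> (U - C)" by (rule measure_Un_le) (use CU openG closedG in auto)
    finally show ?thesis using that CU by simp
  qed
  obtain U where U: "openin G.X U" "?t A \<subseteq> U" "measure \<mu> U < measure \<mu> (?t A) + e/2"
  proof -
    obtain C U where CU: "closedin G.X C" "openin G.X U" "C \<subseteq> ?t A" "?t A \<subseteq> U" "measure \<mu> (U - C) < e/2"
      using G.X.regular_approx[OF fin_mu sets_\<mu> tA, of "e/2"] e by auto
    have "measure \<mu> U \<le> measure \<mu> (?t A \<union> (U - C))"
      by (rule \<mu>.finite_measure_mono) (use CU openG closedG tA in auto)
    also have "\<dots> \<le> measure \<mu> (?t A) + measure \<mu> (U - C)" by (rule measure_Un_le) (use CU openG closedG tA in auto)
    finally show ?thesis using that CU by simp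
  qed
  have tcl: "closedin G.X (?t K)" if K: "closedin G.X K" "\<And>x. x \<in> K \<Longrightarrow> \<pi> x \<in> src H ` f" for K
  proof -
    have "K \<subseteq> src G ` lift f" using dom K closedin_units by blast
    then have "compactin TG {g \<in> lift f. src G g \<in> K}" by (rule G.compactin_src_lift[OF lb K(1)])
    then have "compactin G.X (rng G ` {g \<in> lift f. src G g \<in> K})" by (rule image_compactin[OF _ G.continuous_rng_X])
    moreover have "rng G ` {g \<in> lift f. src G g \<in> K} = ?t K" by (auto simp: moves_def)
    ultimately show ?thesis using G.X.compactin_iff_closedin by simp
  qed
  let ?N = "{x. \<exists>y\<in>U. moves f x y}"
  have oN: "openin G.X ?N" by (rule open_preimage[OF nb(1) U(1)])
  have CN: "C \<subseteq> ?N"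
  proof
    fix x assume x: "x \<in> C"
    then have "x \<in> units G" "\<pi> x \<in> src H ` f" using C(2) Au A(2) by auto
    then obtain y where "moves f x y" using moves_dom[OF nb(2)] by blast
    then show "x \<in> ?N" using U(2) x C(2) by blast
  qed
  obtain W where W: "openin G.X W" "C \<subseteq> W" "G.X closure_of W \<subseteq> ?N"
    using G.X.open_nbhd[OF C(1) oN CN] by blast
  let ?K = "G.X closure_of W"
  have Kd: "\<pi> x \<in> src H ` f" if "x \<in> ?K" for x using W(3) that moves_\<pi>(1) by blast
  have tK: "closedin G.X (?t ?K)" by (rule tcl) (use Kd in auto)
  have tKU: "?t ?K \<subseteq> U"
  proof clarify
    fix x y assume xy: "x \<in> ?K" "moves f x y"
    then obtain y' where "y' \<in> U" "moves f x y'" using W(3) by blast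
    then show "y \<in> U" using moves_fun[OF nb(3) xy(2)] by blast
  qed
  obtain V where V: "openin G.X V" "?t ?K \<subseteq> V" "G.X closure_of V \<subseteq> U"
    using G.X.open_nbhd[OF tK U(1) tKU] by blast
  have WK: "W \<subseteq> ?K" and VV: "V \<subseteq> G.X closure_of V"
    using closure_of_subset[OF openin_subset[OF W(1)]] closure_of_subset[OF openin_subset[OF V(1)]] by auto
  have "measure \<mu> C \<le> measure \<mu> W" by (rule \<mu>.finite_measure_mono[OF W(2) openG[OF W(1)]])
  also have "\<dots> \<le> L W" by (rule open_le[OF W(1)])
  also have "\<dots> \<le> L ?K" by (rule L_mono[OF WK])
  also have "\<dots> \<le> L V" by (rule L_move[OF fop _ Kd tK V(1,2)]) simp
  also have "\<dots> \<le> L (G.X closure_of V)" by (rule L_mono[OF VV])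
  also have "\<dots> \<le> measure \<mu> (G.X closure_of V)" by (rule closed_le) simp
  also have "\<dots> \<le> measure \<mu> U" by (rule \<mu>.finite_measure_mono[OF V(3) openG[OF U(1)]])
  finally show "measure \<mu> A \<le> measure \<mu> (?t A) + e" using C(3) U(3) by linarith
qed

text \<open>For nice sets invariance is first an inequality; the inverse of a nice set is nice,
  which gives equality. The lifts of countably many nice sets cover the arrows of
  \<open>G\<close>.\<close>

lemma pmp_\<mu>: "pmp G (borel_of TG) \<mu>"
proof -
  have o: "openin TH B" if "B \<in> {f. H.nice f}" for B using H.nice_basic(1) that by blast
  have c: "arr H \<subseteq> \<Union> {f. H.nice f}" 
  proof
    fix h assume "h \<in> arr H"
    then obtain f where "H.nice f" "h \<in> f" by (rule H.nice_nbhd)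
    then show "h \<in> \<Union> {f. H.nice f}" by blast
  qed
  obtain N :: "nat \<Rightarrow> 'a set" where N: "\<And>n. N n \<in> {f. H.nice f} \<or> N n = {}" "(\<Union>n. N n) = arr H"
    by (rule H.countable_subcover[OF o c], assumption, rule that)
  have oN: "openin TH (N n)" "inj_on (src H) (N n)" "inj_on (rng H) (N n)" for n
    using N(1)[of n] H.nice_basic by auto
  show ?thesis
  proof (rule G.pmpI[of \<mu> "\<lambda>n. lift (N n)"])
    show "prob_space \<mu>" by (rule prob_\<mu>)
    show "sets \<mu> = sets (borel_of G.X)" by (rule sets_\<mu>)
    show "lift (N n) \<in> sets (borel_of TG)" for n using lift_open[OF oN(1)] by (rule openin_borel_of)
    show "inj_on (src G) (lift (N n))" "inj_on (rng G) (lift (N n))" for n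
      using lift_inj_src lift_inj_rng oN by auto
    show "(\<Union>n. lift (N n)) = arr G" using N(2) \<pi>_arr unfolding lift_def by blast
    fix n A assume A: "A \<in> sets (borel_of TG)" "A \<subseteq> lift (N n)"
    show "emeasure \<mu> (src G ` A) = emeasure \<mu> (rng G ` A)"
    proof (cases "N n = {}")
      case True then have "A = {}" using A(2) by (auto simp: lift_def)
      then show ?thesis by simp
    next
      case False
      then have nice: "H.nice (N n)" using N(1) by auto
      note nb = H.nice_basic[OF nice]
      have s: "src G ` A \<in> sets \<mu>" "rng G ` A \<in> sets \<mu>" using G.image_borel[OF A(1)] sets_\<mu> by auto
      have m: "moves (N n) (src G g) (rng G g)" if "g \<in> A" for g using that A(2) by (auto simp: moves_def)
      have t1: "{y. \<exists>x\<in>src G ` A. moves (N n) x y} = rng G ` A"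
        using m moves_fun[OF nb(3)] by blast
      have t2: "{y. \<exists>x\<in>rng G ` A. moves (H.finv (N n)) x y} = src G ` A"
        unfolding moves_finv[OF nb(2)] using m moves_inj[OF nb(4)] by blast
      have "measure \<mu> (src G ` A) \<le> measure \<mu> (rng G ` A)"
        using \<mu>_move[OF nice s(1)] m moves_\<pi>(1) unfolding t1 by blast
      moreover have "measure \<mu> (rng G ` A) \<le> measure \<mu> (src G ` A)"
        using \<mu>_move[OF H.nice_finv[OF nice] s(2)] m moves_\<pi>(2) H.finv_images(2)[OF nb(2)] unfolding t2 by blast
      ultimately show ?thesis by (simp add: \<mu>.emeasure_eq_measure)
    qed
  qed
qed

end

section \<open>Partitions\<close>

lemma partition_on_eqI:
  assumes "partition_on A R" "X \<in> R" "Y \<in> R" "x \<in> X" "x \<in> Y" shows "X = Y"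
  using assms unfolding partition_on_def disjoint_def by (metis IntI empty_iff)

text \<open>Cells collect the points that no member of \<open>S\<close> distinguishes. In a
  partition of which all members of \<open>S\<close> are unions, an atom meeting a member lies
  inside it, so each atom stays within one cell.\<close>

lemma coarsest_partition_eq:
  assumes S: "\<And>B. B \<in> S \<Longrightarrow> B \<subseteq> A"
  defines "cell \<equiv> \<lambda>x. {y \<in> A. \<forall>B\<in>S. y \<in> B \<longleftrightarrow> x \<in> B}"
  shows "coarsest_partition A S = cell ` A" "partition_on A (cell ` A)"
    "\<And>B. B \<in> S \<Longrightarrow> \<exists>C\<subseteq>cell ` A. B = \<Union>C"
proof -
  let ?good = "\<lambda>R. partition_on A R \<and> (\<forall>B\<in>S. \<exists>C\<subseteq>R. B = \<Union>C)"
  have cc: "cell x = cell y" if "y \<in> cell x" for x y using that by (auto simp: cell_def)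
  have self: "x \<in> cell x" if "x \<in> A" for x using that by (simp add: cell_def)
  show p: "partition_on A (cell ` A)"
  proof (rule partition_onI)
    show "\<Union> (cell ` A) = A" using self by (auto simp: cell_def)
    show "disjnt X Y" if "X \<in> cell ` A" "Y \<in> cell ` A" "X \<noteq> Y" for X Y
      using that cc unfolding disjnt_def by (metis Int_iff all_not_in_conv imageE)
    show "{} \<notin> cell ` A" using self by auto
  qed
  show u: "\<exists>C\<subseteq>cell ` A. B = \<Union>C" if B: "B \<in> S" for B
  proof (intro exI[of _ "cell ` B"] conjI)
    show "cell ` B \<subseteq> cell ` A" using S[OF B] by blast
    show "B = \<Union> (cell ` B)" using S[OF B] self B by (auto simp: cell_def)
  qed
  have coarse: "refines A R (cell ` A)" if R: "?good R" for R
    unfolding refines_def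
  proof (intro conjI ballI)
    fix X assume X: "X \<in> R"
    have pR: "partition_on A R" by (rule conjunct1[OF R])
    have "X \<noteq> {}"
    proof
      assume "X = {}"
      then show False using partition_onD3[OF pR] X by simp
    qed
    then obtain x where x: "x \<in> X" by blast
    have "X \<subseteq> \<Union>R" using X by (rule Union_upper)
    then have XA: "X \<subseteq> A" by (simp only: partition_onD1[OF pR, symmetric])
    have "y \<in> B \<longleftrightarrow> x \<in> B" if y: "y \<in> X" and B: "B \<in> S" for y B
    proof -
      obtain C where C: "C \<subseteq> R" "B = \<Union>C"
        using bspec[OF conjunct2[OF R] B] by (elim exE conjE) (rule that)
      have "X \<in> C" if "z \<in> X" "z \<in> B" for z
      proof -
        obtain c where c: "c \<in> C" "z \<in> c" using C \<open>z \<in> B\<close> by blast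
        then have "c = X" using partition_on_eqI[of A R c X z] R X C(1) \<open>z \<in> X\<close> by auto
        then show ?thesis using c by simp
      qed
      then show ?thesis using C(2) x y by blast
    qed
    then have "X \<subseteq> cell x" using XA by (auto simp: cell_def)
    then show "\<exists>Y\<in>cell ` A. X \<subseteq> Y" using x XA by blast
  qed (use R p in auto)
  have g: "?good (cell ` A)" using p u by blast
  show "coarsest_partition A S = cell ` A"
    unfolding coarsest_partition_def Let_def
  proof (rule the_equality)
    have "\<forall>R'. ?good R' \<longrightarrow> refines A R' (cell ` A)" by (intro allI impI coarse)
    with g show "?good (cell ` A) \<and> (\<forall>R'. ?good R' \<longrightarrow> refines A R' (cell ` A))" by (rule conjI)
    fix R assume R: "?good R \<and> (\<forall>R'. ?good R' \<longrightarrow> refines A R' R)"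
    then have "refines A R (cell ` A)" by (intro coarse) (rule conjunct1)
    moreover have "refines A (cell ` A) R" using conjunct2[OF R, rule_format, OF g] .
    ultimately show "R = cell ` A" by (rule refines_asym)
  qed
qed

lemma sigma_sets_finite_partition:
  assumes R: "finite R" "partition_on A R"
  shows "sigma_sets A R = {\<Union>C | C. C \<subseteq> R}"
proof (intro equalityI subsetI)
  fix B assume "B \<in> sigma_sets A R"
  then have "\<exists>C\<subseteq>R. B = \<Union>C"
  proof induction
    case (Basic a) then show ?case by (intro exI[of _ "{a}"]) auto
  next
    case Empty show ?case by (intro exI[of _ "{}"]) auto
  next
    case (Compl a)
    then obtain C where C: "C \<subseteq> R" "a = \<Union>C" by blast
    have "A - a = \<Union>(R - C)"
    proof (intro equalityI subsetI)
      fix x assume "x \<in> A - a"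
      then show "x \<in> \<Union>(R - C)" using C R(2) unfolding partition_on_def by blast
    next
      fix x assume "x \<in> \<Union>(R - C)"
      then obtain X where X: "X \<in> R" "X \<notin> C" "x \<in> X" by blast
      then have "x \<notin> a" using C partition_on_eqI[OF R(2)] by (metis UnionE subsetD)
      then show "x \<in> A - a" using X R(2) unfolding partition_on_def by blast
    qed
    then show ?case by blast
  next
    case (Union a)
    then obtain C where C: "\<And>i. C i \<subseteq> R" "\<And>i. a i = \<Union>(C i)" by metis
    have "(\<Union>i. a i) = \<Union>(\<Union>i. C i)" unfolding C(2) by blast
    moreover have "(\<Union>i. C i) \<subseteq> R" using C(1) by blast
    ultimately show ?case by (intro exI[of _ "\<Union>i. C i"] conjI)
  qed
  then show "B \<in> {\<Union>C | C. C \<subseteq> R}" by blast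
next
  fix B assume "B \<in> {\<Union>C | C. C \<subseteq> R}"
  then obtain C where C: "C \<subseteq> R" "B = \<Union>C" by blast
  interpret sigma_algebra A "sigma_sets A R"
    by (rule sigma_algebra_sigma_sets) (use R(2) in \<open>auto simp: partition_on_def\<close>)
  show "B \<in> sigma_sets A R"
    unfolding C(2) by (rule finite_Union) (use C(1) R(1) finite_subset in \<open>auto intro: sigma_sets.Basic\<close>)
qed

lemma finite_set_homs: "finite \<Sigma> \<Longrightarrow> finite (set_homs A \<Sigma> d)"
  unfolding set_homs_def by (rule finite_subset[of _ "\<Sigma> \<rightarrow>\<^sub>E Pow {1..d}"]) (auto intro: finite_PiE)

lemma coarsest_finite_partition:
  assumes S: "finite S" "S \<subseteq> sets M"
  shows "finite_partition M (coarsest_partition (space M) S)"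
    "B \<in> S \<Longrightarrow> \<exists>C\<subseteq>coarsest_partition (space M) S. B = \<Union>C"
proof -
  have Su: "B \<subseteq> space M" if "B \<in> S" for B using sets.sets_into_space S(2) that by blast
  let ?cell = "\<lambda>x. {y \<in> space M. \<forall>B\<in>S. y \<in> B \<longleftrightarrow> x \<in> B}"
  have c1: "coarsest_partition (space M) S = ?cell ` space M" by (rule coarsest_partition_eq(1)) (rule Su)
  have c2: "partition_on (space M) (?cell ` space M)" by (rule coarsest_partition_eq(2)) (rule Su)
  show "\<exists>C\<subseteq>coarsest_partition (space M) S. B = \<Union>C" if "B \<in> S"
    unfolding c1 by (rule coarsest_partition_eq(3)) (use Su that in auto)
  have "?cell x = (\<Inter>B\<in>S. if x \<in> B then B else space M - B) \<inter> space M" for x by (auto split: if_splits)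
  moreover have "(\<Inter>B\<in>S. if x \<in> B then B else space M - B) \<inter> space M \<in> sets M" for x
  proof (cases "S = {}")
    case False
    then have "(\<Inter>B\<in>S. if x \<in> B then B else space M - B) \<in> sets M"
      using S by (intro sets.finite_INT) auto
    then show ?thesis by auto
  qed simp
  ultimately have Rs: "?cell ` space M \<subseteq> sets M" by auto
  have "finite (?cell ` space M)"
  proof (rule finite_surj)
    show "finite (Pow S)" using S(1) by simp
    \<comment> \<open>A cell is determined by the subfamily of \<open>S\<close> whose members
      contain it.\<close>
    show "?cell ` space M \<subseteq> (\<lambda>T. {y \<in> space M. \<forall>B\<in>S. y \<in> B \<longleftrightarrow> B \<in> T}) ` Pow S"
    proof
      fix X assume "X \<in> ?cell ` space M"
      then obtain x where x: "X = ?cell x" by auto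
      have "X = {y \<in> space M. \<forall>B\<in>S. y \<in> B \<longleftrightarrow> B \<in> {B \<in> S. x \<in> B}}" unfolding x by auto
      then show "X \<in> (\<lambda>T. {y \<in> space M. \<forall>B\<in>S. y \<in> B \<longleftrightarrow> B \<in> T}) ` Pow S" by blast
    qed
  qed
  then show "finite_partition M (coarsest_partition (space M) S)"
    unfolding c1 finite_partition_def using c2 Rs by simp
qed

section \<open>Invariant measures on the extension and the generated partitions\<close>

locale factor_measure = factor H TH \<nu> G TG \<pi>
  for H :: "('h, 'm) gpd_scheme" and TH \<nu> and G :: "('g, 'n) gpd_scheme" and TG \<pi> +
  fixes \<mu> :: "'g measure"
  assumes pmpG: "pmp G (borel_of TG) \<mu>" and push: "distr \<mu> \<nu> \<pi> = \<nu>"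
begin

sublocale GM: pmp_etale G TG \<mu>
  by unfold_locales (rule pmpG)

lemma measure_preimage:
  assumes "B \<in> sets \<nu>" shows "measure \<mu> {x \<in> units G. \<pi> x \<in> B} = measure \<nu> B" "{x \<in> units G. \<pi> x \<in> B} \<in> sets \<mu>"
proof -
  have m: "\<pi> \<in> \<mu> \<rightarrow>\<^sub>M \<nu>"
    using borel_of_measurable[OF \<pi>_contX] measurable_cong_sets[OF GM.sets_\<nu> H.sets_\<nu>] by simp
  have e: "\<pi> -` B \<inter> space \<mu> = {x \<in> units G. \<pi> x \<in> B}" by auto
  have "measure (distr \<mu> \<nu> \<pi>) B = measure \<mu> (\<pi> -` B \<inter> space \<mu>)" by (rule measure_distr[OF m assms])
  then show "measure \<mu> {x \<in> units G. \<pi> x \<in> B} = measure \<nu> B" unfolding push e by simp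
  show "{x \<in> units G. \<pi> x \<in> B} \<in> sets \<mu>" using measurable_sets[OF m assms] e by simp
qed

text \<open>The arrows over \<open>f\<close> that start in \<open>A\<close> form a set on which
  source and range are injective; invariance compares its two images.\<close>

lemma measure_act_set:
  assumes f: "f \<in> fp" and A: "A \<in> sets \<mu>"
  shows "measure \<mu> (mvs f A) = measure \<mu> {x \<in> A. \<pi> x \<in> src H ` f}" "mvs f A \<in> sets \<mu>"
proof -
  let ?E = "{g \<in> lift f. src G g \<in> A}"
  note fD = fpD[OF f]
  have A': "A \<in> sets (borel_of G.X)" using A GM.sets_\<nu> by simp
  have Au: "A \<subseteq> units G" using sets.sets_into_space[OF A] by simp
  have E: "?E \<in> sets (borel_of TG)" by (rule act_set_borel(2)[OF f A'])
  show "mvs f A \<in> sets \<mu>" using act_set_borel(1)[OF f A'] GM.sets_\<nu> by simp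
  have i: "inj_on (src G) ?E" "inj_on (rng G) ?E"
    using inj_on_subset[OF lift_inj_src[OF fD(3)], of ?E] inj_on_subset[OF lift_inj_rng[OF fD(4)], of ?E] by auto
  have "src G ` ?E = {x \<in> A. \<pi> x \<in> src H ` f}"
  proof (intro equalityI subsetI)
    fix x assume "x \<in> {x \<in> A. \<pi> x \<in> src H ` f}"
    then have x: "x \<in> A" "\<pi> x \<in> src H ` f" by auto
    then obtain y where "moves f x y" using moves_dom[OF fD(2)] Au by blast
    then show "x \<in> src G ` ?E" using x by (auto simp: moves_def)
  qed (auto simp: lift_def \<pi>_src)
  then show "measure \<mu> (mvs f A) = measure \<mu> {x \<in> A. \<pi> x \<in> src H ` f}"
    using GM.pmp_eq[OF E i] act_set_eq(2)[OF fD(2,3) Au] by simp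
qed

text \<open>Since \<open>units H \<in> F\<close> acts trivially, each atom of \<open>\<P>\<close> is
  itself one of the generating sets and hence belongs to the new algebra.\<close>

lemma partition_act_props:
  assumes P: "finite_partition \<mu> \<P>" and F: "F \<in> Fpow (fp)" "units H \<in> F"
  defines "R \<equiv> partition_act G H \<pi> \<P> F"
  shows "finite_partition \<mu> R" "\<And>f p. f \<in> F \<Longrightarrow> p \<in> \<P> \<Longrightarrow> mvs f p \<in> sigma_sets (units G) R"
    "\<P> \<subseteq> sigma_sets (units G) R" "partition_on (units G) R" "sigma_sets (units G) R = {\<Union>C | C. C \<subseteq> R}"
proof -
  define S where "S = {mvs f p | f p. f \<in> F \<and> p \<in> \<P>}"
  have Ps: "\<P> \<subseteq> sets \<mu>" "finite \<P>" "\<Union>\<P> = units G" using P by (auto simp: finite_partition_def partition_on_def)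
  have fF: "finite F" "F \<subseteq> fp" using F by (auto simp: Fpow_def)
  have "S = (\<lambda>(f, p). mvs f p) ` (F \<times> \<P>)" by (auto simp: S_def)
  then have fS: "finite S" using fF Ps by simp
  have Ss: "B \<in> sets \<mu>" if "B \<in> S" for B using that measure_act_set(2) fF Ps by (auto simp: S_def)
  then have "S \<subseteq> sets \<mu>" by blast
  note cf = coarsest_finite_partition[OF fS this, unfolded GM.space_\<nu>]
  have Req: "R = coarsest_partition (units G) S" unfolding R_def partition_act_def S_def[symmetric] by (rule refl)
  show fpR: "finite_partition \<mu> R" unfolding Req by (rule cf(1))
  then show pR: "partition_on (units G) R" by (simp add: finite_partition_def)
  have "finite R" using fpR by (simp add: finite_partition_def)
  show ss: "sigma_sets (units G) R = {\<Union>C | C. C \<subseteq> R}" by (rule sigma_sets_finite_partition[OF \<open>finite R\<close> pR])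
  show a: "mvs f p \<in> sigma_sets (units G) R" if "f \<in> F" "p \<in> \<P>" for f p
  proof -
    have "mvs f p \<in> S" using that by (auto simp: S_def)
    then have "\<exists>C\<subseteq>R. mvs f p = \<Union>C" unfolding Req by (rule cf(2))
    then show ?thesis unfolding ss by (elim exE conjE) (intro CollectI exI conjI)
  qed
  show "\<P> \<subseteq> sigma_sets (units G) R"
  proof
    fix p assume p: "p \<in> \<P>"
    then have "mvs (units H) p = p" using Ps by (intro act_set_units) blast
    then show "p \<in> sigma_sets (units G) R" using a[OF F(2) p] by simp
  qed
qed

end

sublocale content_measure \<subseteq> FM: factor_measure H TH \<nu> G TG \<pi> \<mu>
  by unfold_locales (rule pmp_\<mu>, rule pushforward)

section \<open>From microstates to approximate homomorphisms\<close>

context content_measure begin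

text \<open>A Borel partition \<open>R\<close> refining \<open>\<Q>\<close> is replaced by the fibres of a labelling whose
  cells contain disjoint open sets \<open>N A\<close> exhausting the atoms up to \<open>\<eta>\<close>.\<close>

lemma labelling:
  assumes R: "finite_partition \<mu> R" and Q: "finite_partition \<mu> \<Q>" "refines (units G) R \<Q>"
    and Z: "closedin G.X Z" "measure \<mu> Z = 0" "\<And>q. q \<in> \<Q> \<Longrightarrow> openin G.X (q - Z)" and "\<eta> > 0"
  obtains lab N where "\<And>x. x \<in> units G \<Longrightarrow> lab x \<in> R" "\<And>x q. x \<in> units G \<Longrightarrow> q \<in> \<Q> \<Longrightarrow> lab x \<subseteq> q \<longleftrightarrow> x \<in> q"
    "\<And>A. A \<in> R \<Longrightarrow> openin G.X (N A)" "\<And>A x. A \<in> R \<Longrightarrow> x \<in> N A \<Longrightarrow> lab x = A"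
    "\<And>A. A \<in> R \<Longrightarrow> measure \<mu> (A - N A) < \<eta>"
    "\<And>A. A \<in> R \<Longrightarrow> \<exists>C. closedin G.X C \<and> C \<subseteq> A \<and> C \<subseteq> N A \<and> measure \<mu> (A - C) < \<eta>"
proof -
  have Rp: "finite R" "partition_on (units G) R" "R \<subseteq> sets \<mu>" using R space_\<mu> by (auto simp: finite_partition_def)
  have Qp: "partition_on (units G) \<Q>" "\<Q> \<subseteq> sets \<mu>" using Q space_\<mu> by (auto simp: finite_partition_def)
  \<comment> \<open>The null set \<open>Z\<close> is removed at once, so that the closed cores lie
    in the open sets \<open>q - Z\<close>.\<close>
  have "\<exists>C. closedin G.X C \<and> C \<subseteq> A - Z \<and> measure \<mu> (A - C) < \<eta>" if A: "A \<in> R" for A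
  proof -
    have s: "A - Z \<in> sets \<mu>" "A \<in> sets \<mu>" using Rp(3) A closedG[OF Z(1)] by auto
    obtain C U where CU: "closedin G.X C" "openin G.X U" "C \<subseteq> A - Z" "A - Z \<subseteq> U" "measure \<mu> (U - C) < \<eta>"
      using G.X.regular_approx[OF fin_mu sets_\<mu> s(1) \<open>\<eta> > 0\<close>] by metis
    have "measure \<mu> (A - C) \<le> measure \<mu> ((U - C) \<union> Z)"
      by (rule \<mu>.finite_measure_mono) (use CU openG closedG Z(1) in auto)
    also have "\<dots> \<le> measure \<mu> (U - C) + measure \<mu> Z"
      by (rule measure_Un_le) (use CU openG closedG Z(1) in auto)
    finally show ?thesis using CU Z(2) by (intro exI[of _ C]) auto
  qed
  then obtain C where C: "\<And>A. A \<in> R \<Longrightarrow> closedin G.X (C A)" "\<And>A. A \<in> R \<Longrightarrow> C A \<subseteq> A - Z"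
    "\<And>A. A \<in> R \<Longrightarrow> measure \<mu> (A - C A) < \<eta>" by metis
  obtain as where as: "set as = R" "distinct as" using finite_distinct_list[OF Rp(1)] by blast
  define m where "m = length as"
  have asR: "as ! i \<in> R" if "i < m" for i using that as(1) by (auto simp: m_def)
  have disj: "disjoint_family_on (\<lambda>i. C (as ! i)) {..<m}"
    unfolding disjoint_family_on_def
  proof (intro ballI impI, rule ccontr)
    fix i j assume ij: "i \<in> {..<m}" "j \<in> {..<m}" "i \<noteq> j" "C (as ! i) \<inter> C (as ! j) \<noteq> {}"
    then obtain x where "x \<in> as ! i" "x \<in> as ! j" using C(2) asR by blast
    then have "as ! i = as ! j" using partition_on_eqI[OF Rp(2)] asR ij by blast
    then show False using ij as(2) by (simp add: m_def nth_eq_iff_index_eq)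
  qed
  obtain W where W: "\<And>i. i < m \<Longrightarrow> openin G.X (W i)" "\<And>i. i < m \<Longrightarrow> C (as ! i) \<subseteq> W i" "disjoint_family_on W {..<m}"
    using G.X.disjoint_open_nbhds[of m "\<lambda>i. C (as ! i)"] C(1) asR disj by metis
  define qq where "qq A = (SOME q. q \<in> \<Q> \<and> A \<subseteq> q)" for A
  have qq: "qq A \<in> \<Q> \<and> A \<subseteq> qq A" if "A \<in> R" for A
  proof -
    have "\<exists>q\<in>\<Q>. A \<subseteq> q" using Q(2) that by (simp add: refines_def)
    then obtain q where "q \<in> \<Q> \<and> A \<subseteq> q" by (elim bexE) (rule that, rule conjI)
    then show ?thesis unfolding qq_def by (rule someI[of "\<lambda>q. q \<in> \<Q> \<and> A \<subseteq> q"])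
  qed
  \<comment> \<open>Intersecting with the open set \<open>qq A - Z\<close> keeps the label of a
    point inside the atom of \<open>\<Q>\<close> that contains the point.\<close>
  define N where "N A = (\<Union>i\<in>{i. i < m \<and> as ! i = A}. W i) \<inter> (qq A - Z)" for A
  have oN: "openin G.X (N A)" if "A \<in> R" for A
    unfolding N_def using Z(3) qq[OF that] W(1) by (intro openin_Int openin_Union) auto
  have CN: "C A \<subseteq> N A" if A: "A \<in> R" for A
  proof -
    obtain i where i: "i < m" "as ! i = A" using A as(1) by (metis in_set_conv_nth m_def)
    show ?thesis using W(2)[OF i(1)] C(2)[OF A] qq[OF A] i by (auto simp: N_def)
  qed
  have Ndisj: "A = B" if xAB: "x \<in> N A" "x \<in> N B" for x A B
  proof -
    obtain i j where "i < m" "as ! i = A" "x \<in> W i" "j < m" "as ! j = B" "x \<in> W j" using xAB by (auto simp: N_def)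
    moreover from this have "i = j" using W(3) unfolding disjoint_family_on_def by (metis IntI empty_iff lessThan_iff)
    ultimately show ?thesis by simp
  qed
  have Nq: "x \<in> qq A" if "x \<in> N A" for x A using that by (simp add: N_def)
  \<comment> \<open>Outside the sets \<open>N A\<close> a point is labelled by its own atom of
    \<open>R\<close>.\<close>
  define lab where "lab x = (if \<exists>A\<in>R. x \<in> N A then THE A. A \<in> R \<and> x \<in> N A else SOME A. A \<in> R \<and> x \<in> A)" for x
  have labN: "lab x = A" if "A \<in> R" "x \<in> N A" for A x
  proof -
    have "(THE A. A \<in> R \<and> x \<in> N A) = A" by (rule the_equality) (use that Ndisj in auto)
    then show ?thesis using that by (auto simp: lab_def)
  qed
  have lab: "lab x \<in> R \<and> x \<in> qq (lab x)" if x: "x \<in> units G" for x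
  proof (cases "\<exists>A\<in>R. x \<in> N A")
    case True
    then obtain A where "A \<in> R" "x \<in> N A" by blast
    then show ?thesis using labN Nq by metis
  next
    case False
    have "\<exists>A. A \<in> R \<and> x \<in> A" using x Rp(2) unfolding partition_on_def by blast
    then have "lab x \<in> R \<and> x \<in> lab x" unfolding lab_def using False someI_ex[of "\<lambda>A. A \<in> R \<and> x \<in> A"] by simp
    then show ?thesis using qq by blast
  qed
  show ?thesis
  proof (rule that[of lab N])
    show "lab x \<in> R" if "x \<in> units G" for x using lab[OF that] by simp
    show "lab x \<subseteq> q \<longleftrightarrow> x \<in> q" if x: "x \<in> units G" and q: "q \<in> \<Q>" for x q
    proof
      note l = lab[OF x]
      have ne: "lab x \<noteq> {}" using l Rp(2) unfolding partition_on_def by metis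
      assume "lab x \<subseteq> q"
      then obtain y where "y \<in> q" "y \<in> qq (lab x)" using ne qq l by blast
      then have "q = qq (lab x)" using partition_on_eqI[OF Qp(1) q] qq l by blast
      then show "x \<in> q" using l by simp
    next
      note l = lab[OF x]
      assume "x \<in> q"
      then have "q = qq (lab x)" using partition_on_eqI[OF Qp(1) q] qq l by blast
      then show "lab x \<subseteq> q" using qq l by blast
    qed
    show "openin G.X (N A)" if "A \<in> R" for A by (rule oN[OF that])
    show "lab x = A" if "A \<in> R" "x \<in> N A" for A x by (rule labN[OF that])
    show "measure \<mu> (A - N A) < \<eta>" if A: "A \<in> R" for A
    proof -
      have "measure \<mu> (A - N A) \<le> measure \<mu> (A - C A)"
        by (rule \<mu>.finite_measure_mono) (use CN[OF A] Rp(3) A closedG[OF C(1)[OF A]] in auto)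
      then show ?thesis using C(3)[OF A] by simp
    qed
    show "\<exists>C. closedin G.X C \<and> C \<subseteq> A \<and> C \<subseteq> N A \<and> measure \<mu> (A - C) < \<eta>" if A: "A \<in> R" for A
      using C[OF A] CN[OF A] by (intro exI[of _ "C A"]) auto
  qed
qed

lemma measure_Diff_le: "A \<in> sets \<mu> \<Longrightarrow> B \<in> sets \<mu> \<Longrightarrow> measure \<mu> A \<le> measure \<mu> B + measure \<mu> (A - B)"
proof -
  assume s: "A \<in> sets \<mu>" "B \<in> sets \<mu>"
  have "measure \<mu> A \<le> measure \<mu> (B \<union> (A - B))" by (rule \<mu>.finite_measure_mono) (use s in auto)
  also have "\<dots> \<le> measure \<mu> B + measure \<mu> (A - B)" by (rule measure_Un_le) (use s in auto)
  finally show ?thesis .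
qed

text \<open>Two sets are close if both sizes are hardly larger than that of their intersection. Let
  \<open>m\<close> be the mass of \<open>mvs f P\<close> and \<open>f'\<close> an open approximation
  of \<open>f\<close>. As densities, the image of \<open>QP\<close> under \<open>\<sigma> f'\<close>
  has at most \<open>m + 6 * e\<close>, \<open>QT\<close> at most \<open>m + 2 * e\<close>, their
  intersection at least \<open>m - 6 * e\<close>, and passing from \<open>f\<close> to
  \<open>f'\<close> costs \<open>2 * e\<close>. This makes
  \<open>2 + 6 + 2 + 12 = 22\<close>.\<close>

lemma hom_estimate:
  assumes f: "f \<in> fp" and e: "e > 0"
    and P: "P \<in> sets \<mu>" "openin G.X NP" "NP \<subseteq> QP" "QP \<subseteq> units G" "measure \<mu> (P - NP) \<le> e" "L QP \<le> measure \<mu> P + e"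
    and T: "openin G.X NT" "NT \<subseteq> QT" "QT \<subseteq> units G" "L QT \<le> measure \<mu> (mvs f P) + e"
    and C: "closedin G.X C" "C \<subseteq> mvs f P" "C \<subseteq> NT" "measure \<mu> (mvs f P - C) \<le> e"
  shows "eventually (\<lambda>(n, \<sigma>, x). normcard n (sym_diff (fin_act_set (\<sigma> f) {i\<in>{1..n}. x i \<in> QP}) {i\<in>{1..n}. x i \<in> QT}) \<le> 22 * e) (config L)"
proof -
  let ?pre = "\<lambda>f. {x \<in> units G. \<pi> x \<in> src H ` f}" and ?fP = "mvs f P"
  note fD = fpD[OF f]
  obtain f' where f': "f' \<in> H.open_pseudogroup" "measure \<nu> (src H ` (f - f')) + measure \<nu> (src H ` (f' - f)) < e"
    using H.approx_open_pseudogroup[OF f e] by blast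
  note fb = H.open_pseudogroup_basic[OF f'(1)]
  note f'D = fpD[OF fb(5)]
  have nn: "0 \<le> measure \<nu> (src H ` (f - f'))" "0 \<le> measure \<nu> (src H ` (f' - f))" by simp_all
  have sd: "src H ` (f - f') \<in> sets \<nu>" "src H ` (f' - f) \<in> sets \<nu>" "src H ` f \<in> sets \<nu>" "src H ` f' \<in> sets \<nu>"
    using H.src_sets fD(1) f'D(1) by auto
  let ?m = "measure \<mu> ?fP"
  have Pu: "P \<subseteq> units G" using sets.sets_into_space[OF P(1)] space_\<mu> by simp
  have aS: "?fP \<in> sets \<mu>" by (rule FM.measure_act_set(2)[OF f P(1)])
  have mP: "?m = measure \<mu> {x \<in> P. \<pi> x \<in> src H ` f}" by (rule FM.measure_act_set(1)[OF f P(1)])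
  obtain W where W: "openin G.X W" "C \<subseteq> W" "G.X closure_of W \<subseteq> NT" using G.X.open_nbhd[OF C(1) T(1) C(3)] by blast
  have WW: "W \<subseteq> G.X closure_of W" using closure_of_subset[OF openin_subset[OF W(1)]] .
  \<comment> \<open>Points of \<open>NP\<close> that \<open>f'\<close> carries into
    \<open>W\<close>; the set is open, so its mass is a lower bound for \<open>L\<close>. Most of
    their indices are sent into the intersection.\<close>
  define O1 where "O1 = {x. \<exists>y\<in>W. moves f' x y} \<inter> NP"
  have oO: "openin G.X O1" unfolding O1_def using open_preimage[OF fb(1) W(1)] P(2) by auto
  \<comment> \<open>The closure of the domain is removed instead of the domain, so that
    \<open>E\<close> is open; the difference is null.\<close>
  define E where "E = units G - {x \<in> units G. \<pi> x \<in> H.X closure_of (src H ` f')}"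
  have cle: "closedin G.X {x \<in> units G. \<pi> x \<in> H.X closure_of (src H ` f')}"
    using closedin_continuous_map_preimage[OF \<pi>_contX, of "H.X closure_of (src H ` f')"] unfolding G.topspace_X by simp
  have oE: "openin G.X E" unfolding E_def by (rule openin_diff[OF openin_unitsI cle])
  have oNE: "openin G.X (NP \<inter> E)" using P(2) oE by auto
  have osf: "openin H.X (src H ` f')" by (rule H.open_map_src[OF fb(1)])
  have sub_cl: "src H ` f' \<subseteq> H.X closure_of (src H ` f')" using closure_of_subset[OF openin_subset[OF osf]] .
  note mpre = FM.measure_preimage
  have LO: "L O1 \<ge> ?m - 3 * e"
  proof -
    \<comment> \<open>The part of \<open>P\<close> that \<open>f\<close> carries onto
      \<open>C\<close>. Invariance gives it the mass of \<open>C\<close>, and up to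
      \<open>2 * e\<close> it lies in \<open>O1\<close>.\<close>
    define M where "M = {x. \<exists>y\<in>C. moves f x y}"
    have "M = mvs (H.finv f) C"
      unfolding M_def using act_set_eq(1)[OF H.finv_images(1)[OF fD(2)] H.finv_inj(1)[OF fD(2,3,4)] closedin_units[OF C(1)]]
      by (auto simp: moves_finv[OF fD(2)])
    then have Ms: "M \<in> sets \<mu>" using FM.measure_act_set(2)[OF H.finv_full_pseudogroup[OF f] closedG[OF C(1)]] by simp
    have MP: "M \<subseteq> P"
    proof
      fix x assume "x \<in> M"
      then obtain y where y: "y \<in> C" "moves f x y" by (auto simp: M_def)
      then obtain x' where "x' \<in> P" "moves f x' y" using C(2) act_set_eq(1)[OF fD(2,3) Pu] by blast
      then show "x \<in> P" using moves_inj[OF fD(4)] y by blast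
    qed
    have "mvs f M = C"
    proof -
      have "mvs f M = {y. \<exists>x\<in>M. moves f x y}" by (rule act_set_eq(1)[OF fD(2,3)]) (use MP Pu in auto)
      also have "\<dots> = C"
      proof (intro equalityI subsetI)
        fix y assume "y \<in> {y. \<exists>x\<in>M. moves f x y}"
        then show "y \<in> C" unfolding M_def using moves_fun[OF fD(3)] by blast
      next
        fix y assume y: "y \<in> C"
        then obtain x where "moves f x y" using C(2) act_set_eq(1)[OF fD(2,3) Pu] by blast
        then show "y \<in> {y. \<exists>x\<in>M. moves f x y}" using y unfolding M_def by blast
      qed
      finally show ?thesis .
    qed
    moreover have "{x \<in> M. \<pi> x \<in> src H ` f} = M" using moves_\<pi>(1) by (auto simp: M_def)
    ultimately have "measure \<mu> M = measure \<mu> C" using FM.measure_act_set(1)[OF f Ms] by simp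
    moreover have "?m \<le> measure \<mu> C + e" using measure_Diff_le[OF aS closedG[OF C(1)]] C(4) by linarith
    ultimately have 1: "?m \<le> measure \<mu> M + e" by simp
    have "M - O1 \<subseteq> (?pre (f - f')) \<union> (P - NP)"
    proof
      fix x assume x: "x \<in> M - O1"
      then obtain y g where g: "y \<in> C" "g \<in> arr G" "\<pi> g \<in> f" "src G g = x" "rng G g = y" by (auto simp: M_def moves_def lift_def)
      show "x \<in> (?pre (f - f')) \<union> (P - NP)"
      proof (cases "\<pi> g \<in> f'")
        case True
        then have "moves f' x y" using g by (auto simp: moves_def lift_def)
        then have "x \<notin> NP" using x g(1) W(2) by (auto simp: O1_def)
        then show ?thesis using x MP by auto
      next
        case False
        then have "\<pi> x \<in> src H ` (f - f')" using g \<pi>_src[OF g(2)] by auto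
        then show ?thesis using g by auto
      qed
    qed
    then have "measure \<mu> (M - O1) \<le> measure \<mu> ((?pre (f - f')) \<union> (P - NP))"
      by (rule \<mu>.finite_measure_mono) (use mpre(2)[OF sd(1)] P(1) openG[OF P(2)] in auto)
    also have "\<dots> \<le> measure \<mu> (?pre (f - f')) + measure \<mu> (P - NP)"
      by (rule measure_Un_le) (use mpre(2)[OF sd(1)] P(1) openG[OF P(2)] in auto)
    finally have "measure \<mu> (M - O1) \<le> 2 * e" using mpre(1)[OF sd(1)] f'(2) nn P(5) by linarith
    then have "?m - 3 * e \<le> measure \<mu> O1" using 1 measure_Diff_le[OF Ms openG[OF oO]] by linarith
    also have "\<dots> \<le> L O1" by (rule open_le[OF oO])
    finally show ?thesis .
  qed
  \<comment> \<open>Indices with points in \<open>NP \<inter> E\<close> mostly lie outside the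
    domain of \<open>\<sigma> f'\<close>, so this difference bounds the size of the image of
    \<open>QP\<close>.\<close>
  have LS: "L QP - L (NP \<inter> E) \<le> ?m + 3 * e"
  proof -
    let ?c = "{x \<in> units G. \<pi> x \<in> H.X closure_of (src H ` f')}" and ?Pf = "{x \<in> P. \<pi> x \<in> src H ` f}"
    let ?Z = "?c - (?pre f')"
    let ?Y = "(?pre (f' - f)) \<union> ?Z"
    have c1: "measure \<mu> ?Z = 0"
    proof -
      have "measure \<mu> ?Z = measure \<mu> ?c - measure \<mu> (?pre f')"
        by (rule \<mu>.finite_measure_Diff) (use mpre(2)[OF sd(4)] closedG[OF cle] sub_cl in auto)
      also have "\<dots> = 0" using mpre(1)[OF sd(4)] mpre(1)[OF H.closed_\<nu>, of "H.X closure_of (src H ` f')"] fb(7) by simp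
      finally show ?thesis .
    qed
    have fs: "?Pf \<in> sets \<mu>"
    proof -
      have "?Pf = P \<inter> (?pre f)" using Pu by auto
      then show ?thesis using P(1) mpre(2)[OF sd(3)] by simp
    qed
    have "P - (NP \<inter> E) \<subseteq> (P - NP) \<union> (?Pf \<union> ?Y)"
      using Pu by (auto simp: E_def)
    then have "measure \<mu> (P - (NP \<inter> E)) \<le> measure \<mu> ((P - NP) \<union> (?Pf \<union> ?Y))"
      by (rule \<mu>.finite_measure_mono) (use mpre(2)[OF sd(2)] mpre(2)[OF sd(4)] P(1) openG[OF P(2)] fs closedG[OF cle] in auto)
    also have "\<dots> \<le> measure \<mu> (P - NP) + measure \<mu> (?Pf \<union> ?Y)"
      by (rule measure_Un_le) (use mpre(2)[OF sd(2)] mpre(2)[OF sd(4)] P(1) openG[OF P(2)] fs closedG[OF cle] in auto)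
    also have "measure \<mu> (?Pf \<union> ?Y)
      \<le> measure \<mu> ?Pf + measure \<mu> ?Y"
      by (rule measure_Un_le) (use mpre(2)[OF sd(2)] mpre(2)[OF sd(4)] fs closedG[OF cle] in auto)
    also have "measure \<mu> ?Y
      \<le> measure \<mu> (?pre (f' - f)) + measure \<mu> ?Z"
      by (rule measure_Un_le) (use mpre(2)[OF sd(2)] mpre(2)[OF sd(4)] closedG[OF cle] in auto)
    finally have "measure \<mu> (P - (NP \<inter> E)) \<le> e + (?m + (e + 0))"
      using mpre(1)[OF sd(2)] f'(2) nn P(5) c1 mP by linarith
    then have "measure \<mu> P \<le> measure \<mu> (NP \<inter> E) + ?m + 2 * e" using measure_Diff_le[OF P(1) openG[OF oNE]] by linarith
    then show ?thesis using open_le[OF oNE] P(6) by linarith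
  qed
  have TW: "closedin G.X (G.X closure_of W)" "closedin G.X (units G - NT)"
    using closedin_diff[OF closedin_topspace T(1)] unfolding G.topspace_X by auto
  have sm: "src_meas H \<nu> (sym_diff f f') = ennreal (measure \<nu> (src H ` (f - f')) + measure \<nu> (src H ` (f' - f)))"
    by (rule H.src_meas_sym_diff[OF f fb(5)])
  have dis: "G.X closure_of W \<inter> (units G - NT) = {}" using W(3) by blast
  show ?thesis
    using ev_basic ev_dom[OF fb(6) e] ev_close[OF f'(1) TW dis e]
      ev_cont[OF f fb(5) e sm add_nonneg_nonneg[OF nn]] ev_emp[OF e, where A=QP and L=L] ev_emp[OF e, where A=QT and L=L]
      ev_emp[OF e, where A="NP \<inter> E" and L=L] ev_emp[OF e, where A=O1 and L=L]
  proof eventually_elim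
    case (elim z)
    obtain n \<sigma> x where z: "z = (n, \<sigma>, x)" by (cases z)
    note el = elim[unfolded z case_prod_conv]
    have n: "0 < n" and \<sigma>: "\<And>f. f \<in> fp \<Longrightarrow> \<sigma> f \<in> fin_pseudogroup n" and xu: "\<And>i. i \<in> {1..n} \<Longrightarrow> x i \<in> units G"
      using el(1) by (auto simp: Map_set_def)
    note sD = fin_pseudogroupD[OF \<sigma>[OF fb(5)]] and s0D = fin_pseudogroupD[OF \<sigma>[OF f]]
    let ?I = "\<lambda>A. {i\<in>{1..n}. x i \<in> A}"
    let ?U = "fin_act_set (\<sigma> f) (?I QP)" and ?S = "fin_act_set (\<sigma> f') (?I QP)" and ?T = "?I QT"
    have emp: "real (card (?I A)) = emp n x A * n" for A using n by (simp add: emp_def)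
    have fS: "finite ?U" "finite ?S" "finite ?T"
    proof -
      have fs: "fin_act_set s A \<subseteq> fst ` s" for s A
      proof
        fix i assume "i \<in> fin_act_set s A"
        then obtain j where "(i, j) \<in> s" by (auto simp: fin_act_set_def)
        then show "i \<in> fst ` s" by (rule image_eqI[rotated]) simp
      qed
      show "finite ?U" by (rule finite_subset[OF fs finite_imageI[OF s0D(4)]])
      show "finite ?S" by (rule finite_subset[OF fs finite_imageI[OF sD(4)]])
    qed simp
    let ?D = "sym_diff (\<sigma> f) (\<sigma> f')"
    have fDD: "finite ?D" using sD(4) s0D(4) by simp
    have 1: "real (card (sym_diff ?U ?S)) \<le> 2 * e * n"
    proof -
      have "sym_diff ?U ?S \<subseteq> fst ` ?D"
      proof
        fix i assume "i \<in> sym_diff ?U ?S"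
        then obtain j where "(i, j) \<in> ?D" unfolding fin_act_set_def by blast
        then show "i \<in> fst ` ?D" by (rule image_eqI[rotated]) simp
      qed
      then have "card (sym_diff ?U ?S) \<le> card (fst ` ?D)" by (rule card_mono[OF finite_imageI[OF fDD]])
      also have "\<dots> \<le> card ?D" by (rule card_image_le[OF fDD])
      finally have "card (sym_diff ?U ?S) \<le> card ?D" .
      moreover have "real (card ?D) \<le> (e + (measure \<nu> (src H ` (f - f')) + measure \<nu> (src H ` (f' - f)))) * n"
        by (rule normcard_less[OF el(4) fDD n]) simp
      moreover have "\<dots> \<le> 2 * e * n" using f'(2) by (intro mult_right_mono) auto
      ultimately show ?thesis by linarith
    qed
    let ?Bd = "{i\<in>{1..n}. (mv f' (x i) = None) \<noteq> (fin_act (\<sigma> f') i = None)}"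
    let ?Bc = "{i\<in>{1..n}. \<exists>j y. (j, i) \<in> \<sigma> f' \<and> moves f' (x i) y \<and> y \<in> G.X closure_of W \<and> x j \<in> units G - NT}"
    let ?dom = "{i\<in>?I QP. \<exists>j. (j, i) \<in> \<sigma> f'}"
    \<comment> \<open>The term \<open>6 * e\<close> consists of three from \<open>LS\<close>, two
      from the empirical measures and one from the domain mismatch.\<close>
    have 2: "real (card ?S) \<le> (?m + 6 * e) * n"
    proof -
      have "?S \<subseteq> (\<lambda>i. THE j. (j, i) \<in> \<sigma> f') ` ?dom"
      proof
        fix j assume "j \<in> ?S"
        then obtain i where i: "i \<in> ?I QP" "(j, i) \<in> \<sigma> f'" by (auto simp: fin_act_set_def)
        then have "(THE j. (j, i) \<in> \<sigma> f') = j" using sD(2) by (intro the_equality)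
        then show "j \<in> (\<lambda>i. THE j. (j, i) \<in> \<sigma> f') ` ?dom" using i by (intro image_eqI[of _ _ i]) auto
      qed
      then have "card ?S \<le> card ?dom" by (rule surj_card_le[rotated]) simp
      moreover have "?I (NP \<inter> E) \<subseteq> (?I QP - ?dom) \<union> ?Bd"
      proof (rule subsetI, rule ccontr)
        fix i assume i: "i \<in> ?I (NP \<inter> E)" "i \<notin> (?I QP - ?dom) \<union> ?Bd"
        then have "\<pi> (x i) \<notin> src H ` f'" using sub_cl by (auto simp: E_def)
        then have "mv f' (x i) = None" using act_iff(2)[OF f'D(2,3)] xu i by blast
        moreover have "(mv f' (x i) = None) = (fin_act (\<sigma> f') i = None)" using i by blast
        ultimately have "\<forall>j. (j, i) \<notin> \<sigma> f'" using fin_act_iff(2)[OF \<sigma>[OF fb(5)]] by metis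
        then show False using i P(3) by auto
      qed
      then have "real (card (?I (NP \<inter> E))) \<le> real (card (?I QP - ?dom)) + real (card ?Bd)" by (rule card_le_Un) auto
      moreover have "real (card (?I QP - ?dom)) = real (card (?I QP)) - real (card ?dom)"
        by (subst card_Diff_subset) (auto intro!: of_nat_diff card_mono)
      ultimately have "real (card ?S) \<le> real (card (?I QP)) - real (card (?I (NP \<inter> E))) + e * n" using el(2) by linarith
      also have "\<dots> = (emp n x QP - emp n x (NP \<inter> E) + e) * n" unfolding emp by (simp add: algebra_simps)
      also have "\<dots> \<le> (?m + 6 * e) * n" using el(5,7) LS by (intro mult_right_mono) (auto simp: abs_less_iff)
      finally show ?thesis .
    qed
    have 3: "real (card ?T) \<le> (?m + 2 * e) * n"
      unfolding emp using el(6) T(4) by (intro mult_right_mono) (auto simp: abs_less_iff)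
    \<comment> \<open>The term \<open>6 * e\<close> consists of three from \<open>LO\<close>, one
      from the empirical measure and one each for \<open>?Bd\<close> and \<open>?Bc\<close>.\<close>
    have 4: "(?m - 6 * e) * n \<le> real (card (?S \<inter> ?T))"
    proof -
      have "?I O1 \<subseteq> {i. \<exists>j\<in>?S \<inter> ?T. (j, i) \<in> \<sigma> f'} \<union> (?Bd \<union> ?Bc)"
      proof (rule subsetI, rule ccontr)
        fix i assume i: "i \<in> ?I O1" "i \<notin> {i. \<exists>j\<in>?S \<inter> ?T. (j, i) \<in> \<sigma> f'} \<union> (?Bd \<union> ?Bc)"
        then obtain y where y: "y \<in> W" "moves f' (x i) y" by (auto simp: O1_def)
        then have "mv f' (x i) = Some y" using act_iff(1)[OF f'D(2,3) xu] i by blast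
        moreover have "(mv f' (x i) = None) = (fin_act (\<sigma> f') i = None)" using i by blast
        ultimately obtain j where j: "(j, i) \<in> \<sigma> f'" using fin_act_iff(2)[OF \<sigma>[OF fb(5)]] by (metis option.distinct(1))
        then have jn: "j \<in> {1..n}" using sD(1) by auto
        have "i \<in> ?I QP" using i P(3) by (auto simp: O1_def)
        then have "j \<in> ?S" using j by (auto simp: fin_act_set_def)
        moreover have "x j \<in> NT"
        proof (rule ccontr)
          assume "x j \<notin> NT"
          then have "i \<in> ?Bc" using j y WW xu[OF jn] i by blast
          then show False using i by blast
        qed
        then have "j \<in> ?T" using T(2) jn by auto
        ultimately show False using i j by blast
      qed
      moreover note p = fin_preimage_card[OF \<sigma>[OF fb(5)], of "?S \<inter> ?T"]
      ultimately have "real (card (?I O1)) \<le> real (card {i. \<exists>j\<in>?S \<inter> ?T. (j, i) \<in> \<sigma> f'}) + real (card (?Bd \<union> ?Bc))"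
        using fS by (intro card_le_Un) auto
      also have "real (card (?Bd \<union> ?Bc)) \<le> real (card ?Bd) + real (card ?Bc)" by (rule card_Un_real)
      finally have "real (card (?I O1)) \<le> real (card (?S \<inter> ?T)) + (e * n + e * n)"
        using p(1) fS el(2,3) by simp
      then have "emp n x O1 * n - 2 * e * n \<le> real (card (?S \<inter> ?T))" unfolding emp by simp
      moreover have "(?m - 6 * e) * n \<le> (emp n x O1 - 2 * e) * n"
        using el(8) LO by (intro mult_right_mono) (auto simp: abs_less_iff)
      ultimately show ?thesis by (simp add: algebra_simps)
    qed
    have "real (card (?S - ?T)) = real (card ?S) - real (card (?S \<inter> ?T))"
      using fS card_Diff_subset_Int[of ?S ?T] card_mono[of ?S "?S \<inter> ?T"] by (simp add: of_nat_diff)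
    moreover have "real (card (?T - ?S)) = real (card ?T) - real (card (?S \<inter> ?T))"
      using fS card_Diff_subset_Int[of ?T ?S] card_mono[of ?T "?S \<inter> ?T"] by (simp add: of_nat_diff Int_commute)
    moreover have "sym_diff ?U ?T \<subseteq> sym_diff ?U ?S \<union> ((?S - ?T) \<union> (?T - ?S))" by blast
    then have "real (card (sym_diff ?U ?T)) \<le> real (card (sym_diff ?U ?S)) + real (card ((?S - ?T) \<union> (?T - ?S)))"
      by (rule card_le_Un) (use fS in auto)
    moreover have "real (card ((?S - ?T) \<union> (?T - ?S))) \<le> real (card (?S - ?T)) + real (card (?T - ?S))" by (rule card_Un_real)
    ultimately have "real (card (sym_diff ?U ?T)) \<le> 2 * e * n + (?m + 6 * e) * n + (?m + 2 * e) * n - 2 * ((?m - 6 * e) * n)"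
      using 1 2 3 4 by linarith
    also have "\<dots> = 22 * e * n" by (simp add: algebra_simps)
    finally show ?case using n by (simp add: z normcard_def field_simps)
  qed
qed

text \<open>A microstate is read through the labelling: \<open>B\<close> goes to the indices whose
  label lies in \<open>B\<close>. Labels are atoms, so unions and intersections are preserved
  exactly, and on \<open>\<Q>\<close> the true itinerary appears; only the masses and the
  compatibility with the action are approximate.\<close>

lemma microstate_hom:
  assumes Q: "finite_partition \<mu> \<Q>" and Z: "closedin G.X Z" "measure \<mu> Z = 0" "\<And>q. q \<in> \<Q> \<Longrightarrow> openin G.X (q - Z)"
    and P: "finite_partition \<mu> \<P>" "refines (units G) \<P> \<Q>" and F: "F \<in> Fpow fp" "units H \<in> F" and "\<delta> > 0"
  defines "\<Sigma> \<equiv> alg \<P> F"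
  obtains lab where "\<And>x q. x \<in> units G \<Longrightarrow> q \<in> \<Q> \<Longrightarrow> lab x \<subseteq> q \<longleftrightarrow> x \<in> q"
    "eventually (\<lambda>(n, \<sigma>, x). restrict (\<lambda>B. {i\<in>{1..n}. lab (x i) \<subseteq> B}) \<Sigma> \<in> Hom G H \<mu> \<pi> n \<sigma> \<P> F \<delta>) (config L)"
    "\<Q> \<subseteq> \<Sigma>" "finite \<Sigma>"
proof -
  define R where "R = partition_act G H \<pi> \<P> F"
  note pa = FM.partition_act_props[OF P(1) F, folded R_def]
  have \<Sigma>: "\<Sigma> = {\<Union>C | C. C \<subseteq> R}" unfolding \<Sigma>_def R_def[symmetric] by (rule pa(5))
  have Rf: "finite R" "R \<subseteq> sets \<mu>" using pa(1) by (auto simp: finite_partition_def)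
  have Pf: "finite \<P>" "\<P> \<subseteq> sets \<mu>" "partition_on (units G) \<P>" using P(1) space_\<mu> by (auto simp: finite_partition_def)
  have fin\<Sigma>: "finite \<Sigma>"
  proof -
    have "\<Sigma> = Union ` Pow R" unfolding \<Sigma> by auto
    then show ?thesis using Rf(1) by simp
  qed
  have unionR: "\<Union>C \<in> \<Sigma>" if "C \<subseteq> R" for C using that unfolding \<Sigma> by blast
  have \<Sigma>s: "B \<in> sets \<mu>" if "B \<in> \<Sigma>" for B
    using that Rf unfolding \<Sigma> by (auto intro!: sets.finite_Union intro: finite_subset)
  have P\<Sigma>: "\<P> \<subseteq> \<Sigma>" using pa(3) unfolding \<Sigma>_def R_def .
  have decomp: "B = \<Union>{A \<in> R. A \<subseteq> B}" if "B \<in> \<Sigma>" for B using that unfolding \<Sigma> by blast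
  have Q\<Sigma>: "\<Q> \<subseteq> \<Sigma>"
  proof
    fix q assume q: "q \<in> \<Q>"
    have qp: "partition_on (units G) \<Q>" using Q space_\<mu> by (simp add: finite_partition_def)
    have "q \<subseteq> \<Union>{A \<in> R. A \<subseteq> q}"
    proof
      fix x assume x: "x \<in> q"
      then have xu: "x \<in> units G" using partition_onD1[OF qp] q by blast
      then obtain p where p: "p \<in> \<P>" "x \<in> p" using partition_onD1[OF Pf(3)] by blast
      obtain q' where q': "q' \<in> \<Q>" "p \<subseteq> q'" using P(2) p(1) unfolding refines_def by blast
      have "q' = q" using partition_on_eqI[OF qp q'(1) q] p q' x by blast
      moreover obtain A where "A \<in> R" "A \<subseteq> p" "x \<in> A" using decomp[of p] P\<Sigma> p by blast
      ultimately show "x \<in> \<Union>{A \<in> R. A \<subseteq> q}" using q'(2) by blast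
    qed
    then have "q = \<Union>{A \<in> R. A \<subseteq> q}" by blast
    then show "q \<in> \<Sigma>" using unionR[of "{A \<in> R. A \<subseteq> q}"] by simp
  qed
  have RQ: "refines (units G) R \<Q>"
    unfolding refines_def
  proof (intro conjI ballI)
    show "partition_on (units G) R" by (rule pa(4))
    show qp: "partition_on (units G) \<Q>" using Q space_\<mu> by (simp add: finite_partition_def)
    fix A assume A: "A \<in> R"
    then have "A \<noteq> {}" using partition_onD3[OF pa(4)] by metis
    then obtain x where x: "x \<in> A" by blast
    then have "x \<in> units G" using A partition_onD1[OF pa(4)] by blast
    then obtain q where q: "q \<in> \<Q>" "x \<in> q" using partition_onD1[OF qp] by blast
    then obtain A' where A': "A' \<in> R" "A' \<subseteq> q" "x \<in> A'" using decomp[of q] Q\<Sigma> by blast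
    then have "A' = A" using partition_on_eqI[OF pa(4)] A x by blast
    then show "\<exists>q\<in>\<Q>. A \<subseteq> q" using q A' by blast
  qed
  define r where "r = real (card R)"
  \<comment> \<open>Each atom of \<open>\<P>\<close> costs \<open>22 * e\<close> by
    \<open>hom_estimate\<close>, each atom of \<open>R\<close> costs \<open>2 * e\<close> for its
    mass; the factor 23 keeps both sums strictly below \<open>\<delta>\<close>.\<close>
  define e where "e = \<delta> / (23 * (real (card \<P>) + r + 1))"
  define \<eta> where "\<eta> = e / (r + 1)"
  have r0: "0 \<le> r" by (simp add: r_def)
  have e0: "e > 0" using \<open>\<delta> > 0\<close> r0 by (simp add: e_def)
  have eP: "real (card \<P>) * (22 * e) < \<delta>" "r * (2 * e) < \<delta>"
  proof -
    have "23 * (real (card \<P>) + r + 1) * e = \<delta>" using r0 by (simp add: e_def add_nonneg_eq_0_iff)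
    moreover have "real (card \<P>) * (22 * e) < 23 * (real (card \<P>) + r + 1) * e" "r * (2 * e) < 23 * (real (card \<P>) + r + 1) * e"
    proof -
      have "22 * real (card \<P>) < 23 * (real (card \<P>) + r + 1)" "2 * r < 23 * (real (card \<P>) + r + 1)"
        using r0 of_nat_0_le_iff[of "card \<P>"] unfolding distrib_left by linarith+
      from this[THEN mult_strict_right_mono[OF _ e0]] show "real (card \<P>) * (22 * e) < 23 * (real (card \<P>) + r + 1) * e"
        "r * (2 * e) < 23 * (real (card \<P>) + r + 1) * e" by (simp_all add: ac_simps)
    qed
    ultimately show "real (card \<P>) * (22 * e) < \<delta>" "r * (2 * e) < \<delta>" by simp_all
  qed
  have \<eta>: "\<eta> > 0" "r * \<eta> \<le> e"
  proof -
    show "\<eta> > 0" using e0 r0 by (simp add: \<eta>_def)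
    have "r * \<eta> = e * (r / (r + 1))" by (simp add: \<eta>_def)
    also have "\<dots> \<le> e * 1" using e0 r0 by (intro mult_left_mono) auto
    finally show "r * \<eta> \<le> e" by simp
  qed
  obtain lab N where lab: "\<And>x. x \<in> units G \<Longrightarrow> lab x \<in> R" "\<And>x q. x \<in> units G \<Longrightarrow> q \<in> \<Q> \<Longrightarrow> lab x \<subseteq> q \<longleftrightarrow> x \<in> q"
    and N: "\<And>A. A \<in> R \<Longrightarrow> openin G.X (N A)" "\<And>A x. A \<in> R \<Longrightarrow> x \<in> N A \<Longrightarrow> lab x = A"
    "\<And>A. A \<in> R \<Longrightarrow> measure \<mu> (A - N A) < \<eta>"
    "\<And>A. A \<in> R \<Longrightarrow> \<exists>C. closedin G.X C \<and> C \<subseteq> A \<and> C \<subseteq> N A \<and> measure \<mu> (A - C) < \<eta>"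
    by (rule labelling[OF pa(1) Q RQ Z \<eta>(1)], assumption, rule that)
  obtain C where C: "\<And>A. A \<in> R \<Longrightarrow> closedin G.X (C A)" "\<And>A. A \<in> R \<Longrightarrow> C A \<subseteq> A" "\<And>A. A \<in> R \<Longrightarrow> C A \<subseteq> N A"
    "\<And>A. A \<in> R \<Longrightarrow> measure \<mu> (A - C A) < \<eta>" using N(4) by metis
  define \<Lambda> where "\<Lambda> B = {x \<in> units G. lab x \<subseteq> B}" for B
  define NN where "NN B = (\<Union>A\<in>{A \<in> R. A \<subseteq> B}. N A)" for B
  define CC where "CC B = (\<Union>A\<in>{A \<in> R. A \<subseteq> B}. C A)" for B
  have oNN: "openin G.X (NN B)" for B unfolding NN_def using N(1) by (intro openin_Union) auto
  have cCC: "closedin G.X (CC B)" for B unfolding CC_def using C(1) Rf(1) by (intro closedin_Union) auto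
  have CCB: "CC B \<subseteq> B" "CC B \<subseteq> NN B" for B using C(2,3) unfolding CC_def NN_def by blast+
  have NNL: "NN B \<subseteq> \<Lambda> B" for B
    using N(2) openin_units[OF N(1)] unfolding NN_def \<Lambda>_def by blast
  have \<Lambda>u: "\<Lambda> B \<subseteq> units G" for B by (auto simp: \<Lambda>_def)
  have mC: "measure \<mu> (B - CC B) \<le> e" if B: "B \<in> \<Sigma>" for B
  proof -
    have "B - CC B \<subseteq> (\<Union>A\<in>{A \<in> R. A \<subseteq> B}. A - C A)"
    proof
      fix x assume x: "x \<in> B - CC B"
      then obtain A where "A \<in> R" "A \<subseteq> B" "x \<in> A" using decomp[OF B] by blast
      then show "x \<in> (\<Union>A\<in>{A \<in> R. A \<subseteq> B}. A - C A)" using x by (auto simp: CC_def)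
    qed
    then have "measure \<mu> (B - CC B) \<le> measure \<mu> (\<Union>A\<in>{A \<in> R. A \<subseteq> B}. A - C A)"
      by (rule \<mu>.finite_measure_mono) (use Rf closedG[OF C(1)] in \<open>auto intro!: sets.finite_UN\<close>)
    also have "\<dots> \<le> (\<Sum>A\<in>{A \<in> R. A \<subseteq> B}. measure \<mu> (A - C A))"
      by (rule \<mu>.finite_measure_subadditive_finite) (use Rf closedG[OF C(1)] in auto)
    also have "\<dots> \<le> (\<Sum>A\<in>{A \<in> R. A \<subseteq> B}. \<eta>)"
      by (rule sum_mono) (use C(4) in \<open>auto intro: less_imp_le\<close>)
    also have "\<dots> = real (card {A \<in> R. A \<subseteq> B}) * \<eta>" by simp
    also have "\<dots> \<le> r * \<eta>"
      unfolding r_def using \<eta>(1) card_mono[OF Rf(1), of "{A \<in> R. A \<subseteq> B}"] by (intro mult_right_mono) auto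
    finally show ?thesis using \<eta>(2) by simp
  qed
  have mN: "measure \<mu> (B - NN B) \<le> e" if B: "B \<in> \<Sigma>" for B
  proof -
    have "measure \<mu> (B - NN B) \<le> measure \<mu> (B - CC B)"
      by (rule \<mu>.finite_measure_mono) (use CCB(2)[of B] \<Sigma>s[OF B] closedG[OF cCC] in auto)
    then show ?thesis using mC[OF B] by simp
  qed
  have labne: "lab x \<noteq> {}" if "x \<in> units G" for x using lab(1)[OF that] partition_onD3[OF pa(4)] by metis
  have lab_iff: "lab x \<subseteq> \<Union>D \<longleftrightarrow> lab x \<in> D" if x: "x \<in> units G" and D: "D \<subseteq> R" for x D
  proof
    assume "lab x \<subseteq> \<Union>D"
    then obtain y A where "y \<in> lab x" "A \<in> D" "y \<in> A" using labne[OF x] by blast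
    then show "lab x \<in> D" using partition_on_eqI[OF pa(4) lab(1)[OF x], of A y] D by blast
  qed blast
  have unitsR: "units G = \<Union>R" by (rule partition_onD1[OF pa(4)])
  have compl\<Sigma>: "units G - B \<in> \<Sigma>" if "B \<in> \<Sigma>" for B
    using that unfolding \<Sigma>_def by (rule sigma_sets.Compl)
  \<comment> \<open>The labelling respects complements, which turns the lower bound for
    \<open>L\<close> on \<open>\<Lambda> B\<close> into an upper bound although
    \<open>\<Lambda> B\<close> need be neither open nor closed.\<close>
  have \<Lambda>compl: "\<Lambda> (units G - B) = units G - \<Lambda> B" if B: "B \<in> \<Sigma>" for B
  proof -
    obtain D where D: "D \<subseteq> R" "B = \<Union>D" using B unfolding \<Sigma> by blast
    have "units G - B = \<Union>(R - D)"
      unfolding unitsR D(2) using partition_on_eqI[OF pa(4)] D(1) by blast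
    then have "lab x \<subseteq> units G - B \<longleftrightarrow> \<not> lab x \<subseteq> B" if "x \<in> units G" for x
      using lab_iff[OF that, of "R - D"] lab_iff[OF that D(1)] lab(1)[OF that] D(2) by auto
    then show ?thesis by (auto simp: \<Lambda>_def)
  qed
  have L_low: "L (\<Lambda> B) \<ge> measure \<mu> B - e" if B: "B \<in> \<Sigma>" for B
  proof -
    have "measure \<mu> B \<le> measure \<mu> (NN B) + measure \<mu> (B - NN B)" by (rule measure_Diff_le[OF \<Sigma>s[OF B] openG[OF oNN]])
    then show ?thesis using mN[OF B] open_le[OF oNN, of B] L_mono[OF NNL[of B]] by linarith
  qed
  have L_up: "L (\<Lambda> B) \<le> measure \<mu> B + e" if B: "B \<in> \<Sigma>" for B
  proof -
    have "L (\<Lambda> (units G - B)) = 1 - L (\<Lambda> B)" unfolding \<Lambda>compl[OF B] by (rule L_Compl[OF \<Lambda>u])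
    moreover have "measure \<mu> (units G - B) = 1 - measure \<mu> B" using \<mu>.prob_compl[OF \<Sigma>s[OF B]] space_\<mu> by simp
    ultimately show ?thesis using L_low[OF compl\<Sigma>[OF B]] by linarith
  qed
  have est: "eventually (\<lambda>(n, \<sigma>, x). normcard n (sym_diff (fin_act_set (\<sigma> f) {i\<in>{1..n}. x i \<in> \<Lambda> p}) {i\<in>{1..n}. x i \<in> \<Lambda> (mvs f p)}) \<le> 22 * e) (config L)"
    if fp: "f \<in> F" "p \<in> \<P>" for f p
  proof -
    have f: "f \<in> fp" using fp F by (auto simp: Fpow_def)
    have p: "p \<in> \<Sigma>" using fp P\<Sigma> by blast
    have t: "mvs f p \<in> \<Sigma>" unfolding \<Sigma>_def R_def[symmetric] by (rule pa(2)[OF fp])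
    show ?thesis
      by (rule hom_estimate[OF f e0 \<Sigma>s[OF p] oNN NNL \<Lambda>u mN[OF p] L_up[OF p] oNN NNL \<Lambda>u L_up[OF t] cCC CCB mC[OF t]])
  qed
  have fF: "finite F" using F by (simp add: Fpow_def)
  have ev1: "eventually (\<lambda>z. \<forall>f\<in>F. \<forall>p\<in>\<P>. case z of (n, \<sigma>, x) \<Rightarrow> normcard n (sym_diff (fin_act_set (\<sigma> f) {i\<in>{1..n}. x i \<in> \<Lambda> p}) {i\<in>{1..n}. x i \<in> \<Lambda> (mvs f p)}) \<le> 22 * e) (config L)"
    by (intro eventually_ball_finite[OF fF] eventually_ball_finite[OF Pf(1)] ballI est)
  have ev2: "eventually (\<lambda>z. \<forall>A\<in>R. case z of (n, \<sigma>, x) \<Rightarrow> \<bar>emp n x (\<Lambda> A) - L (\<Lambda> A)\<bar> < e) (config L)"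
    by (intro eventually_ball_finite[OF Rf(1)] ballI ev_emp e0)
  show ?thesis
  proof (rule that[OF lab(2) _ Q\<Sigma> fin\<Sigma>])
    show "eventually (\<lambda>(n, \<sigma>, x). restrict (\<lambda>B. {i\<in>{1..n}. lab (x i) \<subseteq> B}) \<Sigma> \<in> Hom G H \<mu> \<pi> n \<sigma> \<P> F \<delta>) (config L)"
      using ev1 ev2 ev_basic
    proof eventually_elim
      case (elim z)
      obtain n \<sigma> x where z: "z = (n, \<sigma>, x)" by (cases z)
      note el = elim[unfolded z case_prod_conv]
      have n: "0 < n" and xu: "\<And>i. i \<in> {1..n} \<Longrightarrow> x i \<in> units G" using el(3) by auto
      let ?\<phi> = "restrict (\<lambda>B. {i\<in>{1..n}. lab (x i) \<subseteq> B}) \<Sigma>"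
      have \<phi>: "?\<phi> B = {i\<in>{1..n}. x i \<in> \<Lambda> B}" if "B \<in> \<Sigma>" for B using that xu by (auto simp: \<Lambda>_def)
      have un: "B \<union> D \<in> \<Sigma>" "B \<inter> D \<in> \<Sigma>" "lab (x i) \<subseteq> B \<union> D \<longleftrightarrow> lab (x i) \<subseteq> B \<or> lab (x i) \<subseteq> D"
        if BD: "B \<in> \<Sigma>" "D \<in> \<Sigma>" and i: "i \<in> {1..n}" for B D i
      proof -
        obtain B' D' where d: "B' \<subseteq> R" "B = \<Union>B'" "D' \<subseteq> R" "D = \<Union>D'" using BD unfolding \<Sigma> by blast
        have "B \<union> D = \<Union>(B' \<union> D')" using d by blast
        moreover have "B \<inter> D = \<Union>(B' \<inter> D')" unfolding d(2,4) using partition_on_eqI[OF pa(4)] d(1,3) by blast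
        ultimately show "B \<union> D \<in> \<Sigma>" "B \<inter> D \<in> \<Sigma>" using unionR[of "B' \<union> D'"] unionR[of "B' \<inter> D'"] d by auto
        show "lab (x i) \<subseteq> B \<union> D \<longleftrightarrow> lab (x i) \<subseteq> B \<or> lab (x i) \<subseteq> D"
          using lab_iff[OF xu[OF i], of "B' \<union> D'"] lab_iff[OF xu[OF i] d(1)] lab_iff[OF xu[OF i] d(3)] d
          unfolding \<open>B \<union> D = \<Union>(B' \<union> D')\<close> by auto
      qed
      have e\<Sigma>: "{} \<in> \<Sigma>" "units G \<in> \<Sigma>" using unionR[of "{}"] unionR[of R] unitsR by auto
      have "?\<phi> \<in> set_homs (units G) \<Sigma> n"
        unfolding set_homs_def
      proof (intro CollectI conjI ballI)
        show "?\<phi> \<in> \<Sigma> \<rightarrow>\<^sub>E Pow {1..n}" by (auto simp: PiE_iff)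
        show "?\<phi> {} = {}" using e\<Sigma>(1) labne xu by auto
        show "?\<phi> (units G) = {1..n}" using e\<Sigma>(2) lab(1)[OF xu] unitsR by auto
        fix B D assume BD: "B \<in> \<Sigma>" "D \<in> \<Sigma>"
        have 1: "1 \<in> {1..n}" using n by simp
        show "?\<phi> (B \<union> D) = ?\<phi> B \<union> ?\<phi> D" using BD un(1)[OF BD 1] un(3)[OF BD] by auto
        show "?\<phi> (B \<inter> D) = ?\<phi> B \<inter> ?\<phi> D" using BD un(2)[OF BD 1] by auto
      qed
      moreover have "(\<Sum>p\<in>\<P>. normcard n (sym_diff (fin_act_set (\<sigma> f) (?\<phi> p)) (?\<phi> (mvs f p)))) < \<delta>" if f: "f \<in> F" for f
      proof -
        have "(\<Sum>p\<in>\<P>. normcard n (sym_diff (fin_act_set (\<sigma> f) (?\<phi> p)) (?\<phi> (mvs f p)))) \<le> (\<Sum>p\<in>\<P>. 22 * e)"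
        proof (rule sum_mono)
          fix p assume p: "p \<in> \<P>"
          have t: "mvs f p \<in> \<Sigma>" unfolding \<Sigma>_def R_def[symmetric] by (rule pa(2)[OF f p])
          show "normcard n (sym_diff (fin_act_set (\<sigma> f) (?\<phi> p)) (?\<phi> (mvs f p))) \<le> 22 * e"
            unfolding \<phi>[OF t] \<phi>[OF subsetD[OF P\<Sigma> p]] using el(1) f p by blast
        qed
        then show ?thesis using eP(1) by simp
      qed
      moreover have "(\<Sum>A\<in>R. \<bar>normcard n (?\<phi> A) - measure \<mu> A\<bar>) < \<delta>"
      proof -
        have "(\<Sum>A\<in>R. \<bar>normcard n (?\<phi> A) - measure \<mu> A\<bar>) \<le> (\<Sum>A\<in>R. 2 * e)"
        proof (rule sum_mono)
          fix A assume A: "A \<in> R"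
          then have A\<Sigma>: "A \<in> \<Sigma>" using unionR[of "{A}"] by simp
          have "normcard n (?\<phi> A) = emp n x (\<Lambda> A)" unfolding \<phi>[OF A\<Sigma>] by (simp add: normcard_def emp_def)
          moreover have "\<bar>emp n x (\<Lambda> A) - L (\<Lambda> A)\<bar> < e" using el(2) A by blast
          ultimately show "\<bar>normcard n (?\<phi> A) - measure \<mu> A\<bar> \<le> 2 * e"
            using L_low[OF A\<Sigma>] L_up[OF A\<Sigma>] by linarith
        qed
        then show ?thesis using eP(2) by (simp add: r_def)
      qed
      ultimately have "?\<phi> \<in> Hom G H \<mu> \<pi> n \<sigma> \<P> F \<delta>"
        unfolding Hom_def R_def[symmetric] \<Sigma>_def[symmetric] by (simp add: \<Sigma>_def R_def)
      then show ?case by (simp add: z)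
    qed
  qed
qed

end

section \<open>From homomorphisms to microstates\<close>

text \<open>Replacing \<open>g\<close> by a function \<open>s\<close> constant on atoms costs
  \<open>a\<close> in each of the two averages. For \<open>s\<close> both averages are sums over
  atoms, which differ by at most \<open>M * e\<close> per atom.\<close>

lemma emp_integral_close:
  fixes g :: "'a \<Rightarrow> real"
  assumes "prob_space \<mu>" and P: "finite_partition \<mu> \<P>" and g: "g \<in> borel_measurable \<mu>"
    and M: "\<And>y. y \<in> space \<mu> \<Longrightarrow> \<bar>g y\<bar> \<le> M"
    and a: "\<And>p y z. p \<in> \<P> \<Longrightarrow> y \<in> p \<Longrightarrow> z \<in> p \<Longrightarrow> \<bar>g y - g z\<bar> \<le> a"
    and n: "0 < n" and x: "\<And>i. i \<in> {1..n} \<Longrightarrow> x i \<in> space \<mu>"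
    and e: "\<And>p. p \<in> \<P> \<Longrightarrow> \<bar>real (card {i\<in>{1..n}. x i \<in> p}) / real n - measure \<mu> p\<bar> \<le> e"
  shows "\<bar>(\<Sum>i\<in>{1..n}. g (x i)) / real n - (\<integral>y. g y \<partial>\<mu>)\<bar> \<le> 2 * a + M * card \<P> * e"
proof -
  interpret prob_space \<mu> by fact
  have Pf: "finite \<P>" "\<P> \<subseteq> sets \<mu>" and pP: "partition_on (space \<mu>) \<P>" using P by (auto simp: finite_partition_def)
  have ne: "p \<noteq> {}" if "p \<in> \<P>" for p using partition_onD3[OF pP] that by auto
  define c where "c p = g (SOME y. y \<in> p)" for p
  have cp: "(SOME y. y \<in> p) \<in> p" if "p \<in> \<P>" for p using ne[OF that] by (simp add: some_in_eq)
  have sub: "p \<subseteq> space \<mu>" if "p \<in> \<P>" for p using partition_onD1[OF pP] that by auto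
  define s where "s y = (\<Sum>p\<in>\<P>. c p * indicator p y)" for y
  have sy: "s y = c p" if p: "p \<in> \<P>" "y \<in> p" for p y
  proof -
    have "s y = (\<Sum>q\<in>\<P>. if q = p then c p else 0)"
      unfolding s_def
    proof (rule sum.cong[OF refl])
      fix q assume q: "q \<in> \<P>"
      show "c q * indicator q y = (if q = p then c p else 0)"
      proof (cases "q = p")
        case False
        then have "y \<notin> q" using partition_on_eqI[OF pP q p(1)] p(2) by blast
        then show ?thesis using False by simp
      qed (use p in simp)
    qed
    then show ?thesis using p Pf(1) by simp
  qed
  have gs: "\<bar>g y - s y\<bar> \<le> a" if y: "y \<in> space \<mu>" for y
  proof -
    obtain p where p: "p \<in> \<P>" "y \<in> p" using partition_onD1[OF pP] y by auto
    show ?thesis unfolding sy[OF p] c_def by (rule a[OF p cp[OF p(1)]])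
  qed
  have ms: "s \<in> borel_measurable \<mu>"
    unfolding s_def using Pf(2) by (intro borel_measurable_sum borel_measurable_times borel_measurable_const borel_measurable_indicator) auto
  have cM: "\<bar>c p\<bar> \<le> M" if "p \<in> \<P>" for p unfolding c_def using M sub[OF that] cp[OF that] by blast
  have ig: "integrable \<mu> g" by (rule integrable_const_bound[of _ M]) (use M g in \<open>auto intro!: AE_I2\<close>)
  have igs: "integrable \<mu> s" unfolding s_def using Pf(2) by (intro Bochner_Integration.integrable_sum integrable_mult_right integrable_real_indicator) (auto simp: emeasure_eq_measure)
  have ints: "(\<integral>y. s y \<partial>\<mu>) = (\<Sum>p\<in>\<P>. c p * measure \<mu> p)"
  proof -
    have "(\<integral>y. s y \<partial>\<mu>) = (\<Sum>p\<in>\<P>. \<integral>y. c p * indicator p y \<partial>\<mu>)"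
      unfolding s_def using Pf(2) by (intro Bochner_Integration.integral_sum integrable_mult_right integrable_real_indicator) (auto simp: emeasure_eq_measure)
    also have "\<dots> = (\<Sum>p\<in>\<P>. c p * measure \<mu> p)"
      by (rule sum.cong) (use sub in \<open>auto simp: Int_absorb2\<close>)
    finally show ?thesis .
  qed
  have 1: "\<bar>(\<integral>y. g y \<partial>\<mu>) - (\<integral>y. s y \<partial>\<mu>)\<bar> \<le> a"
  proof -
    have "\<bar>(\<integral>y. g y \<partial>\<mu>) - (\<integral>y. s y \<partial>\<mu>)\<bar> = \<bar>\<integral>y. g y - s y \<partial>\<mu>\<bar>" using ig igs by simp
    also have "\<dots> \<le> (\<integral>y. \<bar>g y - s y\<bar> \<partial>\<mu>)" by (rule integral_abs_bound)
    also have "\<dots> \<le> (\<integral>y. a \<partial>\<mu>)" by (rule integral_mono) (use ig igs gs in auto)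
    finally show ?thesis by (simp add: prob_space)
  qed
  have 2: "\<bar>(\<Sum>i\<in>{1..n}. g (x i)) / real n - (\<Sum>i\<in>{1..n}. s (x i)) / real n\<bar> \<le> a"
  proof -
    have "\<bar>\<Sum>i\<in>{1..n}. g (x i) - s (x i)\<bar> \<le> (\<Sum>i\<in>{1..n}. \<bar>g (x i) - s (x i)\<bar>)" by (rule sum_abs)
    also have "\<dots> \<le> (\<Sum>i\<in>{1..n}. a)" by (rule sum_mono) (rule gs[OF x])
    finally have "\<bar>\<Sum>i\<in>{1..n}. g (x i) - s (x i)\<bar> / n \<le> n * a / n" by (intro divide_right_mono) auto
    then show ?thesis using n by (simp add: sum_subtractf diff_divide_distrib[symmetric])
  qed
  have 3: "(\<Sum>i\<in>{1..n}. s (x i)) / real n = (\<Sum>p\<in>\<P>. c p * (card {i\<in>{1..n}. x i \<in> p} / real n))"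
  proof -
    have "(\<Sum>i\<in>{1..n}. s (x i)) = (\<Sum>p\<in>\<P>. \<Sum>i\<in>{1..n}. c p * indicator p (x i))"
      unfolding s_def by (rule sum.swap)
    also have "\<dots> = (\<Sum>p\<in>\<P>. c p * card {i\<in>{1..n}. x i \<in> p})"
      by (rule sum.cong) (auto simp: sum_distrib_left[symmetric] indicator_def sum.If_cases Int_def)
    finally show ?thesis by (simp add: sum_divide_distrib)
  qed
  have 4: "\<bar>(\<Sum>p\<in>\<P>. c p * (card {i\<in>{1..n}. x i \<in> p} / real n)) - (\<Sum>p\<in>\<P>. c p * measure \<mu> p)\<bar> \<le> M * card \<P> * e"
  proof -
    have "\<bar>(\<Sum>p\<in>\<P>. c p * (card {i\<in>{1..n}. x i \<in> p} / real n)) - (\<Sum>p\<in>\<P>. c p * measure \<mu> p)\<bar>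
      = \<bar>\<Sum>p\<in>\<P>. c p * (card {i\<in>{1..n}. x i \<in> p} / real n - measure \<mu> p)\<bar>"
      by (simp add: sum_subtractf right_diff_distrib)
    also have "\<dots> \<le> (\<Sum>p\<in>\<P>. \<bar>c p * (card {i\<in>{1..n}. x i \<in> p} / real n - measure \<mu> p)\<bar>)" by (rule sum_abs)
    also have "\<dots> \<le> (\<Sum>p\<in>\<P>. M * e)"
      unfolding abs_mult by (rule sum_mono, rule mult_mono) (use cM e in \<open>auto intro: order_trans[OF abs_ge_zero]\<close>)
    finally show ?thesis by (simp add: mult_ac)
  qed
  show ?thesis using 1 2 4 unfolding 3 ints by linarith
qed

text \<open>Atoms are mapped to disjoint sets that cover all indices, so each index determines one
  atom, and any point of that atom can be chosen.\<close>

lemma hom_points: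
  assumes R: "finite R" "partition_on A R" and \<phi>: "\<phi> \<in> set_homs A (sigma_sets A R) n"
  obtains x where "x \<in> {1..n} \<rightarrow>\<^sub>E A" "\<And>B i. B \<in> sigma_sets A R \<Longrightarrow> i \<in> {1..n} \<Longrightarrow> i \<in> \<phi> B \<longleftrightarrow> x i \<in> B"
proof -
  have ss: "sigma_sets A R = {\<Union>C | C. C \<subseteq> R}" by (rule sigma_sets_finite_partition[OF R])
  have hom: "\<phi> {} = {}" "\<phi> A = {1..n}" "\<And>B C. B \<in> sigma_sets A R \<Longrightarrow> C \<in> sigma_sets A R \<Longrightarrow> \<phi> (B \<union> C) = \<phi> B \<union> \<phi> C \<and> \<phi> (B \<inter> C) = \<phi> B \<inter> \<phi> C"
    using \<phi> unfolding set_homs_def by auto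
  have Un: "\<phi> (\<Union>C) = \<Union>(\<phi> ` C)" if "C \<subseteq> R" for C
    using finite_subset[OF that R(1)] that
  proof (induction C rule: finite_induct)
    case (insert X C)
    then have "X \<in> sigma_sets A R" "\<Union>C \<in> sigma_sets A R" unfolding ss by (auto intro: sigma_sets.Basic)
    then have "\<phi> (X \<union> \<Union>C) = \<phi> X \<union> \<phi> (\<Union>C)" using hom(3) by blast
    then show ?case using insert by simp
  qed (simp add: hom)
  have RA: "\<Union>R = A" using partition_onD1[OF R(2)] by simp
  have "\<exists>X\<in>R. i \<in> \<phi> X" if "i \<in> {1..n}" for i
    using Un[of R] RA hom(2) that by auto
  then obtain X where X: "\<And>i. i \<in> {1..n} \<Longrightarrow> X i \<in> R \<and> i \<in> \<phi> (X i)" by metis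
  define x where "x = (\<lambda>i\<in>{1..n}. SOME y. y \<in> X i)"
  have xX: "x i \<in> X i" if "i \<in> {1..n}" for i
  proof -
    have "X i \<noteq> {}" using X[OF that] partition_onD3[OF R(2)] by auto
    then show ?thesis using that by (simp add: x_def some_in_eq)
  qed
  show ?thesis
  proof (rule that)
    show "x \<in> {1..n} \<rightarrow>\<^sub>E A"
    proof (rule PiE_I)
      fix i assume "i \<in> {1..n}"
      then show "x i \<in> A" using xX X RA by blast
    qed (auto simp: x_def)
    fix B i assume B: "B \<in> sigma_sets A R" and i: "i \<in> {1..n}"
    then obtain C where C: "C \<subseteq> R" "B = \<Union>C" unfolding ss by blast
    show "i \<in> \<phi> B \<longleftrightarrow> x i \<in> B"
    proof
      assume "i \<in> \<phi> B"
      then obtain Y where Y: "Y \<in> C" "i \<in> \<phi> Y" using Un[OF C(1)] C(2) by auto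
      have sY: "Y \<in> sigma_sets A R" "X i \<in> sigma_sets A R" using Y C X[OF i] by (auto intro: sigma_sets.Basic)
      have "i \<in> \<phi> (Y \<inter> X i)" using hom(3)[OF sY] Y X[OF i] by auto
      then have "Y \<inter> X i \<noteq> {}" using hom(1) by auto
      then have "Y = X i" using partition_on_eqI[OF R(2)] Y C X[OF i] by blast
      then show "x i \<in> B" using xX[OF i] Y C by auto
    next
      assume "x i \<in> B"
      then obtain Y where Y: "Y \<in> C" "x i \<in> Y" using C by auto
      then have "Y = X i" using partition_on_eqI[OF R(2)] xX[OF i] C X[OF i] by blast
      then show "i \<in> \<phi> B" using Un[OF C(1)] C(2) Y X[OF i] by auto
    qed
  qed
qed

section \<open>Tuples of points that represent a homomorphism\<close>

locale factor_metric_measure = factor_metric H TH \<nu> G TG \<pi> \<rho> + factor_measure H TH \<nu> G TG \<pi> \<mu>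
  for H :: "('a, 'b) gpd_scheme" and TH \<nu> and G :: "('c, 'd) gpd_scheme" and TG \<pi> \<rho> \<mu>
begin

definition represents :: "nat \<Rightarrow> 'a sofic_map \<Rightarrow> 'c set set \<Rightarrow> 'a set set \<Rightarrow> ('c set \<Rightarrow> nat set) \<Rightarrow> (nat \<Rightarrow> 'c) \<Rightarrow> bool" where
  "represents n \<sigma> \<P> F \<phi> x \<longleftrightarrow> x \<in> {1..n} \<rightarrow>\<^sub>E units G \<and>
     (\<forall>B\<in>alg \<P> F. \<forall>i\<in>{1..n}. i \<in> \<phi> B \<longleftrightarrow> x i \<in> B)"

lemma hom_represents:
  assumes P: "finite_partition \<mu> \<P>" and F: "F \<in> Fpow fp" "units H \<in> F" and \<phi>: "\<phi> \<in> Hom G H \<mu> \<pi> n \<sigma> \<P> F e"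
  obtains x where "represents n \<sigma> \<P> F \<phi> x"
proof -
  note pa = partition_act_props[OF P F]
  have "\<phi> \<in> set_homs (units G) (alg \<P> F) n" using \<phi> by (simp add: Hom_def)
  then obtain x where "x \<in> {1..n} \<rightarrow>\<^sub>E units G"
    "\<And>B i. B \<in> alg \<P> F \<Longrightarrow> i \<in> {1..n} \<Longrightarrow> i \<in> \<phi> B \<longleftrightarrow> x i \<in> B"
    using hom_points[OF _ pa(4)] pa(1) unfolding finite_partition_def by blast
  then show ?thesis by (intro that[of x]) (simp add: represents_def)
qed

lemma represents_eq:
  assumes \<phi>: "\<phi> \<in> Hom G H \<mu> \<pi> n \<sigma> \<P> F e" and r: "represents n \<sigma> \<P> F \<phi> x"
    and B: "B \<in> alg \<P> F"
  shows "\<phi> B = {i\<in>{1..n}. x i \<in> B}"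
proof -
  have "\<phi> B \<subseteq> {1..n}" using \<phi> B by (auto simp: Hom_def set_homs_def)
  then show ?thesis using r B by (auto simp: represents_def)
qed

text \<open>\<open>Hom\<close> bounds the sum of the errors over all atoms, so a union of atoms is
  controlled with the same error.\<close>

lemma represents_mass:
  assumes P: "finite_partition \<mu> \<P>" and F: "F \<in> Fpow fp" "units H \<in> F" and \<phi>: "\<phi> \<in> Hom G H \<mu> \<pi> n \<sigma> \<P> F e"
    and r: "represents n \<sigma> \<P> F \<phi> x" and B: "B \<in> alg \<P> F"
  shows "\<bar>emp n x B - measure \<mu> B\<bar> \<le> e"
proof -
  define R where "R = partition_act G H \<pi> \<P> F"
  note pa = partition_act_props[OF P F, folded R_def]
  have Rf: "finite R" "R \<subseteq> sets \<mu>" using pa(1) by (auto simp: finite_partition_def)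
  obtain C where C: "C \<subseteq> R" "B = \<Union>C" using B unfolding R_def[symmetric] pa(5) by blast
  have fC: "finite C" using C(1) Rf(1) finite_subset by blast
  have dC: "disjoint C" using partition_onD2[OF pa(4)] C(1) by (auto simp: disjoint_def)
  have m: "measure \<mu> B = (\<Sum>X\<in>C. measure \<mu> X)"
    using GM.\<nu>.finite_measure_finite_Union[of C "\<lambda>X. X"] C Rf fC dC by (auto simp: disjoint_def disjoint_family_on_def)
  have E: "emp n x X = normcard n (\<phi> X)" if "X \<in> R" for X
  proof -
    have "X \<in> alg \<P> F" using that by (simp add: R_def)
    then show ?thesis using represents_eq[OF \<phi> r] by (simp add: emp_def normcard_def)
  qed
  have c: "emp n x B = (\<Sum>X\<in>C. emp n x X)"
  proof -
    have "{i\<in>{1..n}. x i \<in> B} = (\<Union>X\<in>C. {i\<in>{1..n}. x i \<in> X})" unfolding C(2) by auto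
    moreover have "card (\<Union>X\<in>C. {i\<in>{1..n}. x i \<in> X}) = (\<Sum>X\<in>C. card {i\<in>{1..n}. x i \<in> X})"
      using dC by (intro card_UN_disjoint fC) (auto simp: disjoint_def)
    ultimately show ?thesis by (simp add: emp_def sum_divide_distrib)
  qed
  have "\<bar>emp n x B - measure \<mu> B\<bar> = \<bar>\<Sum>X\<in>C. emp n x X - measure \<mu> X\<bar>" unfolding m c by (simp add: sum_subtractf)
  also have "\<dots> \<le> (\<Sum>X\<in>C. \<bar>emp n x X - measure \<mu> X\<bar>)" by (rule sum_abs)
  also have "\<dots> \<le> (\<Sum>X\<in>R. \<bar>emp n x X - measure \<mu> X\<bar>)" by (rule sum_mono2[OF Rf(1) C(1)]) simp
  also have "\<dots> = (\<Sum>X\<in>R. \<bar>normcard n (\<phi> X) - measure \<mu> X\<bar>)" by (rule sum.cong) (simp_all add: E)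
  also have "\<dots> < e" using \<phi> by (simp add: Hom_def R_def)
  finally show ?thesis by simp
qed

text \<open>Read index by index, the condition of \<open>Hom\<close> at the inverse of
  \<open>f\<close> says that \<open>f\<close> moves \<open>x i\<close> into \<open>q\<close> iff the
  sofic map of the inverse sends some \<open>j\<close> with \<open>x j \<in> q\<close> to
  \<open>i\<close>. \<open>sofic_inverse\<close> exchanges such pairs with pairs of
  \<open>\<sigma> f\<close> at a cost of \<open>2 * e\<close> in each direction; with the error
  \<open>e\<close> of \<open>Hom\<close> this makes 5.\<close>

lemma represents_orbit:
  assumes P: "finite_partition \<mu> \<P>" and F: "F \<in> Fpow fp" "units H \<in> F" and \<phi>: "\<phi> \<in> Hom G H \<mu> \<pi> n \<sigma> \<P> F e"
    and r: "represents n \<sigma> \<P> F \<phi> x" and f: "f \<in> fp" "H.finv f \<in> F"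
    and a: "0 \<le> a" "\<And>q y z. q \<in> \<P> \<Longrightarrow> y \<in> q \<Longrightarrow> z \<in> q \<Longrightarrow> \<rho> y z \<le> a"
    and n: "0 < n" and \<sigma>: "\<sigma> \<in> Map_set fp n" and m: "multiplicative_on H n F0 e \<sigma>"
    and F0: "{f, H.finv f, set_mult H f (H.finv f), set_mult H (H.finv f) f} \<subseteq> F0"
  shows "real (card (off_orb n \<sigma> f x a)) \<le> 5 * e * n"
proof -
  define \<Sigma> where "\<Sigma> = alg \<P> F"
  note pa = partition_act_props[OF P F, folded \<Sigma>_def]
  have Pf: "finite \<P>" "\<Union>\<P> = units G" using P by (auto simp: finite_partition_def partition_on_def)
  note fD = fpD[OF f(1)]
  let ?f' = "H.finv f"
  have f': "?f' \<in> fp" by (rule H.finv_full_pseudogroup[OF f(1)])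
  have ff: "H.finv ?f' = f" by (rule H.finv_finv[OF fD(2)])
  have fin: "\<sigma> f \<in> fin_pseudogroup n" "\<sigma> ?f' \<in> fin_pseudogroup n" using \<sigma> f(1) f' by (auto simp: Map_set_def)
  note sD = fin_pseudogroupD[OF fin(1)] and sD' = fin_pseudogroupD[OF fin(2)]
  have xu: "x i \<in> units G" if "i \<in> {1..n}" for i using r that by (auto simp: represents_def)
  have eq: "\<phi> B = {i\<in>{1..n}. x i \<in> B}" if "B \<in> \<Sigma>" for B using represents_eq[OF \<phi> r] that by (simp add: \<Sigma>_def)
  have c1: "real (card {(i, j) \<in> \<sigma> f. (j, i) \<notin> \<sigma> ?f'}) \<le> 2 * e * n"
    by (rule sofic_inverse[OF f(1) \<sigma> m _ n]) (use F0 in auto)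
  have c2: "real (card {(i, j) \<in> \<sigma> ?f'. (j, i) \<notin> \<sigma> f}) \<le> 2 * e * n"
    using sofic_inverse[OF f' \<sigma> m _ n] F0 unfolding ff by auto
  let ?D = "\<lambda>q. sym_diff (fin_act_set (\<sigma> ?f') (\<phi> q)) (\<phi> (mvs ?f' q))"
  have aS: "mvs ?f' q \<in> \<Sigma>" "q \<in> \<Sigma>" if "q \<in> \<P>" for q using pa(2)[OF f(2) that] pa(3) that by auto
  have fD': "finite (?D q)" if "q \<in> \<P>" for q
  proof (rule finite_subset)
    show "?D q \<subseteq> {1..n}" using sD'(1) eq[OF aS(1)[OF that]] by (auto simp: fin_act_set_def)
  qed simp
  have c3: "real (card (\<Union>q\<in>\<P>. ?D q)) \<le> e * n"
  proof -
    have "card (\<Union>q\<in>\<P>. ?D q) \<le> (\<Sum>q\<in>\<P>. card (?D q))" by (rule card_UN_le[OF Pf(1)])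
    then have "real (card (\<Union>q\<in>\<P>. ?D q)) / n \<le> (\<Sum>q\<in>\<P>. real (card (?D q))) / n"
      by (intro divide_right_mono) (simp_all flip: of_nat_sum)
    also have "\<dots> = (\<Sum>q\<in>\<P>. normcard n (?D q))" by (simp add: normcard_def sum_divide_distrib)
    also have "\<dots> < e" using \<phi> f(2) by (simp add: Hom_def)
    finally show ?thesis using n by (simp add: field_simps)
  qed
  let ?A = "fst ` {(i, j) \<in> \<sigma> ?f'. (j, i) \<notin> \<sigma> f}" and ?B = "snd ` {(i, j) \<in> \<sigma> f. (j, i) \<notin> \<sigma> ?f'}"
  have fin1: "finite {(i, j) \<in> \<sigma> ?f'. (j, i) \<notin> \<sigma> f}" by (rule finite_subset[OF _ sD'(4)]) auto
  have fin2: "finite {(i, j) \<in> \<sigma> f. (j, i) \<notin> \<sigma> ?f'}" by (rule finite_subset[OF _ sD(4)]) auto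
  have "(off_orb n \<sigma> f x a) \<subseteq> (\<Union>q\<in>\<P>. ?D q) \<union> ?A \<union> ?B"
  proof (rule subsetI, rule ccontr)
    fix i assume i: "i \<in> (off_orb n \<sigma> f x a)"
      and nb: "i \<notin> (\<Union>q\<in>\<P>. ?D q) \<union> ?A \<union> ?B"
    have i': "i \<in> {1..n}" using i by simp
    have D: "i \<in> fin_act_set (\<sigma> ?f') (\<phi> q) \<longleftrightarrow> i \<in> \<phi> (mvs ?f' q)" if "q \<in> \<P>" for q
      using nb that by blast
    have A: "(j, i) \<in> \<sigma> f" if "(i, j) \<in> \<sigma> ?f'" for j
    proof (rule ccontr)
      assume "(j, i) \<notin> \<sigma> f"
      then have "i \<in> ?A" using that by force
      then show False using nb by blast
    qed
    have B: "(i, j) \<in> \<sigma> ?f'" if "(j, i) \<in> \<sigma> f" for j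
    proof (rule ccontr)
      assume "(i, j) \<notin> \<sigma> ?f'"
      then have "i \<in> ?B" using that by force
      then show False using nb by blast
    qed
    have act: "i \<in> \<phi> (mvs ?f' q) \<longleftrightarrow> (\<exists>y\<in>q. moves f (x i) y)" if q: "q \<in> \<P>" for q
    proof -
      have qu: "q \<subseteq> units G" using Pf(2) q by auto
      have "i \<in> \<phi> (mvs ?f' q) \<longleftrightarrow> x i \<in> mvs ?f' q" using eq[OF aS(1)[OF q]] i' by simp
      also have "\<dots> \<longleftrightarrow> (\<exists>y\<in>q. moves ?f' y (x i))" unfolding act_set_eq(1)[OF fpD(2,3)[OF f'] qu] by simp
      finally show ?thesis unfolding moves_finv[OF fD(2)] .
    qed
    show False
    proof (cases "mv f (x i)")
      case (Some y)
      then have y: "moves f (x i) y" using act_iff(1)[OF fD(2,3) xu[OF i']] by simp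
      then obtain q where q: "q \<in> \<P>" "y \<in> q" using moves_units(2) Pf(2) by blast
      then have "i \<in> fin_act_set (\<sigma> ?f') (\<phi> q)" using D act y by blast
      then obtain j where j: "j \<in> \<phi> q" "(i, j) \<in> \<sigma> ?f'" by (auto simp: fin_act_set_def)
      then have "fin_act (\<sigma> f) i = Some j" using A fin_act_iff(1)[OF fin(1)] by blast
      moreover have "x j \<in> q" using j(1) eq[OF aS(2)[OF q(1)]] by simp
      ultimately show False using i Some a(2)[OF q] by simp
    next
      case None
      then have nm: "\<not> moves f (x i) y" for y using act_iff(1)[OF fD(2,3) xu[OF i']] by (metis option.distinct(1))
      have "fin_act (\<sigma> f) i = None"
      proof (rule ccontr)
        assume "fin_act (\<sigma> f) i \<noteq> None"
        then have "\<not> (\<forall>j. (j, i) \<notin> \<sigma> f)" unfolding fin_act_iff(2)[OF fin(1)] .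
        then obtain j where "(j, i) \<in> \<sigma> f" by blast
        then have ij: "(i, j) \<in> \<sigma> ?f'" by (rule B)
        then have j: "j \<in> {1..n}" using sD'(1) by auto
        then obtain q where q: "q \<in> \<P>" "x j \<in> q" using xu Pf(2) by blast
        then have "j \<in> \<phi> q" using eq[OF aS(2)[OF q(1)]] j by simp
        then have "i \<in> fin_act_set (\<sigma> ?f') (\<phi> q)" using ij by (auto simp: fin_act_set_def)
        then show False using D[OF q(1)] act[OF q(1)] nm by blast
      qed
      then show False using i None a(1) by simp
    qed
  qed
  then have "card (off_orb n \<sigma> f x a) \<le> card ((\<Union>q\<in>\<P>. ?D q) \<union> ?A \<union> ?B)"
    by (rule card_mono[rotated]) (use fin1 fin2 Pf(1) fD' in blast)
  moreover have "real (card ((\<Union>q\<in>\<P>. ?D q) \<union> ?A \<union> ?B)) \<le> real (card (\<Union>q\<in>\<P>. ?D q)) + real (card ?A) + real (card ?B)"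
    using card_Un_real[of "(\<Union>q\<in>\<P>. ?D q) \<union> ?A" ?B] card_Un_real[of "\<Union>q\<in>\<P>. ?D q" ?A] by linarith
  moreover have "real (card ?A) \<le> 2 * e * n" "real (card ?B) \<le> 2 * e * n"
    using card_image_le[OF fin1, of fst] card_image_le[OF fin2, of snd] c1 c2 by linarith+
  ultimately show ?thesis using c3 by linarith
qed

end

text \<open>Lets one pseudometric control \<open>\<rho>\<close> together with finitely many test
  functions, so that one fine partition serves both.\<close>

lemma continuous_pseudometric_add_sum:
  fixes k :: "'i \<Rightarrow> 'a \<Rightarrow> real"
  assumes \<rho>: "continuous_pseudometric X \<rho>" and I: "finite I" "\<And>i. i \<in> I \<Longrightarrow> continuous_map X euclideanreal (k i)"
  shows "continuous_pseudometric X (\<lambda>x y. \<rho> x y + (\<Sum>i\<in>I. \<bar>k i x - k i y\<bar>))"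
  unfolding continuous_pseudometric_def
proof (intro conjI ballI)
  fix x y z assume xyz: "x \<in> topspace X" "y \<in> topspace X" "z \<in> topspace X"
  have "\<rho> x z \<le> \<rho> x y + \<rho> y z" using \<rho> xyz unfolding continuous_pseudometric_def by blast
  moreover have "(\<Sum>i\<in>I. \<bar>k i x - k i z\<bar>) \<le> (\<Sum>i\<in>I. \<bar>k i x - k i y\<bar> + \<bar>k i y - k i z\<bar>)" by (rule sum_mono) linarith
  ultimately show "\<rho> x z + (\<Sum>i\<in>I. \<bar>k i x - k i z\<bar>) \<le> \<rho> x y + (\<Sum>i\<in>I. \<bar>k i x - k i y\<bar>) + (\<rho> y z + (\<Sum>i\<in>I. \<bar>k i y - k i z\<bar>))"
    by (simp add: sum.distrib)
next
  have c: "continuous_map (prod_topology X X) euclideanreal (\<lambda>p. k i (fst p))" "continuous_map (prod_topology X X) euclideanreal (\<lambda>p. k i (snd p))" if "i \<in> I" for i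
    using continuous_map_compose[OF continuous_map_fst I(2)[OF that]] continuous_map_compose[OF continuous_map_snd I(2)[OF that]]
    by (auto simp: o_def)
  have "continuous_map (prod_topology X X) euclideanreal (\<lambda>p. (case p of (x, y) \<Rightarrow> \<rho> x y) + (\<Sum>i\<in>I. \<bar>k i (fst p) - k i (snd p)\<bar>))"
    using \<rho> unfolding continuous_pseudometric_def
    by (intro continuous_map_add continuous_map_sum continuous_map_real_abs continuous_map_diff c I(1)) auto
  then show "continuous_map (prod_topology X X) euclideanreal (\<lambda>(x, y). \<rho> x y + (\<Sum>i\<in>I. \<bar>k i x - k i y\<bar>))"
    by (simp add: case_prod_beta')
qed (use \<rho> in \<open>auto simp: continuous_pseudometric_def abs_minus_commute intro!: add_nonneg_nonneg sum_nonneg\<close>)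

section \<open>Separated microstates from homomorphisms with different itineraries\<close>

context factor_metric_measure begin

text \<open>Up to a small loss, distinct \<open>\<Q>\<close>-itineraries are separated by points of disjoint closed sets,
  hence, by compactness, by finitely many elements of the topological full group.\<close>

lemma separating_data:
  assumes Q: "finite_partition \<mu> \<Q>" and "s > 0"
  obtains C Gs \<theta> where "\<And>q. q \<in> \<Q> \<Longrightarrow> C q \<in> sets \<mu>" "\<And>q. q \<in> \<Q> \<Longrightarrow> C q \<subseteq> q"
    "measure \<mu> (\<Union>q\<in>\<Q>. q - C q) \<le> s" "finite Gs" "Gs \<subseteq> fg" "0 < \<theta>"
    "\<And>q q' x y. q \<in> \<Q> \<Longrightarrow> q' \<in> \<Q> \<Longrightarrow> q \<noteq> q' \<Longrightarrow> x \<in> C q \<Longrightarrow> y \<in> C q' \<Longrightarrow> \<exists>g\<in>Gs. \<theta> < \<rho> (gact g x) (gact g y)"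
proof -
  have Qf: "finite \<Q>" "\<Q> \<subseteq> sets \<mu>" "partition_on (units G) \<Q>" using Q by (auto simp: finite_partition_def)
  define s' where "s' = s / (real (card \<Q>) + 1)"
  have s': "s' > 0" "card \<Q> * s' \<le> s" using \<open>s > 0\<close> by (simp_all add: s'_def field_simps)
  have "\<exists>C. closedin G.X C \<and> C \<subseteq> q \<and> measure \<mu> (q - C) < s'" if q: "q \<in> \<Q>" for q
  proof -
    obtain C U where CU: "closedin G.X C" "openin G.X U" "C \<subseteq> q" "q \<subseteq> U" "measure \<mu> (U - C) < s'"
      using G.X.regular_approx[OF GM.\<nu>.finite_measure_axioms GM.sets_\<nu> _ s'(1), of q] q Qf(2) by blast
    have "measure \<mu> (q - C) \<le> measure \<mu> (U - C)"
      by (rule GM.\<nu>.finite_measure_mono) (use CU GM.open_\<nu> GM.closed_\<nu> in auto)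
    then show ?thesis using CU by auto
  qed
  then obtain C where C: "\<And>q. q \<in> \<Q> \<Longrightarrow> closedin G.X (C q)" "\<And>q. q \<in> \<Q> \<Longrightarrow> C q \<subseteq> q" "\<And>q. q \<in> \<Q> \<Longrightarrow> measure \<mu> (q - C q) < s'"
    by metis
  have sC: "C q \<in> sets \<mu>" if "q \<in> \<Q>" for q using C(1)[OF that] by (rule GM.closed_\<nu>)
  have small: "measure \<mu> (\<Union>q\<in>\<Q>. q - C q) \<le> s"
  proof -
    have "measure \<mu> (\<Union>q\<in>\<Q>. q - C q) \<le> (\<Sum>q\<in>\<Q>. measure \<mu> (q - C q))"
      by (rule GM.\<nu>.finite_measure_subadditive_finite) (use Qf sC in auto)
    also have "\<dots> \<le> (\<Sum>q\<in>\<Q>. s')" by (rule sum_mono) (use C(3) in \<open>auto intro: less_imp_le\<close>)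
    also have "\<dots> \<le> s" using s'(2) by simp
    finally show ?thesis .
  qed
  define I where "I = {(q, q') \<in> \<Q> \<times> \<Q>. q \<noteq> q'}"
  have fI: "finite I" unfolding I_def by (rule finite_subset[of _ "\<Q> \<times> \<Q>"]) (use Qf in auto)
  have "\<exists>Gs \<theta>. finite Gs \<and> Gs \<subseteq> fg \<and> 0 < \<theta> \<and> (\<forall>x\<in>C (fst p). \<forall>y\<in>C (snd p). \<exists>g\<in>Gs. \<theta> < \<rho> (gact g x) (gact g y))"
    if p: "p \<in> I" for p
  proof -
    have q: "fst p \<in> \<Q>" "snd p \<in> \<Q>" "fst p \<noteq> snd p" using p by (auto simp: I_def)
    have "C (fst p) \<inter> C (snd p) = {}"
      using C(2)[OF q(1)] C(2)[OF q(2)] partition_on_eqI[OF Qf(3) q(1,2)] q(3) by blast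
    then obtain Gs \<theta> where "finite Gs" "Gs \<subseteq> fg" "\<theta> > 0"
      "\<And>x y. x \<in> C (fst p) \<Longrightarrow> y \<in> C (snd p) \<Longrightarrow> \<exists>g\<in>Gs. \<theta> < \<rho> (gact g x) (gact g y)"
      using separate[OF C(1)[OF q(1)] C(1)[OF q(2)]] by metis
    then show ?thesis by (intro exI[of _ Gs] exI[of _ \<theta>]) simp
  qed
  then obtain Gs \<theta> where G: "\<And>p. p \<in> I \<Longrightarrow> finite (Gs p)" "\<And>p. p \<in> I \<Longrightarrow> Gs p \<subseteq> fg"
    "\<And>p. p \<in> I \<Longrightarrow> 0 < \<theta> p"
    "\<And>p x y. p \<in> I \<Longrightarrow> x \<in> C (fst p) \<Longrightarrow> y \<in> C (snd p) \<Longrightarrow> \<exists>g\<in>Gs p. \<theta> p < \<rho> (gact g x) (gact g y)"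
    by (metis (no_types, lifting))
  \<comment> \<open>The inserted 1 covers a partition without two distinct atoms.\<close>
  define \<theta>' where "\<theta>' = Min (insert 1 (\<theta> ` I))"
  show ?thesis
  proof (rule that[of C "\<Union>p\<in>I. Gs p" \<theta>'])
    have "0 < t" if "t \<in> insert 1 (\<theta> ` I)" for t
    proof (rule insertE[OF that])
      assume "t \<in> \<theta> ` I"
      then show "0 < t" by (rule imageE) (simp only: G(3))
    qed simp
    moreover have "\<theta>' \<in> insert 1 (\<theta> ` I)" unfolding \<theta>'_def by (rule Min_in) (use fI in simp_all)
    ultimately show "0 < \<theta>'" by blast
    show "finite (\<Union>p\<in>I. Gs p)" using fI G(1) by (rule finite_UN_I)
    show "(\<Union>p\<in>I. Gs p) \<subseteq> fg" using G(2) by (rule UN_least)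
    fix q q' x y assume q: "q \<in> \<Q>" "q' \<in> \<Q>" "q \<noteq> q'" and xy: "x \<in> C q" "y \<in> C q'"
    have p: "(q, q') \<in> I" using q by (simp add: I_def)
    obtain g where g: "g \<in> Gs (q, q')" "\<theta> (q, q') < \<rho> (gact g x) (gact g y)" using G(4)[OF p] xy by auto
    have "\<theta>' \<le> \<theta> (q, q')" unfolding \<theta>'_def using fI p by (intro Min_le) auto
    then show "\<exists>g\<in>\<Union>p\<in>I. Gs p. \<theta>' < \<rho> (gact g x) (gact g y)" using g p by (intro bexI[of _ g]) auto
  qed (use sC C(2) small in auto)
qed

text \<open>If the tuples were close, \<open>x j\<close> and \<open>y j\<close> would be within
  \<open>\<theta> / 2\<close> for most \<open>j\<close>. At an index with different atoms, off the
  exceptional sets, some \<open>g\<close> separates \<open>x i\<close> from \<open>y i\<close> by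
  more than \<open>\<theta>\<close>, while the path through \<open>x j\<close> and
  \<open>y j\<close> has length at most
  \<open>\<theta> / 4 + \<theta> / 2 + \<theta> / 4\<close>.\<close>

lemma represents_separated:
  fixes c s \<theta> :: real
  assumes x: "represents n \<sigma> \<P> F \<phi> x" and y: "represents n \<sigma> \<P> F \<phi>' y"
    and n: "0 < n" and \<sigma>: "\<sigma> \<in> Map_set fp n"
    and Q: "partition_on (units G) \<Q>" and Gs: "finite Gs" "Gs \<subseteq> fg" and \<theta>: "0 < \<theta>"
    and sep: "\<And>q q' u v. q \<in> \<Q> \<Longrightarrow> q' \<in> \<Q> \<Longrightarrow> q \<noteq> q' \<Longrightarrow> u \<in> C q \<Longrightarrow> v \<in> C q' \<Longrightarrow> \<exists>g\<in>Gs. \<theta> < \<rho> (gact g u) (gact g v)"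
    and bx: "\<And>g. g \<in> Gs \<Longrightarrow> real (card (off_orb n \<sigma> g x (\<theta> / 4))) \<le> c * n"
    and yb: "\<And>g. g \<in> Gs \<Longrightarrow> real (card (off_orb n \<sigma> g y (\<theta> / 4))) \<le> c * n"
    and wx: "emp n x (\<Union>q\<in>\<Q>. q - C q) \<le> s" and wy: "emp n y (\<Union>q\<in>\<Q>. q - C q) \<le> s"
    and h: "real (card {i\<in>{1..n}. \<not> (\<exists>q\<in>\<Q>. x i \<in> q \<and> y i \<in> q)}) > (2 * s + 3 * c * card Gs) * n"
    and c: "0 < c"
  shows "\<theta> * sqrt c / 4 < dist2 n \<rho> x y"
proof (rule ccontr)
  assume "\<not> ?thesis"
  \<comment> \<open>The factor 2 yields the strict bound that \<open>dist2_count\<close> asks for;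
    \<open>\<theta> * sqrt c / 2\<close> against the threshold \<open>\<theta> / 2\<close> gives
    density \<open>c\<close>.\<close>
  moreover have "\<theta> * sqrt c / 4 < \<theta> * sqrt c / 2" using \<theta> c by simp
  ultimately have d: "dist2 n \<rho> x y < \<theta> * sqrt c / 2" by linarith
  have xu: "x i \<in> units G" and yu: "y i \<in> units G" if "i \<in> {1..n}" for i using x y that by (auto simp: represents_def)
  let ?J = "{j\<in>{1..n}. \<theta> / 2 \<le> \<rho> (x j) (y j)}"
  have "real (card ?J) \<le> (\<theta> * sqrt c / 2 / (\<theta> / 2))\<^sup>2 * n"
    by (rule dist2_count[OF _ d]) (use \<rho>_props(2) xu yu \<theta> n in auto)
  then have J: "real (card ?J) \<le> c * n" using \<theta> c by simp
  let ?bx = "\<lambda>g. (off_orb n \<sigma> g x (\<theta> / 4))"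
  let ?cy = "\<lambda>g. (off_orb n \<sigma> g y (\<theta> / 4))"
  let ?W = "\<Union>q\<in>\<Q>. q - C q"
  define wx' where "wx' = {i\<in>{1..n}. x i \<in> ?W}"
  define wy' where "wy' = {i\<in>{1..n}. y i \<in> ?W}"
  \<comment> \<open>Three sets of density at most \<open>c\<close>: \<open>x\<close> or
    \<open>y\<close> misbehaves under \<open>g\<close>, or the image index is one at which
    \<open>x\<close> and \<open>y\<close> are far apart.\<close>
  define B where "B g = ?bx g \<union> ?cy g \<union> {i. \<exists>j\<in>?J. (j, i) \<in> \<sigma> g}" for g
  have gfp: "g \<in> fp" if "g \<in> Gs" for g
    using H.open_pseudogroup_basic(5)[OF H.nice_open_pseudogroup[OF H.nice_full_group]] Gs(2) that by blast
  have fin: "\<sigma> g \<in> fin_pseudogroup n" if "g \<in> Gs" for g using \<sigma> gfp[OF that] by (auto simp: Map_set_def)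
  have fB: "finite (B g)" "real (card (B g)) \<le> 3 * c * n" if g: "g \<in> Gs" for g
  proof -
    note p = fin_preimage_card[OF fin[OF g], of ?J]
    show "finite (B g)" unfolding B_def using p(2) by auto
    show "real (card (B g)) \<le> 3 * c * n"
      unfolding B_def using card_Un_real[of "?bx g \<union> ?cy g" "{i. \<exists>j\<in>?J. (j, i) \<in> \<sigma> g}"] card_Un_real[of "?bx g" "?cy g"] bx[OF g] yb[OF g] p(1) J
      by (simp del: atLeastAtMost_iff)
  qed
  have w: "real (card wx') \<le> s * n" "real (card wy') \<le> s * n"
    using wx wy n by (simp_all add: wx'_def wy'_def emp_def field_simps)
  have sub: "{i\<in>{1..n}. \<not> (\<exists>q\<in>\<Q>. x i \<in> q \<and> y i \<in> q)} \<subseteq> wx' \<union> wy' \<union> (\<Union>g\<in>Gs. B g)"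
  proof (rule subsetI, rule ccontr)
    fix i assume "i \<in> {i\<in>{1..n}. \<not> (\<exists>q\<in>\<Q>. x i \<in> q \<and> y i \<in> q)}" and nb: "i \<notin> wx' \<union> wy' \<union> (\<Union>g\<in>Gs. B g)"
    then have i: "i \<in> {1..n}" "\<not> (\<exists>q\<in>\<Q>. x i \<in> q \<and> y i \<in> q)" by blast+
    obtain q q' where q: "q \<in> \<Q>" "q' \<in> \<Q>" "x i \<in> q" "y i \<in> q'"
      using xu[OF i(1)] yu[OF i(1)] partition_onD1[OF Q] by blast
    have "x i \<notin> ?W" "y i \<notin> ?W" using nb i(1) by (simp_all add: wx'_def wy'_def)
    then have "x i \<in> C q" "y i \<in> C q'" using q by blast+
    moreover have "q \<noteq> q'" using i(2) q by blast
    ultimately obtain g where g: "g \<in> Gs" "\<theta> < \<rho> (gact g (x i)) (gact g (y i))" using sep q by blast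
    have gG: "g \<in> fg" using g(1) Gs(2) by auto
    note gx = gact[OF gG xu[OF i(1)]] and gy = gact[OF gG yu[OF i(1)]]
    have nB: "i \<notin> B g" using nb g(1) by blast
    then have e: "ed (Some (gact g (x i))) (map_option x (fin_act (\<sigma> g) i)) \<le> \<theta> / 4"
      "ed (Some (gact g (y i))) (map_option y (fin_act (\<sigma> g) i)) \<le> \<theta> / 4"
      using i(1) gx(1) gy(1) by (simp_all add: B_def)
    have "\<rho> (gact g (x i)) (gact g (y i)) \<le> diam" using \<rho>_props(5) gx gy by auto
    then have big: "\<theta> < diam" using g(2) by linarith
    have "fin_act (\<sigma> g) i \<noteq> None"
    proof
      assume "fin_act (\<sigma> g) i = None"
      then have "ed (Some (gact g (x i))) None \<le> \<theta> / 4" using e(1) by (simp only: option.map)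
      then show False using big \<theta> unfolding ed_simps by linarith
    qed
    then obtain j where j: "fin_act (\<sigma> g) i = Some j" by auto
    then have ji: "(j, i) \<in> \<sigma> g" using fin_act_iff(1)[OF fin[OF g(1)]] by simp
    then have jn: "j \<in> {1..n}" using fin_pseudogroupD(1)[OF fin[OF g(1)]] by auto
    then have nJ: "\<rho> (x j) (y j) < \<theta> / 2" proof -
      have "i \<notin> {i. \<exists>j\<in>?J. (j, i) \<in> \<sigma> g}" using nB unfolding B_def by blast
      then have "j \<notin> ?J" using ji by blast
      then show ?thesis using jn by simp
    qed
    have "\<rho> (gact g (x i)) (x j) \<le> \<theta> / 4" "\<rho> (gact g (y i)) (y j) \<le> \<theta> / 4" using e j by auto
    moreover have "\<rho> (gact g (x i)) (gact g (y i)) \<le> \<rho> (gact g (x i)) (x j) + \<rho> (x j) (gact g (y i))"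
      by (rule \<rho>_props(4)) (use gx gy xu jn in auto)
    moreover have "\<rho> (x j) (gact g (y i)) \<le> \<rho> (x j) (y j) + \<rho> (y j) (gact g (y i))"
      by (rule \<rho>_props(4)) (use gy xu yu jn in auto)
    moreover have "\<rho> (y j) (gact g (y i)) = \<rho> (gact g (y i)) (y j)" by (rule \<rho>_props(3)) (use gy yu jn in auto)
    ultimately show False using g(2) nJ by linarith
  qed
  have "real (card {i\<in>{1..n}. \<not> (\<exists>q\<in>\<Q>. x i \<in> q \<and> y i \<in> q)}) \<le> real (card (wx' \<union> wy' \<union> (\<Union>g\<in>Gs. B g)))"
    by (rule of_nat_mono, rule card_mono[OF _ sub]) (use Gs(1) fB(1) in \<open>auto simp: wx'_def wy'_def\<close>)
  also have "\<dots> \<le> real (card wx') + real (card wy') + real (card (\<Union>g\<in>Gs. B g))"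
    using card_Un_real[of "wx' \<union> wy'" "\<Union>g\<in>Gs. B g"] card_Un_real[of wx' wy'] by linarith
  also have "real (card (\<Union>g\<in>Gs. B g)) \<le> (\<Sum>g\<in>Gs. real (card (B g)))"
    using card_UN_le[OF Gs(1), of B] by (simp flip: of_nat_sum)
  also have "\<dots> \<le> (\<Sum>g\<in>Gs. 3 * c * real n)" by (rule sum_mono) (rule fB(2))
  also have "\<dots> = 3 * c * card Gs * n" by simp
  finally show False using h w by (simp add: distrib_right)
qed

end

context factor_metric_measure begin

lemma units_nonempty: "units G \<noteq> {}"
  using GM.\<nu>.not_empty by simp

text \<open>Off \<open>5 * e * n\<close> indices the orbit error is at most \<open>a\<close>, and
  everywhere at most \<open>diam\<close>. The test functions, composed with \<open>\<pi>\<close>,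
  are averaged over \<open>\<mu>\<close>, whose image is \<open>\<nu>\<close>.\<close>

lemma represents_Orb:
  fixes a e M \<delta> :: real
  assumes P: "finite_partition \<mu> \<P>" and F: "F \<in> Fpow fp" "units H \<in> F" and \<phi>: "\<phi> \<in> Hom G H \<mu> \<pi> n \<sigma> \<P> F e"
    and r: "represents n \<sigma> \<P> F \<phi> x" and E: "E \<in> Fpow pt" "\<And>f. f \<in> E \<Longrightarrow> H.finv f \<in> F" and K: "K \<in> Fpow CH"
    and a: "0 \<le> a" "\<And>q y z. q \<in> \<P> \<Longrightarrow> y \<in> q \<Longrightarrow> z \<in> q \<Longrightarrow> \<rho> y z \<le> a"
      "\<And>k q y z. k \<in> K \<Longrightarrow> q \<in> \<P> \<Longrightarrow> y \<in> q \<Longrightarrow> z \<in> q \<Longrightarrow> \<bar>k (\<pi> y) - k (\<pi> z)\<bar> \<le> a"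
    and M: "\<And>k y. k \<in> K \<Longrightarrow> y \<in> units G \<Longrightarrow> \<bar>k (\<pi> y)\<bar> \<le> M"
    and n: "0 < n" and \<sigma>: "\<sigma> \<in> Map_set fp n" and m: "multiplicative_on H n F0 e \<sigma>"
    and F0: "\<And>f. f \<in> E \<Longrightarrow> {f, H.finv f, set_mult H f (H.finv f), set_mult H (H.finv f) f} \<subseteq> F0"
    and num: "a\<^sup>2 + diam\<^sup>2 * (5 * e) < \<delta>\<^sup>2" "2 * a + M * card \<P> * e < \<delta>" "0 < \<delta>"
  shows "x \<in> orb n \<sigma> E K \<delta>"
proof -
  have x: "x \<in> {1..n} \<rightarrow>\<^sub>E units G" using r by (simp add: represents_def)
  then have xu: "x i \<in> units G" if "i \<in> {1..n}" for i using that by auto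
  have "dist2 n ed (\<lambda>i. mv f (x i)) (\<lambda>i. map_option x (fin_act (\<sigma> f) i)) < \<delta>" if f: "f \<in> E" for f
  proof -
    have fpt: "f \<in> pt" using E(1) f by (auto simp: Fpow_def)
    note ffp = ptD(1)[OF fpt]
    have fin: "\<sigma> f \<in> fin_pseudogroup n" using \<sigma> ffp by (auto simp: Map_set_def)
    have b: "real (card (off_orb n \<sigma> f x a)) \<le> 5 * e * n"
      by (rule represents_orbit[OF P F \<phi> r ffp E(2)[OF f] a(1,2) n \<sigma> m F0[OF f]])
    have "dist2 n ed (\<lambda>i. mv f (x i)) (\<lambda>i. map_option x (fin_act (\<sigma> f) i)) \<le> sqrt (a\<^sup>2 + diam\<^sup>2 * (5 * e))"
      by (rule dist2_le[where r=ed and x="\<lambda>i. mv f (x i)" and x'="\<lambda>i. map_option x (fin_act (\<sigma> f) i)"])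
        (use ed_bounds[OF act_range[OF ffp xu] fin_act_range[OF fin xu] units_nonempty] a(1) b n in auto)
    also have "\<dots> < \<delta>" using num(1,3) by (simp add: real_less_lsqrt)
    finally show ?thesis .
  qed
  moreover have "\<bar>(\<Sum>i\<in>{1..n}. k (\<pi> (x i))) / real n - (\<integral>y. k y \<partial>\<nu>)\<bar> < \<delta>" if k: "k \<in> K" for k
  proof -
    have kc: "continuous_map H.X euclideanreal k" using K k by (auto simp: Fpow_def)
    have m\<pi>: "\<pi> \<in> \<mu> \<rightarrow>\<^sub>M \<nu>"
      using borel_of_measurable[OF \<pi>_contX] measurable_cong_sets[OF GM.sets_\<nu> H.sets_\<nu>] by simp
    have mk: "k \<in> borel_measurable \<nu>"
      using continuous_map_borel_measurable[OF kc] by (simp add: measurable_cong_sets[OF H.sets_\<nu> refl])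
    have "(\<integral>y. k y \<partial>\<nu>) = (\<integral>y. k y \<partial>(distr \<mu> \<nu> \<pi>))" by (simp only: push)
    also have "\<dots> = (\<integral>y. k (\<pi> y) \<partial>\<mu>)" by (rule integral_distr[OF m\<pi> mk])
    finally have i: "(\<integral>y. k y \<partial>\<nu>) = (\<integral>y. k (\<pi> y) \<partial>\<mu>)" .
    have "\<bar>(\<Sum>i\<in>{1..n}. k (\<pi> (x i))) / real n - (\<integral>y. k (\<pi> y) \<partial>\<mu>)\<bar> \<le> 2 * a + M * card \<P> * e"
    proof (rule emp_integral_close[OF GM.\<nu>.prob_space_axioms P])
      show "(\<lambda>y. k (\<pi> y)) \<in> borel_measurable \<mu>" using measurable_compose[OF m\<pi> mk] .
      fix p assume "p \<in> \<P>"
      then have "p \<in> alg \<P> F" using partition_act_props(3)[OF P F] by blast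
      from represents_mass[OF P F \<phi> r this]
      show "\<bar>real (card {i\<in>{1..n}. x i \<in> p}) / real n - measure \<mu> p\<bar> \<le> e" by (simp add: emp_def)
    qed (use a(3)[OF k] M[OF k] n xu in auto)
    then show ?thesis using num(2) unfolding i by linarith
  qed
  ultimately show ?thesis using x by (simp add: Orb_def)
qed

text \<open>A partition small for \<open>\<rho>\<close> plus the variation of the test functions is
  refined jointly with \<open>S\<close> and \<open>\<Q>\<close>; the resulting atoms lie inside the
  small sets.\<close>

lemma fine_partition:
  fixes a :: real
  assumes Q: "finite_partition \<mu> \<Q>" and S: "finite S" "S \<subseteq> sets \<mu>" and K: "K \<in> Fpow CH" and "a > 0"
  obtains \<P> where "finite_partition \<mu> \<P>" "refines (units G) \<P> \<Q>" "\<And>B. B \<in> S \<union> \<Q> \<Longrightarrow> \<exists>C\<subseteq>\<P>. B = \<Union>C"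
    "\<And>q y z. q \<in> \<P> \<Longrightarrow> y \<in> q \<Longrightarrow> z \<in> q \<Longrightarrow> \<rho> y z \<le> a"
    "\<And>k q y z. k \<in> K \<Longrightarrow> q \<in> \<P> \<Longrightarrow> y \<in> q \<Longrightarrow> z \<in> q \<Longrightarrow> \<bar>k (\<pi> y) - k (\<pi> z)\<bar> \<le> a"
proof -
  define \<rho>' where "\<rho>' x y = \<rho> x y + (\<Sum>k\<in>K. \<bar>k (\<pi> x) - k (\<pi> y)\<bar>)" for x y
  have fK: "finite K" "K \<subseteq> CH" using K by (auto simp: Fpow_def)
  have ck: "continuous_map G.X euclideanreal (\<lambda>x. k (\<pi> x))" if "k \<in> K" for k
    using continuous_map_compose[OF \<pi>_contX, of euclideanreal k] fK that by (auto simp: o_def)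
  have \<rho>': "continuous_pseudometric G.X \<rho>'"
    unfolding \<rho>'_def by (rule continuous_pseudometric_add_sum[OF \<rho> fK(1)]) (rule ck)
  obtain \<S> Z where "finite_partition \<mu> \<S>" and small: "\<And>q x y. q \<in> \<S> \<Longrightarrow> x \<in> q \<Longrightarrow> y \<in> q \<Longrightarrow> \<rho>' x y \<le> a"
    using G.X.small_partition[OF \<rho>' GM.\<nu>.finite_measure_axioms GM.sets_\<nu> \<open>a > 0\<close>] by metis
  then have Sf: "finite \<S>" "\<S> \<subseteq> sets \<mu>" "\<Union>\<S> = units G" by (auto simp: finite_partition_def partition_on_def)
  have Qf: "finite \<Q>" "\<Q> \<subseteq> sets \<mu>" "partition_on (units G) \<Q>" using Q by (auto simp: finite_partition_def)
  define T where "T = S \<union> \<Q> \<union> \<S>"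
  have T: "finite T" "T \<subseteq> sets \<mu>" using Sf Qf S by (auto simp: T_def)
  define \<P> where "\<P> = coarsest_partition (units G) T"
  note cf = coarsest_finite_partition[OF T, unfolded GM.space_\<nu>, folded \<P>_def]
  have pP: "partition_on (units G) \<P>" using cf(1) by (simp add: finite_partition_def)
  have inside: "p \<subseteq> B" if h: "p \<in> \<P>" "B \<in> T" "y \<in> p" "y \<in> B" for p B y
  proof -
    obtain C where C: "C \<subseteq> \<P>" "B = \<Union>C" using cf(2)[OF h(2)] by blast
    then obtain p' where p': "p' \<in> C" "y \<in> p'" using h(4) by blast
    then have "p' = p" using partition_on_eqI[OF pP _ h(1) p'(2) h(3)] C(1) by blast
    then show ?thesis using C p' by blast
  qed
  have sm: "\<rho>' y z \<le> a" if "q \<in> \<P>" "y \<in> q" "z \<in> q" for q y z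
  proof -
    have "y \<in> units G" using that partition_onD1[OF pP] by blast
    then obtain B where B: "B \<in> \<S>" "y \<in> B" using Sf(3) by blast
    then have "q \<subseteq> B" using inside[of q B y] that by (auto simp: T_def)
    then show ?thesis using small[OF B] that by blast
  qed
  have yz: "y \<in> units G" if "q \<in> \<P>" "y \<in> q" for q y using that partition_onD1[OF pP] by blast
  show ?thesis
  proof (rule that[of \<P>])
    show "finite_partition \<mu> \<P>" by (rule cf(1))
    show "refines (units G) \<P> \<Q>" unfolding refines_def
    proof (intro conjI ballI)
      fix p assume p: "p \<in> \<P>"
      then obtain y where y: "y \<in> p" using partition_onD3[OF pP] by (metis ex_in_conv)
      then obtain q where q: "q \<in> \<Q>" "y \<in> q" using yz[OF p] partition_onD1[OF Qf(3)] by blast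
      then have "p \<subseteq> q" using inside[OF p, of q y] y by (auto simp: T_def)
      then show "\<exists>q\<in>\<Q>. p \<subseteq> q" using q by blast
    qed (use pP Qf in auto)
    show "\<exists>C\<subseteq>\<P>. B = \<Union>C" if "B \<in> S \<union> \<Q>" for B by (rule cf(2)) (use that in \<open>simp add: T_def\<close>)
    fix q y z assume q: "q \<in> \<P>" "y \<in> q" "z \<in> q"
    have "0 \<le> (\<Sum>k\<in>K. \<bar>k (\<pi> y) - k (\<pi> z)\<bar>)" by (simp add: sum_nonneg)
    then show "\<rho> y z \<le> a" using sm[OF q] unfolding \<rho>'_def by linarith
    fix k assume k: "k \<in> K"
    have "\<bar>k (\<pi> y) - k (\<pi> z)\<bar> \<le> (\<Sum>k\<in>K. \<bar>k (\<pi> y) - k (\<pi> z)\<bar>)"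
      using member_le_sum[OF k, of "\<lambda>k. \<bar>k (\<pi> y) - k (\<pi> z)\<bar>"] fK(1) by simp
    moreover have "0 \<le> \<rho> y z" using \<rho>_props(2) yz q by blast
    ultimately show "\<bar>k (\<pi> y) - k (\<pi> z)\<bar> \<le> a" using sm[OF q] by (simp add: \<rho>'_def)
  qed
qed

lemma continuous_bounded:
  assumes K: "K \<in> Fpow CH"
  obtains M where "0 \<le> M" "\<And>k y. k \<in> K \<Longrightarrow> y \<in> units G \<Longrightarrow> \<bar>k (\<pi> y)\<bar> \<le> M"
proof -
  have "\<exists>M. \<forall>y\<in>units G. \<bar>k (\<pi> y)\<bar> \<le> M" if k: "k \<in> K" for k
  proof -
    have "continuous_map H.X euclideanreal k" using K k by (auto simp: Fpow_def)
    then have "compactin euclideanreal (k ` topspace H.X)"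
      using image_compactin H.compact_units compact_space_def by blast
    then have "bounded (k ` units H)" unfolding H.topspace_X by (simp add: compact_imp_bounded)
    then obtain M where "\<forall>t\<in>k ` units H. norm t \<le> M" unfolding bounded_iff by blast
    then show ?thesis using \<pi>_units by (intro exI[of _ M]) auto
  qed
  then obtain M where M: "\<And>k y. k \<in> K \<Longrightarrow> y \<in> units G \<Longrightarrow> \<bar>k (\<pi> y)\<bar> \<le> M k" by metis
  have fK: "finite K" using K by (simp add: Fpow_def)
  show ?thesis
  proof (rule that[of "\<Sum>k\<in>K. \<bar>M k\<bar>"])
    fix k y assume k: "k \<in> K" and y: "y \<in> units G"
    have "\<bar>k (\<pi> y)\<bar> \<le> \<bar>M k\<bar>" using M[OF k y] by linarith
    also have "\<dots> \<le> (\<Sum>k\<in>K. \<bar>M k\<bar>)" by (rule member_le_sum[OF k]) (use fK in auto)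
    finally show "\<bar>k (\<pi> y)\<bar> \<le> (\<Sum>k\<in>K. \<bar>M k\<bar>)" .
  qed (simp add: sum_nonneg)
qed

text \<open>The data on the side of homomorphisms may depend on \<open>F\<close>, \<open>K\<close>
  and \<open>\<delta>\<close>, because that side carries infima over them. The scale
  \<open>\<epsilon>\<close> is a parameter, to be fixed earlier.\<close>

definition hom_dominated :: "'c set set \<Rightarrow> real \<Rightarrow> real \<Rightarrow> 'a set set \<Rightarrow> ('a \<Rightarrow> real) set \<Rightarrow> real \<Rightarrow> bool" where
  "hom_dominated \<Q> \<kappa> \<epsilon> F K \<delta> \<longleftrightarrow> (\<exists>\<P> F' e F0. finite_partition \<mu> \<P> \<and> refines (units G) \<P> \<Q> \<and> F' \<in> Fpow fp \<and> units H \<in> F' \<and> 0 < e \<and> F0 \<in> Fpow fp \<and>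
        (\<forall>n \<sigma>. 0 < n \<longrightarrow> \<sigma> \<in> Map_set fp n \<longrightarrow> multiplicative_on H n F0 e \<sigma> \<longrightarrow>
          of_nat (Hom_count G H \<mu> \<pi> n \<sigma> \<P> F' e \<Q>) \<le>
            ennreal (exp (\<kappa> * real n)) * sep_number \<epsilon> (orb n \<sigma> F K \<delta>) (dist2 n \<rho>)))"

text \<open>The proportion \<open>t\<close> from \<open>packing\<close> depends only on
  \<open>\<kappa>\<close> and the number of atoms of \<open>\<Q>\<close>, and the separating
  elements only on \<open>\<Q>\<close> and \<open>t\<close>. Hence \<open>\<epsilon>\<close> can be
  chosen before \<open>F\<close>, \<open>K\<close> and \<open>\<delta>\<close>, as the order of
  supremum and infima demands.\<close>

lemma Hom_count_le_sep_number:
  fixes \<kappa> :: real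
  assumes Q: "finite_partition \<mu> \<Q>" and "\<kappa> > 0"
  obtains \<epsilon> :: real where "\<epsilon> > 0"
    "\<And>F K \<delta>. F \<in> Fpow pt \<Longrightarrow> K \<in> Fpow CH \<Longrightarrow> 0 < \<delta> \<Longrightarrow>
      hom_dominated \<Q> \<kappa> \<epsilon> F K \<delta>"
proof -
  have Qf: "finite \<Q>" "\<Q> \<subseteq> sets \<mu>" "partition_on (units G) \<Q>" using Q by (auto simp: finite_partition_def)
  obtain t :: real where t: "t > 0"
    "\<And>(n::nat) (V::'c set set) Y. finite V \<Longrightarrow> card V \<le> card \<Q> \<Longrightarrow> Y \<subseteq> {1..n} \<rightarrow>\<^sub>E V \<Longrightarrow>
      \<exists>S\<subseteq>Y. pairwise (\<lambda>a b. t * n < card {i\<in>{1..n}. a i \<noteq> b i}) S \<and> card Y \<le> card S * exp (\<kappa> * n)"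
    by (rule packing[OF \<open>\<kappa> > 0\<close>, of "card \<Q>"], rule that)
  \<comment> \<open>Budget for \<open>represents_separated\<close>: a mass of at most
    \<open>2 * s\<close> for each of two tuples gives \<open>t / 4\<close>, and \<open>Gs\<close>
    contributes at most \<open>3 * t / 8\<close> through \<open>c\<close>; together this is below
    \<open>t\<close>.\<close>
  define s where "s = t / 16"
  have s: "s > 0" using t(1) by (simp add: s_def)
  obtain C Gs \<theta> where C: "\<And>q. q \<in> \<Q> \<Longrightarrow> C q \<in> sets \<mu>" "\<And>q. q \<in> \<Q> \<Longrightarrow> C q \<subseteq> q"
    "measure \<mu> (\<Union>q\<in>\<Q>. q - C q) \<le> s" and Gs: "finite Gs" "Gs \<subseteq> fg" and \<theta>: "0 < \<theta>"
    and sep: "\<And>q q' x y. q \<in> \<Q> \<Longrightarrow> q' \<in> \<Q> \<Longrightarrow> q \<noteq> q' \<Longrightarrow> x \<in> C q \<Longrightarrow> y \<in> C q' \<Longrightarrow> \<exists>g\<in>Gs. \<theta> < \<rho> (gact g x) (gact g y)"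
    using separating_data[OF Q s] by blast
  define c where "c = t / (8 * (real (card Gs) + 1))"
  have c: "c > 0" "3 * c * card Gs \<le> 3 * t / 8"
    using t(1) by (simp_all add: c_def field_simps)
  have Gpt: "g \<in> pt" if "g \<in> Gs" for g
    using H.open_pseudogroup_basic(6)[OF H.nice_open_pseudogroup[OF H.nice_full_group]] Gs(2) that by blast
  show ?thesis
  proof (rule that[of "\<theta> * sqrt c / 4"])
    show "0 < \<theta> * sqrt c / 4" using \<theta> c by simp
    fix F K and \<delta> :: real assume F: "F \<in> Fpow pt" and K: "K \<in> Fpow CH" and \<delta>: "0 < \<delta>"
    \<comment> \<open>The separating elements are tested along with \<open>F\<close>, so that the
      tuples also follow the action of \<open>Gs\<close>.\<close>
    define E where "E = F \<union> Gs"
    have E: "finite E" "E \<subseteq> pt" using F Gs(1) Gpt by (auto simp: E_def Fpow_def)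
    have Efp: "f \<in> fp" "H.finv f \<in> fp" "set_mult H f (H.finv f) \<in> fp" "set_mult H (H.finv f) f \<in> fp" if f: "f \<in> E" for f
    proof -
      show ffp: "f \<in> fp" using ptD(1) E(2) f by blast
      show "H.finv f \<in> fp" by (rule H.finv_full_pseudogroup[OF ffp])
      show "set_mult H f (H.finv f) \<in> fp" by (rule set_mult_finv_full_pseudogroup[OF ffp])
      show "set_mult H (H.finv f) f \<in> fp"
        using set_mult_finv_full_pseudogroup[OF H.finv_full_pseudogroup[OF ffp]] H.finv_finv[OF fpD(2)[OF ffp]] by simp
    qed
    define a where "a = min (\<delta> / 4) (\<theta> / 4)"
    have a: "a > 0" "a \<le> \<delta> / 4" "a \<le> \<theta> / 4" using \<delta> \<theta> by (simp_all add: a_def)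
    have CS: "finite (C ` \<Q>)" "C ` \<Q> \<subseteq> sets \<mu>" using Qf(1) C(1) by auto
    obtain \<P> where P: "finite_partition \<mu> \<P>" "refines (units G) \<P> \<Q>"
      and PU: "\<And>B. B \<in> C ` \<Q> \<union> \<Q> \<Longrightarrow> \<exists>C\<subseteq>\<P>. B = \<Union>C"
      and osc: "\<And>q y z. q \<in> \<P> \<Longrightarrow> y \<in> q \<Longrightarrow> z \<in> q \<Longrightarrow> \<rho> y z \<le> a"
        "\<And>k q y z. k \<in> K \<Longrightarrow> q \<in> \<P> \<Longrightarrow> y \<in> q \<Longrightarrow> z \<in> q \<Longrightarrow> \<bar>k (\<pi> y) - k (\<pi> z)\<bar> \<le> a"
      by (rule fine_partition[OF Q CS K a(1)], rule that)
    obtain M where M: "0 \<le> M" "\<And>k y. k \<in> K \<Longrightarrow> y \<in> units G \<Longrightarrow> \<bar>k (\<pi> y)\<bar> \<le> M"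
      using continuous_bounded[OF K] by metis
    define m where "m = M * real (card \<P>)"
    have m: "m \<ge> 0" using M(1) by (simp add: m_def)
    \<comment> \<open>The four terms serve the density \<open>c\<close> for \<open>Gs\<close>, the
      mass of the part outside the sets \<open>C q\<close>, the mean square orbit error, and the
      error of the integrals.\<close>
    define e where "e = min (min (c / 5) s) (min (\<delta>\<^sup>2 / (10 * (diam\<^sup>2 + 1))) (\<delta> / (4 * (m + 1))))"
    have e: "0 < e" "5 * e \<le> c" "e \<le> s" "diam\<^sup>2 * (5 * e) \<le> \<delta>\<^sup>2 / 2" "m * e \<le> \<delta> / 4"
    proof -
      have p: "diam\<^sup>2 + 1 > 0" by (simp add: add_nonneg_pos)
      show "0 < e" unfolding e_def using c s \<delta> m p by auto
      show "5 * e \<le> c" "e \<le> s" by (auto simp: e_def)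
      have "diam\<^sup>2 * (5 * e) \<le> diam\<^sup>2 * (5 * (\<delta>\<^sup>2 / (10 * (diam\<^sup>2 + 1))))"
        by (intro mult_left_mono) (auto simp: e_def)
      also have "\<dots> = \<delta>\<^sup>2 / 2 * (diam\<^sup>2 / (diam\<^sup>2 + 1))" using p by (simp add: field_simps)
      also have "\<dots> \<le> \<delta>\<^sup>2 / 2 * 1" using p by (intro mult_left_mono) (auto simp: divide_le_eq)
      finally show "diam\<^sup>2 * (5 * e) \<le> \<delta>\<^sup>2 / 2" by simp
      have "m * e \<le> m * (\<delta> / (4 * (m + 1)))" by (intro mult_left_mono m) (auto simp: e_def)
      also have "\<dots> = \<delta> / 4 * (m / (m + 1))" using m by (simp add: field_simps)
      also have "\<dots> \<le> \<delta> / 4 * 1" using m \<delta> by (intro mult_left_mono) (auto simp: divide_le_eq)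
      finally show "m * e \<le> \<delta> / 4" by simp
    qed
    define F' where "F' = insert (units H) (H.finv ` E)"
    have F': "F' \<in> Fpow fp" "units H \<in> F'" using E(1) Efp(2) units_full_pseudogroup by (auto simp: F'_def Fpow_def)
    define F0 where "F0 = (\<Union>f\<in>E. {f, H.finv f, set_mult H f (H.finv f), set_mult H (H.finv f) f})"
    have F0: "F0 \<in> Fpow fp" using E(1) Efp by (auto simp: F0_def Fpow_def)
    define \<Sigma> where "\<Sigma> = alg \<P> F'"
    note pa = partition_act_props[OF P(1) F', folded \<Sigma>_def]
    interpret \<Sigma>: sigma_algebra "units G" \<Sigma>
      unfolding \<Sigma>_def by (rule sigma_algebra_sigma_sets) (use partition_onD1[OF pa(4)] in auto)
    have BS: "B \<in> \<Sigma>" if B: "B \<in> C ` \<Q> \<union> \<Q>" for B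
    proof -
      obtain D where D: "D \<subseteq> \<P>" "B = \<Union>D" using PU[OF B] by blast
      have "finite D" using D(1) P(1) finite_subset by (auto simp: finite_partition_def)
      then show ?thesis unfolding D(2) using D(1) pa(3) by (intro \<Sigma>.finite_Union) auto
    qed
    have WS: "(\<Union>q\<in>\<Q>. q - C q) \<in> \<Sigma>" using Qf(1) BS by (intro \<Sigma>.finite_UN) auto
    show "hom_dominated \<Q> \<kappa> (\<theta> * sqrt c / 4) F K \<delta>"
      unfolding hom_dominated_def
    proof (intro exI conjI allI impI)
      fix n \<sigma> assume n: "0 < n" and \<sigma>: "\<sigma> \<in> Map_set fp n" and mu: "multiplicative_on H n F0 e \<sigma>"
      let ?H = "Hom G H \<mu> \<pi> n \<sigma> \<P> F' e"
      have "\<exists>x. represents n \<sigma> \<P> F' \<phi> x" if "\<phi> \<in> ?H" for \<phi> using hom_represents[OF P(1) F' that] by blast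
      then obtain x where x: "\<And>\<phi>. \<phi> \<in> ?H \<Longrightarrow> represents n \<sigma> \<P> F' \<phi> (x \<phi>)" by metis
      have xu: "x \<phi> i \<in> units G" if "\<phi> \<in> ?H" "i \<in> {1..n}" for \<phi> i using x[OF that(1)] that(2) by (auto simp: represents_def)
      have eq: "\<phi> B = {i\<in>{1..n}. x \<phi> i \<in> B}" if "\<phi> \<in> ?H" "B \<in> \<Sigma>" for \<phi> B
        using represents_eq[OF that(1) x[OF that(1)]] that(2) by (simp add: \<Sigma>_def)
      have orb: "x \<phi> \<in> orb n \<sigma> F K \<delta>" if \<phi>: "\<phi> \<in> ?H" for \<phi>
      proof (rule represents_Orb[OF P(1) F' \<phi> x[OF \<phi>] F _ K _ _ _ _ n \<sigma> mu])
        show "a\<^sup>2 + diam\<^sup>2 * (5 * e) < \<delta>\<^sup>2"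
        proof -
          have "a\<^sup>2 \<le> (\<delta> / 4)\<^sup>2" using a by (intro power_mono) auto
          moreover have "(\<delta> / 4)\<^sup>2 = \<delta>\<^sup>2 / 16" by (simp add: power_divide)
          moreover have "0 < \<delta>\<^sup>2" using \<delta> by simp
          ultimately show ?thesis using e(4) by linarith
        qed
        show "2 * a + M * real (card \<P>) * e < \<delta>" using e(5) a(2) \<delta> unfolding m_def by linarith
      qed (use a \<delta> in \<open>auto intro: osc M(2) simp: F'_def F0_def E_def\<close>)
      \<comment> \<open>The words \<open>l \<phi>\<close> formed from these labels are itineraries
        over the finite alphabet \<open>\<Q>\<close>, to which \<open>packing\<close>
        applies.\<close>
      define lab where "lab y = (THE q. q \<in> \<Q> \<and> y \<in> q)" for y
      have lab: "lab y = q" if "q \<in> \<Q>" "y \<in> q" for y q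
        unfolding lab_def using partition_on_eqI[OF Qf(3)] that by (intro the_equality) auto
      define l where "l \<phi> = (\<lambda>i\<in>{1..n}. lab (x \<phi> i))" for \<phi>
      have lQ: "lab (x \<phi> i) \<in> \<Q>" if h: "\<phi> \<in> ?H" "i \<in> {1..n}" for \<phi> i
      proof -
        obtain q where "q \<in> \<Q>" "x \<phi> i \<in> q" using xu[OF h] partition_onD1[OF Qf(3)] by blast
        then show ?thesis using lab by simp
      qed
      have Y: "l ` ?H \<subseteq> {1..n} \<rightarrow>\<^sub>E \<Q>" using lQ by (auto simp: l_def)
      obtain S where S: "S \<subseteq> l ` ?H" "pairwise (\<lambda>a b. t * n < card {i\<in>{1..n}. a i \<noteq> b i}) S"
        "card (l ` ?H) \<le> card S * exp (\<kappa> * n)"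
        using t(2)[OF Qf(1) order_refl Y] by blast
      have fY: "finite (l ` ?H)" by (rule finite_subset[OF Y]) (use Qf(1) in \<open>auto intro: finite_PiE\<close>)
      \<comment> \<open>One homomorphism is kept for each word selected by the packing.\<close>
      obtain T where T: "T \<subseteq> ?H" "inj_on l T" "S = l ` T" using S(1) subset_image_inj by metis
      have fT: "finite T" using T(2,3) S(1) fY finite_subset finite_image_iff by metis
      \<comment> \<open>The restriction of a homomorphism to the algebra of \<open>\<Q>\<close> is
        determined by its itinerary.\<close>
      have count: "Hom_count G H \<mu> \<pi> n \<sigma> \<P> F' e \<Q> \<le> card (l ` ?H)"
      proof -
        have "(\<lambda>\<phi>. restrict \<phi> (sigma_sets (units G) \<Q>)) ` ?H \<subseteq>
          (\<lambda>v. \<lambda>B\<in>sigma_sets (units G) \<Q>. {i\<in>{1..n}. v i \<subseteq> B}) ` l ` ?H"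
        proof -
          have "restrict \<phi> (sigma_sets (units G) \<Q>) = (\<lambda>B\<in>sigma_sets (units G) \<Q>. {i\<in>{1..n}. l \<phi> i \<subseteq> B})" if \<phi>: "\<phi> \<in> ?H" for \<phi>
          proof (rule restrict_ext)
            fix B assume "B \<in> sigma_sets (units G) \<Q>"
            then obtain D where D: "D \<subseteq> \<Q>" "B = \<Union>D" unfolding sigma_sets_finite_partition[OF Qf(1,3)] by blast
            have "finite D" using D(1) Qf(1) finite_subset by blast
            then have BS': "B \<in> \<Sigma>" unfolding D(2) using D(1) BS by (intro \<Sigma>.finite_Union) auto
            have "x \<phi> i \<in> B \<longleftrightarrow> lab (x \<phi> i) \<subseteq> B" if i: "i \<in> {1..n}" for i
            proof -
              obtain q where q: "q \<in> \<Q>" "x \<phi> i \<in> q" using xu[OF \<phi> i] partition_onD1[OF Qf(3)] by blast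
              have "q \<subseteq> B" if "x \<phi> i \<in> B"
                using that D q partition_on_eqI[OF Qf(3) q(1) _ q(2)] by blast
              then show ?thesis using q lab[OF q] by auto
            qed
            then show "\<phi> B = {i\<in>{1..n}. l \<phi> i \<subseteq> B}" unfolding eq[OF \<phi> BS'] by (auto simp: l_def)
          qed
          then show ?thesis by (auto simp: image_image)
        qed
        then show ?thesis unfolding Hom_count_def
          using surj_card_le[OF fY] by blast
      qed
      have dist: "\<theta> * sqrt c / 4 < dist2 n \<rho> (x \<phi>) (x \<phi>')" if \<phi>: "\<phi> \<in> T" "\<phi>' \<in> T" "\<phi> \<noteq> \<phi>'" for \<phi> \<phi>'
      proof -
        have H: "\<phi> \<in> ?H" "\<phi>' \<in> ?H" using \<phi> T(1) by auto
        have bad: "real (card (off_orb n \<sigma> g (x \<psi>) (\<theta> / 4))) \<le> c * n"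
          if g: "g \<in> Gs" and \<psi>: "\<psi> \<in> ?H" for g \<psi>
        proof -
          have gE: "g \<in> E" using g by (simp add: E_def)
          have "real (card (off_orb n \<sigma> g (x \<psi>) (\<theta> / 4))) \<le> 5 * e * n"
          proof (rule represents_orbit[OF P(1) F' \<psi> x[OF \<psi>] Efp(1)[OF gE] _ _ _ n \<sigma> mu])
            show "\<rho> y z \<le> \<theta> / 4" if "q \<in> \<P>" "y \<in> q" "z \<in> q" for q y z using osc(1)[OF that] a(3) by linarith
          qed (use gE \<theta> in \<open>auto simp: F'_def F0_def\<close>)
          also have "\<dots> \<le> c * n" using e(2) by (intro mult_right_mono) auto
          finally show ?thesis .
        qed
        have w: "emp n (x \<psi>) (\<Union>q\<in>\<Q>. q - C q) \<le> 2 * s" if "\<psi> \<in> ?H" for \<psi>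
          using represents_mass[OF P(1) F' that x[OF that] WS[unfolded \<Sigma>_def]] C(3) e(3) by linarith
        have "l \<phi> \<noteq> l \<phi>'" using inj_onD[OF T(2)] \<phi> by blast
        then have "t * n < card {i\<in>{1..n}. l \<phi> i \<noteq> l \<phi>' i}" using S(2) \<phi> unfolding T(3) pairwise_def by blast
        also have "card {i\<in>{1..n}. l \<phi> i \<noteq> l \<phi>' i} \<le> card {i\<in>{1..n}. \<not> (\<exists>q\<in>\<Q>. x \<phi> i \<in> q \<and> x \<phi>' i \<in> q)}"
          by (rule card_mono) (use lab in \<open>auto simp: l_def\<close>)
        finally have h: "t * n < card {i\<in>{1..n}. \<not> (\<exists>q\<in>\<Q>. x \<phi> i \<in> q \<and> x \<phi>' i \<in> q)}" by simp
        have "(2 * (2 * s) + 3 * c * card Gs) * n \<le> t * n"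
          using c(2) t(1) by (intro mult_right_mono) (auto simp: s_def)
        then have h': "real (card {i\<in>{1..n}. \<not> (\<exists>q\<in>\<Q>. x \<phi> i \<in> q \<and> x \<phi>' i \<in> q)}) > (2 * (2 * s) + 3 * c * card Gs) * n"
          using h by linarith
        show ?thesis
          by (rule represents_separated[OF x[OF H(1)] x[OF H(2)] n \<sigma> Qf(3) Gs \<theta> sep _ _ w[OF H(1)] w[OF H(2)] h' c(1)])
            (use bad H in auto)
      qed
      have injx: "inj_on x T"
      proof (rule inj_onI, rule ccontr)
        fix \<phi> \<phi>' assume h: "\<phi> \<in> T" "\<phi>' \<in> T" "x \<phi> = x \<phi>'" "\<phi> \<noteq> \<phi>'"
        then have "\<theta> * sqrt c / 4 < dist2 n \<rho> (x \<phi>) (x \<phi>)" using dist[OF h(1,2,4)] by simp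
        moreover have "\<rho> (x \<phi> i) (x \<phi> i) = 0" if "i \<in> {1..n}" for i
          using xu[OF _ that, of \<phi>] h(1) T(1) by (intro \<rho>_props(1)) auto
        then have "dist2 n \<rho> (x \<phi>) (x \<phi>) = 0" by (simp add: dist2_def)
        moreover have "0 < \<theta> * sqrt c" using \<theta> c by simp
        ultimately show False by linarith
      qed
      have "x ` T \<in> {S. finite S \<and> S \<subseteq> orb n \<sigma> F K \<delta> \<and> pairwise (\<lambda>y z. \<theta> * sqrt c / 4 < dist2 n \<rho> y z) S}"
        using fT orb T(1) dist by (auto simp: pairwise_def)
      then have "of_nat (card (x ` T)) \<le> sep_number (\<theta> * sqrt c / 4) (orb n \<sigma> F K \<delta>) (dist2 n \<rho>)"
        unfolding sep_number_def by (rule SUP_upper)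
      then have sn: "ennreal (real (card S)) \<le> sep_number (\<theta> * sqrt c / 4) (orb n \<sigma> F K \<delta>) (dist2 n \<rho>)"
        using card_image[OF injx] card_image[OF T(2)] T(3) by (simp add: ennreal_of_nat_eq_real_of_nat)
      have "real (Hom_count G H \<mu> \<pi> n \<sigma> \<P> F' e \<Q>) \<le> card S * exp (\<kappa> * n)" using count S(3) by linarith
      then have "ennreal (real (Hom_count G H \<mu> \<pi> n \<sigma> \<P> F' e \<Q>)) \<le> ennreal (exp (\<kappa> * n) * card S)"
        by (intro ennreal_leI) (simp add: mult.commute)
      also have "\<dots> = ennreal (exp (\<kappa> * n)) * ennreal (card S)" by (simp add: ennreal_mult)
      also have "\<dots> \<le> ennreal (exp (\<kappa> * n)) * sep_number (\<theta> * sqrt c / 4) (orb n \<sigma> F K \<delta>) (dist2 n \<rho>)"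
        by (rule mult_left_mono[OF sn]) simp
      finally show "of_nat (Hom_count G H \<mu> \<pi> n \<sigma> \<P> F' e \<Q>) \<le>
            ennreal (exp (\<kappa> * real n)) * sep_number (\<theta> * sqrt c / 4) (orb n \<sigma> F K \<delta>) (dist2 n \<rho>)"
        by (simp add: ennreal_of_nat_eq_real_of_nat)
    qed (use P F' F0 e(1) in auto)
  qed
qed

end

section \<open>The variational principle\<close>

lemma sep_number_mono:
  assumes "X \<subseteq> Y" shows "sep_number \<epsilon> X r \<le> sep_number \<epsilon> Y r"
  unfolding sep_number_def by (rule SUP_subset_mono) (use assms in auto)

lemma sep_number_empty: "sep_number \<epsilon> {} r = 0"
proof -
  have e: "{S. finite S \<and> S \<subseteq> {} \<and> pairwise (\<lambda>x y. \<epsilon> < r x y) S} = {{}}" by auto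
  show ?thesis unfolding sep_number_def e by simp
qed

lemma sep_number_ge_1:
  assumes "x \<in> X" shows "1 \<le> sep_number \<epsilon> X r"
proof -
  have "of_nat (card {x}) \<le> sep_number \<epsilon> X r"
    unfolding sep_number_def by (rule SUP_upper) (use assms in auto)
  then show ?thesis by simp
qed

lemma sep_number_leI:
  assumes "\<And>S. finite S \<Longrightarrow> S \<subseteq> X \<Longrightarrow> pairwise (\<lambda>x y. \<epsilon> < r x y) S \<Longrightarrow> of_nat (card S) \<le> c"
  shows "sep_number \<epsilon> X r \<le> c"
  unfolding sep_number_def by (rule SUP_least) (use assms in auto)

text \<open>A separated set is split along the cover, and its parts stay separated.\<close>

lemma sep_number_UN_le:
  assumes "finite I" "X \<subseteq> (\<Union>i\<in>I. Y i)"
  shows "sep_number \<epsilon> X r \<le> (\<Sum>i\<in>I. sep_number \<epsilon> (Y i) r)"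
proof (rule sep_number_leI)
  fix S assume S: "finite S" "S \<subseteq> X" "pairwise (\<lambda>x y. \<epsilon> < r x y) S"
  have "S = (\<Union>i\<in>I. S \<inter> Y i)" using S(2) assms(2) by blast
  then have "card S \<le> (\<Sum>i\<in>I. card (S \<inter> Y i))" using card_UN_le[OF assms(1), of "\<lambda>i. S \<inter> Y i"] by simp
  then have "of_nat (card S) \<le> (of_nat (\<Sum>i\<in>I. card (S \<inter> Y i)) :: ennreal)" by (rule of_nat_mono)
  also have "\<dots> = (\<Sum>i\<in>I. of_nat (card (S \<inter> Y i)))" by simp
  also have "\<dots> \<le> (\<Sum>i\<in>I. sep_number \<epsilon> (Y i) r)"
  proof (rule sum_mono)
    fix i
    have "pairwise (\<lambda>x y. \<epsilon> < r x y) (S \<inter> Y i)" using S(3) by (auto simp: pairwise_def)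
    then show "of_nat (card (S \<inter> Y i)) \<le> sep_number \<epsilon> (Y i) r"
      unfolding sep_number_def using S(1) by (intro SUP_upper) auto
  qed
  finally show "of_nat (card S) \<le> (\<Sum>i\<in>I. sep_number \<epsilon> (Y i) r)" .
qed

lemma (in growth_setting) growth_const_1: "growth (\<lambda>n \<sigma>. 1) \<le> 0"
  unfolding exp_growth_def
proof (rule Limsup_bounded)
  show "\<forall>\<^sub>F j in FF. elog (lp_norm p (\<P> j) (\<lambda>\<sigma>. 1)) / ereal (real (d j)) \<le> 0"
    using prob d_pos
  proof eventually_elim
    case (elim j)
    then interpret prob_space "\<P> j" by simp
    have "lp_norm p (\<P> j) (\<lambda>\<sigma>. 1) \<le> 1"
    proof (cases "p = \<infinity>")
      case True
      then show ?thesis using esssup_I[of "\<lambda>_. 1::ennreal" "\<P> j" 1] by (simp add: lp_norm_def)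
    next
      case False
      then show ?thesis by (simp add: lp_norm_def ennpowr_def emeasure_space_1)
    qed
    then have "elog (lp_norm p (\<P> j) (\<lambda>\<sigma>. 1)) \<le> elog 1" by (rule elog_mono)
    also have "elog 1 = 0" by (simp add: elog_def)
    finally have "elog (lp_norm p (\<P> j) (\<lambda>\<sigma>. 1)) / ereal (real (d j)) \<le> 0 / ereal (real (d j))"
      by (rule ereal_divide_right_mono) (use elim in simp)
    then show ?case by simp
  qed
qed

section \<open>Growth rates of microstates and of homomorphisms\<close>

locale sofic_factor = factor_metric H TH \<nu> G TG \<pi> \<rho> + growth_setting FF d \<P> p
  for H :: "('a, 'b) gpd_scheme" and TH \<nu> and G :: "('c, 'd) gpd_scheme" and TG \<pi> \<rho>
    and FF :: "'j filter" and d and \<P> :: "'j \<Rightarrow> 'a sofic_map measure" and p +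
  assumes maps: "eventually (\<lambda>j. space (\<P> j) = Map_set fp (d j) \<and> sets (\<P> j) = sets (Map_borel fp (d j))) FF"
    and traces: "F \<in> Fpow fp \<Longrightarrow> 0 < \<delta> \<Longrightarrow>
      ((\<lambda>j. measure (\<P> j) {\<sigma> \<in> space (\<P> j). trace_preserving_on H \<nu> (d j) F \<delta> \<sigma>}) \<longlongrightarrow> 1) FF"
    and mults: "F \<in> Fpow fp \<Longrightarrow> 0 < \<delta> \<Longrightarrow> eventually (\<lambda>j. AE \<sigma> in \<P> j. multiplicative_on H (d j) F \<delta> \<sigma>) FF"
    and conts: "F \<in> Fpow fp \<Longrightarrow> 0 < \<delta> \<Longrightarrow> eventually (\<lambda>j. AE \<sigma> in \<P> j. \<forall>f\<in>F. \<forall>g\<in>F.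
      ennreal (normcard (d j) (sym_diff (\<sigma> f) (\<sigma> g))) < ennreal \<delta> + src_meas H \<nu> (sym_diff f g)) FF"
begin

abbreviation "orb_count \<epsilon> \<delta> F K \<equiv> \<lambda>n \<sigma>. sep_number \<epsilon> (orb n \<sigma> F K \<delta>) (dist2 n \<rho>)"

abbreviation "near_count \<epsilon> L F K \<A> \<delta> \<equiv> \<lambda>n \<sigma>. sep_number \<epsilon> (Orb_near L F K \<A> \<delta> n \<sigma>) (dist2 n \<rho>)"

abbreviation "hom_count \<mu> \<Q> \<R> F \<delta> \<equiv> \<lambda>n \<sigma>. of_nat (Hom_count G H \<mu> \<pi> n \<sigma> \<R> F \<delta> \<Q>) :: ennreal"

text \<open>\<open>top_growth\<close> and \<open>hom_growth\<close> are the expressions under the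
  outer suprema of the two entropies, taken along the filter \<open>FF\<close>.\<close>

definition "top_growth \<epsilon> = (INF \<delta>\<in>{0<..}. INF F\<in>Fpow pt. INF K\<in>Fpow CH. growth (orb_count \<epsilon> \<delta> F K))"

definition "hom_growth \<mu> \<Q> = (INF \<R>\<in>{\<R>. finite_partition \<mu> \<R> \<and> refines (units G) \<R> \<Q>}.
  INF F\<in>{F \<in> Fpow fp. units H \<in> F}. INF \<delta>\<in>{0<..}. growth (hom_count \<mu> \<Q> \<R> F \<delta>))"

lemma pt_fp: "F \<in> Fpow pt \<Longrightarrow> F \<in> Fpow fp"
  using ptD(1) by (auto simp: Fpow_def)

lemma mble_local:
  assumes "\<And>n \<sigma> \<sigma>'. (\<And>f. f \<in> F \<Longrightarrow> \<sigma> f = \<sigma>' f) \<Longrightarrow> X n \<sigma> = X n \<sigma>'" and F: "F \<in> Fpow fp"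
  shows "mble X"
  unfolding mble_def using maps
proof eventually_elim
  case (elim j)
  show ?case
  proof (rule Map_borel_measurable_finite[OF _ F])
    fix \<sigma> \<sigma>' :: "'a sofic_map" assume "\<And>f. f \<in> F \<Longrightarrow> \<sigma> f = \<sigma>' f"
    then show "X (d j) \<sigma> = X (d j) \<sigma>'" by (rule assms(1))
  qed (use elim in auto)
qed

lemma Orb_cong: "(\<And>f. f \<in> F \<Longrightarrow> \<sigma> f = \<sigma>' f) \<Longrightarrow> orb n \<sigma> F K \<delta> = orb n \<sigma>' F K \<delta>"
  by (simp add: Orb_def)

lemma mble_orb: assumes "F \<in> Fpow pt" shows "mble (orb_count \<epsilon> \<delta> F K)"
proof (rule mble_local[OF _ pt_fp[OF assms]])
  fix n and \<sigma> \<sigma>' :: "'a sofic_map" assume "\<And>f. f \<in> F \<Longrightarrow> \<sigma> f = \<sigma>' f"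
  from Orb_cong[OF this] show "orb_count \<epsilon> \<delta> F K n \<sigma> = orb_count \<epsilon> \<delta> F K n \<sigma>'" by simp
qed

lemma mble_near: assumes "F \<in> Fpow pt" shows "mble (near_count \<epsilon> L F K \<A> \<delta>)"
proof (rule mble_local[OF _ pt_fp[OF assms]])
  fix n and \<sigma> \<sigma>' :: "'a sofic_map" assume e: "\<And>f. f \<in> F \<Longrightarrow> \<sigma> f = \<sigma>' f"
  have o: "orb n \<sigma> F K \<delta> = orb n \<sigma>' F K \<delta>" by (rule Orb_cong) (rule e)
  have "Orb_near L F K \<A> \<delta> n \<sigma> = Orb_near L F K \<A> \<delta> n \<sigma>'" unfolding Orb_near_def o using e by auto
  then show "near_count \<epsilon> L F K \<A> \<delta> n \<sigma> = near_count \<epsilon> L F K \<A> \<delta> n \<sigma>'" by simp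
qed

lemma mble_hom: assumes "F \<in> Fpow fp" shows "mble (hom_count \<mu> \<Q> \<R> F \<delta>)"
proof (rule mble_local[OF _ assms])
  fix n and \<sigma> \<sigma>' :: "'a sofic_map" assume e: "\<And>f. f \<in> F \<Longrightarrow> \<sigma> f = \<sigma>' f"
  have "Hom G H \<mu> \<pi> n \<sigma> \<R> F \<delta> = Hom G H \<mu> \<pi> n \<sigma>' \<R> F \<delta>" unfolding Hom_def using e by auto
  then show "hom_count \<mu> \<Q> \<R> F \<delta> n \<sigma> = hom_count \<mu> \<Q> \<R> F \<delta> n \<sigma>'" by (simp add: Hom_count_def)
qed

lemma Map_set_AE: "eventually (\<lambda>j. AE \<sigma> in \<P> j. \<sigma> \<in> Map_set fp (d j)) FF"
  using maps by eventually_elim (auto intro: AE_I2)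

lemma almost_sofic_AE:
  assumes "F0 \<in> Fpow fp" "0 < \<delta>" shows "eventually (\<lambda>j. AE \<sigma> in \<P> j. almost_sofic F0 \<delta> (d j) \<sigma>) FF"
  using mults[OF assms] conts[OF assms] Map_set_AE d_pos
proof eventually_elim
  case (elim j)
  from elim(1-3) show ?case by eventually_elim (use elim(4) in \<open>simp add: almost_sofic_def\<close>)
qed

text \<open>The factor \<open>exp (\<kappa> * n)\<close> lost in the packing costs
  \<open>\<kappa>\<close> in the rate, and \<open>\<kappa>\<close> is arbitrary. The scale
  \<open>\<epsilon>\<close> depends on \<open>\<kappa>\<close>, hence the supremum on the
  right.\<close>

lemma hom_growth_le_top_growth:
  assumes "factor_measure H TH \<nu> G TG \<pi> \<mu>" and Q: "finite_partition \<mu> \<Q>"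
  shows "hom_growth \<mu> \<Q> \<le> (SUP \<epsilon>\<in>{0<..}. top_growth \<epsilon>)"
proof (rule ereal_le_epsilon2)
  interpret M: factor_measure H TH \<nu> G TG \<pi> \<mu> by fact
  interpret MM: factor_metric_measure H TH \<nu> G TG \<pi> \<rho> \<mu> by unfold_locales
  fix \<kappa> :: real assume "0 < \<kappa>"
  obtain \<epsilon> :: real where \<epsilon>: "\<epsilon> > 0" and ex: "\<And>F K \<delta>. F \<in> Fpow pt \<Longrightarrow> K \<in> Fpow CH \<Longrightarrow> 0 < \<delta> \<Longrightarrow>
      MM.hom_dominated \<Q> \<kappa> \<epsilon> F K \<delta>"
    by (rule MM.Hom_count_le_sep_number[OF Q \<open>0 < \<kappa>\<close>], rule that)
  \<comment> \<open>Moving the finite \<open>\<kappa>\<close> to the left allows the infima in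
    \<open>top_growth\<close> to be taken on the right.\<close>
  have sub: "x - ereal \<kappa> \<le> g" if "x \<le> ereal \<kappa> + g" for x g using that by (cases x; cases g) auto
  have "hom_growth \<mu> \<Q> - ereal \<kappa> \<le> growth (orb_count \<epsilon> \<delta> F K)"
    if F: "F \<in> Fpow pt" and K: "K \<in> Fpow CH" and \<delta>: "\<delta> > 0" for \<delta> F K
  proof (rule sub)
    obtain \<R> F' e F0 where R: "finite_partition \<mu> \<R>" "refines (units G) \<R> \<Q>" "F' \<in> Fpow fp" "units H \<in> F'" "0 < e" "F0 \<in> Fpow fp"
      and le: "\<And>n \<sigma>. 0 < n \<Longrightarrow> \<sigma> \<in> Map_set fp n \<Longrightarrow> multiplicative_on H n F0 e \<sigma> \<Longrightarrow>
        hom_count \<mu> \<Q> \<R> F' e n \<sigma> \<le> ennreal (exp (\<kappa> * real n)) * orb_count \<epsilon> \<delta> F K n \<sigma>"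
      using ex[OF F K \<delta>] unfolding MM.hom_dominated_def by metis
    have "hom_growth \<mu> \<Q> \<le> growth (hom_count \<mu> \<Q> \<R> F' e)"
      unfolding hom_growth_def by (intro INF_lower2[of \<R>] INF_lower2[of F'] INF_lower2[of e]) (use R in auto)
    also have "\<dots> \<le> ereal \<kappa> + growth (orb_count \<epsilon> \<delta> F K)"
    proof (rule growth_mono_exp[OF mble_hom[OF R(3)] mble_orb[OF F]])
      show "\<forall>\<^sub>F j in FF. AE \<sigma> in \<P> j. hom_count \<mu> \<Q> \<R> F' e (d j) \<sigma> \<le> ennreal (exp (\<kappa> * real (d j))) * orb_count \<epsilon> \<delta> F K (d j) \<sigma>"
        using mults[OF R(6,5)] Map_set_AE d_pos
      proof eventually_elim
        case (elim j)
        from elim(1,2) show ?case by eventually_elim (rule le[OF elim(3)])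
      qed
    qed
    finally show "hom_growth \<mu> \<Q> \<le> ereal \<kappa> + growth (orb_count \<epsilon> \<delta> F K)" .
  qed
  then have "hom_growth \<mu> \<Q> - ereal \<kappa> \<le> top_growth \<epsilon>"
    unfolding top_growth_def by (intro INF_greatest) auto
  also have "\<dots> \<le> (SUP \<epsilon>\<in>{0<..}. top_growth \<epsilon>)" by (rule SUP_upper) (use \<epsilon> in simp)
  finally show "hom_growth \<mu> \<Q> \<le> (SUP \<epsilon>\<in>{0<..}. top_growth \<epsilon>) + ereal \<kappa>"
    by (cases "hom_growth \<mu> \<Q>"; cases "SUP \<epsilon>\<in>{0<..}. top_growth \<epsilon>") (auto simp: algebra_simps)
qed

text \<open>For a partition with atoms of \<open>\<rho>\<close>-diameter at most
  \<open>\<epsilon>\<close>, two microstates with the same itinerary are within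
  \<open>\<epsilon>\<close> in mean square. So \<open>\<epsilon>\<close>-separated microstates
  induce different restrictions to \<open>\<Q>\<close>, whatever the refinement
  \<open>\<R>\<close>.\<close>

lemma growth_near_le_hom_growth:
  assumes "content_measure H TH \<nu> G TG \<pi> \<rho> L \<mu>" and "\<epsilon> > 0"
    and h: "\<And>F K \<A> \<delta>. F \<in> Fpow pt \<Longrightarrow> K \<in> Fpow CH \<Longrightarrow> finite \<A> \<Longrightarrow> 0 < \<delta> \<Longrightarrow> h \<le> growth (near_count \<epsilon> L F K \<A> \<delta>)"
  shows "\<exists>\<Q>. finite_partition \<mu> \<Q> \<and> h \<le> hom_growth \<mu> \<Q>"
proof -
  interpret C: content_measure H TH \<nu> G TG \<pi> \<rho> L \<mu> by fact
  obtain \<Q> Z where Q: "finite_partition \<mu> \<Q>" and Z: "closedin G.X Z" "measure \<mu> Z = 0" "\<And>q. q \<in> \<Q> \<Longrightarrow> openin G.X (q - Z)"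
    and small: "\<And>q x y. q \<in> \<Q> \<Longrightarrow> x \<in> q \<Longrightarrow> y \<in> q \<Longrightarrow> \<rho> x y \<le> \<epsilon>"
    using G.X.small_partition[OF \<rho> C.\<mu>.finite_measure_axioms C.sets_\<mu> \<open>\<epsilon> > 0\<close>] by metis
  have Qu: "\<Union>\<Q> = units G" using Q C.space_\<mu> by (auto simp: finite_partition_def partition_on_def)
  have "h \<le> growth (hom_count \<mu> \<Q> \<R> F \<delta>)"
    if R: "finite_partition \<mu> \<R>" "refines (units G) \<R> \<Q>" and F: "F \<in> Fpow fp" "units H \<in> F" and \<delta>: "\<delta> > 0" for \<R> F \<delta>
  proof -
    define \<Sigma> where "\<Sigma> = alg \<R> F"
    define \<phi> where "\<phi> lab n x = restrict (\<lambda>B. {i\<in>{1..n}. lab (x i) \<subseteq> B}) \<Sigma>" for lab :: "'c \<Rightarrow> 'c set" and n :: nat and x :: "nat \<Rightarrow> 'c"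
    obtain lab where lab: "\<And>x q. x \<in> units G \<Longrightarrow> q \<in> \<Q> \<Longrightarrow> lab x \<subseteq> q \<longleftrightarrow> x \<in> q"
      and ev': "eventually (\<lambda>(n, \<sigma>, x). restrict (\<lambda>B. {i\<in>{1..n}. lab (x i) \<subseteq> B}) \<Sigma> \<in> Hom G H \<mu> \<pi> n \<sigma> \<R> F \<delta>) (config L)"
      and \<Sigma>: "\<Q> \<subseteq> \<Sigma>" "finite \<Sigma>"
      by (rule C.microstate_hom[OF Q Z R F \<delta>, folded \<Sigma>_def], assumption, rule that)
    have ev: "eventually (\<lambda>(n, \<sigma>, x). \<phi> lab n x \<in> Hom G H \<mu> \<pi> n \<sigma> \<R> F \<delta>) (config L)"
      using ev' unfolding \<phi>_def .
    \<comment> \<open>The eventual statement is unwound into concrete constraints, for which the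
      hypothesis on growth is available.\<close>
    obtain F' K F0 \<A> \<delta>' where e: "F' \<in> Fpow pt" "K \<in> Fpow CH" "F0 \<in> Fpow fp" "finite \<A>" "0 < \<delta>'"
      and hom: "\<And>n \<sigma> x. almost_sofic F0 \<delta>' n \<sigma> \<Longrightarrow> x \<in> Orb_near L F' K \<A> \<delta>' n \<sigma> \<Longrightarrow> \<phi> lab n x \<in> Hom G H \<mu> \<pi> n \<sigma> \<R> F \<delta>"
      using ev unfolding eventually_config by auto
    have le: "near_count \<epsilon> L F' K \<A> \<delta>' n \<sigma> \<le> hom_count \<mu> \<Q> \<R> F \<delta> n \<sigma>" if s: "almost_sofic F0 \<delta>' n \<sigma>" for n \<sigma>
    proof (rule sep_number_leI)
      fix S assume S: "finite S" "S \<subseteq> Orb_near L F' K \<A> \<delta>' n \<sigma>" "pairwise (\<lambda>x y. \<epsilon> < dist2 n \<rho> x y) S"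
      have n: "0 < n" using s by (simp add: almost_sofic_def)
      let ?r = "\<lambda>\<psi>. restrict \<psi> (sigma_sets (units G) \<Q>)"
      have inj: "inj_on (\<lambda>x. ?r (\<phi> lab n x)) S"
      proof (rule inj_onI, rule ccontr)
        fix x y assume xy: "x \<in> S" "y \<in> S" "?r (\<phi> lab n x) = ?r (\<phi> lab n y)" "x \<noteq> y"
        have u: "x i \<in> units G" "y i \<in> units G" if "i \<in> {1..n}" for i
          using xy(1,2) S(2) that by (auto simp: Orb_near_def Orb_def PiE_iff)
        have "\<rho> (x i) (y i) \<le> \<epsilon>" if i: "i \<in> {1..n}" for i
        proof -
          obtain q where q: "q \<in> \<Q>" "x i \<in> q" using u(1)[OF i] Qu by blast
          have "?r (\<phi> lab n x) q = ?r (\<phi> lab n y) q" using xy(3) by simp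
          then have "\<phi> lab n x q = \<phi> lab n y q" using q(1) by (simp add: sigma_sets.Basic)
          then have "{i\<in>{1..n}. lab (x i) \<subseteq> q} = {i\<in>{1..n}. lab (y i) \<subseteq> q}" using subsetD[OF \<Sigma>(1) q(1)] by (simp add: \<phi>_def)
          then have "lab (y i) \<subseteq> q" using i lab[OF u(1)[OF i] q(1)] q(2) by blast
          then have "y i \<in> q" using lab[OF u(2)[OF i] q(1)] by simp
          then show ?thesis using small[OF q] by simp
        qed
        then have "dist2 n \<rho> x y \<le> sqrt (\<epsilon>\<^sup>2 + \<epsilon>\<^sup>2 * 0)"
        proof (intro dist2_le)
          assume *: "\<And>i. i \<in> {1..n} \<Longrightarrow> \<rho> (x i) (y i) \<le> \<epsilon>"
          then have "{i\<in>{1..n}. \<not> \<rho> (x i) (y i) \<le> \<epsilon>} = {}" by blast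
          then show "real (card {i\<in>{1..n}. \<not> \<rho> (x i) (y i) \<le> \<epsilon>}) \<le> 0 * real n" by simp
        qed (use \<rho>_props(2) u \<open>\<epsilon> > 0\<close> n in auto)
        moreover have "\<epsilon> < dist2 n \<rho> x y" using S(3) xy unfolding pairwise_def by blast
        ultimately show False using \<open>\<epsilon> > 0\<close> by simp
      qed
      have "finite (Hom G H \<mu> \<pi> n \<sigma> \<R> F \<delta>)"
        by (rule finite_subset[OF _ finite_set_homs[OF \<Sigma>(2)]]) (auto simp: Hom_def \<Sigma>_def)
      moreover have "(\<lambda>x. ?r (\<phi> lab n x)) ` S \<subseteq> ?r ` Hom G H \<mu> \<pi> n \<sigma> \<R> F \<delta>" using hom[OF s] S(2) by blast
      ultimately have "card S \<le> Hom_count G H \<mu> \<pi> n \<sigma> \<R> F \<delta> \<Q>"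
        unfolding Hom_count_def using card_inj_on_le[OF inj] by blast
      then show "of_nat (card S) \<le> hom_count \<mu> \<Q> \<R> F \<delta> n \<sigma>" by (rule of_nat_mono)
    qed
    have "h \<le> growth (near_count \<epsilon> L F' K \<A> \<delta>')" by (rule h[OF e(1,2,4,5)])
    also have "\<dots> \<le> growth (hom_count \<mu> \<Q> \<R> F \<delta>)"
    proof (rule growth_mono[OF mble_near[OF e(1)] mble_hom[OF F(1)]])
      show "\<forall>\<^sub>F j in FF. AE \<sigma> in \<P> j. near_count \<epsilon> L F' K \<A> \<delta>' (d j) \<sigma> \<le> hom_count \<mu> \<Q> \<R> F \<delta> (d j) \<sigma>"
        using almost_sofic_AE[OF e(3,5)]
      proof eventually_elim
        case (elim j)
        then show ?case by eventually_elim (rule le)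
      qed
    qed
    finally show ?thesis .
  qed
  then have "h \<le> hom_growth \<mu> \<Q>" unfolding hom_growth_def by (intro INF_greatest) auto
  then show ?thesis using Q by blast
qed

end

section \<open>Control of domains, and the case of a single unit\<close>

context sofic_factor begin

text \<open>A point which leaves the domain is at the maximal distance \<open>diam\<close> from one which does not, so
  membership in \<open>Orb\<close> controls domains as soon as \<open>diam > 0\<close>.\<close>

lemma Orb_subset_Orb_near:
  assumes n: "0 < n" and \<sigma>: "\<sigma> \<in> Map_set fp n" and F: "F \<in> Fpow pt" and "0 < \<delta>" "0 < diam"
  shows "Orb G H \<nu> \<pi> n \<sigma> F K (min \<delta> (diam * sqrt (\<delta> / 2))) \<rho> \<subseteq> Orb_near L F K {} \<delta> n \<sigma>"
proof
  fix x assume x: "x \<in> Orb G H \<nu> \<pi> n \<sigma> F K (min \<delta> (diam * sqrt (\<delta> / 2))) \<rho>"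
  then have xu: "\<And>i. i \<in> {1..n} \<Longrightarrow> x i \<in> units G" by (auto simp: Orb_def PiE_iff)
  have ne: "units G \<noteq> {}" using xu[of 1] n by auto
  have "real (card (off_dom n \<sigma> f x)) < \<delta> * n" if f: "f \<in> F" for f
  proof -
    have ffp: "f \<in> fp" using pt_fp[OF F] f by (auto simp: Fpow_def)
    have fin: "\<sigma> f \<in> fin_pseudogroup n" using \<sigma> ffp by (auto simp: Map_set_def)
    let ?e = "\<lambda>i. ed (mv f (x i)) (map_option x (fin_act (\<sigma> f) i))"
    \<comment> \<open>The tolerance \<open>diam * sqrt (\<delta> / 2)\<close> leaves density
      \<open>\<delta> / 2\<close>, so that the required inequality is strict.\<close>
    have "real (card {i\<in>{1..n}. diam \<le> ?e i}) \<le> (diam * sqrt (\<delta> / 2) / diam)\<^sup>2 * n"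
    proof (rule dist2_count[where r=ed and x="\<lambda>i. mv f (x i)" and x'="\<lambda>i. map_option x (fin_act (\<sigma> f) i)"])
      show "0 \<le> ?e i" if "i \<in> {1..n}" for i
        by (rule ed_bounds(1)[OF act_range[OF ffp xu[OF that]] fin_act_range[OF fin xu] ne])
      show "dist2 n ed (\<lambda>i. mv f (x i)) (\<lambda>i. map_option x (fin_act (\<sigma> f) i)) < diam * sqrt (\<delta> / 2)"
        using x f by (simp add: Orb_def)
    qed (use assms in auto)
    also have "\<dots> = \<delta> / 2 * n" using assms by simp
    finally have c: "real (card {i\<in>{1..n}. diam \<le> ?e i}) \<le> \<delta> / 2 * n" .
    have dle: "diam \<le> ?e i" if h: "(mv f (x i) = None) \<noteq> (fin_act (\<sigma> f) i = None)" for i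
    proof (cases "mv f (x i)")
      case None
      then obtain j where "fin_act (\<sigma> f) i = Some j" using h by auto
      then show ?thesis unfolding None by (simp only: option.map ed_simps)
    next
      case (Some y)
      then have "fin_act (\<sigma> f) i = None" using h by simp
      then show ?thesis unfolding Some by (simp only: option.map ed_simps)
    qed
    have "card (off_dom n \<sigma> f x) \<le> card {i\<in>{1..n}. diam \<le> ?e i}"
    proof (rule card_mono, simp, rule subsetI)
      fix i assume "i \<in> (off_dom n \<sigma> f x)"
      then have i: "i \<in> {1..n} \<and> (mv f (x i) = None) \<noteq> (fin_act (\<sigma> f) i = None)" by (rule CollectD)
      show "i \<in> {i\<in>{1..n}. diam \<le> ?e i}" by (rule CollectI, rule conjI, rule conjunct1[OF i], rule dle, rule conjunct2[OF i])
    qed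
    moreover have "\<delta> / 2 * n < \<delta> * n" using n \<open>0 < \<delta>\<close> by simp
    ultimately show ?thesis using c by linarith
  qed
  moreover have "x \<in> orb n \<sigma> F K \<delta>" using x by (auto simp: Orb_def)
  ultimately show "x \<in> Orb_near L F K {} \<delta> n \<sigma>" by (simp add: Orb_near_def)
qed

text \<open>Without test sets all microstates are counted, for any \<open>L\<close>; the tolerance
  is that of \<open>Orb_subset_Orb_near\<close>.\<close>

lemma top_growth_le_near:
  assumes F: "F \<in> Fpow pt" and K: "K \<in> Fpow CH" and \<delta>: "0 < \<delta>" and "0 < diam"
  shows "top_growth \<epsilon> \<le> growth (near_count \<epsilon> L F K {} \<delta>)"
proof -
  define \<delta>' where "\<delta>' = min \<delta> (diam * sqrt (\<delta> / 2))"
  have "top_growth \<epsilon> \<le> growth (orb_count \<epsilon> \<delta>' F K)"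
    unfolding top_growth_def by (intro INF_lower2[of \<delta>'] INF_lower2[of F] INF_lower2[of K]) (use assms in \<open>auto simp: \<delta>'_def\<close>)
  also have "\<dots> \<le> growth (near_count \<epsilon> L F K {} \<delta>)"
  proof (rule growth_mono[OF mble_orb[OF F] mble_near[OF F]])
    show "\<forall>\<^sub>F j in FF. AE \<sigma> in \<P> j. orb_count \<epsilon> \<delta>' F K (d j) \<sigma> \<le> near_count \<epsilon> L F K {} \<delta> (d j) \<sigma>"
      using Map_set_AE d_pos
    proof eventually_elim
      case (elim j)
      from elim(1) show ?case unfolding \<delta>'_def
        by eventually_elim (rule sep_number_mono[OF Orb_subset_Orb_near[OF elim(2) _ F \<delta> \<open>0 < diam\<close>]])
    qed
  qed
  finally show ?thesis .
qed

text \<open>The empty set is idempotent, so its image is almost diagonal; its trace is zero, so the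
  diagonal part is small.\<close>

lemma sofic_empty:
  assumes \<sigma>: "\<sigma> \<in> Map_set fp n" and m: "multiplicative_on H n F0 e \<sigma>" and t: "trace_preserving_on H \<nu> n F0 e \<sigma>"
    and F0: "{} \<in> F0" "{} \<in> fp" and n: "0 < n"
  shows "real (card (\<sigma> {})) \<le> 2 * e * n"
proof -
  have s: "\<sigma> {} \<in> fin_pseudogroup n" using \<sigma> F0(2) by (auto simp: Map_set_def)
  note sD = fin_pseudogroupD[OF s]
  let ?p = "pmult n (\<sigma> {}) (\<sigma> {})" and ?u = "units (pair_gpd n)"
  have mm: "normcard n (sym_diff (\<sigma> {}) ?p) < e" using m F0(1) unfolding multiplicative_on_def by (force simp: set_mult_def)
  have "?p \<subseteq> {1..n} \<times> {1..n}" by (auto simp: set_mult_def composable_def pair_gpd_def)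
  then have fp': "finite (sym_diff (\<sigma> {}) ?p)" using sD(4) finite_subset by (metis finite_Diff finite_SigmaI finite_Un finite_atLeastAtMost)
  have 1: "real (card (\<sigma> {} - ?p)) \<le> e * n" by (rule normcard_less[OF mm fp' n]) auto
  have "\<bar>fin_tr n (\<sigma> {}) - tr H \<nu> {}\<bar> < e" using t F0(1) by (simp add: trace_preserving_on_def)
  then have "normcard n (\<sigma> {} \<inter> ?u) < e" by (simp add: fin_tr_def tr_def)
  then have 2: "real (card (\<sigma> {} \<inter> ?u)) \<le> e * n" by (rule normcard_less[OF _ _ n]) (use sD(4) in auto)
  have "\<sigma> {} \<subseteq> (\<sigma> {} - ?p) \<union> (\<sigma> {} \<inter> ?u)"
  proof
    fix z assume z: "z \<in> \<sigma> {}"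
    obtain i j where ij: "z = (i, j)" by fastforce
    have "i = j" if zp: "z \<in> ?p"
    proof -
      obtain k where "(i, k) \<in> \<sigma> {}" "(k, j) \<in> \<sigma> {}" using zp fin_mult_iff[OF s s] unfolding ij by blast
      then show ?thesis using sD(2,3) z ij by blast
    qed
    then show "z \<in> (\<sigma> {} - ?p) \<union> (\<sigma> {} \<inter> ?u)" using z sD(1) unfolding ij pair_gpd_def by auto
  qed
  from card_le_Un[OF this] show ?thesis using 1 2 sD(4) by simp
qed

text \<open>The inverse of \<open>f\<close> times \<open>f\<close> is the unit set, of trace one.
  Its image contains almost the whole diagonal and almost agrees with the product, which misses the
  diagonal where \<open>\<sigma> f\<close> is undefined.\<close>

lemma sofic_total:
  assumes \<sigma>: "\<sigma> \<in> Map_set fp n" and m: "multiplicative_on H n F0 e \<sigma>" and t: "trace_preserving_on H \<nu> n F0 e \<sigma>"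
    and f: "f \<in> fp" "src H ` f = units H" and F0: "{f, H.finv f, units H} \<subseteq> F0" and n: "0 < n"
  shows "real (card {i\<in>{1..n}. fin_act (\<sigma> f) i = None}) \<le> 2 * e * n"
proof -
  note fD = fpD[OF f(1)]
  have f': "H.finv f \<in> fp" by (rule H.finv_full_pseudogroup[OF f(1)])
  have u: "set_mult H (H.finv f) f = units H"
    using set_mult_finv[OF f'] H.finv_finv[OF fD(2)] H.finv_images(3)[OF fD(2)] f(2) by simp
  have s: "\<sigma> f \<in> fin_pseudogroup n" "\<sigma> (H.finv f) \<in> fin_pseudogroup n" "\<sigma> (units H) \<in> fin_pseudogroup n"
    using \<sigma> f(1) f' units_full_pseudogroup by (auto simp: Map_set_def)
  let ?p = "pmult n (\<sigma> (H.finv f)) (\<sigma> f)" and ?u = "units (pair_gpd n)"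
  have mm: "normcard n (sym_diff (\<sigma> (units H)) ?p) < e"
    using m F0 u unfolding multiplicative_on_def by (metis insert_subset)
  have "?p \<subseteq> {1..n} \<times> {1..n}" by (auto simp: set_mult_def composable_def pair_gpd_def)
  then have fp': "finite (sym_diff (\<sigma> (units H)) ?p)"
    using fin_pseudogroupD(4)[OF s(3)] finite_subset by (metis finite_Diff finite_SigmaI finite_Un finite_atLeastAtMost)
  have 1: "real (card (\<sigma> (units H) - ?p)) \<le> e * n" by (rule normcard_less[OF mm fp' n]) auto
  have "tr H \<nu> (units H) = 1" using H.\<nu>.prob_space by (simp add: tr_def)
  moreover have "\<bar>fin_tr n (\<sigma> (units H)) - tr H \<nu> (units H)\<bar> < e" using t F0 by (simp add: trace_preserving_on_def)
  ultimately have "1 - e < normcard n (\<sigma> (units H) \<inter> ?u)" by (simp add: fin_tr_def)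
  then have 2: "(1 - e) * n \<le> real (card (\<sigma> (units H) \<inter> ?u))" using n by (simp add: normcard_def field_simps)
  have fu: "finite ?u" "card ?u = n"
  proof -
    have "?u = (\<lambda>i. (i, i)) ` {1..n}" by (auto simp: pair_gpd_def)
    then show "finite ?u" "card ?u = n" by (simp_all add: card_image inj_on_def)
  qed
  have "card (?u - \<sigma> (units H)) = card ?u - card (\<sigma> (units H) \<inter> ?u)"
    using fu(1) by (simp add: card_Diff_subset_Int Int_commute)
  moreover have "card (\<sigma> (units H) \<inter> ?u) \<le> n" using card_mono[OF fu(1), of "\<sigma> (units H) \<inter> ?u"] fu(2) by simp
  ultimately have 3: "real (card (?u - \<sigma> (units H))) \<le> e * n" using 2 fu(2) by (simp add: algebra_simps of_nat_diff)
  have "real (card {i\<in>{1..n}. fin_act (\<sigma> f) i = None}) \<le> real (card ((\<sigma> (units H) - ?p) \<union> (?u - \<sigma> (units H))))"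
  proof (rule of_nat_mono, rule card_inj_on_le[of "\<lambda>i. (i, i)"])
    show "(\<lambda>i. (i, i)) ` {i\<in>{1..n}. fin_act (\<sigma> f) i = None} \<subseteq> (\<sigma> (units H) - ?p) \<union> (?u - \<sigma> (units H))"
    proof (rule image_subsetI)
      fix i assume i: "i \<in> {i\<in>{1..n}. fin_act (\<sigma> f) i = None}"
      then have "\<forall>k. (k, i) \<notin> \<sigma> f" using fin_act_iff(2)[OF s(1), of i] by simp
      then have "(i, i) \<notin> ?p" using fin_mult_iff[OF s(2,1)] by blast
      moreover have "(i, i) \<in> ?u" using i by (simp add: pair_gpd_def)
      ultimately show "(i, i) \<in> (\<sigma> (units H) - ?p) \<union> (?u - \<sigma> (units H))" by blast
    qed
  qed (use fp' fu in \<open>auto simp: inj_on_def\<close>)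
  then show ?thesis using 1 3 card_Un_real[of "\<sigma> (units H) - ?p" "?u - \<sigma> (units H)"] by linarith
qed

text \<open>With \<open>diam\<close> not positive no translate can separate two points, against
  dynamical generation.\<close>

lemma one_point:
  assumes "\<not> 0 < diam" "x \<in> units G" "y \<in> units G" shows "x = y"
proof (rule ccontr)
  assume "x \<noteq> y"
  then obtain g where g: "g \<in> fg" "0 < ed (mv g x) (mv g y)"
    using gen assms unfolding dynamically_generating_def by blast
  have "\<rho> (gact g x) (gact g y) \<le> diam" using \<rho>_props(5) gact(3)[OF g(1)] assms by blast
  then show False using g gact(1)[OF g(1)] assms by simp
qed

lemma units_image: "\<pi> ` units G = units H"
proof (intro equalityI subsetI)
  fix u assume u: "u \<in> units H"
  then have "u \<in> \<pi> ` arr G" using cb H.units_arr unfolding class_bijective_factor_def by blast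
  then obtain g where g: "g \<in> arr G" "u = \<pi> g" by blast
  then have "u = \<pi> (src G g)" using \<pi>_src[OF g(1)] H.unit_src[OF u] by simp
  then show "u \<in> \<pi> ` units G" using g(1) by simp
qed (use \<pi>_units in auto)

text \<open>Here \<open>G\<close> and \<open>H\<close> have one unit each. Two tuples are never
  separated, so the growth is at most zero. Conversely the constant tuple is a microstate as soon as
  domains match, and traces ensure this because a test element is either empty or has full
  source.\<close>

lemma top_growth_le_near_degenerate:
  assumes F: "F \<in> Fpow pt" and K: "K \<in> Fpow CH" and \<delta>: "0 < \<delta>" and D: "\<not> 0 < diam" and \<epsilon>: "0 < \<epsilon>"
  shows "top_growth \<epsilon> \<le> growth (near_count \<epsilon> L F K {} \<delta>)"
proof -
  have Ffp: "F \<in> Fpow fp" by (rule pt_fp[OF F])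
  have "units H \<noteq> {}" using H.\<nu>.not_empty by simp
  then obtain u where u: "u \<in> units G" using units_image by blast
  have G1: "units G = {u}" using one_point[OF D] u by blast
  have H1: "units H = {\<pi> u}" using units_image G1 by simp
  have d0: "diam = 0" using diam_nonneg G1 D by auto
  have "top_growth \<epsilon> \<le> growth (orb_count \<epsilon> 1 {} {})"
    unfolding top_growth_def by (intro INF_lower2[of 1] INF_lower2[of "{}"]) (auto simp: Fpow_def)
  also have "\<dots> \<le> growth (\<lambda>n \<sigma>. 1)"
  proof (rule growth_mono)
    show "mble (orb_count \<epsilon> 1 {} {})" by (rule mble_orb) (simp add: Fpow_def)
    have le: "orb_count \<epsilon> 1 {} {} n \<sigma> \<le> 1" for n \<sigma>
    proof (rule sep_number_leI)
      fix S assume S: "finite S" "S \<subseteq> orb n \<sigma> {} {} 1" "pairwise (\<lambda>x y. \<epsilon> < dist2 n \<rho> x y) S"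
      have "x = y" if xy: "x \<in> S" "y \<in> S" for x y
      proof (rule ccontr)
        assume "x \<noteq> y"
        then have "\<epsilon> < dist2 n \<rho> x y" using S(3) xy unfolding pairwise_def by blast
        moreover have "x i = u" "y i = u" if "i \<in> {1..n}" for i
          using xy S(2) G1 that by (auto simp: Orb_def PiE_iff)
        then have "dist2 n \<rho> x y = 0" using \<rho>_props(1)[OF u u] by (simp add: dist2_def)
        ultimately show False using \<epsilon> by simp
      qed
      then have "card S \<le> 1" using S(1) by (metis card_le_Suc0_iff_eq One_nat_def)
      then have "(of_nat (card S) :: ennreal) \<le> of_nat 1" by (rule of_nat_mono)
      then show "(of_nat (card S) :: ennreal) \<le> 1" by simp
    qed
    then show "\<forall>\<^sub>F j in FF. AE \<sigma> in \<P> j. orb_count \<epsilon> 1 {} {} (d j) \<sigma> \<le> 1" by simp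
  qed (simp add: mble_def)
  also have "\<dots> \<le> 0" by (rule growth_const_1)
  also have "0 \<le> growth (near_count \<epsilon> L F K {} \<delta>)"
  proof -
    define e where "e = \<delta> / 3"
    have e: "e > 0" "2 * e < \<delta>" using \<delta> by (simp_all add: e_def)
    \<comment> \<open>The unit set and the inverses are there for \<open>sofic_total\<close>, the
      empty set for \<open>sofic_empty\<close>.\<close>
    define F0 where "F0 = insert {} (insert (units H) (F \<union> H.finv ` F))"
    have emp: "{} \<in> fp" by (simp add: H.full_pseudogroup_iff)
    have F0: "F0 \<in> Fpow fp"
      using Ffp H.finv_full_pseudogroup units_full_pseudogroup emp by (auto simp: F0_def Fpow_def)
    define A where "A j = {\<sigma> \<in> space (\<P> j). trace_preserving_on H \<nu> (d j) F0 e \<sigma>}" for j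
    have "((\<lambda>j. measure (\<P> j) (A j)) \<longlongrightarrow> 1) FF" unfolding A_def by (rule traces[OF F0 e(1)])
    then have evA: "eventually (\<lambda>j. measure (\<P> j) (A j) > 1/2) FF" by (rule order_tendstoD(1)) simp
    have point: "1 \<le> near_count \<epsilon> L F K {} \<delta> n \<sigma>"
      if n: "0 < n" and \<sigma>: "\<sigma> \<in> Map_set fp n" and m: "multiplicative_on H n F0 e \<sigma>" and t: "trace_preserving_on H \<nu> n F0 e \<sigma>" for n \<sigma>
    proof (rule sep_number_ge_1)
      let ?x = "\<lambda>i\<in>{1..n}. u"
      have fD: "f \<in> fp" "\<sigma> f \<in> fin_pseudogroup n" if "f \<in> F" for f using that Ffp \<sigma> by (auto simp: Fpow_def Map_set_def)
      have ed0: "ed a b = 0" if "a \<in> insert None (Some ` units G)" "b \<in> insert None (Some ` units G)" for a b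
        using ed_bounds[OF that] G1 d0 by auto
      have "dist2 n ed (\<lambda>i. mv f (?x i)) (\<lambda>i. map_option ?x (fin_act (\<sigma> f) i)) = 0" if f: "f \<in> F" for f
      proof -
        have "ed (mv f (?x i)) (map_option ?x (fin_act (\<sigma> f) i)) = 0" if i: "i \<in> {1..n}" for i
          by (rule ed0[OF act_range[OF fD(1)[OF f]] fin_act_range[OF fD(2)[OF f]]]) (use u i in auto)
        then show ?thesis by (simp add: dist2_def)
      qed
      moreover have "\<bar>(\<Sum>i\<in>{1..n}. k (\<pi> (?x i))) / real n - (\<integral>y. k y \<partial>\<nu>)\<bar> < \<delta>" for k :: "'a \<Rightarrow> real"
      proof -
        have "(\<integral>y. k y \<partial>\<nu>) = (\<integral>y. k (\<pi> u) \<partial>\<nu>)" by (rule Bochner_Integration.integral_cong) (use H1 in auto)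
        also have "\<dots> = k (\<pi> u)" using H.\<nu>.prob_space by simp
        finally show ?thesis using n \<delta> by simp
      qed
      moreover have "real (card (off_dom n \<sigma> f ?x)) < \<delta> * n" if f: "f \<in> F" for f
      proof -
        let ?B = "(off_dom n \<sigma> f ?x)"
        note a = act_iff(2)[OF fpD(2,3)[OF fD(1)[OF f]] u]
        have "2 * e * n < \<delta> * n" using e n by simp
        moreover have "real (card ?B) \<le> 2 * e * n"
        proof (cases "f = {}")
          case True
          have s: "\<sigma> {} \<in> fin_pseudogroup n" using fD(2)[OF f] True by simp
          have "real (card ?B) \<le> real (card (snd ` \<sigma> {}))"
          proof (rule of_nat_mono, rule card_mono)
            show "?B \<subseteq> snd ` \<sigma> {}"
            proof
              fix i assume "i \<in> ?B"
              then have "fin_act (\<sigma> {}) i \<noteq> None" using a True by (auto split: if_splits)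
              then obtain k where "fin_act (\<sigma> {}) i = Some k" by blast
              then show "i \<in> snd ` \<sigma> {}" using fin_act_iff(1)[OF s] by force
            qed
          qed (use fin_pseudogroupD(4)[OF s] in simp)
          also have "\<dots> \<le> real (card (\<sigma> {}))" using card_image_le[OF fin_pseudogroupD(4)[OF s], of snd] by simp
          also have "\<dots> \<le> 2 * e * n" by (rule sofic_empty[OF \<sigma> m t _ emp n]) (simp add: F0_def)
          finally show ?thesis .
        next
          case False
          have fa: "f \<subseteq> arr H" by (rule fpD(2)[OF fD(1)[OF f]])
          have sf: "src H ` f = units H"
          proof -
            have "src H ` f \<subseteq> {\<pi> u}" using fa H.src_in H1 by blast
            from subset_singletonD[OF this] show ?thesis using False H1 by auto
          qed
          have "?B = {i\<in>{1..n}. fin_act (\<sigma> f) i = None}"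
            using a sf H1 by auto
          then show ?thesis using sofic_total[OF \<sigma> m t fD(1)[OF f] sf _ n] f by (simp add: F0_def)
        qed
        ultimately show ?thesis by linarith
      qed
      ultimately show "?x \<in> Orb_near L F K {} \<delta> n \<sigma>" using u \<delta> by (simp add: Orb_near_def Orb_def)
    qed
    show ?thesis
    proof (rule growth_nonneg[OF mble_near[OF F], of A])
      show "\<forall>\<^sub>F j in FF. A j \<in> sets (\<P> j) \<and> 1/2 \<le> measure (\<P> j) (A j) \<and>
        (AE \<sigma> in \<P> j. \<sigma> \<in> A j \<longrightarrow> 1 \<le> near_count \<epsilon> L F K {} \<delta> (d j) \<sigma>)"
        using evA mults[OF F0 e(1)] Map_set_AE d_pos
      proof eventually_elim
        case (elim j)
        \<comment> \<open>A set outside the sigma-algebra has \<open>measure\<close> zero by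
          convention, so the bound above \<open>1/2\<close> already yields measurability.\<close>
        have "A j \<in> sets (\<P> j)"
        proof (rule ccontr)
          assume "A j \<notin> sets (\<P> j)"
          then show False using elim(1) by (simp add: measure_notin_sets)
        qed
        moreover from elim(2,3) have "AE \<sigma> in \<P> j. \<sigma> \<in> A j \<longrightarrow> 1 \<le> near_count \<epsilon> L F K {} \<delta> (d j) \<sigma>"
        proof eventually_elim
          case (elim \<sigma>)
          then show ?case using point[OF \<open>0 < d j\<close> elim(2,1)] by (simp add: A_def)
        qed
        ultimately show ?case using elim(1) by simp
      qed
    qed
  qed
  finally show ?thesis .
qed

end

section \<open>The two inequalities between the entropies\<close>

context sofic_factor begin

text \<open>By compactness finitely many possible empirical measures suffice; if for each of them the
  microstates had growth less than that of all microstates, then so would their union.\<close>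

lemma growing_content:
  assumes \<epsilon>: "0 < \<epsilon>" and h: "-\<infinity> < top_growth \<epsilon>"
  obtains L where "\<And>F K \<A> \<delta>. F \<in> Fpow pt \<Longrightarrow> K \<in> Fpow CH \<Longrightarrow> finite \<A> \<Longrightarrow> 0 < \<delta> \<Longrightarrow>
    top_growth \<epsilon> \<le> growth (near_count \<epsilon> L F K \<A> \<delta>)"
proof -
  \<comment> \<open>Test sets and a tolerance for which, under suitable further constraints, the
    microstates near \<open>L\<close> grow too slowly.\<close>
  define R where "R L \<A> e \<longleftrightarrow> (\<exists>F K. F \<in> Fpow pt \<and> K \<in> Fpow CH \<and> growth (near_count \<epsilon> L F K \<A> e) < top_growth \<epsilon>)"
    for L \<A> and e :: real
  have "\<exists>L. \<forall>\<A> e. finite \<A> \<longrightarrow> 0 < e \<longrightarrow> \<not> R L \<A> e"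
  proof (rule ccontr)
    assume "\<not> ?thesis"
    then have ex: "\<exists>\<A> e. finite \<A> \<and> 0 < e \<and> R L \<A> e" for L by blast
    obtain \<L> where L: "finite \<L>" "\<And>l. \<forall>A. l A \<in> {0..1} \<Longrightarrow>
      \<exists>(L, \<A>, e)\<in>\<L>. finite \<A> \<and> 0 < e \<and> R L \<A> e \<and> (\<forall>A\<in>\<A>. \<bar>l A - L A\<bar> < e)"
      by (rule set_function_selection[of R, OF ex], rule that)
    define I where "I = {(L, \<A>, e) \<in> \<L>. finite \<A> \<and> 0 < e \<and> R L \<A> e}"
    have fI: "finite I" unfolding I_def by (rule finite_subset[OF _ L(1)]) auto
    define W where "W t z \<longleftrightarrow> fst z \<in> Fpow pt \<and> snd z \<in> Fpow CH \<and> growth (near_count \<epsilon> (fst t) (fst z) (snd z) (fst (snd t)) (snd (snd t))) < top_growth \<epsilon>" for t z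
    have "\<exists>z. W t z"
      if t: "t \<in> I" for t
    proof -
      have "R (fst t) (fst (snd t)) (snd (snd t))" using t by (auto simp: I_def)
      then obtain F K where "F \<in> Fpow pt \<and> K \<in> Fpow CH \<and> growth (near_count \<epsilon> (fst t) F K (fst (snd t)) (snd (snd t))) < top_growth \<epsilon>"
        unfolding R_def by (elim exE) (rule that)
      then show ?thesis by (intro exI[of _ "(F, K)"]) (simp add: W_def)
    qed
    then have "\<forall>t\<in>I. \<exists>z. W t z"
      by (rule ballI)
    from bchoice[OF this] obtain z where
      z: "\<forall>t\<in>I. W t (z t)" ..
    define F where "F t = fst (z t)" for t
    define K where "K t = snd (z t)" for t
    have FK: "F t \<in> Fpow pt" "K t \<in> Fpow CH"
      "growth (near_count \<epsilon> (fst t) (F t) (K t) (fst (snd t)) (snd (snd t))) < top_growth \<epsilon>" if "t \<in> I" for t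
      using z[rule_format, OF that] by (simp_all add: F_def K_def W_def)
    \<comment> \<open>The inserted 1 covers an empty \<open>I\<close>, for which the sum of the
      counts has growth \<open>-\<infinity>\<close>.\<close>
    define \<delta> where "\<delta> = Min (insert 1 ((\<lambda>t. snd (snd t)) ` I))"
    have \<delta>: "0 < \<delta>" "\<And>t. t \<in> I \<Longrightarrow> \<delta> \<le> snd (snd t)"
    proof -
      have "\<delta> \<in> insert 1 ((\<lambda>t. snd (snd t)) ` I)" unfolding \<delta>_def by (rule Min_in) (use fI in simp_all)
      then show "0 < \<delta>" by (auto simp: I_def)
      show "\<delta> \<le> snd (snd t)" if "t \<in> I" for t unfolding \<delta>_def by (rule Min_le) (use fI that in auto)
    qed
    define F' where "F' = (\<Union>t\<in>I. F t)"
    define K' where "K' = (\<Union>t\<in>I. K t)"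
    have FK': "F' \<in> Fpow pt" "K' \<in> Fpow CH" using FK(1,2) fI unfolding F'_def K'_def Fpow_def by blast+
    let ?N = "\<lambda>t. near_count \<epsilon> (fst t) (F t) (K t) (fst (snd t)) (snd (snd t))"
    \<comment> \<open>The empirical measure of \<open>x\<close>, a set function with values in the
      unit interval, selects the neighbourhood. The function \<open>\<lambda>_. 0\<close> stands for
      an arbitrary content, as the family of test sets is empty.\<close>
    have cover: "Orb_near (\<lambda>_. 0) F' K' {} \<delta> n \<sigma> \<subseteq> (\<Union>t\<in>I. Orb_near (fst t) (F t) (K t) (fst (snd t)) (snd (snd t)) n \<sigma>)" if n: "0 < n" for n \<sigma>
    proof
      fix x assume x: "x \<in> Orb_near (\<lambda>_. 0) F' K' {} \<delta> n \<sigma>"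
      have "emp n x A \<in> {0..1}" for A
      proof -
        have "card {i\<in>{1..n}. x i \<in> A} \<le> card {1..n}" by (rule card_mono) auto
        then show ?thesis using n by (simp add: emp_def)
      qed
      then obtain t where t: "t \<in> I" "\<And>A. A \<in> fst (snd t) \<Longrightarrow> \<bar>emp n x A - fst t A\<bar> < snd (snd t)"
        using L(2)[of "emp n x"] by (fastforce simp: I_def)
      have "x \<in> Orb_near (fst t) (F t) (K t) {} (snd (snd t)) n \<sigma>"
      proof -
        have "x \<in> Orb_near (\<lambda>_. 0) (F t) (K t) {} (snd (snd t)) n \<sigma>"
          using Orb_near_antimono[of "F t" F' "K t" K' "{}" "{}" \<delta> "snd (snd t)"] t(1) \<delta>(2)[OF t(1)] x
          unfolding F'_def K'_def by blast
        then show ?thesis by (simp add: Orb_near_def)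
      qed
      then show "x \<in> (\<Union>t\<in>I. Orb_near (fst t) (F t) (K t) (fst (snd t)) (snd (snd t)) n \<sigma>)"
        using t by (auto simp: Orb_near_def)
    qed
    have sum: "mble (\<lambda>n \<sigma>. \<Sum>t\<in>I. ?N t n \<sigma>) \<and> growth (\<lambda>n \<sigma>. \<Sum>t\<in>I. ?N t n \<sigma>) < top_growth \<epsilon>"
      by (rule growth_sum_less[OF fI h]) (use FK mble_near in auto)
    have "top_growth \<epsilon> \<le> growth (near_count \<epsilon> (\<lambda>_. 0) F' K' {} \<delta>)"
      by (cases "0 < diam") (auto intro: top_growth_le_near top_growth_le_near_degenerate FK' \<delta>(1) \<epsilon>)
    also have "\<dots> \<le> growth (\<lambda>n \<sigma>. \<Sum>t\<in>I. ?N t n \<sigma>)"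
    proof (rule growth_mono[OF mble_near[OF FK'(1)] conjunct1[OF sum]])
      show "\<forall>\<^sub>F j in FF. AE \<sigma> in \<P> j. near_count \<epsilon> (\<lambda>_. 0) F' K' {} \<delta> (d j) \<sigma> \<le> (\<Sum>t\<in>I. ?N t (d j) \<sigma>)"
        using d_pos by eventually_elim (intro AE_I2 sep_number_UN_le[OF fI] cover)
    qed
    finally show False using conjunct2[OF sum] by simp
  qed
  then obtain L where L: "\<And>\<A> e. finite \<A> \<Longrightarrow> 0 < e \<Longrightarrow> \<not> R L \<A> e" by blast
  show ?thesis
  proof (rule that[of L])
    fix F K and \<A> :: "'c set set" and \<delta> :: real assume "F \<in> Fpow pt" "K \<in> Fpow CH" "finite \<A>" "0 < \<delta>"
    then show "top_growth \<epsilon> \<le> growth (near_count \<epsilon> L F K \<A> \<delta>)"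
      using L[of \<A> \<delta>] unfolding R_def by (meson not_le_imp_less)
  qed
qed

text \<open>The bound \<open>-\<infinity> < top_growth \<epsilon>\<close> guarantees the microstates
  from which \<open>L\<close> and then \<open>\<mu>\<close> are built.\<close>

lemma top_growth_le_hom_growth:
  assumes \<epsilon>: "0 < \<epsilon>" and h: "-\<infinity> < top_growth \<epsilon>"
  obtains \<mu> \<Q> where "pmp G (borel_of TG) \<mu>" "distr \<mu> \<nu> \<pi> = \<nu>" "finite_partition \<mu> \<Q>" "top_growth \<epsilon> \<le> hom_growth \<mu> \<Q>"
proof -
  obtain L where L: "\<And>F K \<A> \<delta>. F \<in> Fpow pt \<Longrightarrow> K \<in> Fpow CH \<Longrightarrow> finite \<A> \<Longrightarrow> 0 < \<delta> \<Longrightarrow>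
    top_growth \<epsilon> \<le> growth (near_count \<epsilon> L F K \<A> \<delta>)"
    by (rule growing_content[OF assms], rule that)
  \<comment> \<open>A growth rate above \<open>-\<infinity>\<close> forces nonempty sets of
    microstates for some sofic maps with the almost sure properties.\<close>
  have "config L \<noteq> bot"
  proof
    assume "config L = bot"
    then have "eventually (\<lambda>_. False) (config L)" by simp
    then obtain F K F0 \<A> \<delta> where e: "F \<in> Fpow pt" "K \<in> Fpow CH" "F0 \<in> Fpow fp" "finite \<A>" "0 < \<delta>"
      and none: "\<And>n \<sigma> x. almost_sofic F0 \<delta> n \<sigma> \<Longrightarrow> x \<notin> Orb_near L F K \<A> \<delta> n \<sigma>"
      unfolding eventually_config by blast
    have "-\<infinity> < growth (near_count \<epsilon> L F K \<A> \<delta>)" using h L[OF e(1,2,4,5)] by (rule less_le_trans)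
    from growth_witness[OF mble_near[OF e(1)] this d_pos almost_sofic_AE[OF e(3,5)]]
    obtain j \<sigma> where "almost_sofic F0 \<delta> (d j) \<sigma>" "near_count \<epsilon> L F K \<A> \<delta> (d j) \<sigma> \<noteq> 0" by blast
    moreover from this(1) none have "Orb_near L F K \<A> \<delta> (d j) \<sigma> = {}" by blast
    ultimately show False by (simp add: sep_number_empty)
  qed
  then interpret C: content H TH \<nu> G TG \<pi> \<rho> L by unfold_locales
  obtain \<mu> where \<mu>: "prob_space \<mu>" "sets \<mu> = sets (borel_of G.X)" "\<And>U. openin G.X U \<Longrightarrow> measure \<mu> U \<le> L U"
    by (rule C.limit_measure, rule that)
  interpret M: content_measure H TH \<nu> G TG \<pi> \<rho> L \<mu>
    by (intro content_measure.intro content_measure_axioms.intro C.content_axioms \<mu>)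
  have "\<exists>\<Q>. finite_partition \<mu> \<Q> \<and> top_growth \<epsilon> \<le> hom_growth \<mu> \<Q>"
    by (rule growth_near_le_hom_growth[OF M.content_measure_axioms \<epsilon>]) (rule L)
  then obtain \<Q> where "finite_partition \<mu> \<Q>" "top_growth \<epsilon> \<le> hom_growth \<mu> \<Q>" by blast
  then show ?thesis by (rule that[OF M.pmp_\<mu> M.pushforward])
qed

lemma variational_principle:
  "(SUP \<epsilon>\<in>{0<..}. top_growth \<epsilon>) =
    (SUP \<mu>\<in>{\<mu>. pmp G (borel_of TG) \<mu> \<and> distr \<mu> \<nu> \<pi> = \<nu>}. SUP \<Q>\<in>{\<Q>. finite_partition \<mu> \<Q>}. hom_growth \<mu> \<Q>)"
  (is "?T = ?M")
proof (rule antisym)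
  show "?T \<le> ?M"
  proof (rule SUP_least)
    fix \<epsilon> :: real assume \<epsilon>: "\<epsilon> \<in> {0<..}"
    show "top_growth \<epsilon> \<le> ?M"
    proof (cases "top_growth \<epsilon> = -\<infinity>")
      case False
      then obtain \<mu> \<Q> where m: "pmp G (borel_of TG) \<mu>" "distr \<mu> \<nu> \<pi> = \<nu>" "finite_partition \<mu> \<Q>" "top_growth \<epsilon> \<le> hom_growth \<mu> \<Q>"
        using top_growth_le_hom_growth[of \<epsilon>] \<epsilon> by (metis ereal_infty_less(2) greaterThan_iff)
      have "hom_growth \<mu> \<Q> \<le> (SUP \<Q>\<in>{\<Q>. finite_partition \<mu> \<Q>}. hom_growth \<mu> \<Q>)" by (rule SUP_upper) (use m in simp)
      also have "\<dots> \<le> ?M" by (rule SUP_upper[of \<mu>]) (use m in simp)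
      finally show ?thesis using m(4) by simp
    qed simp
  qed
  show "?M \<le> ?T"
  proof (intro SUP_least)
    fix \<mu> \<Q> assume "\<mu> \<in> {\<mu>. pmp G (borel_of TG) \<mu> \<and> distr \<mu> \<nu> \<pi> = \<nu>}" "\<Q> \<in> {\<Q>. finite_partition \<mu> \<Q>}"
    moreover from this have "factor_measure H TH \<nu> G TG \<pi> \<mu>"
      by (intro factor_measure.intro factor_measure_axioms.intro factor_axioms) auto
    ultimately show "hom_growth \<mu> \<Q> \<le> ?T" by (intro hom_growth_le_top_growth) auto
  qed
qed

end

theorem theorem10p1:
  fixes H :: "'h gpd" and TH :: "'h topology" and \<nu> :: "'h measure"
    and G :: "'g gpd" and TG :: "'g topology" and \<pi> :: "'g \<Rightarrow> 'h"
    and J :: "'j set" and le :: "'j \<Rightarrow> 'j \<Rightarrow> bool" and d :: "'j \<Rightarrow> nat"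
    and \<P> :: "'j \<Rightarrow> 'h sofic_map measure"
    and p :: ennreal and \<beta> :: "'j bias" and \<rho> :: "'g \<Rightarrow> 'g \<Rightarrow> real"
  assumes "separable_etale_groupoid H TH" and "pmp H (borel_of TH) \<nu>"
    and "separable_etale_groupoid G TG"
    and "class_bijective_factor G H \<pi>" and "continuous_map TG TH \<pi>"
    and "sofic_approximation H (borel_of TH) \<nu> J le d \<P>"
    and "asymptotically_continuous H (borel_of TH) \<nu> J le d \<P>"
    and "compact_space (unit_top H TH)" and "metrizable_space (unit_top H TH)"
    and "compact_space (unit_top G TG)" and "metrizable_space (unit_top G TG)"
    and "regular_measure (unit_top H TH) \<nu>"
    and "1 \<le> p" and "bias_for J le \<beta>" and "\<beta> \<noteq> Bias_minus"
    and "continuous_pseudometric (unit_top G TG) \<rho>" and "dynamically_generating G H TH \<pi> \<rho>"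
  shows "top_entropy G H TH \<nu> \<pi> J le d \<P> \<beta> p \<rho> =
    (SUP \<mu>\<in>{\<mu>. pmp G (borel_of TG) \<mu> \<and> distr \<mu> \<nu> \<pi> = \<nu>}.
       measure_entropy G \<mu> H (borel_of TH) \<pi> J le d \<P> \<beta> p)"
proof -
  interpret factor_metric H TH \<nu> G TG \<pi> \<rho>
    by (intro factor_metric.intro factor_metric_axioms.intro factor.intro factor_axioms.intro pmp_etale.intro
        pmp_etale_axioms.intro etale_compact.intro etale_compact_axioms.intro assms)
  have sofic: "directed_set J le"
    "\<And>j. j \<in> J \<Longrightarrow> 0 < d j \<and> prob_space (\<P> j) \<and> space (\<P> j) = Map_set fp (d j) \<and> sets (\<P> j) = sets (Map_borel fp (d j))"
    "\<And>F \<delta>. F \<in> Fpow fp \<Longrightarrow> 0 < \<delta> \<Longrightarrow>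
      ((\<lambda>j. measure (\<P> j) {\<sigma> \<in> space (\<P> j). trace_preserving_on H \<nu> (d j) F \<delta> \<sigma>}) \<longlongrightarrow> 1) (tails J le)"
    "\<And>F \<delta>. F \<in> Fpow fp \<Longrightarrow> 0 < \<delta> \<Longrightarrow> \<exists>j\<in>J. \<forall>j'\<in>J. le j j' \<longrightarrow> (AE \<sigma> in \<P> j'. multiplicative_on H (d j') F \<delta> \<sigma>)"
    "filterlim d at_top (tails J le)"
    using assms(6) unfolding sofic_approximation_def by blast+
  have cont: "\<exists>j\<in>J. \<forall>j'\<in>J. le j j' \<longrightarrow> (AE \<sigma> in \<P> j'. \<forall>f\<in>F. \<forall>g\<in>F.
      ennreal (normcard (d j') (sym_diff (\<sigma> f) (\<sigma> g))) < ennreal \<delta> + src_meas H \<nu> (sym_diff f g))"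
    if "F \<in> Fpow fp" "0 < \<delta>" for F \<delta>
    using assms(7) that unfolding asymptotically_continuous_def by blast
  \<comment> \<open>Both entropies now become upper limits along the same filter, and conditions
    valid from some index of \<open>J\<close> on hold eventually along it.\<close>
  obtain FF where FF: "FF \<noteq> bot" "FF \<le> tails J le" and lim: "\<And>\<Phi>. bias_lim J le \<beta> \<Phi> = Limsup FF \<Phi>"
    by (rule bias_lim_eq_Limsup[OF sofic(1) assms(14,15)], rule that)
  have ev: "eventually P FF" if "\<exists>j\<in>J. \<forall>j'\<in>J. le j j' \<longrightarrow> P j'" for P
    using that FF(2) eventually_tails[OF sofic(1)] unfolding le_filter_def by blast
  have evJ: "eventually P FF" if "\<And>j. j \<in> J \<Longrightarrow> P j" for P
  proof (rule ev)
    obtain j where "j \<in> J" using sofic(1) by (auto simp: directed_set_def)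
    then show "\<exists>j\<in>J. \<forall>j'\<in>J. le j j' \<longrightarrow> P j'" by (intro bexI[of _ j] ballI impI that)
  qed
  interpret sofic_factor H TH \<nu> G TG \<pi> \<rho> FF d \<P> p
  proof unfold_locales
    show "filterlim d at_top FF" by (rule filterlim_mono[OF sofic(5) order_refl FF(2)])
    fix F and \<delta> :: real assume F: "F \<in> Fpow fp" "0 < \<delta>"
    show "((\<lambda>j. measure (\<P> j) {\<sigma> \<in> space (\<P> j). trace_preserving_on H \<nu> (d j) F \<delta> \<sigma>}) \<longlongrightarrow> 1) FF"
      by (rule tendsto_mono[OF FF(2) sofic(3)[OF F]])
    show "\<forall>\<^sub>F j in FF. AE \<sigma> in \<P> j. multiplicative_on H (d j) F \<delta> \<sigma>" by (rule ev[OF sofic(4)[OF F]])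
    show "\<forall>\<^sub>F j in FF. AE \<sigma> in \<P> j. \<forall>f\<in>F. \<forall>g\<in>F.
      ennreal (normcard (d j) (sym_diff (\<sigma> f) (\<sigma> g))) < ennreal \<delta> + src_meas H \<nu> (sym_diff f g)" by (rule ev[OF cont[OF F]])
  qed (use FF(1) assms(13) sofic(2) in \<open>auto intro!: evJ\<close>)
  have gr: "growth_rate J le d \<P> \<beta> p X = growth X" for X
    by (simp add: growth_rate_def exp_growth_def lim)
  show ?thesis
    using variational_principle
    unfolding top_entropy_def measure_entropy_def gr top_growth_def hom_growth_def .
qed

end
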